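(* Let $\beta,\gamma>0$ be constants. For parameters $N$, $k$, $\epsilon$ with $N=\Omega(\max\{k^2,k/\epsilon^2\})$, there is an approximate sparse recovery system consisting of an $m\times N$ measurement matrix $\Phi$ and a decoding algorithm $\mathcal{D}$ with the following property: for every vector $\mathbf{x}\in\mathbb{R}^N$, given $\Phi\mathbf{x}$, the algorithm outputs $\widehat{\mathbf{x}}=\mathcal{D}(\Phi\mathbf{x})$ satisfying \[\|\widehat{\mathbf{x}}-\mathbf{x}\|_1\le(1+\epsilon)\|\mathbf{x}_{[k]}-\mathbf{x}\|_1 .\] The matrix $\Phi$ has $m=O\!\left(\frac{k}{\epsilon}\log\frac{N}{k}\left(\left(\frac{\log N}{\log k}\right)^{\gamma}+\frac{1}{\epsilon}\right)\right)$ rows and $\mathcal{D}$ runs in time $O(k^{1+\beta}\,\mathrm{poly}(\log N,1/\epsilon))$. When $\epsilon=O\big((\log k/\log N)^{\gamma}\big)$, the number of rows is $m=O(\epsilon^{-2}k\log(N/k))$. If, in addition, $k\le \log^{O(1)}N$, the running time can be reduced to $O(k\,\mathrm{poly}(N,1/\epsilon))$.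
   Context: For $\mathbf{x}\in\mathbb{R}^N$, $\mathbf{x}_{[k]}$ denotes the best $k$-term approximation of $\mathbf{x}$: the vector obtained from $\mathbf{x}$ by zeroing out all but its $k$ largest-magnitude entries. The measurement matrix $\Phi$ is fixed in advance and must work simultaneously for all signals $\mathbf{x}$ (the "for all" model). The constants hidden in the $O(\cdot)$, $\Omega(\cdot)$ and $\mathrm{poly}$ notations may depend on $\beta$ and $\gamma$.
   Formalization: The formal statement assumes k ≥ 2, since log N/log k is undefined at k = 1, and 0 < ε ≤ 1, since for unbounded ε the bound on the number of rows tends to 0 and the claim fails. *)

theory Defs
  imports Complex_Main "Jordan_Normal_Form.Matrix"
begin

section \<open>Norm and best k-term approximation\<close>

definition l1_norm :: "real vec \<Rightarrow> real" where
  "l1_norm v = (\<Sum>i<dim_vec v. \<bar>v $ i\<bar>)"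

text \<open>Position of entry \<open>i\<close> in the order of decreasing magnitude, counted from 0. Ties are broken
  in favour of the smaller index, which makes the \<open>k\<close> largest entries well defined; the error
  \<open>l1_norm (best_approx k x - x)\<close> does not depend on this choice.\<close>

definition magnitude_rank :: "real vec \<Rightarrow> nat \<Rightarrow> nat" where
  "magnitude_rank x i =
     card {j. j < dim_vec x \<and> (\<bar>x $ j\<bar> > \<bar>x $ i\<bar> \<or> \<bar>x $ j\<bar> = \<bar>x $ i\<bar> \<and> j < i)}"

definition best_approx :: "nat \<Rightarrow> real vec \<Rightarrow> real vec" where
  "best_approx k x = vec (dim_vec x) (\<lambda>i. if magnitude_rank x i < k then x $ i else 0)"

section \<open>A random access machine with words and reals\<close>

text \<open>Running time is the number of steps of a RAM with two memories, one of machine words and one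
  of reals. Word arithmetic is taken modulo \<open>2 ^ word_bits\<close>, so a word cannot carry more than
  \<open>word_bits\<close> bits; reals are exact and support the field operations and comparison, but there is
  no conversion (such as floor) from reals to words. Three read-only inputs are accessed
  by word addresses: the measurement vector, and a table of words and a table of reals that are
  fixed in advance together with the matrix (hash functions, codes, parameters) and thus do not
  depend on the signal. The decoded vector is a write-only output, initially zero, so an output
  with few nonzero entries can be produced in sublinear time.\<close>

datatype word_op = WAdd | WSub | WMul | WDiv | WMod

fun word_op_val :: "word_op \<Rightarrow> nat \<Rightarrow> nat \<Rightarrow> nat" where
  "word_op_val WAdd a b = a + b"
| "word_op_val WSub a b = a - b"
| "word_op_val WMul a b = a * b"
| "word_op_val WDiv a b = a div b"
| "word_op_val WMod a b = a mod b"

datatype real_op = RAdd | RSub | RMul | RDiv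

fun real_op_val :: "real_op \<Rightarrow> real \<Rightarrow> real \<Rightarrow> real" where
  "real_op_val RAdd a b = a + b"
| "real_op_val RSub a b = a - b"
| "real_op_val RMul a b = a * b"
| "real_op_val RDiv a b = a / b"

datatype instr =
    WConst nat nat
  | WArith word_op nat nat nat
  | WLoad nat nat
  | WStore nat nat
  | RLoad nat nat
  | RStore nat nat
  | RArith real_op nat nat nat
  | ROfWord nat nat
  | ReadMeasurement nat nat
  | ReadWordTable nat nat
  | ReadRealTable nat nat
  | Emit nat nat
  | JumpWLess nat nat nat
  | JumpRLess nat nat nat

record preprocessed =
  word_bits :: nat
  word_table :: "nat \<Rightarrow> nat"
  real_table :: "nat \<Rightarrow> real"

record config =
  pc :: nat
  words :: "nat \<Rightarrow> nat"
  reals :: "nat \<Rightarrow> real"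
  emitted :: "nat \<Rightarrow> real"

definition init_config :: config where
  "init_config = \<lparr>pc = 0, words = (\<lambda>_. 0), reals = (\<lambda>_. 0), emitted = (\<lambda>_. 0)\<rparr>"

definition set_word :: "preprocessed \<Rightarrow> nat \<Rightarrow> nat \<Rightarrow> config \<Rightarrow> config" where
  "set_word A a v c = c\<lparr>pc := Suc (pc c), words := (words c)(a := v mod 2 ^ word_bits A)\<rparr>"

definition set_real :: "nat \<Rightarrow> real \<Rightarrow> config \<Rightarrow> config" where
  "set_real r v c = c\<lparr>pc := Suc (pc c), reals := (reals c)(r := v)\<rparr>"

fun exec :: "preprocessed \<Rightarrow> real vec \<Rightarrow> instr \<Rightarrow> config \<Rightarrow> config" where
  "exec A y (WConst a n) c = set_word A a n c"
| "exec A y (WArith f a b b') c = set_word A a (word_op_val f (words c b) (words c b')) c"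
| "exec A y (WLoad a b) c = set_word A a (words c (words c b)) c"
| "exec A y (WStore a b) c = set_word A (words c a) (words c b) c"
| "exec A y (RLoad r a) c = set_real r (reals c (words c a)) c"
| "exec A y (RStore a r) c = set_real (words c a) (reals c r) c"
| "exec A y (RArith f r s s') c = set_real r (real_op_val f (reals c s) (reals c s')) c"
| "exec A y (ROfWord r a) c = set_real r (real (words c a)) c"
| "exec A y (ReadMeasurement r a) c =
     set_real r (if words c a < dim_vec y then y $ words c a else 0) c"
| "exec A y (ReadWordTable a b) c = set_word A a (word_table A (words c b)) c"
| "exec A y (ReadRealTable r a) c = set_real r (real_table A (words c a)) c"
| "exec A y (Emit a r) c =
     c\<lparr>pc := Suc (pc c), emitted := (emitted c)(words c a := reals c r)\<rparr>"
| "exec A y (JumpWLess a b l) c = c\<lparr>pc := (if words c a < words c b then l else Suc (pc c))\<rparr>"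
| "exec A y (JumpRLess r s l) c = c\<lparr>pc := (if reals c r < reals c s then l else Suc (pc c))\<rparr>"

definition halted :: "instr list \<Rightarrow> config \<Rightarrow> bool" where
  "halted P c \<longleftrightarrow> length P \<le> pc c"

definition step :: "instr list \<Rightarrow> preprocessed \<Rightarrow> real vec \<Rightarrow> config \<Rightarrow> config" where
  "step P A y c = (if halted P c then c else exec A y (P ! pc c) c)"

text \<open>A halted configuration is a fixed point of \<open>step\<close>: being halted after \<open>t\<close> steps means
  that the running time is at most \<open>t\<close>.\<close>

definition run :: "instr list \<Rightarrow> preprocessed \<Rightarrow> real vec \<Rightarrow> nat \<Rightarrow> config" where
  "run P A y t = (step P A y ^^ t) init_config"

section \<open>Approximate sparse recovery\<close>

text \<open>The program \<open>P\<close> with preprocessed data \<open>A\<close> and the matrix \<open>\<Phi>\<close> recover every signal from its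
  measurements within \<open>t\<close> steps.\<close>

definition sparse_recovery_system ::
  "nat \<Rightarrow> nat \<Rightarrow> real \<Rightarrow> real mat \<Rightarrow> instr list \<Rightarrow> preprocessed \<Rightarrow> nat \<Rightarrow> bool" where
  "sparse_recovery_system N k \<epsilon> \<Phi> P A t \<longleftrightarrow>
     dim_col \<Phi> = N \<and>
     (\<forall>x \<in> carrier_vec N.
        let c = run P A (\<Phi> *\<^sub>v x) t in
          halted P c \<and>
          l1_norm (vec N (emitted c) - x) \<le> (1 + \<epsilon>) * l1_norm (best_approx k x - x))"

text \<open>The constant \<open>C0\<close> is the one hidden in \<open>N = \<Omega>(max {k\<^sup>2, k/\<epsilon>\<^sup>2})\<close>. The condition
  \<open>k \<ge> 2\<close> makes the quotient \<open>log N / log k\<close> meaningful, and \<open>\<epsilon>\<close> has to be bounded since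
  the row bound tends to 0 as \<open>\<epsilon>\<close> grows.\<close>

definition admissible :: "real \<Rightarrow> nat \<Rightarrow> nat \<Rightarrow> real \<Rightarrow> bool" where
  "admissible C0 N k \<epsilon> \<longleftrightarrow>
     2 \<le> k \<and> 0 < \<epsilon> \<and> \<epsilon> \<le> 1 \<and> real N \<ge> C0 * max (real k ^ 2) (real k / \<epsilon> ^ 2)"

end

(* The items are hashed into about k/\<epsilon> buckets by a family of hash functions
   under which all small sets expand; for each bucket the sum of its entries and the sum of those entries
   whose item has bit 1 in an error correcting code are measured. Expansion implies that in the error bounds of
   any few items each part of the tail is charged only a bounded number of times. So a round which
   finds candidates, estimates their residuals by medians and keeps the k largest estimates contracts the
   error truncated at a level proportional to the tail, and O(log (k/\<epsilon>)) rounds suffice.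

   The candidates must be found in time k^(1+\<beta>) polylog, without a pass over all items. An item is spread
   over the nodes of an expanding graph. At each node it is known only by an address from a range of size about
   (k/\<epsilon>)^(1+\<beta>), and its message there consists of its addresses at the neighbouring nodes and of a piece of
   a list recoverable encoding of the item. Few wrong messages leave a core of nodes in which short walks still
   reach many nodes; the pieces collected on these walks yield a short list containing the item. The longer the
   walks, the fewer wrong bits are tolerated: this costs the factor (log N / log k)^\<gamma>.

   The hash families exist by the probabilistic method. The decoder is a straight-line program which uses them
   as tables; its code is stored in the word table and run by one fixed interpreter. *)

theory Submission
  imports Defs
begin

section \<open>Hash families that expand small sets\<close>

text \<open>The decoder must read a message before it knows the item, so the bucket of an item
  depends only on its address at a node. Then the addresses have to expand too: with a range of size
  \<open>G\<close> this takes about log N / (\<epsilon> log (\<epsilon> G / k)) nodes, and each node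
  needs of the order of log G hash functions to carry its message. If \<open>G\<close> exceeds k /
  \<epsilon> by a power, the two logarithms are comparable and the product stays O(log N /
  \<epsilon>). This is where \<beta> enters. The exponent \<gamma> enters through the degree
  \<open>D = 4 ^ b\<close>. Out of \<open>D ^ l\<close> walks only \<open>(D / 4) ^ l\<close> end
  nodes are guaranteed, so an end node collects a list of length about \<open>4 ^ l\<close>, and the
  hints that sort out wrong list entries make a piece about \<open>4 ^ l\<close> times as long as
  the part of the item that it carries. There are about \<open>(4 ^ l) ^ (b - 1)\<close> nodes, and
  the information of an item asks for \<open>(4 ^ l) ^ (b - 2)\<close> of order log N / log G. With
  b - 2 \<ge> 1 / \<gamma> the loss \<open>4 ^ l\<close> is O((log N / log k)^\<gamma>).\<close>

definition repeats :: "('a::linorder => 'b) => 'a set => 'a set" where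
  "repeats h T = {x \<in> T. \<exists>x'\<in>T. x' < x \<and> h x' = h x}"

text \<open>The least preimage of each value is the only one that is not a repeat.\<close>

lemma card_repeats:
  assumes "finite T"
  shows "card (repeats h T) + card (h ` T) = card T" proof -
  have sub: "repeats h T \<subseteq> T" by (auto simp: repeats_def)
  have "inj_on h (T - repeats h T)"
  proof (rule inj_onI)
    fix x y assume *: "x \<in> T - repeats h T" "y \<in> T - repeats h T" "h x = h y"
    show "x = y"
    proof (rule ccontr)
      assume "x \<noteq> y"
      hence "x < y \<or> y < x" by auto
      thus False using * unfolding repeats_def by (auto simp: eq_commute)
    qed
  qed
  moreover have "h ` (T - repeats h T) = h ` T"
  proof
    show "h ` T \<subseteq> h ` (T - repeats h T)"
    proof
      fix b assume "b \<in> h ` T"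
      hence ne: "{x \<in> T. h x = b} \<noteq> {}" by auto
      have fin: "finite {x \<in> T. h x = b}" using assms by auto
      define m where "m = Min {x \<in> T. h x = b}"
      have m: "m \<in> {x \<in> T. h x = b}" unfolding m_def using Min_in[OF fin ne] .
      have "m \<notin> repeats h T"
      proof
        assume "m \<in> repeats h T"
        then obtain x' where "x' \<in> T" "x' < m" "h x' = h m" by (auto simp: repeats_def)
        hence "x' \<in> {x \<in> T. h x = b}" using m by auto
        hence "m \<le> x'" unfolding m_def using fin by simp
        thus False using \<open>x' < m\<close> by simp
      qed
      thus "b \<in> h ` (T - repeats h T)" using m by auto
    qed
  qed auto
  ultimately have "card (T - repeats h T) = card (h ` T)" using card_image by force
  moreover have "card (T - repeats h T) = card T - card (repeats h T)" using sub assms by (intro card_Diff_subset finite_subset[OF sub])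
  moreover have "card (repeats h T) \<le> card T" using sub assms by (rule card_mono[rotated])
  ultimately show ?thesis by simp
qed

text \<open>The values of the random function are exposed one key at a time; the conditional expectation
  of the potential never exceeds its initial value for a suitable choice of the next value.\<close>

lemma derandomised_exposure:
  fixes Q :: "'s => nat set" and w lam :: "'s => real" and c :: "'s => nat" and B d M :: nat
  assumes "finite I" and B: "B > 0"
    and w: "\<And>S. S \<in> I ==> w S \<ge> 0" and lam: "\<And>S. S \<in> I ==> lam S \<ge> 1"
    and Q: "\<And>S. S \<in> I ==> finite (Q S)"
    and c: "\<And>S q. S \<in> I ==> q \<in> Q S ==> card {q' \<in> Q S. q' < q \<and> q' mod d = q mod d} \<le> c S"
  defines "dirty \<equiv> \<lambda>H S q. \<exists>q'\<in>Q S. q' < q \<and> q' mod d = q mod d \<and> H q' = (H q :: nat)"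
  shows "\<exists>H. (\<forall>q. H q < B) \<and>
     (\<Sum>S\<in>I. w S * lam S ^ card {q \<in> Q S. q < M \<and> dirty H S q}
              * (1 + lam S * c S / B) ^ card {q \<in> Q S. q \<ge> M})
     \<le> (\<Sum>S\<in>I. w S * (1 + lam S * c S / B) ^ card (Q S))"
proof (induction M)
  case 0
  show ?case using B by (intro exI[of _ "\<lambda>_. 0"]) auto
next
  case (Suc M)
  then obtain H where HB: "\<And>q. H q < B" and H: "(\<Sum>S\<in>I. w S * lam S ^ card {q \<in> Q S. q < M \<and> dirty H S q}
              * (1 + lam S * c S / B) ^ card {q \<in> Q S. q \<ge> M})
     \<le> (\<Sum>S\<in>I. w S * (1 + lam S * c S / B) ^ card (Q S))" by blast
  define Hb where "Hb b = H(M := b)" for b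
  let ?A = "\<lambda>S. {q \<in> Q S. q < M \<and> dirty H S q}"
  let ?A1 = "\<lambda>b S. {q \<in> Q S. q < Suc M \<and> dirty (Hb b) S q}"
  define p where "p b S = w S * lam S ^ card (?A1 b S)
              * (1 + lam S * c S / B) ^ card {q \<in> Q S. q \<ge> Suc M}" for b S
  define p0 where "p0 S = w S * lam S ^ card (?A S)
              * (1 + lam S * c S / B) ^ card {q \<in> Q S. q \<ge> M}" for S
  have main: "(\<Sum>b<B. p b S) \<le> B * p0 S" if S: "S \<in> I" for S proof -
    have dir: "dirty (Hb b) S q = dirty H S q" if "q < M" for q b using that unfolding dirty_def Hb_def by (intro bex_cong) auto
    show ?thesis
    proof (cases "M \<in> Q S")
      case False
      have e1: "(?A1 b S) = (?A S)" for b
        using False dir by (auto simp: less_Suc_eq)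
      have e2: "{q \<in> Q S. q \<ge> Suc M} = {q \<in> Q S. q \<ge> M}" using False by (auto simp: Suc_le_eq le_less)
      have "p b S = p0 S" for b unfolding p_def p0_def e1 e2 ..
      thus ?thesis by simp
    next
      case True
      \<comment> \<open>Only the at most \<open>c S\<close> values taken by earlier keys of the same
        hash function make \<open>M\<close> dirty. They multiply the potential by
        \<open>lam S\<close>, all others leave it alone, and summed over the \<open>B\<close> values
        this is exactly the factor that the unexposed key \<open>M\<close> had reserved.\<close>
      define D where "D = H ` {q' \<in> Q S. q' < M \<and> q' mod d = M mod d}"
      have fD: "finite D" unfolding D_def using Q[OF S] by auto
      have cD: "card D \<le> c S" unfolding D_def
        using c[OF S True] card_image_le[of "{q' \<in> Q S. q' < M \<and> q' mod d = M mod d}" H] Q[OF S] by auto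
      have dM: "dirty (Hb b) S M \<longleftrightarrow> b \<in> D" for b unfolding dirty_def Hb_def D_def by auto
      define n where "n = card (?A S)"
      have e1: "card (?A1 b S) = n + (if b \<in> D then 1 else 0)" for b proof -
        have "(?A1 b S) =
              (?A S) \<union> (if b \<in> D then {M} else {})" using True dir dM by (auto simp: less_Suc_eq)
        moreover have "finite (?A S)" using Q[OF S] by simp
        moreover have "M \<notin> (?A S)" by simp
        ultimately show ?thesis unfolding n_def by simp
      qed
      have e2: "card {q \<in> Q S. q \<ge> M} = Suc (card {q \<in> Q S. q \<ge> Suc M})" proof -
        have "{q \<in> Q S. q \<ge> M} = insert M {q \<in> Q S. q \<ge> Suc M}" using True by auto
        thus ?thesis using Q[OF S] by auto
      qed
      define R where "R = w S * lam S ^ n * (1 + lam S * c S / B) ^ card {q \<in> Q S. q \<ge> Suc M}"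
      have R0: "R \<ge> 0" unfolding R_def using w[OF S] lam[OF S] by simp
      have "(\<Sum>b<B. p b S) = (\<Sum>b<B. R * (if b \<in> D then lam S else 1))" by (rule sum.cong) (auto simp: p_def e1 R_def)
      also have "\<dots> = R * (\<Sum>b<B. if b \<in> D then lam S else 1)" by (simp add: sum_distrib_left)
      also have "(\<Sum>b<B. if b \<in> D then lam S else 1) \<le> (\<Sum>b<B. 1 + (if b \<in> D then lam S else 0))" by (rule sum_mono) auto
      also have "\<dots> = B + lam S * card ({..<B} \<inter> D)" by (simp add: sum.distrib sum.If_cases Int_def)
      also have "\<dots> \<le> B + lam S * c S" proof -
        have "card ({..<B} \<inter> D) \<le> c S" using cD fD card_mono[of D "{..<B} \<inter> D"] by simp
        thus ?thesis using lam[OF S] by (intro add_left_mono mult_left_mono) auto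
      qed
      also have "R * (B + lam S * c S) = B * p0 S" using B unfolding p0_def R_def e2 n_def[symmetric] by (simp add: field_simps)
      finally show ?thesis using R0 by (auto simp: mult_left_mono)
    qed
  qed
  have "(\<Sum>b<B. \<Sum>S\<in>I. p b S) = (\<Sum>S\<in>I. \<Sum>b<B. p b S)" by (rule sum.swap)
  also have "\<dots> \<le> (\<Sum>S\<in>I. B * p0 S)" using main by (rule sum_mono)
  also have "\<dots> = (\<Sum>b<B. \<Sum>S\<in>I. p0 S)" by (simp add: sum_distrib_left)
  finally have le: "(\<Sum>b<B. \<Sum>S\<in>I. p b S) \<le> (\<Sum>b<B. \<Sum>S\<in>I. p0 S)" .
  \<comment> \<open>Averaging: some value of the key does no worse than the mean.\<close>
  have "\<exists>b<B. (\<Sum>S\<in>I. p b S) \<le> (\<Sum>S\<in>I. p0 S)"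
  proof (rule ccontr)
    assume "\<not> ?thesis"
    hence "(\<Sum>b\<in>{..<B}. (\<Sum>S\<in>I. p0 S)) < (\<Sum>b\<in>{..<B}. (\<Sum>S\<in>I. p b S))"
      using B by (intro sum_strict_mono[of "{..<B}"]) (auto simp: not_le)
    thus False using le by simp
  qed
  then obtain b where b: "b < B" "(\<Sum>S\<in>I. p b S) \<le> (\<Sum>S\<in>I. p0 S)" by blast
  have "\<forall>q. Hb b q < B" using b HB by (auto simp: Hb_def)
  moreover have "(\<Sum>S\<in>I. p b S) \<le> (\<Sum>S\<in>I. w S * (1 + lam S * c S / B) ^ card (Q S))" using b(2) H unfolding p0_def by linarith
  ultimately show ?case unfolding p_def by blast
qed

text \<open>Seen as a bipartite graph of left degree \<open>d\<close>, whose right vertices are the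
  pairs of a hash function and a bucket, this is a lossless expander: small sets have nearly as many
  neighbours as edges.\<close>

definition expanding :: "nat => nat => real => nat => (nat => nat => nat) => bool" where
  "expanding N K \<eta> d h \<longleftrightarrow>
     (\<forall>S\<subseteq>{..<N}. card S \<le> K --> (1 - \<eta>) * d * card S \<le> (\<Sum>e<d. real (card (h e ` S))))"

lemma binomial_le_powr: "real (n choose k) \<le> (exp 1 * n / k) ^ k" if "k > 0"
proof -
  have "exp (real k) \<ge> real k ^ k / fact k" proof -
    have "summable (\<lambda>n. real k ^ n / fact n)" using summable_exp[of "real k"] by (simp add: field_simps)
    hence "(\<Sum>n\<in>{k}. real k ^ n / fact n) \<le> (\<Sum>n. real k ^ n / fact n)" by (intro sum_le_suminf) auto
    thus ?thesis unfolding exp_def by (simp add: scaleR_conv_of_real field_simps)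
  qed
  hence f: "real k ^ k \<le> exp (real k) * fact k" by (simp add: field_simps)
  have "(n choose k) * fact k \<le> n ^ k" using binomial_fact_pow by simp
  hence "real (n choose k) * fact k \<le> real n ^ k" using of_nat_mono[where 'a=real, OF \<open>(n choose k) * fact k \<le> n ^ k\<close>] by simp
  hence "real (n choose k) * real k ^ k \<le> real n ^ k * exp (real k)" proof -
    have "real (n choose k) * real k ^ k \<le> real (n choose k) * (exp (real k) * fact k)" using f by (intro mult_left_mono) auto
    also have "\<dots> = exp (real k) * (real (n choose k) * fact k)" by simp
    also have "\<dots> \<le> exp (real k) * real n ^ k"
      using \<open>real (n choose k) * fact k \<le> real n ^ k\<close> by (intro mult_left_mono) auto
    finally show ?thesis by (simp add: mult.commute)
  qed
  moreover have "exp (real k) = exp 1 ^ k" by (metis exp_of_nat_mult mult.right_neutral)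
  ultimately have "real (n choose k) * real k ^ k \<le> (exp 1 * real n) ^ k" by (simp add: power_mult_distrib mult.commute)
  thus ?thesis using that by (simp add: power_divide pos_le_divide_eq)
qed

text \<open>A union bound over all sets \<open>S\<close> with an exponential moment of the number of
  collisions. Only collisions that \<open>h\<close> adds on the images under \<open>g\<close> are
  counted; this allows two stages of hashing whose losses add up.\<close>

lemma expanding_hash_exists:
  fixes N K B d X :: nat and \<eta> :: real and g :: "nat => nat => nat"
  assumes \<eta>: "\<eta> > 0" and B: "B > 0"
    and cond: "\<And>s. 1 \<le> s ==> s \<le> K ==>
       exp 1 \<le> \<eta> * B / (2 * s) \<and> ln (4 * exp 1 * N / s) \<le> \<eta> * d / 2 * ln (\<eta> * B / (2 * s))"
  shows "\<exists>h. (\<forall>e x. h e x < B) \<and> (\<forall>S\<subseteq>{..<N}. card S \<le> K -->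
     (\<Sum>e<d. real (card (g e ` S))) - \<eta> * d * card S \<le> (\<Sum>e<d. real (card (h e ` g e ` S))))"
proof (cases "d = 0")
  case True thus ?thesis using B by auto
next
  case False
  define I where "I = {S. S \<subseteq> {..<N} \<and> S \<noteq> {} \<and> card S \<le> K}"
  have finI: "finite I" unfolding I_def by auto
  \<comment> \<open>With this choice an unexposed key contributes the factor 1 + \<eta> / 2, while
    the weight \<open>w\<close> below makes a set with more than \<eta> * d * card S collisions
    contribute at least 1 on its own.\<close>
  define lam where "lam S = \<eta> * B / (2 * card S)" for S :: "nat set"
  define w where "w S = lam S powr (- (\<eta> * d * card S))" for S :: "nat set"
  \<comment> \<open>The key x * d + e stands for the value of hash function e at x, so one function
    on the natural numbers codes the whole family and q mod d tells the hash functions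
    apart.\<close>
  define Q where "Q S = (\<Union>e<d. (\<lambda>x. x * d + e) ` g e ` S)" for S
  let ?b = "\<lambda>S. (1 + lam S * card S / B)"
  have fS: "finite S" if "S \<in> I" for S using that finite_subset unfolding I_def by auto
  have cS: "card S \<ge> 1" if "S \<in> I" for S using that fS[OF that] unfolding I_def by (auto simp: Suc_le_eq card_gt_0_iff)
  have finQ: "finite (Q S)" if "S \<in> I" for S unfolding Q_def using fS[OF that] by auto
  have lame: "exp 1 \<le> lam S" if "S \<in> I" for S using cond[OF cS[OF that]] that unfolding lam_def I_def by auto
  have e1: "exp (1::real) \<ge> 1" by simp
  have keydisj: "i = j" if "x * d + i = y * d + j" "i < d" "j < d" for x y i j proof -
    have "(x * d + i) mod d = (y * d + j) mod d" using that(1) by (rule arg_cong)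
    thus ?thesis using that(2,3) by simp
  qed
  have key: "{q \<in> Q S. q mod d = e} = (\<lambda>x. x * d + e) ` g e ` S" if "e < d" for S e using that False unfolding Q_def by auto
  have cQ: "card {q' \<in> Q S. q' < q \<and> q' mod d = q mod d} \<le> card S" if "S \<in> I" "q \<in> Q S" for S q proof -
    have "{q' \<in> Q S. q' < q \<and> q' mod d = q mod d} \<subseteq> (\<lambda>x. x * d + q mod d) ` g (q mod d) ` S"
      using key[of "q mod d" S] False by auto
    hence "card {q' \<in> Q S. q' < q \<and> q' mod d = q mod d} \<le> card ((\<lambda>x. x * d + q mod d) ` g (q mod d) ` S)"
      using fS[OF that(1)] by (intro card_mono) auto
    also have "\<dots> \<le> card S" using fS[OF that(1)] by (meson card_image_le finite_imageI le_trans)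
    finally show ?thesis .
  qed
  have cardQ: "card (Q S) = (\<Sum>e<d. card (g e ` S))" if "S \<in> I" for S proof -
    have "card (Q S) = (\<Sum>e<d. card ((\<lambda>x. x * d + e) ` g e ` S))" unfolding Q_def
    proof (rule card_UN_disjoint)
      show "\<forall>i\<in>{..<d}. \<forall>j\<in>{..<d}. i \<noteq> j --> (\<lambda>x. x * d + i) ` g i ` S \<inter> (\<lambda>x. x * d + j) ` g j ` S = {}"
      proof (intro ballI impI)
        fix i j assume "i \<in> {..<d}" "j \<in> {..<d}" "i \<noteq> j"
        thus "(\<lambda>x. x * d + i) ` g i ` S \<inter> (\<lambda>x. x * d + j) ` g j ` S = {}" using keydisj by (auto simp del: mult.commute)
      qed
    qed (use fS[OF that] in auto)
    also have "\<dots> = (\<Sum>e<d. card (g e ` S))" using False by (intro sum.cong refl card_image inj_onI) auto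
    finally show ?thesis .
  qed
  obtain M where M: "\<And>S q. S \<in> I ==> q \<in> Q S ==> q < M"
  proof -
    have "finite (\<Union>S\<in>I. Q S)" using finI finQ by auto
    then obtain M where "\<forall>q\<in>(\<Union>S\<in>I. Q S). q < M" by (meson finite_nat_set_iff_bounded)
    thus ?thesis using that by blast
  qed
  have w0: "\<And>S. S \<in> I ==> w S \<ge> 0" by (simp add: w_def)
  have l1: "\<And>S. S \<in> I ==> lam S \<ge> 1" using lame e1 order_trans by blast
  obtain H where HB: "\<And>q. H q < B" and H:
    "(\<Sum>S\<in>I. w S * lam S ^ card {q \<in> Q S. q < M \<and> (\<exists>q'\<in>Q S. q' < q \<and> q' mod d = q mod d \<and> H q' = H q)}
              * (?b S) ^ card {q \<in> Q S. q \<ge> M})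
     \<le> (\<Sum>S\<in>I. w S * (?b S) ^ card (Q S))"
    using derandomised_exposure[where I=I and Q=Q and w=w and lam=lam and c=card and B=B and d=d and M=M, OF finI B w0 l1 finQ cQ] by blast
  let ?C = "\<lambda>S. {q \<in> Q S. q < M \<and> (\<exists>q'\<in>Q S. q' < q \<and> q' mod d = q mod d \<and> H q' = H q)}"
  define h where "h e x = H (x * d + e)" for e x
  define col where "col S = (\<Sum>e<d. card (repeats (h e) (g e ` S)))" for S
  have dcol: "card (?C S) = col S" if "S \<in> I" for S
  proof -
    let ?D = "{q \<in> Q S. \<exists>q'\<in>Q S. q' < q \<and> q' mod d = q mod d \<and> H q' = H q}"
    have eq: "(?C S) = ?D" using M[OF that] by auto
    have "?D = (\<Union>e<d. (\<lambda>x. x * d + e) ` repeats (h e) (g e ` S))" (is "_ = ?E")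
    proof
      show "?D \<subseteq> ?E"
      proof
        fix q assume "q \<in> ?D"
        then obtain q' where q: "q \<in> Q S" "q' \<in> Q S" "q' < q" "q' mod d = q mod d" "H q' = H q" by auto
        obtain e x where 1: "e < d" "x \<in> g e ` S" "q = x * d + e" using q(1) unfolding Q_def by auto
        hence "q mod d = e" by simp
        hence "q' \<in> (\<lambda>x. x * d + e) ` g e ` S" using key[OF 1(1), of S] q by auto
        then obtain x' where 2: "x' \<in> g e ` S" "q' = x' * d + e" by auto
        have "x' < x" using q(3) 1 2 by auto
        hence "x \<in> repeats (h e) (g e ` S)" using 1 2 q(5) unfolding repeats_def h_def by auto
        thus "q \<in> ?E" using 1 by auto
      qed
      show "?E \<subseteq> ?D"
      proof
        fix q assume "q \<in> ?E"
        then obtain e x where 1: "e < d" "x \<in> repeats (h e) (g e ` S)" "q = x * d + e" by auto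
        then obtain x' where "x \<in> g e ` S" "x' \<in> g e ` S" "x' < x" "h e x' = h e x" unfolding repeats_def by auto
        hence "q \<in> Q S \<and> x' * d + e \<in> Q S \<and> x' * d + e < q \<and> (x' * d + e) mod d = q mod d \<and> H (x' * d + e) = H q"
          using 1 False unfolding Q_def h_def by auto
        thus "q \<in> ?D" by blast
      qed
    qed
    moreover have "card ?E = (\<Sum>e<d. card ((\<lambda>x. x * d + e) ` repeats (h e) (g e ` S)))"
    proof (rule card_UN_disjoint)
      show "\<forall>i\<in>{..<d}. finite ((\<lambda>x. x * d + i) ` repeats (h i) (g i ` S))" using fS[OF that] by (auto simp: repeats_def)
      show "\<forall>i\<in>{..<d}. \<forall>j\<in>{..<d}. i \<noteq> j -->
         (\<lambda>x. x * d + i) ` repeats (h i) (g i ` S) \<inter> (\<lambda>x. x * d + j) ` repeats (h j) (g j ` S) = {}"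
        using keydisj by (auto simp del: mult.commute)
    qed auto
    moreover have "\<dots> = col S" unfolding col_def using False by (intro sum.cong refl card_image inj_onI) auto
    ultimately show ?thesis using eq by simp
  qed
  have colsum: "(\<Sum>e<d. real (card (g e ` S))) = (\<Sum>e<d. real (card (h e ` g e ` S))) + col S" if "finite S" for S proof -
    have "real (card (g e ` S)) = real (card (h e ` g e ` S)) + real (card (repeats (h e) (g e ` S)))" for e
      using card_repeats[of "g e ` S" "h e"] that by (metis add.commute finite_imageI of_nat_add)
    thus ?thesis unfolding col_def by (simp add: sum.distrib)
  qed
  \<comment> \<open>Half of the exponent in \<open>w\<close> pays for the factors of the unexposed
    keys. By the hypothesis on the logarithms the other half beats the number of sets of this size,
    with (1/4) ^ card S to spare for the sum over all sizes.\<close>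
  have bound: "w S * (?b S) ^ card (Q S) \<le> (1/4) ^ card S / (N choose card S)" if S: "S \<in> I" for S proof -
    define s where "s = card S"
    have s1: "s \<ge> 1" "s \<le> K" "s \<le> N" using cS[OF S] S card_mono[of "{..<N}" S] unfolding s_def I_def by auto
    have lp: "lam S > 0" using l1[OF S] by simp
    have "lam S * s / B = \<eta> / 2" using s1 B unfolding lam_def s_def by (simp add: field_simps)
    moreover have "card (Q S) \<le> d * s" proof -
      have "(\<Sum>e<d. card (g e ` S)) \<le> (\<Sum>e<d. s)" unfolding s_def by (intro sum_mono card_image_le fS[OF S])
      thus ?thesis using cardQ[OF S] by simp
    qed
    ultimately have "(?b S) ^ card (Q S) \<le> (1 + \<eta>/2) ^ (d * s)"
      using \<eta> unfolding s_def[symmetric] by (simp only:) (rule power_increasing, auto)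
    also have "\<dots> \<le> exp (\<eta>/2) ^ (d * s)" using \<eta> exp_ge_add_one_self[of "\<eta>/2"] by (intro power_mono) auto
    also have "\<dots> = exp (\<eta> * d * s / 2)" by (simp add: exp_of_nat_mult[symmetric] field_simps)
    also have "\<dots> \<le> exp (\<eta> * d * s / 2 * ln (lam S))" proof -
      have "ln (lam S) \<ge> 1" using lame[OF S] lp by (metis exp_gt_zero ln_exp ln_mono)
      hence "\<eta> * d * s / 2 * 1 \<le> \<eta> * d * s / 2 * ln (lam S)" using \<eta> by (intro mult_left_mono) auto
      thus ?thesis by simp
    qed
    finally have "w S * (?b S) ^ card (Q S) \<le>
        exp (- (\<eta> * d * s) * ln (lam S)) * exp (\<eta> * d * s / 2 * ln (lam S))"
      using lp unfolding w_def powr_def s_def[symmetric] by (intro mult_mono) auto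
    also have "\<dots> = exp (- (s * (\<eta> * d / 2 * ln (lam S))))" by (simp add: exp_add[symmetric] field_simps)
    also have "\<dots> \<le> exp (- (s * ln (4 * exp 1 * N / s)))" proof -
      have "s * ln (4 * exp 1 * N / s) \<le> s * (\<eta> * d / 2 * ln (lam S))"
        using cond[OF s1(1,2)] unfolding lam_def s_def[symmetric] by (intro mult_left_mono) auto
      thus ?thesis by simp
    qed
    also have "\<dots> = 1 / (4 * exp 1 * N / s) ^ s" proof -
      have "exp (s * ln (4 * exp 1 * N / s)) = (4 * exp 1 * N / s) ^ s" using s1 by (simp add: exp_of_nat_mult exp_ln)
      thus ?thesis by (simp add: exp_minus inverse_eq_divide)
    qed
    also have "\<dots> = (1/4)^s / (exp 1 * N / s) ^ s" by (simp add: power_mult_distrib power_divide field_simps)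
    also have "\<dots> \<le> (1/4)^s / (N choose s)" using binomial_le_powr[of s N] s1 by (intro divide_left_mono) (auto simp: zero_less_binomial_iff)
    finally show ?thesis unfolding s_def .
  qed
  have tot: "(\<Sum>S\<in>I. w S * (?b S) ^ card (Q S)) < 1" proof -
    have "(\<Sum>S\<in>I. w S * (?b S) ^ card (Q S)) \<le> (\<Sum>S\<in>I. (1/4) ^ card S / (N choose card S))"
      using bound by (rule sum_mono)
    also have "\<dots> = (\<Sum>s\<in>{1..N}. \<Sum>S\<in>{S\<in>I. card S = s}. (1/4) ^ card S / (N choose card S))"
    proof (rule sum.group[symmetric])
      show "card ` I \<subseteq> {1..N}"
      proof
        fix s assume "s \<in> card ` I"
        then obtain S where "S \<in> I" "s = card S" by auto
        thus "s \<in> {1..N}" using cS[of S] card_mono[of "{..<N}" S] unfolding I_def by auto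
      qed
    qed (use finI in auto)
    also have "\<dots> \<le> (\<Sum>s\<in>{1..N}. (1/4)^s)"
    proof (rule sum_mono)
      fix s assume s: "s \<in> {1..N}"
      have "card {S\<in>I. card S = s} \<le> card {S. S \<subseteq> {..<N} \<and> card S = s}" by (intro card_mono) (auto simp: I_def)
      also have "\<dots> = N choose s" using n_subsets[of "{..<N}" s] by simp
      finally have "real (card {S\<in>I. card S = s}) \<le> N choose s" by simp
      moreover have "(\<Sum>S\<in>{S\<in>I. card S = s}. (1/4::real) ^ card S / (N choose card S)) = card {S\<in>I. card S = s} * ((1/4)^s / (N choose s))"
        by simp
      moreover have "real (N choose s) > 0" using s by (simp add: zero_less_binomial_iff)
      ultimately show "(\<Sum>S\<in>{S\<in>I. card S = s}. (1/4::real) ^ card S / (N choose card S)) \<le> (1/4)^s" by (simp add: field_simps)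
    qed
    also have "(\<Sum>s\<in>{1..N}. (1/4::real)^s) = (1 - (1/4)^N) / 3" by (induction N) auto
    also have "\<dots> < 1" proof -
      have *: "(1 - x) / 3 < 1" if "x \<ge> 0" for x :: real using that by simp
      show ?thesis by (rule *) simp
    qed
    finally show ?thesis .
  qed
  have fin: "col S \<le> \<eta> * d * card S" if S: "S \<in> I" for S proof -

    have T: "w S * lam S ^ col S < 1" proof -
      have "w S * lam S ^ col S \<le> (\<Sum>S\<in>I. w S * lam S ^ col S)"
        using S finI w0 l1 by (intro member_le_sum) (auto intro!: mult_nonneg_nonneg simp: order_trans[OF zero_le_one])
      also have "\<dots> = (\<Sum>S\<in>I. w S * lam S ^ card (?C S)
              * (?b S) ^ card {q \<in> Q S. q \<ge> M})"
      proof (rule sum.cong)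
        fix S assume S: "S \<in> I"
        hence "{q \<in> Q S. q \<ge> M} = {}" using M by (auto simp: not_le[symmetric])
        thus "w S * lam S ^ col S = w S * lam S ^ card (?C S)
              * (?b S) ^ card {q \<in> Q S. q \<ge> M}" using dcol[OF S] by (simp only: card.empty power_0 mult_1_right)
      qed simp
      finally show ?thesis using H tot by simp
    qed
    show ?thesis
    proof (rule ccontr)
      assume "\<not> ?thesis"
      hence "lam S powr (\<eta> * d * card S) \<le> lam S powr col S" using l1[OF S] by (intro powr_mono) auto
      also have "\<dots> = lam S ^ col S" using l1[OF S] by (intro powr_realpow) simp
      finally have "1 \<le> w S * lam S ^ col S" using l1[OF S] unfolding w_def by (simp add: powr_minus field_simps)
      thus False using T by simp
    qed
  qed
  have "(\<Sum>e<d. real (card (g e ` S))) - \<eta> * d * card S \<le> (\<Sum>e<d. real (card (h e ` g e ` S)))"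
    if "S \<subseteq> {..<N}" "card S \<le> K" for S
  proof (cases "S = {}")
    case False
    hence "S \<in> I" using that unfolding I_def by auto
    thus ?thesis using fin[of S] colsum[of S] fS[of S] by linarith
  qed auto
  thus ?thesis using HB unfolding h_def by (intro exI[of _ h]) (auto simp: h_def)
qed

lemma expanding_exists:
  fixes N K B d :: nat and \<eta> :: real
  assumes "\<eta> > 0" and "B > 0"
    and "\<And>s. 1 \<le> s ==> s \<le> K ==>
       exp 1 \<le> \<eta> * B / (2 * s) \<and> ln (4 * exp 1 * N / s) \<le> \<eta> * d / 2 * ln (\<eta> * B / (2 * s))"
  shows "\<exists>h. (\<forall>e x. h e x < B) \<and> expanding N K \<eta> d h"
  using expanding_hash_exists[of \<eta> B K N d "\<lambda>_ x. x", OF assms] unfolding expanding_def by (auto simp: algebra_simps)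

section \<open>Noise in an expanding family of hash functions\<close>

text \<open>A nonnegative \<open>v\<close> is a nonnegative combination of the indicators of its
  superlevel sets; the induction peels off the smallest positive level.\<close>

lemma sum_weighted_nonneg_by_levels:
  fixes f v :: "'a => real"
  assumes "finite I" and "\<And>l. l \<in> I ==> v l \<ge> 0"
    and "\<And>t. t > 0 ==> (\<Sum>l\<in>{l\<in>I. v l \<ge> t}. f l) \<ge> 0"
  shows "(\<Sum>l\<in>I. f l * v l) \<ge> 0" using assms
proof (induction "card I" arbitrary: I v rule: less_induct)
  case less
  show ?case
  proof (cases "\<exists>l\<in>I. v l = 0")
    case True
    define J where "J = {l\<in>I. v l \<noteq> 0}"
    have "J \<subset> I" using True unfolding J_def by auto
    hence "card J < card I" using less.prems(1) by (rule psubset_card_mono[rotated])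
    moreover have "{l\<in>J. v l \<ge> t} = {l\<in>I. v l \<ge> t}" if "t > 0" for t using that unfolding J_def by auto
    ultimately have "(\<Sum>l\<in>J. f l * v l) \<ge> 0" using less.prems unfolding J_def[symmetric] by (intro less.hyps) (auto simp: J_def)
    moreover have "(\<Sum>l\<in>I. f l * v l) = (\<Sum>l\<in>J. f l * v l)" unfolding J_def using less.prems(1) by (intro sum.mono_neutral_right) auto
    ultimately show ?thesis by simp
  next
    case False
    show ?thesis
    proof (cases "I = {}")
      case False
      define m where "m = Min (v ` I)"
      have m: "m \<in> v ` I" "\<And>l. l \<in> I ==> m \<le> v l" unfolding m_def using less.prems(1) False by auto
      have m0: "m > 0" using m(1) less.prems(2) \<open>\<not> (\<exists>l\<in>I. v l = 0)\<close> by (metis image_iff order_le_less)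
      define J where "J = {l\<in>I. v l > m}"
      have "J \<subset> I" using m(1) unfolding J_def by auto
      hence c: "card J < card I" using less.prems(1) by (rule psubset_card_mono[rotated])
      have "(\<Sum>l\<in>J. f l * (v l - m)) \<ge> 0"
      proof (rule less.hyps[OF c])
        show "finite J" using less.prems(1) unfolding J_def by auto
        show "v l - m \<ge> 0" if "l \<in> J" for l using that unfolding J_def by auto
        fix t :: real assume t: "t > 0"
        have "{l\<in>J. v l - m \<ge> t} = {l\<in>I. v l \<ge> t + m}" unfolding J_def using t by auto
        thus "(\<Sum>l\<in>{l\<in>J. v l - m \<ge> t}. f l) \<ge> 0" using less.prems(3)[of "t + m"] t m0 by auto
      qed
      moreover have "(\<Sum>l\<in>I. f l * (v l - m)) = (\<Sum>l\<in>J. f l * (v l - m))"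
        unfolding J_def using less.prems(1) m(2) by (intro sum.mono_neutral_right) force+
      moreover have "(\<Sum>l\<in>I. f l) \<ge> 0" proof -
        have "{l\<in>I. v l \<ge> m} = I" using m(2) by auto
        thus ?thesis using less.prems(3)[OF m0] by simp
      qed
      moreover have "(\<Sum>l\<in>I. f l * v l) = m * (\<Sum>l\<in>I. f l) + (\<Sum>l\<in>I. f l * (v l - m))"
        by (simp add: sum_distrib_left sum.distrib[symmetric] algebra_simps)
      ultimately show ?thesis using m0 by simp
    qed simp
  qed
qed

lemma top_subset_exists:
  fixes v :: "'a => real"
  assumes "finite I" "n \<le> card I"
  shows "\<exists>T\<subseteq>I. card T = n \<and> (\<forall>l\<in>T. \<forall>l'\<in>I - T. v l' \<le> v l)" using assms(2)
proof (induction n)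
  case 0 thus ?case by (intro exI[of _ "{}"]) auto
next
  case (Suc n)
  then obtain T where T: "T \<subseteq> I" "card T = n" "\<forall>l\<in>T. \<forall>l'\<in>I - T. v l' \<le> v l" by auto
  have ne: "I - T \<noteq> {}" using T Suc.prems by (metis Diff_eq_empty_iff Suc_n_not_le_n subset_antisym)
  have fin: "finite (v ` (I - T))" using assms(1) by auto
  have "Max (v ` (I - T)) \<in> v ` (I - T)" using ne fin by (intro Max_in) auto
  then obtain x where x: "x \<in> I - T" "v x = Max (v ` (I - T))" by auto
  have "\<forall>l'\<in>I - T. v l' \<le> v x" using x fin by auto
  moreover have "card (insert x T) = Suc n" using x T finite_subset[OF T(1) assms(1)] by auto
  ultimately show ?case using T x by (intro exI[of _ "insert x T"]) auto
qed

text \<open>An item of \<open>W\<close> has error at most its noise in a fraction \<theta> of its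
  buckets, so its error can be charged to collisions there. By expansion, collisions with heavier
  items are rare on average over every level set, hence no part of the mass is charged often. The
  bound is for all of \<open>W\<close> together; a single item may be hit badly.\<close>

lemma noise_charging:
  fixes a err :: "nat => real" and h :: "nat => nat => nat" and N d K :: nat and \<eta> \<theta> :: real
  assumes ex: "expanding N (3 * K) \<eta> d h"
    and W: "W \<subseteq> {..<N}" "card W \<le> K" and K: "0 < K" "K \<le> N"
    and a: "\<And>l. a l \<ge> 0" and err: "\<And>i. i \<in> W ==> err i \<ge> 0"
    and noisy: "\<And>i. i \<in> W ==> \<theta> * d \<le>
       card {e. e < d \<and> err i \<le> (\<Sum>l\<in>{l. l < N \<and> l \<noteq> i \<and> h e l = h e i}. a l)}"
    and d: "d > 0" and \<eta>: "\<eta> \<ge> 0" "16 * \<eta> \<le> \<theta>" "\<theta> > 0"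
  shows "(\<Sum>i\<in>W. err i) \<le> 16 * \<eta> / \<theta> * (\<Sum>l<N. a l)" proof -
  \<comment> \<open>Errors are added to the masses because an item of \<open>W\<close> is itself
    charged in the buckets where it is dirty. The sum of \<open>v\<close> then contains the total
    error, which is absorbed at the end.\<close>
  define v where "v l = (if l \<in> W then max (a l) (err l) else a l)" for l
  have v0: "v l \<ge> 0" for l using a unfolding v_def by (auto simp: max_def intro: order_trans)
  have av: "a l \<le> v l" for l unfolding v_def by auto
  have ev: "err i \<le> v i" if "i \<in> W" for i using that unfolding v_def by auto
  obtain T where T: "T \<subseteq> {..<N}" "card T = K" "\<And>l l'. l \<in> T ==> l' \<in> {..<N} - T ==> v l' \<le> v l"
    using top_subset_exists[of "{..<N}" K v] K by auto
  \<comment> \<open>Adding the \<open>K\<close> heaviest items has the effect that a level set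
    reaching beyond \<open>A\<close> contains all of \<open>T\<close>, hence at least
    \<open>K\<close> items of \<open>A\<close>.\<close>
  define A where "A = T \<union> W"
  have AN: "A \<subseteq> {..<N}" using T W unfolding A_def by auto
  have fA: "finite A" using AN finite_subset by blast
  have cA: "card A \<le> 2 * K" using card_Un_le[of T W] T W unfolding A_def by linarith
  define lt where "lt l' l \<longleftrightarrow> v l' > v l \<or> v l' = v l \<and> l' < l" for l' l
  have lt_total: "l \<noteq> l' ==> lt l l' \<or> lt l' l" for l l' unfolding lt_def by linarith
  have asym: "asymp_on X lt" "transp_on X lt" for X by (auto simp: lt_def asymp_on_def transp_on_def)
  \<comment> \<open>Collisions are counted against \<open>A\<close> only: for an item of
    \<open>A\<close> against its heavier members, for any other item against all of
    \<open>A\<close>.\<close>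
  define early where "early l' l \<longleftrightarrow> l' \<in> A \<and> (l \<in> A --> lt l' l)" for l' l
  define dirty where "dirty e l \<longleftrightarrow> (\<exists>l'. early l' l \<and> h e l' = h e l)" for e l
  define r where "r l = card {e. e < d \<and> dirty e l}" for l
  let ?T = "\<lambda>e P. {l\<in>P. dirty e l}"
  let ?F = "\<lambda>i. {e. e < d \<and> \<not> dirty e i}"
  let ?s = "\<lambda>P. \<Sum>l\<in>P. real (r l)"
  let ?C = "\<lambda>e. {i\<in>W. \<not> dirty e i}"
  have sumr: "?s P = (\<Sum>e<d. real (card (?T e P)))" if "finite P" for P proof -
    have "?s P = (\<Sum>l\<in>P. \<Sum>e<d. if dirty e l then 1 else 0)"
      unfolding r_def by (simp add: sum.If_cases Int_def lessThan_def)
    also have "\<dots> = (\<Sum>e<d. \<Sum>l\<in>P. if dirty e l then 1 else 0)" by (rule sum.swap)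
    also have "\<dots> = (\<Sum>e<d. real (card (?T e P)))" using that by (simp add: sum.If_cases Int_def)
    finally show ?thesis .
  qed
  \<comment> \<open>In an initial segment of \<open>A\<close> the first item of a bucket is not
    dirty, so dirty items are lost buckets, and expansion limits the loss.\<close>
  have seg: "?s P \<le> \<eta> * d * card P"
    if P: "P \<subseteq> A" and init: "\<And>l l'. l \<in> P ==> l' \<in> A ==> lt l' l ==> l' \<in> P" for P
  proof -
    have fP: "finite P" using P fA finite_subset by blast
    have "card (?T e P) + card (h e ` P) \<le> card P" for e proof -
      have "h e ` P \<subseteq> h e ` (P - (?T e P))"
      proof
        fix b assume "b \<in> h e ` P"
        hence ne: "{l\<in>P. h e l = b} \<noteq> {}" by auto
        have "\<exists>m\<in>{l\<in>P. h e l = b}. \<forall>x\<in>{l\<in>P. h e l = b}. x \<noteq> m --> \<not> lt x m"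
          using Finite_Set.bex_min_element[OF _ asym ne] fP by auto
        then obtain m where m: "m \<in> P" "h e m = b" "\<And>x. x \<in> P ==> h e x = b ==> x \<noteq> m ==> \<not> lt x m" by auto
        have "\<not> dirty e m"
        proof
          assume "dirty e m"
          then obtain l' where l': "early l' m" "h e l' = h e m" unfolding dirty_def by auto
          hence "lt l' m" "l' \<in> A" using P m(1) unfolding early_def by auto
          hence "l' \<in> P" using init m(1) by auto
          thus False using m(2,3) l' \<open>lt l' m\<close> unfolding lt_def by auto
        qed
        thus "b \<in> h e ` (P - (?T e P))" using m by auto
      qed
      hence "card (h e ` P) \<le> card (P - (?T e P))" using fP by (meson card_image_le card_mono finite_Diff finite_imageI le_trans)
      moreover have "card (P - (?T e P)) = card P - card (?T e P)" using fP by (intro card_Diff_subset) auto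
      moreover have "card (?T e P) \<le> card P" using fP by (intro card_mono) auto
      ultimately show ?thesis by linarith
    qed
    hence "(\<Sum>e<d. real (card (?T e P))) \<le> (\<Sum>e<d. real (card P) - real (card (h e ` P)))"
      by (intro sum_mono) (metis add_le_imp_le_diff le_diff_eq of_nat_add of_nat_le_iff)
    also have "\<dots> = d * card P - (\<Sum>e<d. real (card (h e ` P)))" by (simp add: sum_subtractf)
    also have "\<dots> \<le> \<eta> * d * card P" proof -
      have "card P \<le> 3 * K" using card_mono[OF fA P] cA by linarith
      hence "(1 - \<eta>) * d * card P \<le> (\<Sum>e<d. real (card (h e ` P)))" using ex P AN unfolding expanding_def by auto
      thus ?thesis by (simp add: algebra_simps)
    qed
    finally show ?thesis using sumr[OF fP] by simp
  qed
  \<comment> \<open>The block and \<open>A\<close> together have at most 3 * K items, the size up to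
    which \<open>h\<close> expands. The bound includes the losses inside \<open>A\<close>.\<close>
  have blk: "?s U \<le> 3 * \<eta> * d * K" if U: "U \<subseteq> {..<N} - A" "card U \<le> K" for U proof -
    have fU: "finite U" using U finite_subset by blast
    have dj: "U \<inter> A = {}" using U by auto
    have cAU: "card (A \<union> U) = card A + card U" using fA fU dj by (subst card_Un_disjoint) auto
    have "card (?T e U) + card (h e ` (A \<union> U)) \<le> card (A \<union> U)" for e proof -
      have "h e ` (A \<union> U) \<subseteq> h e ` (A \<union> (U - (?T e U)))"
      proof
        fix b assume "b \<in> h e ` (A \<union> U)"
        then obtain l where l: "l \<in> A \<union> U" "b = h e l" by auto
        show "b \<in> h e ` (A \<union> (U - (?T e U)))"
        proof (cases "l \<in> U \<and> dirty e l")
          case True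
          then obtain l' where "l' \<in> A" "h e l' = h e l" unfolding dirty_def early_def by auto
          thus ?thesis using l by (metis UnI1 imageI)
        qed (use l in auto)
      qed
      hence "card (h e ` (A \<union> U)) \<le> card (A \<union> (U - (?T e U)))"
        using fA fU by (meson card_image_le card_mono finite_Diff finite_UnI finite_imageI le_trans)
      also have "\<dots> \<le> card A + card (U - (?T e U))" by (rule card_Un_le)
      also have "card (U - (?T e U)) = card U - card (?T e U)" using fU by (intro card_Diff_subset) auto
      finally have "card (h e ` (A \<union> U)) \<le> card A + (card U - card (?T e U))" .
      moreover have "card (?T e U) \<le> card U" using fU by (intro card_mono) auto
      ultimately show ?thesis using cAU by linarith
    qed
    hence "(\<Sum>e<d. real (card (?T e U))) \<le> (\<Sum>e<d. real (card (A \<union> U)) - real (card (h e ` (A \<union> U))))"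
      by (intro sum_mono) (metis add_le_imp_le_diff le_diff_eq of_nat_add of_nat_le_iff)
    also have "\<dots> = d * card (A \<union> U) - (\<Sum>e<d. real (card (h e ` (A \<union> U))))" by (simp add: sum_subtractf)
    also have "\<dots> \<le> \<eta> * d * card (A \<union> U)" proof -
      have "card (A \<union> U) \<le> 3 * K" using cAU cA U by linarith
      hence "(1 - \<eta>) * d * card (A \<union> U) \<le> (\<Sum>e<d. real (card (h e ` (A \<union> U))))"
        using ex U AN unfolding expanding_def by blast
      thus ?thesis by (simp add: algebra_simps)
    qed
    also have "\<dots> \<le> \<eta> * d * (3 * K)" proof -
      have "real (card (A \<union> U)) \<le> 3 * real K" using cAU cA U by linarith
      thus ?thesis using \<eta> by (intro mult_left_mono) auto
    qed
    finally show ?thesis using sumr[OF fU] by (simp add: algebra_simps)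
  qed
  \<comment> \<open>Larger sets are cut into blocks of size \<open>K\<close>. The last, incomplete
    block costs the extra \<open>K\<close>, which the members of \<open>T\<close> pay for in the
    level sets below.\<close>
  have blks: "?s U \<le> 3 * \<eta> * d * (card U + K)" if U: "U \<subseteq> {..<N} - A" for U using U
  proof (induction "card U" arbitrary: U rule: less_induct)
    case less
    have fU: "finite U" using less.prems finite_subset by blast
    show ?case
    proof (cases "card U \<le> K")
      case True
      have "3 * \<eta> * d * K \<le> 3 * \<eta> * d * (card U + K)" using \<eta> by (intro mult_left_mono) auto
      thus ?thesis using blk[OF less.prems True] by linarith
    next
      case False
      then obtain V where V: "V \<subseteq> U" "card V = K" by (meson nat_le_linear obtain_subset_with_card_n)
      have cU: "card (U - V) = card U - K" using V fU by (simp add: card_Diff_subset finite_subset)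
      have "?s (U - V) \<le> 3 * \<eta> * d * (card (U - V) + K)" using less.prems cU False K by (intro less.hyps) auto
      moreover have "?s V \<le> 3 * \<eta> * d * K" using V less.prems by (intro blk) auto
      moreover have "?s U = ?s (U - V) + ?s V"
        using V fU by (simp add: sum.subset_diff)
      moreover have "real (card (U - V)) = real (card U) - K" using cU False by simp
      ultimately show ?thesis by (simp add: algebra_simps)
    qed
  qed
  have level: "(\<Sum>l\<in>{l\<in>{..<N}. v l \<ge> t}. real (r l)) \<le> 4 * \<eta> * d * card {l\<in>{..<N}. v l \<ge> t}" for t proof -
    define X where "X = {l\<in>{..<N}. v l \<ge> t}"
    have fX: "finite X" unfolding X_def by auto
    have split: "?s X = ?s (X \<inter> A) + ?s (X - A)"
      using fX by (metis Int_commute add.commute sum.Int_Diff)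
    have 1: "?s (X \<inter> A) \<le> \<eta> * d * card (X \<inter> A)" using AN by (intro seg) (auto simp: X_def lt_def)
    have cX: "card X = card (X \<inter> A) + card (X - A)" using fX by (metis Int_Diff_disjoint Int_Diff_Un card_Un_disjoint finite_Diff finite_Int)
    have "?s X \<le> 4 * \<eta> * d * card X"
    proof (cases "X - A = {}")
      case True
      have "1 * (\<eta> * d * card (X \<inter> A)) \<le> 4 * (\<eta> * d * card (X \<inter> A))" using \<eta> by (intro mult_right_mono) auto
      moreover have "?s X = ?s (X \<inter> A)" using split True by simp
      moreover have "card X = card (X \<inter> A)" using cX True by (simp only: card.empty add_0_right)
      ultimately show ?thesis using 1 by simp
    next
      case False
      then obtain l where l: "l \<in> X" "l \<notin> A" by auto
      have "T \<subseteq> X"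
      proof
        fix l' assume l': "l' \<in> T"
        hence "v l \<le> v l'" using T(3)[of l' l] l unfolding X_def A_def by auto
        thus "l' \<in> X" using l l' T(1) unfolding X_def by auto
      qed
      hence "T \<subseteq> X \<inter> A" unfolding A_def by auto
      hence KX: "K \<le> card (X \<inter> A)" using T(2) fX card_mono[of "X \<inter> A" T] by simp
      have "?s (X - A) \<le> 3 * \<eta> * d * (card (X - A) + K)" by (intro blks) (auto simp: X_def)
      also have "\<dots> \<le> 3 * \<eta> * d * (card (X - A) + card (X \<inter> A))" using KX \<eta> by (intro mult_left_mono) auto
      finally have "?s X \<le> \<eta> * d * card (X \<inter> A) + 3 * \<eta> * d * card X"
        using split 1 cX by (simp add: add.commute)
      moreover have "\<eta> * d * card (X \<inter> A) \<le> \<eta> * d * card X" using cX \<eta> by (intro mult_left_mono) auto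
      ultimately show ?thesis by simp
    qed
    thus ?thesis unfolding X_def .
  qed
  define E where "E = (\<Sum>i\<in>W. err i)"
  define Sa where "Sa = (\<Sum>l<N. a l)"
  have rv: "(\<Sum>l<N. r l * v l) \<le> 4 * \<eta> * d * (\<Sum>l<N. v l)" proof -
    have "(\<Sum>l<N. (4 * \<eta> * d - r l) * v l) \<ge> 0"
    proof (rule sum_weighted_nonneg_by_levels)
      show "0 \<le> (\<Sum>l\<in>{l \<in> {..<N}. t \<le> v l}. 4 * \<eta> * d - r l)" for t
        using level[of t] by (simp add: sum_subtractf mult.commute)
    qed (use v0 in auto)
    thus ?thesis by (simp add: left_diff_distrib sum_subtractf sum_distrib_left)
  qed
  have sv: "(\<Sum>l<N. v l) \<le> Sa + E" proof -
    have "(\<Sum>l<N. v l) \<le> (\<Sum>l<N. a l + (if l \<in> W then err l else 0))"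
      using a err unfolding v_def by (intro sum_mono) (auto simp: max_def)
    also have "\<dots> = Sa + (\<Sum>l\<in>{..<N} \<inter> W. err l)" unfolding Sa_def by (simp add: sum.distrib sum.If_cases Int_def)
    also have "{..<N} \<inter> W = W" using W by auto
    finally show ?thesis unfolding E_def .
  qed
  define noise where "noise e i = (\<Sum>l\<in>{l. l < N \<and> l \<noteq> i \<and> h e l = h e i}. a l)" for e i
  have n0: "noise e i \<ge> 0" for e i unfolding noise_def using a by (intro sum_nonneg) auto
  let ?R = "(\<Sum>l<N. r l * v l)"
  have fW: "finite W" using W finite_subset by blast
  \<comment> \<open>Every other item in the bucket of a clean \<open>i\<close> is dirty, as
    \<open>i\<close> comes before it, and two clean items of \<open>W\<close> cannot share a bucket,
    since each would come before the other. So the noises of clean items are sums over disjoint sets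
    of dirty items.\<close>
  have clean: "(\<Sum>i\<in>(?C e). noise e i) \<le> (\<Sum>l\<in>{l. l < N \<and> dirty e l}. a l)" for e proof -
    define L where "L i = {l. l < N \<and> l \<noteq> i \<and> h e l = h e i}" for i
    have cl: "early i l" if "i \<in> W" "\<not> dirty e i" "l \<in> L i" for i l proof -
      have "i \<in> A" using that unfolding A_def by auto
      moreover have "lt i l" if "l \<in> A" proof -
        have "\<not> early l i" using \<open>\<not> dirty e i\<close> \<open>l \<in> L i\<close> unfolding dirty_def L_def by auto
        hence "\<not> lt l i" using that \<open>i \<in> A\<close> unfolding early_def by auto
        thus ?thesis using lt_total[of l i] \<open>l \<in> L i\<close> unfolding L_def by auto
      qed
      ultimately show ?thesis unfolding early_def by auto
    qed
    have "(\<Sum>i\<in>(?C e). noise e i) = (\<Sum>i\<in>(?C e). \<Sum>l\<in>L i. a l)"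
      unfolding noise_def L_def ..
    also have "\<dots> = (\<Sum>l\<in>(\<Union>i\<in>(?C e). L i). a l)"
    proof (rule sum.UNION_disjoint[symmetric])
      show "\<forall>i\<in>{i \<in> W. \<not> dirty e i}. \<forall>j\<in>{i \<in> W. \<not> dirty e i}. i \<noteq> j --> L i \<inter> L j = {}"
      proof (intro ballI impI)
        fix i j assume *: "i \<in> {i \<in> W. \<not> dirty e i}" "j \<in> {i \<in> W. \<not> dirty e i}" "i \<noteq> j"
        show "L i \<inter> L j = {}"
        proof (rule ccontr)
          assume "L i \<inter> L j \<noteq> {}"
          hence "h e i = h e j" unfolding L_def by auto
          hence "i \<in> L j" "j \<in> L i" using * W unfolding L_def by auto
          hence "early i j" "early j i" using cl * by auto
          hence "lt i j" "lt j i" unfolding early_def by auto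
          thus False unfolding lt_def by auto
        qed
      qed
    qed (use fW in \<open>auto simp: L_def\<close>)
    also have "\<dots> \<le> (\<Sum>l\<in>{l. l < N \<and> dirty e l}. a l)"
    proof (rule sum_mono2)
      show "(\<Union>i\<in>(?C e). L i) \<subseteq> {l. l < N \<and> dirty e l}"
      proof
        fix l assume "l \<in> (\<Union>i\<in>(?C e). L i)"
        then obtain i where i: "i \<in> W" "\<not> dirty e i" "l \<in> L i" by auto
        thus "l \<in> {l. l < N \<and> dirty e l}" using cl[OF i] unfolding dirty_def L_def by auto
      qed
    qed (use a in auto)
    finally show ?thesis .
  qed
  \<comment> \<open>Positions where \<open>i\<close> is dirty are charged to its own error, the
    remaining noisy positions to the noise there.\<close>
  have item: "\<theta> * d * err i \<le> r i * err i + (\<Sum>e\<in>(?F i). noise e i)" if i: "i \<in> W" for i proof -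
    define F where "F = {e. e < d \<and> err i \<le> noise e i}"
    have "\<theta> * d \<le> card F" using noisy[OF i] unfolding F_def noise_def .
    also have "card F \<le> card ({e. e < d \<and> dirty e i} \<union> (F \<inter> (?F i)))"
      by (intro card_mono) (auto simp: F_def)
    also have "\<dots> \<le> r i + card (F \<inter> (?F i))" unfolding r_def by (rule card_Un_le)
    finally have "\<theta> * d * err i \<le> (real (r i) + card (F \<inter> (?F i))) * err i"
      using err[OF i] by (intro mult_right_mono) auto
    moreover have "card (F \<inter> (?F i)) * err i \<le> (\<Sum>e\<in>F \<inter> (?F i). noise e i)"
      by (subst sum_constant[symmetric], intro sum_mono) (auto simp: F_def)
    moreover have "(\<Sum>e\<in>F \<inter> (?F i). noise e i) \<le> (\<Sum>e\<in>(?F i). noise e i)"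
      using n0 by (intro sum_mono2) auto
    ultimately show ?thesis by (simp add: algebra_simps)
  qed
  have "\<theta> * d * E = (\<Sum>i\<in>W. \<theta> * d * err i)" unfolding E_def by (simp add: sum_distrib_left)
  also have "\<dots> \<le> (\<Sum>i\<in>W. r i * err i + (\<Sum>e\<in>(?F i). noise e i))" using item by (rule sum_mono)
  also have "\<dots> = (\<Sum>i\<in>W. r i * err i) + (\<Sum>i\<in>W. \<Sum>e\<in>(?F i). noise e i)"
    by (rule sum.distrib)
  also have "(\<Sum>i\<in>W. r i * err i) \<le> ?R" proof -
    have "(\<Sum>i\<in>W. r i * err i) \<le> (\<Sum>i\<in>W. r i * v i)" using ev by (intro sum_mono mult_left_mono) auto
    also have "\<dots> \<le> ?R" using W v0 by (intro sum_mono2) auto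
    finally show ?thesis .
  qed
  also have "(\<Sum>i\<in>W. \<Sum>e\<in>(?F i). noise e i) \<le> ?R" proof -
    have "(\<Sum>i\<in>W. \<Sum>e\<in>(?F i). noise e i) = (\<Sum>i\<in>W. \<Sum>e<d. if \<not> dirty e i then noise e i else 0)"
      by (simp add: sum.inter_filter[symmetric])
    also have "\<dots> = (\<Sum>e<d. \<Sum>i\<in>W. if \<not> dirty e i then noise e i else 0)" by (rule sum.swap)
    also have "\<dots> = (\<Sum>e<d. \<Sum>i\<in>(?C e). noise e i)" using fW by (simp add: sum.inter_filter)
    also have "\<dots> \<le> (\<Sum>e<d. \<Sum>l\<in>{l. l < N \<and> dirty e l}. a l)" using clean by (intro sum_mono)
    also have "\<dots> = (\<Sum>e<d. \<Sum>l<N. if dirty e l then a l else 0)" by (simp add: sum.inter_filter[symmetric])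
    also have "\<dots> = (\<Sum>l<N. \<Sum>e<d. if dirty e l then a l else 0)" by (rule sum.swap)
    also have "\<dots> = (\<Sum>l<N. r l * a l)" unfolding r_def by (intro sum.cong refl) (simp add: sum.If_cases Int_def lessThan_def)
    also have "\<dots> \<le> ?R" using av by (intro sum_mono mult_left_mono) auto
    finally show ?thesis .
  qed
  finally have "\<theta> * d * E \<le> 2 * (4 * \<eta> * d * (\<Sum>l<N. v l))" using rv by linarith
  also have "\<dots> \<le> 2 * (4 * \<eta> * d * (Sa + E))" using sv \<eta> by (intro mult_left_mono) auto
  finally have "d * (\<theta> * E) \<le> d * (8 * \<eta> * (Sa + E))" by (simp add: algebra_simps)
  \<comment> \<open>Since 16 * \<eta> \<le> \<theta>, half of the left side absorbs the errors on
    the right.\<close>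
  hence 1: "\<theta> * E \<le> 8 * \<eta> * (Sa + E)" using d by simp
  have "E \<ge> 0" unfolding E_def using err by (rule sum_nonneg)
  hence "16 * \<eta> * E \<le> \<theta> * E" using \<eta> by (intro mult_right_mono) auto
  hence "\<theta> * E \<le> 16 * \<eta> * Sa" using 1 by (simp add: algebra_simps)
  thus ?thesis using \<eta> unfolding E_def Sa_def by (simp add: field_simps)
qed

section \<open>Convergence of the iteration\<close>

text \<open>The first alternative is for fewer than \<open>k\<close> nonzero estimates; then
  \<open>S\<close> may be smaller than \<open>k\<close> or contain items of estimate 0.\<close>

definition largest_k :: "nat => nat => (nat => real) => nat set => bool" where
  "largest_k N k u S \<longleftrightarrow> S \<subseteq> {..<N} \<and> card S \<le> k \<and>
     ((\<forall>j\<in>{..<N} - S. u j = 0) \<or> card S = k \<and> (\<forall>j\<in>{..<N} - S. \<forall>w\<in>S. \<bar>u j\<bar> \<le> \<bar>u w\<bar>))"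

definition noise_dominated ::
  "nat => nat => (nat => nat => nat) => real => (nat => real) => nat => real => bool" where
  "noise_dominated N d h \<theta> z i err \<longleftrightarrow>
     \<theta> * d \<le> card {e. e < d \<and> err \<le> (\<Sum>l\<in>{l. l < N \<and> l \<noteq> i \<and> h e l = h e i}. \<bar>z l\<bar>)}"

lemma min_sum_le:
  fixes f :: "'a => real"
  assumes "\<tau> \<ge> 0" "\<And>l. l \<in> I ==> f l \<ge> 0"
  shows "min (\<Sum>l\<in>I. f l) \<tau> \<le> (\<Sum>l\<in>I. min (f l) \<tau>)" using assms(2)
proof (induction I rule: infinite_finite_induct)
  case (insert x F)
  have "min (f x + sum f F) \<tau> \<le> min (f x) \<tau> + min (sum f F) \<tau>"
    using insert.prems[of x] sum_nonneg[of F f] insert.prems assms(1) by (fastforce simp: min_def)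
  moreover have "min (sum f F) \<tau> \<le> (\<Sum>l\<in>F. min (f l) \<tau>)" using insert by auto
  ultimately show ?case using insert.hyps by simp
qed (use assms in auto)

text \<open>Truncation at \<tau> is even, subadditive and monotone in the absolute value, which is
  all that the analysis of thresholding uses. A dropped item of \<open>S\<close> is matched with a
  selected item outside \<open>S\<close> whose estimate is at least as large and whose true value is
  part of the tail.\<close>

lemma selection_error:
  fixes x u :: "nat => real"
  assumes S: "S \<subseteq> {..<N}" "card S \<le> k" and L: "largest_k N k u S'" and \<tau>: "\<tau> \<ge> 0"
  shows "(\<Sum>i<N. min \<bar>x i - (if i \<in> S' then u i else 0)\<bar> \<tau>) \<le>
     (\<Sum>i\<in>{..<N} - S. min \<bar>x i\<bar> \<tau>) + 2 * (\<Sum>i\<in>S \<union> S'. min \<bar>u i - x i\<bar> \<tau>)"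
proof -
  let ?v = "\<lambda>i. (if i \<in> S' then u i else 0)"
  define \<phi> where "\<phi> t = min \<bar>t\<bar> \<tau>" for t :: real
  have \<phi>0: "\<phi> t \<ge> 0" for t unfolding \<phi>_def using \<tau> by auto
  have tri: "\<phi> (s + t) \<le> \<phi> s + \<phi> t" for s t unfolding \<phi>_def using \<tau> by (auto simp: min_def)
  have mono: "\<bar>s\<bar> \<le> \<bar>t\<bar> ==> \<phi> s \<le> \<phi> t" for s t unfolding \<phi>_def by auto
  have sym: "\<phi> (s - t) = \<phi> (t - s)" for s t unfolding \<phi>_def by (simp add: abs_minus_commute)
  have S': "S' \<subseteq> {..<N}" "card S' \<le> k" using L unfolding largest_k_def by auto
  have fin: "finite S" "finite S'" using S S' finite_subset by blast+
  define D where "D i = \<phi> (u i - x i)" for i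
  have D0: "D i \<ge> 0" for i unfolding D_def by (rule \<phi>0)
  let ?s = "(\<Sum>i\<in>S - S'. \<phi> (x i))"
  have swap: "?s \<le> (\<Sum>i\<in>S - S'. D i) + (\<Sum>i\<in>S' - S. D i) + (\<Sum>i\<in>S' - S. \<phi> (x i))"
  proof (cases "\<forall>j\<in>{..<N} - S'. u j = 0")
    case True
    hence "?s = (\<Sum>i\<in>S - S'. D i)" using S unfolding D_def \<phi>_def by (intro sum.cong) auto
    moreover have "(\<Sum>i\<in>S' - S. D i) \<ge> 0" "(\<Sum>i\<in>S' - S. \<phi> (x i)) \<ge> 0" using D0 \<phi>0 by (auto intro: sum_nonneg)
    ultimately show ?thesis by linarith
  next
    case False
    hence c: "card S' = k" "\<And>j w. j \<in> {..<N} - S' ==> w \<in> S' ==> \<bar>u j\<bar> \<le> \<bar>u w\<bar>"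
      using L unfolding largest_k_def by auto
    have "card (S - S') \<le> card (S' - S)" proof -
      have "card (S - S') = card S - card (S \<inter> S')" "card (S' - S) = card S' - card (S \<inter> S')"
        using fin by (simp_all add: card_Diff_subset_Int Int_commute)
      thus ?thesis using S c by simp
    qed
    then obtain f where f: "inj_on f (S - S')" "f ` (S - S') \<subseteq> S' - S" using fin by (meson card_le_inj finite_Diff)
    have "?s \<le> (\<Sum>i\<in>S - S'. D i + (D (f i) + \<phi> (x (f i))))"
    proof (rule sum_mono)
      fix i assume i: "i \<in> S - S'"
      hence fi: "f i \<in> S'" using f by auto
      have "\<phi> (x i) \<le> D i + \<phi> (u i)" using tri[of "x i - u i" "u i"] sym[of "x i"] unfolding D_def by simp
      also have "\<phi> (u i) \<le> \<phi> (u (f i))" using c(2)[of i "f i"] i fi S by (intro mono) auto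
      also have "\<phi> (u (f i)) \<le> D (f i) + \<phi> (x (f i))" using tri[of "u (f i) - x (f i)" "x (f i)"] unfolding D_def by simp
      finally show "\<phi> (x i) \<le> D i + (D (f i) + \<phi> (x (f i)))" by simp
    qed
    also have "\<dots> = (\<Sum>i\<in>S - S'. D i) + (\<Sum>j\<in>f ` (S - S'). D j + \<phi> (x j))" using f by (simp add: sum.distrib sum.reindex)
    also have "(\<Sum>j\<in>f ` (S - S'). D j + \<phi> (x j)) \<le> (\<Sum>j\<in>S' - S. D j + \<phi> (x j))"
      using f fin D0 \<phi>0 by (intro sum_mono2) (auto intro: add_nonneg_nonneg)
    finally show ?thesis by (simp add: sum.distrib)
  qed
  have "(\<Sum>i<N. \<phi> (x i - ?v i)) =
      (\<Sum>i\<in>S'. \<phi> (x i - ?v i)) + (\<Sum>i\<in>{..<N} - S'. \<phi> (x i - ?v i))"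
    using S' by (subst sum.subset_diff[of S']) auto
  also have "(\<Sum>i\<in>S'. \<phi> (x i - ?v i)) = (\<Sum>i\<in>S'. D i)"
    unfolding D_def using sym by (intro sum.cong) auto
  also have "(\<Sum>i\<in>{..<N} - S'. \<phi> (x i - ?v i)) = (\<Sum>i\<in>{..<N} - S'. \<phi> (x i))"
    by (intro sum.cong) auto
  also have "\<dots> = ?s + (\<Sum>i\<in>{..<N} - (S \<union> S'). \<phi> (x i))" proof -
    have "{..<N} - S' = (S - S') \<union> ({..<N} - (S \<union> S'))" using S by auto
    thus ?thesis using fin by (simp only:) (subst sum.union_disjoint, auto)
  qed
  finally have 1: "(\<Sum>i<N. \<phi> (x i - ?v i)) =
      (\<Sum>i\<in>S'. D i) + (?s + (\<Sum>i\<in>{..<N} - (S \<union> S'). \<phi> (x i)))" .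
  have 2: "(\<Sum>i\<in>{..<N} - S. \<phi> (x i)) = (\<Sum>i\<in>S' - S. \<phi> (x i)) + (\<Sum>i\<in>{..<N} - (S \<union> S'). \<phi> (x i))"
  proof -
    have "{..<N} - S = (S' - S) \<union> ({..<N} - (S \<union> S'))" using S' by auto
    thus ?thesis using fin by (simp only:) (subst sum.union_disjoint, auto)
  qed
  have 3: "(\<Sum>i\<in>S \<union> S'. D i) = (\<Sum>i\<in>S'. D i) + (\<Sum>i\<in>S - S'. D i)"
    using fin by (subst sum.union_disjoint[symmetric]) (auto intro: sum.cong)
  have 4: "(\<Sum>i\<in>S' - S. D i) \<le> (\<Sum>i\<in>S'. D i)" using fin D0 by (intro sum_mono2) auto
  have 5: "(\<Sum>i\<in>S - S'. D i) \<ge> 0" using D0 by (rule sum_nonneg)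
  have "(\<Sum>i<N. \<phi> (x i - ?v i)) \<le>
     (\<Sum>i\<in>{..<N} - S. \<phi> (x i)) + 2 * (\<Sum>i\<in>S \<union> S'. D i)" using 1 2 3 4 5 swap by linarith
  thus ?thesis unfolding \<phi>_def D_def .
qed

text \<open>Truncating the errors at a level \<open>\<tau>\<close> slightly above the final error makes the initial
  potential at most \<open>k * \<tau>\<close> plus the tail, however large the entries are; hence the number of
  rounds does not depend on the dynamic range of the signal.\<close>

lemma iteration_converges:
  fixes x :: "nat => real" and X :: "nat => nat => real" and \<eta> \<theta> \<epsilon> :: real
  assumes ex: "expanding N (6 * k) \<eta> d h" and k: "0 < k" "2 * k \<le> N" and d: "d > 0"
    and \<eta>: "0 \<le> \<eta>" "128 * \<eta> \<le> \<epsilon> * \<theta>" "0 < \<theta>" and \<epsilon>: "0 < \<epsilon>" "\<epsilon> \<le> 1"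
    and X0: "\<And>i. X 0 i = 0"
    and step: "\<And>j. j < J ==> \<exists>u S'. largest_k N k u S' \<and>
        (\<forall>i<N. X (Suc j) i = (if i \<in> S' then u i else 0)) \<and>
        (\<forall>i<N. noise_dominated N d h \<theta> (\<lambda>l. x l - X j l) i \<bar>u i - x i\<bar>)"
    and J: "(4 * real k + 1) * (1/4) ^ J \<le> \<epsilon> / 4"
    and S: "S \<subseteq> {..<N}" "card S \<le> k"
  shows "(\<Sum>i<N. \<bar>X J i - x i\<bar>) \<le> (1 + \<epsilon>) * (\<Sum>i\<in>{..<N} - S. \<bar>x i\<bar>)" proof -
  define tl where "tl = (\<Sum>i\<in>{..<N} - S. \<bar>x i\<bar>)"
  let ?r = "(\<Sum>i<N. \<bar>x i - X J i\<bar>)"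
  have tl0: "tl \<ge> 0" unfolding tl_def by (simp add: sum_nonneg)
  let ?t = "(1 + \<epsilon> / 3)"
  \<comment> \<open>\<tau> stays free: in the end it is four times the tail, or tends to 0 if the
    tail vanishes.\<close>
  have main: "?r \<le> ?t * tl + \<epsilon> * \<tau> / 16"
    if \<tau>: "\<tau> > 0" "\<tau> \<ge> 4 * tl" for \<tau>
  proof -
    define F where "F j = (\<Sum>i<N. min \<bar>x i - X j i\<bar> \<tau>)" for j
    have F0: "F j \<ge> 0" for j unfolding F_def using \<tau> by (intro sum_nonneg) auto
    have rec: "F (Suc j) \<le> tl + \<epsilon> / 4 * F j" if j: "j < J" for j proof -
      obtain u S' where u: "largest_k N k u S'" "\<And>i. i < N ==> X (Suc j) i = (if i \<in> S' then u i else 0)"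
        "\<And>i. i < N ==> noise_dominated N d h \<theta> (\<lambda>l. x l - X j l) i \<bar>u i - x i\<bar>" using step[OF j] by blast
      let ?m = "\<lambda>e i. (\<Sum>l\<in>{l. l < N \<and> l \<noteq> i \<and> h e l = h e i}. min \<bar>x l - X j l\<bar> \<tau>)"
      let ?n = "\<lambda>e i. (\<Sum>l\<in>{l. l < N \<and> l \<noteq> i \<and> h e l = h e i}. \<bar>x l - X j l\<bar>)"
      have S': "S' \<subseteq> {..<N}" "card S' \<le> k" using u(1) unfolding largest_k_def by auto
      \<comment> \<open>Both the optimal support \<open>S\<close> and the selected one are charged.
        This makes 2 * k items and explains the expansion up to 6 * k.\<close>
      have "(\<Sum>i\<in>S \<union> S'. min \<bar>u i - x i\<bar> \<tau>) \<le> 16 * \<eta> / \<theta> * (\<Sum>l<N. min \<bar>x l - X j l\<bar> \<tau>)"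
      proof (rule noise_charging[where K = "2 * k" and d = d and h = h])
        show "expanding N (3 * (2 * k)) \<eta> d h" using ex by simp
        show "S \<union> S' \<subseteq> {..<N}" using S S' by auto
        show "card (S \<union> S') \<le> 2 * k" using card_Un_le[of S S'] S S' by linarith
        fix i assume "i \<in> S \<union> S'"
        hence i: "i < N" using S S' by auto
        \<comment> \<open>By subadditivity the truncation passes from the noise sum to its summands,
          so the truncated residual may serve as the masses.\<close>
        have "{e. e < d \<and> \<bar>u i - x i\<bar> \<le> (?n e i)}
          \<subseteq> {e. e < d \<and> min \<bar>u i - x i\<bar> \<tau> \<le> (?m e i)}"
        proof (intro Collect_mono impI conjI; elim conjE)
          fix e assume "\<bar>u i - x i\<bar> \<le> (?n e i)"
          hence "min \<bar>u i - x i\<bar> \<tau> \<le> min (?n e i) \<tau>"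
            by simp
          also have "\<dots> \<le> (?m e i)"
            using \<tau> by (intro min_sum_le) auto
          finally show "min \<bar>u i - x i\<bar> \<tau> \<le> (?m e i)" .
        qed
        hence "card {e. e < d \<and> \<bar>u i - x i\<bar> \<le> (?n e i)}
          \<le> card {e. e < d \<and> min \<bar>u i - x i\<bar> \<tau> \<le> (?m e i)}"
          by (intro card_mono) auto
        thus "\<theta> * d \<le> card {e. e < d \<and> min \<bar>u i - x i\<bar> \<tau> \<le> (?m e i)}"
          using u(3)[OF i] unfolding noise_dominated_def by linarith
      next
        have "\<epsilon> * \<theta> \<le> 1 * \<theta>" using \<epsilon> \<eta> by (intro mult_right_mono) auto
        thus "16 * \<eta> \<le> \<theta>" using \<eta> by linarith
      qed (use k d \<eta> \<tau> in auto)
      also have "16 * \<eta> / \<theta> \<le> \<epsilon> / 8" using \<eta> by (simp add: field_simps)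
      finally have W: "(\<Sum>i\<in>S \<union> S'. min \<bar>u i - x i\<bar> \<tau>) \<le> \<epsilon> / 8 * F j"
        using F0[of j] unfolding F_def by (meson mult_right_mono order_trans)
      have "F (Suc j) = (\<Sum>i<N. min \<bar>x i - (if i \<in> S' then u i else 0)\<bar> \<tau>)" unfolding F_def using u(2) by (intro sum.cong) auto
      also have "\<dots> \<le> (\<Sum>i\<in>{..<N} - S. min \<bar>x i\<bar> \<tau>) + 2 * (\<Sum>i\<in>S \<union> S'. min \<bar>u i - x i\<bar> \<tau>)"
        using \<tau> by (intro selection_error[OF S u(1)]) auto
      also have "(\<Sum>i\<in>{..<N} - S. min \<bar>x i\<bar> \<tau>) \<le> tl" unfolding tl_def by (intro sum_mono) auto
      finally show ?thesis using W by linarith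
    qed
    have init: "F 0 \<le> k * \<tau> + tl" proof -
      have "F 0 = (\<Sum>i\<in>S. min \<bar>x i\<bar> \<tau>) + (\<Sum>i\<in>{..<N} - S. min \<bar>x i\<bar> \<tau>)"
        unfolding F_def X0 using S by (subst sum.subset_diff[of S]) auto
      also have "(\<Sum>i\<in>S. min \<bar>x i\<bar> \<tau>) \<le> (\<Sum>i\<in>S. \<tau>)" by (intro sum_mono) auto
      also have "(\<Sum>i\<in>S. \<tau>) \<le> k * \<tau>" using S \<tau> by simp
      also have "(\<Sum>i\<in>{..<N} - S. min \<bar>x i\<bar> \<tau>) \<le> tl" unfolding tl_def by (intro sum_mono) auto
      finally show ?thesis by simp
    qed
    have all: "F j \<le> ?t * tl + (1/4) ^ j * (k * \<tau> + tl)" if "j \<le> J" for j using that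
    proof (induction j)
      case 0
      have "0 \<le> ?t * tl" using \<epsilon> tl0 by simp
      thus ?case using init by simp
    next
      case (Suc j)
      have "F (Suc j) \<le> tl + \<epsilon> / 4 * F j" using rec Suc by simp
      also have "\<epsilon> / 4 * F j \<le> \<epsilon> / 4 * (?t * tl + (1/4) ^ j * (k * \<tau> + tl))"
        using Suc \<epsilon> by (intro mult_left_mono) auto
      also have "\<dots> = \<epsilon> / 4 * ?t * tl + \<epsilon> / 4 * ((1/4) ^ j * (k * \<tau> + tl))" by (simp add: algebra_simps)
      also have "\<epsilon> / 4 * ?t * tl \<le> \<epsilon> / 3 * tl" proof -
        have "\<epsilon> * ?t \<le> \<epsilon> * (4 / 3)" using \<epsilon> by (intro mult_left_mono) auto
        thus ?thesis using tl0 by (intro mult_right_mono) auto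
      qed
      also have "\<epsilon> / 4 * ((1/4) ^ j * (k * \<tau> + tl)) \<le> 1 / 4 * ((1/4) ^ j * (k * \<tau> + tl))"
        using \<epsilon> \<tau> tl0 by (intro mult_right_mono) auto
      finally have "F (Suc j) \<le> tl + (\<epsilon> / 3 * tl + 1 / 4 * ((1/4) ^ j * (k * \<tau> + tl)))" by (simp only: add_left_mono add_right_mono)
      also have "\<dots> = ?t * tl + (1/4) ^ Suc j * (k * \<tau> + tl)"
        by (simp only: power_Suc distrib_right mult_1_left mult.assoc add.assoc)
      finally show ?case .
    qed
    have "(1/4) ^ J * (k * \<tau> + tl) \<le> (1/4) ^ J * ((4 * real k + 1) * (\<tau> / 4))"
      using \<tau> by (intro mult_left_mono) (auto simp: algebra_simps)
    also have "\<dots> = (4 * real k + 1) * (1/4) ^ J * (\<tau> / 4)" by simp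
    also have "\<dots> \<le> \<epsilon> / 4 * (\<tau> / 4)" using J \<tau> by (intro mult_right_mono) auto
    finally have FJ: "F J \<le> ?t * tl + \<epsilon> * \<tau> / 16" using all[of J] by simp
    also have "\<dots> < \<tau>" proof -
      have "?t * tl \<le> (4 / 3) * tl" using \<epsilon> tl0 by (intro mult_right_mono) auto
      moreover have "\<epsilon> * \<tau> \<le> 1 * \<tau>" using \<epsilon> \<tau> by (intro mult_right_mono) auto
      ultimately show ?thesis using \<tau> by linarith
    qed
    \<comment> \<open>The sum of the truncated errors is below the truncation level, so no entry is
      truncated any more and the bound holds for the true error.\<close>
    finally have lt: "F J < \<tau>" .
    have "min \<bar>x i - X J i\<bar> \<tau> = \<bar>x i - X J i\<bar>" if i: "i < N" for i proof -
      have "min \<bar>x i - X J i\<bar> \<tau> \<le> F J"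
        unfolding F_def using i \<tau> by (intro member_le_sum[of i "{..<N}" "\<lambda>i. min \<bar>x i - X J i\<bar> \<tau>"]) auto
      thus ?thesis using lt by (auto simp: min_def split: if_splits)
    qed
    hence "?r = F J" unfolding F_def by simp
    thus ?thesis using FJ by simp
  qed
  have "?r \<le> (1 + \<epsilon>) * tl"
  proof (cases "tl = 0")
    case True
    have "?r \<le> 0"
    proof (rule field_le_epsilon)
      fix e :: real assume "e > 0"
      hence "?r \<le> \<epsilon> * e / 16" using main[of e] True by simp
      also have "\<dots> \<le> e" using \<epsilon> \<open>e > 0\<close> mult_right_mono[of \<epsilon> 1 e] by linarith
      finally show "?r \<le> 0 + e" by simp
    qed
    thus ?thesis using True by simp
  next
    case False
    hence "?r \<le> ?t * tl + \<epsilon> * (4 * tl) / 16" using tl0 by (intro main) auto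
    also have "\<dots> = (1 + 7 * \<epsilon> / 12) * tl" by (simp add: field_simps)
    also have "\<dots> \<le> (1 + \<epsilon>) * tl" using tl0 \<epsilon> by (intro mult_right_mono) auto
    finally show ?thesis .
  qed
  thus ?thesis unfolding tl_def by (simp add: abs_minus_commute)
qed

section \<open>Identification of an item from mostly correct node messages\<close>

definition enc :: "nat => nat list => nat" where
  "enc q xs = foldr (\<lambda>x b. x + q * b) xs 0"

definition digit :: "nat => nat => nat => nat" where
  "digit q j n = (n div q ^ j) mod q"

lemma enc_simps [simp]: "enc q [] = 0" "enc q (x # xs) = x + q * enc q xs" by (auto simp: enc_def)

lemma digit_enc: "[|\<And>x. x \<in> set xs ==> x < q; j < length xs|] ==> digit q j (enc q xs) = xs ! j"
proof (induction xs arbitrary: j)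
  case (Cons x xs)
  have x: "x < q" using Cons.prems by auto
  show ?case
  proof (cases j)
    case 0 thus ?thesis using x by (simp add: digit_def)
  next
    case (Suc j')
    have "(x + q * enc q xs) div (q * q ^ j') = ((x + q * enc q xs) div q) div q ^ j'" by (simp add: div_mult2_eq)
    also have "(x + q * enc q xs) div q = enc q xs" using x by simp
    finally show ?thesis using Cons Suc by (simp add: digit_def)
  qed
qed simp

lemma enc_less: "(\<And>x. x \<in> set xs ==> x < q) ==> enc q xs < q ^ length xs"
proof (induction xs)
  case (Cons x xs)
  have "x < q" "enc q xs < q ^ length xs" using Cons by auto
  hence "x + q * enc q xs < q + q * enc q xs" "Suc (enc q xs) \<le> q ^ length xs" by auto
  hence "x + q * enc q xs < q * Suc (enc q xs)" "q * Suc (enc q xs) \<le> q * q ^ length xs" by (simp_all del: mult_Suc_right add: mult_le_mono2) simp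
  thus ?case by simp
qed simp

lemma digit_less: "q > 0 ==> digit q j n < q" by (simp add: digit_def)

lemma expandingD:
  "expanding N K \<eta> d h ==> S \<subseteq> {..<N} ==> card S \<le> K ==>
   (1 - \<eta>) * d * card S \<le> (\<Sum>e<d. real (card (h e ` S)))" by (auto simp: expanding_def)

text \<open>An expander is a list recoverable code. The symbols of \<open>q + 1\<close> words
  agreeing with the lists in \<theta> positions would number at most \<open>L\<close> per position
  plus one for every miss, too few for expansion.\<close>

lemma list_recovery_bound:
  fixes f :: "nat => nat => nat" and \<eta> \<theta> :: real
  assumes ex: "expanding M (q + 1) \<eta> m f"
    and L: "\<And>p. p < m ==> finite (Q p) \<and> card (Q p) \<le> L"
    and big: "m * L < (\<theta> - \<eta> * m) * (q + 1)"
  shows "card {x. x < M \<and> \<theta> \<le> card {p. p < m \<and> f p x \<in> Q p}} \<le> q"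
proof (rule ccontr)
  let ?O = "\<lambda>x. {p\<in>{..<m}. f p x \<notin> Q p}"
  let ?I = "\<lambda>x. {p. p < m \<and> f p x \<in> Q p}"
  define Z where "Z = {x. x < M \<and> \<theta> \<le> card (?I x)}"
  assume "\<not> ?thesis"
  hence "q + 1 \<le> card Z" unfolding Z_def by simp
  then obtain T where T: "T \<subseteq> Z" "card T = q + 1" by (meson obtain_subset_with_card_n)
  let ?B = "\<lambda>p. {x\<in>T. f p x \<notin> Q p}"
  have fT: "finite T" using T(2) card.infinite by fastforce
  have TM: "T \<subseteq> {..<M}" using T(1) unfolding Z_def by auto
  have 1: "real (card (f p ` T)) \<le> L + card (?B p)" if p: "p < m" for p proof -
    have "f p ` T \<subseteq> Q p \<union> f p ` (?B p)" by auto
    hence "card (f p ` T) \<le> card (Q p \<union> f p ` (?B p))" using L[OF p] fT by (intro card_mono) auto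
    also have "\<dots> \<le> card (Q p) + card (f p ` (?B p))" by (rule card_Un_le)
    also have "\<dots> \<le> L + card (?B p)" using L[OF p] fT by (intro add_mono card_image_le) auto
    finally show ?thesis by simp
  qed
  have "(1 - \<eta>) * m * (q + 1) \<le> (\<Sum>p<m. real (card (f p ` T)))" proof -
    have "(1 - \<eta>) * m * card T \<le> (\<Sum>p<m. real (card (f p ` T)))" using T(2) by (intro expandingD[OF ex TM]) simp
    thus ?thesis using T(2) by simp
  qed
  also have "\<dots> \<le> (\<Sum>p<m. real L + real (card (?B p)))" using 1 by (intro sum_mono) auto
  also have "\<dots> = real (m * L) + (\<Sum>p<m. real (card (?B p)))" by (simp add: sum.distrib)
  also have "(\<Sum>p<m. real (card (?B p))) = (\<Sum>x\<in>T. real (card (?O x)))" proof -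
    have "(\<Sum>p<m. card (?B p)) = (\<Sum>x\<in>T. card (?O x))"
      using fT sum.swap_restrict[of "{..<m}" T "\<lambda>_ _. 1::nat" "\<lambda>p x. f p x \<notin> Q p"] by simp
    thus ?thesis unfolding of_nat_sum[symmetric] by simp
  qed
  also have "\<dots> \<le> (\<Sum>x\<in>T. m - \<theta>)"
  proof (rule sum_mono)
    fix x assume "x \<in> T"
    hence "\<theta> \<le> card (?I x)" using T(1) unfolding Z_def by auto
    moreover have "card (?I x) + card (?O x) = m" proof -
      have "(?I x) \<union> (?O x) = {..<m}" by auto
      moreover have "card ((?I x) \<union> (?O x))
        = card (?I x) + card (?O x)" by (rule card_Un_disjoint) auto
      ultimately show ?thesis by simp
    qed
    ultimately show "real (card (?O x)) \<le> m - \<theta>" by linarith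
  qed
  also have "\<dots> = (q + 1) * (m - \<theta>)" using T(2) by simp
  finally show False using big by (simp add: algebra_simps)
qed

text \<open>For sets of two words expansion is a statement about distance: the family is a code of
  relative distance at least 1 - 2 * \<eta>.\<close>

lemma pair_agreement_bound:
  fixes f :: "nat => nat => nat" and \<eta> :: real
  assumes ex: "expanding M 2 \<eta> m f" and x: "x < M" "y < M" "x \<noteq> y"
  shows "card {p. p < m \<and> f p x = f p y} \<le> 2 * \<eta> * m" proof -
  have "(1 - \<eta>) * m * 2 \<le> (\<Sum>p<m. real (card (f p ` {x, y})))" proof -
    have c: "card {x, y} = 2" using x by simp
    have "(1 - \<eta>) * m * card {x, y} \<le> (\<Sum>p<m. real (card (f p ` {x, y})))" using x c by (intro expandingD[OF ex]) auto
    thus ?thesis unfolding c by simp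
  qed
  also have "\<dots> = (\<Sum>p<m. 2 - (if f p x = f p y then 1 else 0))" by (intro sum.cong) auto
  also have "\<dots> = 2 * real m - real (card {p. p < m \<and> f p x = f p y})" by (simp add: sum_subtractf sum.inter_filter[symmetric])
  finally show ?thesis by (simp add: algebra_simps)
qed

subsection \<open>Linking the nodes\<close>

text \<open>The nodes fall into \<open>D\<close> blocks of \<open>B\<close>, and link
  \<open>r\<close> of a node leads into block \<open>r\<close>. Neighbourhood sizes are therefore
  sums over the links, and expansion of \<open>link\<close> becomes vertex expansion by the factor 3
  * D / 4. \<open>K\<close> is the number of end nodes that walks of length \<open>l\<close> inside
  a good core are sure to reach.\<close>

locale link_graph =
  fixes R D B K l :: nat and link :: "nat => nat => nat"
  assumes R: "R = D * B" and D: "D > 8" "4 dvd D" and K: "K = (D div 4) ^ l"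
    and link_less: "\<And>r v. link r v < B"
    and link_exp: "expanding R K (1/4) D link"
begin

definition nbr :: "nat => nat => nat" where "nbr r v = r * B + link r v"

lemma nbr_less:
  assumes "r < D"
  shows "nbr r v < R" proof -
  have "nbr r v < Suc r * B" unfolding nbr_def using link_less[of r v] by simp
  moreover have "Suc r * B \<le> D * B" using assms by (intro mult_le_mono1) simp
  ultimately show ?thesis using R by linarith
qed

lemma card_nbrs:
  assumes "S \<subseteq> {..<R}" "card S \<le> K"
  shows "3 * D * card S \<le> 4 * card {nbr r v | r v. r < D \<and> v \<in> S}" proof -
  let ?N = "{nbr r v | r v. r < D \<and> v \<in> S}"
  have fS: "finite S" using assms finite_subset by blast
  have "?N = (\<Union>r<D. (\<lambda>b. r * B + b) ` link r ` S)" unfolding nbr_def by auto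
  also have "card \<dots> = (\<Sum>r<D. card ((\<lambda>b. r * B + b) ` link r ` S))"
  proof (rule card_UN_disjoint)
    show "\<forall>i\<in>{..<D}. \<forall>j\<in>{..<D}. i \<noteq> j -->
      (\<lambda>b. i * B + b) ` link i ` S \<inter> (\<lambda>b. j * B + b) ` link j ` S = {}"
    proof (intro ballI impI)
      fix i j :: nat assume "i \<in> {..<D}" "j \<in> {..<D}" "i \<noteq> j"
      have "i = j" if "i * B + b = j * B + c" "b < B" "c < B" for b c proof -
        have "(i * B + b) div B = (j * B + c) div B" using that(1) by (rule arg_cong)
        thus ?thesis using that(2,3) by simp
      qed
      note neq = this
      show "(\<lambda>b. i * B + b) ` link i ` S \<inter> (\<lambda>b. j * B + b) ` link j ` S = {}"
      proof (rule equals0I)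
        fix w assume "w \<in> (\<lambda>b. i * B + b) ` link i ` S \<inter> (\<lambda>b. j * B + b) ` link j ` S"
        then obtain u u' where w: "w = i * B + link i u" "w = j * B + link j u'" by blast
        have "i = j" using neq[of "link i u" "link j u'"] w link_less by simp
        thus False using \<open>i \<noteq> j\<close> by simp
      qed
    qed
  qed (use fS in auto)
  also have "\<dots> = (\<Sum>r<D. card (link r ` S))" by (intro sum.cong refl card_image inj_onI) auto
  finally have "card ?N = (\<Sum>r<D. card (link r ` S))" .
  moreover have "(1 - 1/4) * D * card S \<le> (\<Sum>r<D. real (card (link r ` S)))" using link_exp assms unfolding expanding_def by blast
  ultimately have "real (3 * D * card S) \<le> real (4 * card ?N)" by (simp add: of_nat_sum)
  thus ?thesis by linarith
qed

text \<open>After the bad nodes, a small set of further nodes is removed such that every remaining node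
  keeps more than half of its links: if this removed more than \<open>z\<close> nodes, their neighbourhood
  would be too small for the expansion of the link graph.\<close>

lemma core_exists:
  assumes bad: "Bad \<subseteq> {..<R}" "card Bad \<le> z" and z: "1 \<le> z" "z \<le> K" "2 * z < R"
  obtains U where "U \<subseteq> {..<R} - Bad" "U \<noteq> {}" "\<And>u. u \<in> U ==> 2 * card {r. r < D \<and> nbr r u \<notin> U} \<le> D"
proof -
  let ?E = "\<lambda>Y. {(r, v). r < D \<and> v \<in> Y \<and> nbr r v \<in> Bad \<union> Y}"
  \<comment> \<open>Instead of removing nodes one after another, take a maximal set of which at
    least half of the links, in total, lead to \<open>Bad \<union> Y\<close>.\<close>
  define P where "P Y \<longleftrightarrow> Y \<subseteq> {..<R} - Bad \<and> card Y \<le> z \<and>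
     D * card Y \<le> 2 * card (?E Y)" for Y
  have "P {}" unfolding P_def by auto
  moreover have "\<forall>Y. P Y --> card Y < Suc z" unfolding P_def by (simp add: less_Suc_eq_le)
  ultimately have "\<exists>Y. P Y \<and> (\<forall>Y'. P Y' --> card Y' \<le> card Y)" by (rule ex_has_greatest_nat)
  then obtain Y where Y: "P Y" "\<And>Y'. P Y' ==> card Y' \<le> card Y" by blast
  have YR: "Y \<subseteq> {..<R} - Bad" and Yz: "card Y \<le> z" and
    Ye: "D * card Y \<le> 2 * card (?E Y)" using Y(1) unfolding P_def by auto
  have fY: "finite Y" using YR finite_subset by blast
  let ?N = "{nbr r v | r v. r < D \<and> v \<in> Y}"
  have fB: "finite Bad" using bad finite_subset by blast
  have cBY: "card (Bad \<union> Y) \<le> 2 * z" using card_Un_le[of Bad Y] bad Yz by linarith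
  \<comment> \<open>A set of \<open>z\<close> nodes has at least 3 * D * z / 4 neighbours. But half
    of its links end in \<open>Bad \<union> Y\<close>, which has at most 2 * z nodes, and the others
    reach at most D * z / 2; this contradicts D > 8.\<close>
  have lt: "card Y < z"
  proof (rule ccontr)
    assume "\<not> card Y < z"
    hence cY: "card Y = z" using Yz by simp
    define E where "E = {(r, v). r < D \<and> v \<in> Y}"
    define E1 where "E1 = (?E Y)"
    have fE: "finite E" unfolding E_def using fY by (auto intro: finite_subset[of _ "{..<D} \<times> Y"])
    have cE: "card E = D * z" proof -
      have "E = {..<D} \<times> Y" unfolding E_def by auto
      thus ?thesis using cY by (simp add: card_cartesian_product)
    qed
    have sub: "E1 \<subseteq> E" unfolding E1_def E_def by auto
    have "?N \<subseteq> (Bad \<union> Y) \<union> (\<lambda>(r, v). nbr r v) ` (E - E1)"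
      unfolding E_def E1_def by auto
    hence "card ?N \<le> card ((Bad \<union> Y) \<union> (\<lambda>(r, v). nbr r v) ` (E - E1))"
      using fB fY fE by (intro card_mono) auto
    also have "\<dots> \<le> card (Bad \<union> Y) + card ((\<lambda>(r, v). nbr r v) ` (E - E1))" by (rule card_Un_le)
    also have "\<dots> \<le> 2 * z + card (E - E1)" using cBY card_image_le[of "E - E1"] fE by (intro add_mono) auto
    also have "card (E - E1) = D * z - card E1" using sub fE cE finite_subset[OF sub fE] by (simp add: card_Diff_subset)
    finally have "card ?N \<le> 2 * z + (D * z - card E1)" .
    moreover have "3 * D * z \<le> 4 * card ?N" using card_nbrs[of Y] YR cY z by auto
    moreover have "D * z \<le> 2 * card E1" using Ye cY unfolding E1_def by simp
    ultimately have "D * z \<le> 8 * z" by linarith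
    thus False using D z by simp
  qed
  define U where "U = {..<R} - (Bad \<union> Y)"
  \<comment> \<open>A remaining node that had lost more than half of its links could be added to the
    maximal set \<open>Y\<close>.\<close>
  have "2 * card {r. r < D \<and> nbr r u \<notin> U} \<le> D" if u: "u \<in> U" for u
  proof (rule ccontr)
    assume "\<not> ?thesis"
    hence gt: "D \<le> 2 * card {r. r < D \<and> nbr r u \<notin> U}" by simp
    have uY: "u \<notin> Y" using u unfolding U_def by auto
    have out: "{r. r < D \<and> nbr r u \<notin> U} = {r. r < D \<and> nbr r u \<in> Bad \<union> Y}" using nbr_less unfolding U_def by auto
    define E1 where "E1 = (?E Y)"
    define E2 where "E2 = (\<lambda>r. (r, u)) ` {r. r < D \<and> nbr r u \<in> Bad \<union> Y}"
    have fE1: "finite E1" unfolding E1_def using fY by (auto intro: finite_subset[of _ "{..<D} \<times> Y"])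
    have "card (E1 \<union> E2) = card E1 + card E2" using fE1 uY by (intro card_Un_disjoint) (auto simp: E1_def E2_def)
    moreover have "card E2 = card {r. r < D \<and> nbr r u \<in> Bad \<union> Y}" unfolding E2_def by (intro card_image inj_onI) auto
    moreover have "card (E1 \<union> E2) \<le> card (?E (insert u Y))"
    proof (rule card_mono)
      show "finite (?E (insert u Y))"
        by (rule finite_subset[of _ "{..<D} \<times> insert u Y"]) (use fY in auto)
      show "E1 \<union> E2 \<subseteq> (?E (insert u Y))"
        unfolding E1_def E2_def by auto
    qed
    ultimately have "D * card (insert u Y) \<le> 2 * card (?E (insert u Y))"
      using gt Ye uY fY out unfolding E1_def[symmetric] by simp
    hence "P (insert u Y)" unfolding P_def using YR u lt uY fY unfolding U_def by auto
    thus False using Y(2)[of "insert u Y"] uY fY by simp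
  qed
  moreover have "U \<noteq> {}"
  proof
    assume "U = {}"
    hence "{..<R} \<subseteq> Bad \<union> Y" unfolding U_def by auto
    hence "R \<le> card (Bad \<union> Y)" using fB fY card_mono[of "Bad \<union> Y" "{..<R}"] by simp
    thus False using cBY z by simp
  qed
  ultimately show ?thesis using that[of U] unfolding U_def by auto
qed

definition endn :: "nat => nat list => nat" where
  "endn v ws = foldl (\<lambda>v r. nbr r v) v ws"

definition good_walk :: "nat set => nat => nat list => bool" where
  "good_walk U v ws \<longleftrightarrow> set ws \<subseteq> {..<D} \<and> (\<forall>j\<le>length ws. endn v (take j ws) \<in> U)"

lemma endn_snoc [simp]: "endn v (ws @ [r]) = nbr r (endn v ws)" by (simp add: endn_def)

lemma good_walk_snoc: "good_walk U v (ws @ [r]) \<longleftrightarrow> good_walk U v ws \<and> r < D \<and> nbr r (endn v ws) \<in> U"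
  unfolding good_walk_def by (auto simp: le_Suc_eq all_conj_distrib)

text \<open>One step multiplies by 3 * D / 4, and at most D / 2 links per node leave the core; a
  factor D / 4 remains.\<close>

lemma reachable_many:
  assumes U: "U \<subseteq> {..<R}" and half: "\<And>u. u \<in> U ==> 2 * card {r. r < D \<and> nbr r u \<notin> U} \<le> D"
    and v: "v \<in> U"
  shows "K \<le> card {u. \<exists>ws. length ws = l \<and> good_walk U v ws \<and> endn v ws = u}" proof -
  let ?o = "\<lambda>u. {r. r < D \<and> nbr r u \<notin> U}"
  let ?N = "\<lambda>T. {nbr r u | r u. r < D \<and> u \<in> T}"
  define S where "S n = {u. \<exists>ws. length ws = n \<and> good_walk U v ws \<and> endn v ws = u}" for n
  have SU: "S n \<subseteq> U" for n unfolding S_def good_walk_def by auto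
  have fU: "finite U" using U finite_subset by blast
  have "(D div 4) ^ n \<le> card (S n)" if "n \<le> l" for n using that
  proof (induction n)
    case 0
    have "v \<in> S 0" unfolding S_def good_walk_def using v by (auto simp: endn_def)
    hence "0 < card (S 0)" using finite_subset[OF SU fU] by (auto simp: card_gt_0_iff)
    thus ?case by simp
  next
    case (Suc n)
    define q where "q = (D div 4) ^ n"
    have "q \<le> card (S n)" using Suc unfolding q_def by simp
    \<comment> \<open>Cut down to exactly (D / 4) ^ n nodes, because expansion is available only up
      to \<open>K\<close>.\<close>
    then obtain T where T: "T \<subseteq> S n" "card T = q" by (meson obtain_subset_with_card_n)
    have fT: "finite T" by (rule finite_subset[OF subset_trans[OF T(1) SU] fU])
    have "q \<le> K" unfolding q_def K using Suc.prems D by (intro power_increasing) auto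
    hence 1: "3 * D * q \<le> 4 * card (?N T)"
      using card_nbrs[of T] T(2) subset_trans[OF subset_trans[OF T(1) SU] U] by simp
    define O' where "O' = {(r, u). r < D \<and> u \<in> T \<and> nbr r u \<notin> U}"
    have fO: "finite O'" unfolding O'_def by (rule finite_subset[of _ "{..<D} \<times> T"]) (use fT in auto)
    have sub: "(?N T) \<subseteq> S (Suc n) \<union> (\<lambda>(r, u). nbr r u) ` O'"
    proof
      fix w assume "w \<in> (?N T)"
      then obtain r u where w: "w = nbr r u" "r < D" "u \<in> T" by auto
      show "w \<in> S (Suc n) \<union> (\<lambda>(r, u). nbr r u) ` O'"
      proof (cases "w \<in> U")
        case True
        obtain ws where "length ws = n" "good_walk U v ws" "endn v ws = u" using w T unfolding S_def by auto
        hence "length (ws @ [r]) = Suc n \<and> good_walk U v (ws @ [r]) \<and> endn v (ws @ [r]) = w"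
          using w True by (simp add: good_walk_snoc)
        thus ?thesis unfolding S_def by blast
      next
        case False thus ?thesis using w unfolding O'_def by auto
      qed
    qed
    have "card (?N T) \<le> card (S (Suc n) \<union> (\<lambda>(r, u). nbr r u) ` O')"
      using finite_subset[OF SU fU, of "Suc n"] fO by (intro card_mono[OF _ sub]) simp
    also have "\<dots> \<le> card (S (Suc n)) + card ((\<lambda>(r, u). nbr r u) ` O')" by (rule card_Un_le)
    also have "\<dots> \<le> card (S (Suc n)) + card O'" using fO by (simp add: card_image_le)
    finally have 2: "card (?N T) \<le> card (S (Suc n)) + card O'" .
    have "card O' = (\<Sum>u\<in>T. card (?o u))" proof -
      have "O' = (\<Union>u\<in>T. (\<lambda>r. (r, u)) ` (?o u))" unfolding O'_def by auto
      also have "card \<dots> = (\<Sum>u\<in>T. card ((\<lambda>r. (r, u)) ` (?o u)))"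
        using fT by (intro card_UN_disjoint) auto
      also have "\<dots> = (\<Sum>u\<in>T. card (?o u))" by (intro sum.cong refl card_image inj_onI) auto
      finally show ?thesis .
    qed
    hence "2 * card O' = (\<Sum>u\<in>T. 2 * card (?o u))" by (simp add: sum_distrib_left)
    also have "\<dots> \<le> (\<Sum>u\<in>T. D)" using half T(1) SU[of n] by (intro sum_mono) blast
    also have "\<dots> = D * q" using T(2) by simp
    finally have "D * q \<le> 4 * card (S (Suc n))" using 1 2 by linarith
    moreover have "D = 4 * (D div 4)" using D by simp
    ultimately have "4 * (D div 4 * q) \<le> 4 * card (S (Suc n))" by (metis mult.assoc)
    thus ?case unfolding q_def by simp
  qed
  thus ?thesis unfolding K S_def by simp
qed

end

subsection \<open>Decoding an item\<close>

lemma find_Some_nth: "find P xs = Some y ==> y \<in> set xs \<and> P y" by (auto simp: find_Some_iff)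

text \<open>The \<open>R\<close> nodes form \<open>ng\<close> groups of \<open>m\<close>. Group
  \<open>a\<close> is responsible for the symbol \<open>core a i\<close> of a code for items; its
  piece is spread over its nodes by the list recoverable code \<open>sym\<close>. \<open>th1\<close>
  and \<open>th2\<close> are the agreements demanded within a group and across the groups,
  \<open>q1\<close> and \<open>q2\<close> the resulting list lengths, and \<open>z\<close> is the
  tolerated number of wrong messages. \<open>L\<close> is the list length per node; by
  \<open>DL\<close> at most K / 2 nodes are the end of more walks.\<close>

locale item_code = link_graph R D B K l link
  for R D B K l :: nat and link :: "nat => nat => nat" +
  fixes N G m ng L M0 F q1 q2 th1 th2 z :: nat and et1 et2 et3 :: real
    and sym phi core g :: "nat => nat => nat"
  assumes Rm: "R = ng * m" and m: "m > 0" and L: "L > 0" and DL: "2 * D ^ l \<le> K * (L + 1)"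
    and z: "1 \<le> z" "z \<le> K" "2 * z < R"
    and g_less: "\<And>v i. g v i < G"
    and sym_less: "\<And>p c. sym p c < G" and sym_exp: "expanding (M0 * F ^ ng) (q1 + 1) et1 m sym"
    and q1: "m * L < (th1 - et1 * m) * (q1 + 1)"
    and phi_less: "\<And>a c. phi a c < F" and phi_exp: "expanding M0 2 et2 ng phi"
    and core_less: "\<And>a i. core a i < M0" and core_exp: "expanding N (q2 + 1) et3 ng core"
    and q2: "ng * 1 < (th2 - et3 * ng) * (q2 + 1)"
    and th2: "1 \<le> th2" "(th2 + 2 * et2 * q1 * ng) * m + ng * th1 \<le> K / 2"
begin

text \<open>Besides its own core symbol, group \<open>a\<close> carries a hash \<open>phi a\<close>
  of the core symbol of every group. So a single correct piece allows the right entry to be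
  recognised in the lists of the other groups.\<close>

definition piece :: "nat => nat => nat" where
  "piece a i = core a i + M0 * enc F (map (\<lambda>a'. phi a (core a' i)) [0..<ng])"

definition msg :: "nat => nat => nat" where
  "msg v i = enc G (sym (v mod m) (piece (v div m) i) # map (\<lambda>r. g (nbr r v) i) [0..<D])"

fun gwalk :: "(nat => nat => nat) => nat => nat => nat list => nat" where
  "gwalk M v x [] = x"
| "gwalk M v x (r # ws) = gwalk M (nbr r v) (digit G (Suc r) (M v x)) ws"

definition wordsto :: "nat => nat => nat list list" where
  "wordsto v u = filter (\<lambda>ws. endn v ws = u) (List.n_lists l [0..<D])"

text \<open>Walks to the same node may end in different addresses and then read different symbols;
  the j-th walk supplies the j-th entry of the list of \<open>u\<close>.\<close>

definition claim :: "(nat => nat => nat) => nat => nat => nat => nat => nat" where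
  "claim M v x u j = (if j < length (wordsto v u) then digit G 0 (M u (gwalk M v x (wordsto v u ! j))) else 0)"

text \<open>The lists of a whole group are packed into one word, so that decoding the group is a
  table lookup.\<close>

definition claims :: "(nat => nat => nat) => nat => nat => nat => nat" where
  "claims M v x a = enc G (map (\<lambda>q. claim M v x (a * m + q div L) (q mod L)) [0..<m * L])"

text \<open>List decoding by exhaustive search. This search and the one in \<open>finals\<close> are
  evaluated when tables are built and cost no decoding time.\<close>

definition pieces :: "nat => nat list" where
  "pieces n = filter (\<lambda>pk. th1 \<le> card {p. p < m \<and> sym p pk \<in> (\<lambda>j. digit G (p * L + j) n) ` {..<L}})
     [0..<M0 * F ^ ng]"

definition start :: "nat => nat => nat" where
  "start n c = (if c < length (pieces n) then pieces n ! c else 0)"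

definition hint :: "nat => nat => nat" where
  "hint a pk = digit F a (pk div M0)"

definition select :: "nat => nat => nat => nat" where
  "select a n t = (case find (\<lambda>pk. phi a (pk mod M0) = t) (pieces n) of Some pk => pk mod M0 | None => 0)"

definition selects :: "(nat => nat => nat) => nat => nat => nat => nat => nat" where
  "selects M v x a c = enc M0 (map (\<lambda>a'. select a (claims M v x a') (hint a' (start (claims M v x a) c))) [0..<ng])"

definition finals :: "nat => nat list" where
  "finals n = filter (\<lambda>i. th2 \<le> card {a. a < ng \<and> core a i = digit M0 a n}) [0..<N]"

definition final :: "nat => nat => nat" where
  "final n c = (if c < length (finals n) then Suc (finals n ! c) else 0)"

definition cand :: "(nat => nat => nat) => nat => nat => nat => nat => nat => nat" where
  "cand M v x a c c' = final (selects M v x a c) c'"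

lemma G0: "G > 0" using g_less[of 0 0] by simp
lemma M00: "M0 > 0" using core_less[of 0 0] by simp
lemma F0: "F > 0" using phi_less[of 0 0] by simp

lemma piece_less: "piece a i < M0 * F ^ ng"
proof -
  have "enc F (map (\<lambda>a'. phi a (core a' i)) [0..<ng]) < F ^ length (map (\<lambda>a'. phi a (core a' i)) [0..<ng])"
    using phi_less by (intro enc_less) auto
  hence "Suc (enc F (map (\<lambda>a'. phi a (core a' i)) [0..<ng])) \<le> F ^ ng" by simp
  hence "M0 * Suc (enc F (map (\<lambda>a'. phi a (core a' i)) [0..<ng])) \<le> M0 * F ^ ng" by (rule mult_le_mono2)
  thus ?thesis unfolding piece_def using core_less[of a i] by simp
qed

lemma piece_mod: "piece a i mod M0 = core a i" unfolding piece_def using core_less[of a i] by simp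

lemma hint_piece: "a' < ng ==> hint a' (piece a i) = phi a (core a' i)"
proof -
  assume a': "a' < ng"
  have "piece a i div M0 = enc F (map (\<lambda>a'. phi a (core a' i)) [0..<ng])" unfolding piece_def using core_less[of a i] by simp
  thus "hint a' (piece a i) = phi a (core a' i)"
    unfolding hint_def using a' phi_less by (subst \<open>piece a i div M0 = _\<close>, subst digit_enc) auto
qed

lemma msg_less: "msg v i < G ^ Suc D"
proof -
  have "enc G (sym (v mod m) (piece (v div m) i) # map (\<lambda>r. g (nbr r v) i) [0..<D])
     < G ^ length (sym (v mod m) (piece (v div m) i) # map (\<lambda>r. g (nbr r v) i) [0..<D])" using sym_less g_less by (intro enc_less) auto
  thus ?thesis unfolding msg_def by simp
qed

lemma msg_sym: "digit G 0 (msg v i) = sym (v mod m) (piece (v div m) i)" unfolding msg_def using sym_less g_less by (subst digit_enc) auto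

lemma msg_link: "r < D ==> digit G (Suc r) (msg v i) = g (nbr r v) i" unfolding msg_def using sym_less g_less by (subst digit_enc) auto

lemma claim_less: "claim M v x u j < G" unfolding claim_def using G0 by (auto intro: digit_less)

lemma claims_less: "claims M v x a < G ^ (m * L)"
proof -
  have "claims M v x a < G ^ length (map (\<lambda>q. claim M v x (a * m + q div L) (q mod L)) [0..<m * L])"
    unfolding claims_def using claim_less by (intro enc_less) auto
  thus ?thesis by simp
qed

lemma claims_digit: "p < m ==> j < L ==> digit G (p * L + j) (claims M v x a) = claim M v x (a * m + p) j"
proof -
  assume pj: "p < m" "j < L"
  have "p * L + j < Suc p * L" using pj by simp
  also have "\<dots> \<le> m * L" using pj by (intro mult_le_mono1) simp
  finally have "p * L + j < m * L" .
  thus "digit G (p * L + j) (claims M v x a) = claim M v x (a * m + p) j" unfolding claims_def using claim_less pj by (subst digit_enc) auto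
qed

lemma select_less: "select a n t < M0" unfolding select_def using M00 by (auto split: option.split)

lemma selects_less: "selects M v x a c < M0 ^ ng"
proof -
  have "selects M v x a c < M0 ^ length (map (\<lambda>a'. select a (claims M v x a') (hint a' (start (claims M v x a) c))) [0..<ng])"
    unfolding selects_def using select_less by (intro enc_less) auto
  thus ?thesis by simp
qed

lemma cand_le: "cand M v x a c c' \<le> N"
proof -
  have "finals n ! c' < N" if "c' < length (finals n)" for n using nth_mem[OF that] unfolding finals_def by auto
  thus ?thesis unfolding cand_def final_def by (auto simp: Suc_le_eq)
qed

lemma length_filter_upt: "length (filter P [0..<n]) = card {x. x < n \<and> P x}"
proof -
  have "length (filter P [0..<n]) = card (set (filter P [0..<n]))" by (intro distinct_card[symmetric]) simp
  also have "set (filter P [0..<n]) = {x. x < n \<and> P x}" by auto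
  finally show ?thesis .
qed

lemma length_pieces: "length (pieces n) \<le> q1"
proof -
  have eq: "length (pieces n) = card {x. x < M0 * F ^ ng \<and> th1 \<le> card {p. p < m \<and> sym p x \<in> (\<lambda>j. digit G (p * L + j) n) ` {..<L}}}"
    unfolding pieces_def by (rule length_filter_upt)
  have "card {x. x < M0 * F ^ ng \<and> real th1 \<le> real (card {p. p < m \<and> sym p x \<in> (\<lambda>j. digit G (p * L + j) n) ` {..<L}})} \<le> q1"
  proof (rule list_recovery_bound[OF sym_exp])
    show "finite ((\<lambda>j. digit G (p * L + j) n) ` {..<L}) \<and> card ((\<lambda>j. digit G (p * L + j) n) ` {..<L}) \<le> L" for p
      using card_image_le[of "{..<L}"] by auto
  qed (use q1 in \<open>simp add: add.commute\<close>)
  thus ?thesis unfolding eq by simp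
qed

lemma length_finals: "length (finals n) \<le> q2"
proof -
  have eq: "length (finals n) = card {x. x < N \<and> th2 \<le> card {a. a < ng \<and> core a x = digit M0 a n}}"
    unfolding finals_def by (rule length_filter_upt)
  have "card {x. x < N \<and> real th2 \<le> real (card {a. a < ng \<and> core a x \<in> {digit M0 a n}})} \<le> q2"
    by (rule list_recovery_bound[OF core_exp, where L = 1]) (use q2 in \<open>simp_all add: add.commute\<close>)
  thus ?thesis unfolding eq by simp
qed

lemma gwalk_correct:
  assumes "good_walk U v ws" and "\<And>u. u \<in> U ==> M u (g u i) = msg u i"
  shows "gwalk M v (g v i) ws = g (endn v ws) i" using assms(1)
proof (induction ws arbitrary: v)
  case Nil thus ?case by (simp add: endn_def)
next
  case (Cons r ws)
  have r: "r < D" using Cons.prems unfolding good_walk_def by auto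
  have v: "v \<in> U" using Cons.prems unfolding good_walk_def by (auto simp: endn_def dest: spec[of _ 0])
  have e: "endn v (r # ws') = endn (nbr r v) ws'" for ws' by (simp add: endn_def)
  have "good_walk U (nbr r v) ws" unfolding good_walk_def
  proof (intro conjI allI impI)
    show "set ws \<subseteq> {..<D}" using Cons.prems unfolding good_walk_def by auto
    fix j assume "j \<le> length ws"
    hence "endn v (take (Suc j) (r # ws)) \<in> U" using Cons.prems unfolding good_walk_def by (auto simp del: take_Suc_Cons)
    thus "endn (nbr r v) (take j ws) \<in> U" using e by simp
  qed
  hence "gwalk M (nbr r v) (g (nbr r v) i) ws = g (endn (nbr r v) ws) i" by (rule Cons.IH)
  thus ?case using assms(2)[OF v] msg_link[OF r] e by simp
qed

text \<open>Only \<open>D ^ l\<close> walks start at \<open>v\<close>, and each overfull node uses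
  up more than \<open>L\<close> of them.\<close>

lemma card_overfull: "card {u. u < R \<and> L < length (wordsto v u)} * (L + 1) \<le> D ^ l"
proof -
  let ?O = "{u. u < R \<and> L < length (wordsto v u)}"
  let ?W = "List.n_lists l [0..<D]"
  have "card ?O * (L + 1) = (\<Sum>u\<in>?O. L + 1)" by simp
  also have "\<dots> \<le> (\<Sum>u\<in>?O. length (wordsto v u))" by (intro sum_mono) auto
  also have "\<dots> \<le> (\<Sum>u<R. length (wordsto v u))" by (intro sum_mono2) auto
  also have "\<dots> = (\<Sum>u<R. card {ws \<in> set ?W. endn v ws = u})"
  proof (rule sum.cong)
    fix u assume "u \<in> {..<R}"
    have "distinct (wordsto v u)" unfolding wordsto_def by (simp add: distinct_n_lists)
    hence "length (wordsto v u) = card (set (wordsto v u))" by (rule distinct_card[symmetric])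
    thus "length (wordsto v u) = card {ws \<in> set ?W. endn v ws = u}" unfolding wordsto_def by simp
  qed simp
  also have "\<dots> = card (\<Union>u<R. {ws \<in> set ?W. endn v ws = u})" by (subst card_UN_disjoint) auto
  also have "\<dots> \<le> card (set ?W)" by (intro card_mono) auto
  also have "\<dots> \<le> length ?W" by (rule card_length)
  also have "\<dots> = D ^ l" by (simp add: length_n_lists)
  finally show ?thesis .
qed

text \<open>From a core node with its correct address, walks in the core deliver correct symbols at
  many end nodes. In every group where enough of these end nodes lie, the right piece is in the
  list. One of these groups has hints that single out the right piece in nearly all others, and then
  enough core symbols are right to list the item.\<close>

theorem item_found:
  assumes i: "i < N" and bad: "card {v. v < R \<and> M v (g v i) \<noteq> msg v i} \<le> z"
  shows "\<exists>v<R. \<exists>a<ng. \<exists>c<q1. \<exists>c'<q2. cand M v (g v i) a c c' = Suc i" proof -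
  define Bad where "Bad = {v. v < R \<and> M v (g v i) \<noteq> msg v i}"
  have B: "Bad \<subseteq> {..<R}" "card Bad \<le> z" using bad unfolding Bad_def by auto
  obtain U where U: "U \<subseteq> {..<R} - Bad" "U \<noteq> {}" "\<And>u. u \<in> U ==> 2 * card {r. r < D \<and> nbr r u \<notin> U} \<le> D"
  proof (rule core_exists[OF B z])
    fix U' assume *: "U' \<subseteq> {..<R} - Bad" "U' \<noteq> {}" "\<And>u. u \<in> U' ==> 2 * card {r. r < D \<and> nbr r u \<notin> U'} \<le> D"
    show thesis by (rule that[OF *])
  qed
  have UM: "M u (g u i) = msg u i" if "u \<in> U" for u using U(1) that unfolding Bad_def by auto
  obtain v where v: "v \<in> U" using U(2) by blast
  have UR: "U \<subseteq> {..<R}" using U(1) by blast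
  have vR: "v < R" using v UR by blast
  define x where "x = g v i"
  let ?Ps = "\<lambda>a. pieces (claims M v x a)"
  let ?W = "\<lambda>a. {pk\<in>set (?Ps a). pk mod M0 \<noteq> core a i}"
  define S where "S = {u. \<exists>ws. length ws = l \<and> good_walk U v ws \<and> endn v ws = u}"
  have KS: "K \<le> card S" unfolding S_def using reachable_many[OF UR U(3) v] .
  have SU: "S \<subseteq> U" unfolding S_def good_walk_def by auto
  have fS: "finite S" by (rule finite_subset[OF subset_trans[OF SU UR]]) simp
  \<comment> \<open>Nodes with too long lists are given up; there are at most K / 2 of them.\<close>
  define O' where "O' = {u. u < R \<and> L < length (wordsto v u)}"
  have fO: "finite O'" unfolding O'_def by simp
  have "card O' * (L + 1) \<le> D ^ l" unfolding O'_def by (rule card_overfull)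
  hence "2 * card O' * (L + 1) \<le> K * (L + 1)" using DL by simp
  hence cO: "2 * card O' \<le> K" by (simp only: mult_le_cancel2)
  define S' where "S' = S - O'"
  let ?T = "\<lambda>a. {p. p < m \<and> a * m + p \<in> S'}"
  have cS': "K \<le> 2 * card S'" proof -
    have "card S \<le> card (S' \<union> O')" using fS fO unfolding S'_def by (intro card_mono) auto
    also have "\<dots> \<le> card S' + card O'" by (rule card_Un_le)
    finally show ?thesis using KS cO by linarith
  qed
  have S'claim: "\<exists>j<L. claim M v x u j = sym (u mod m) (piece (u div m) i)" if "u \<in> S'" for u proof -
    have "u \<in> S" "u \<notin> O'" using that unfolding S'_def by auto
    then obtain ws where ws: "length ws = l" "good_walk U v ws" "endn v ws = u" unfolding S_def by auto
    have u: "u \<in> U" "u < R" using \<open>u \<in> S\<close> SU UR by auto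
    have "set ws \<subseteq> {..<D}" using ws(2) unfolding good_walk_def by simp
    hence "ws \<in> set (List.n_lists l [0..<D])" using ws(1) by (auto simp: set_n_lists)
    hence "ws \<in> set (wordsto v u)" using ws(3) unfolding wordsto_def by simp
    then obtain j where j: "j < length (wordsto v u)" "wordsto v u ! j = ws" by (auto simp: in_set_conv_nth)
    have "j < L" using j(1) \<open>u \<notin> O'\<close> u unfolding O'_def by auto
    moreover have "claim M v x u j = digit G 0 (M u (g u i))"
      using j gwalk_correct[where M = M and i = i, OF ws(2) UM] ws(3) unfolding claim_def x_def by simp
    ultimately show ?thesis using UM[OF u(1)] msg_sym by auto
  qed
  \<comment> \<open>The groups outside \<open>Gr\<close> account for at most ng * th1 nodes of
    \<open>S'\<close>, so the remaining ones force \<open>Gr\<close> to be large.\<close>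
  define Gr where "Gr = {a. a < ng \<and> th1 \<le> card (?T a)}"
  let ?I = "\<lambda>a. ((\<lambda>p. a * m + p) ` (?T a))"
  let ?c = "(2 * et2 * ng)"
  have fGr: "finite Gr" unfolding Gr_def by simp
  have S'R: "S' \<subseteq> {..<ng * m}" using SU UR Rm unfolding S'_def by auto
  have "card S' \<le> card Gr * m + ng * th1" proof -
    have "S' = (\<Union>a<ng. (\<lambda>p. a * m + p) ` (?T a))"
    proof
      show "S' \<subseteq> (\<Union>a<ng. (\<lambda>p. a * m + p) ` (?T a))"
      proof
        fix u assume u: "u \<in> S'"
        hence "u < ng * m" using S'R by auto
        hence "u div m < ng" using m by (simp add: less_mult_imp_div_less)
        moreover have "u = u div m * m + u mod m" by simp
        moreover have "u mod m < m" using m by simp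
        ultimately show "u \<in> (\<Union>a<ng. (\<lambda>p. a * m + p) ` (?T a))"
          using u by (intro UN_I[of "u div m"] image_eqI[of _ _ "u mod m"]) auto
      qed
    qed auto
    hence "card S' \<le> (\<Sum>a<ng. card (?I a))"
      using card_UN_le[of "{..<ng}" "\<lambda>a. (\<lambda>p. a * m + p) ` (?T a)"] by simp
    also have "\<dots> \<le> (\<Sum>a<ng. (if a \<in> Gr then m else 0) + th1)"
    proof (rule sum_mono)
      fix a assume a: "a \<in> {..<ng}"
      have 1: "card (?I a) \<le> card (?T a)"
        by (rule card_image_le) simp
      have 2: "card (?T a) \<le> card {..<m}" by (rule card_mono) auto
      show "card (?I a) \<le> (if a \<in> Gr then m else 0) + th1"
      proof (cases "a \<in> Gr")
        case False
        thus ?thesis using 1 a unfolding Gr_def by auto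
      qed (use 1 2 in auto)
    qed
    also have "\<dots> = (\<Sum>a<ng. if a \<in> Gr then m else 0) + ng * th1" by (simp only: sum.distrib sum_constant card_lessThan of_nat_id)
    also have "(\<Sum>a<ng. if a \<in> Gr then m else 0) = card Gr * m" proof -
      have "{..<ng} \<inter> Gr = Gr" unfolding Gr_def by auto
      thus ?thesis by (simp add: sum.If_cases)
    qed
    finally show ?thesis .
  qed
  hence "K / 2 \<le> card Gr * m + ng * th1" using cS' by linarith
  hence "(th2 + 2 * et2 * q1 * ng) * m \<le> card Gr * m" using th2(2) by linarith
  hence Grbig: "th2 + 2 * et2 * q1 * ng \<le> card Gr" using m by simp
  have piece_in: "piece a i \<in> set (?Ps a)" if a: "a \<in> Gr" for a proof -
    have "(?T a) \<subseteq>
      {p. p < m \<and> sym p (piece a i) \<in> (\<lambda>j. digit G (p * L + j) (claims M v x a)) ` {..<L}}"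
    proof
      fix p assume "p \<in> (?T a)"
      hence p: "p < m" "a * m + p \<in> S'" by auto
      then obtain j where j: "j < L" "claim M v x (a * m + p) j = sym p (piece a i)" using S'claim[OF p(2)] by auto
      hence "digit G (p * L + j) (claims M v x a) = sym p (piece a i)" using claims_digit p by simp
      thus "p \<in> {p. p < m \<and> sym p (piece a i) \<in> (\<lambda>j. digit G (p * L + j) (claims M v x a)) ` {..<L}}"
        using p j(1) by (auto intro!: image_eqI[of _ _ j])
    qed
    hence "card (?T a) \<le>
      card {p. p < m \<and> sym p (piece a i) \<in> (\<lambda>j. digit G (p * L + j) (claims M v x a)) ` {..<L}}" by (intro card_mono) auto
    thus ?thesis using a piece_less unfolding pieces_def Gr_def by auto
  qed
  \<comment> \<open>The groups whose hint about \<open>a\<close> also fits a wrong entry in the list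
    of \<open>a\<close>. The distance of \<open>phi\<close> makes them few for each of the at most
    \<open>q1\<close> entries.\<close>
  define Cl where "Cl a = {a0. a0 < ng \<and> (\<exists>pk\<in>set (?Ps a). pk mod M0 \<noteq> core a i \<and>
      phi a0 (pk mod M0) = phi a0 (core a i))}" for a
  let ?C = "\<lambda>a0. {a\<in>Gr. a0 \<in> Cl a}"
  have cCl: "card (Cl a) \<le> q1 * ?c" for a proof -
    have "Cl a \<subseteq> (\<Union>pk\<in>(?W a). {a0. a0 < ng \<and> phi a0 (pk mod M0) = phi a0 (core a i)})"
      unfolding Cl_def by auto
    hence "card (Cl a) \<le> card (\<Union>pk\<in>(?W a). {a0. a0 < ng \<and> phi a0 (pk mod M0) = phi a0 (core a i)})"
      by (intro card_mono) auto
    also have "\<dots> \<le> (\<Sum>pk\<in>(?W a). card {a0. a0 < ng \<and> phi a0 (pk mod M0) = phi a0 (core a i)})"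
      by (intro card_UN_le) auto
    finally have "real (card (Cl a)) \<le> (\<Sum>pk\<in>(?W a). real (card {a0. a0 < ng \<and> phi a0 (pk mod M0) = phi a0 (core a i)}))"
      unfolding of_nat_sum[symmetric] of_nat_le_iff .
    also have "\<dots> \<le> (\<Sum>pk\<in>(?W a). 2 * et2 * ng)"
      using M00 core_less by (intro sum_mono pair_agreement_bound[OF phi_exp]) auto
    also have "\<dots> = card (?W a) * ?c" by simp
    also have "\<dots> \<le> q1 * ?c"
    proof (rule mult_right_mono)
      have "card (?W a) \<le> card (set (?Ps a))"
        by (intro card_mono) auto
      also have "\<dots> \<le> length (?Ps a)" by (rule card_length)
      also have "\<dots> \<le> q1" by (rule length_pieces)
      finally show "real (card (?W a)) \<le> q1" by simp
      have "(1 - et2) * ng * card ({0} :: nat set) \<le> (\<Sum>e<ng. real (card (phi e ` {0})))" using M00 by (intro expandingD[OF phi_exp]) auto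
      hence "(1 - et2) * ng \<le> ng" by simp
      thus "0 \<le> 2 * et2 * ng" by (simp add: algebra_simps)
    qed
    finally show ?thesis .
  qed
  have "Gr \<noteq> {}"
  proof
    assume "Gr = {}"
    hence "K / 2 \<le> ng * th1" using \<open>K / 2 \<le> card Gr * m + ng * th1\<close> by simp
    hence "(th2 + 2 * et2 * q1 * ng) * m \<le> 0" using th2(2) by linarith
    moreover have "q1 * ?c \<ge> 0" using cCl[of 0] by linarith
    hence "0 < th2 + 2 * et2 * q1 * ng" using th2(1) by (simp add: ac_simps)
    hence "0 < (th2 + 2 * et2 * q1 * ng) * m" using m by (intro mult_pos_pos) auto
    ultimately show False by linarith
  qed
  \<comment> \<open>Double counting: if every group of \<open>Gr\<close> confused many others, some
    \<open>Cl a\<close> would be too large.\<close>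
  have "\<exists>a0\<in>Gr. card (?C a0) \<le> q1 * ?c"
  proof (rule ccontr)
    assume "\<not> ?thesis"
    hence "(\<Sum>a0\<in>Gr. q1 * ?c) < (\<Sum>a0\<in>Gr. real (card (?C a0)))"
      using fGr \<open>Gr \<noteq> {}\<close> by (intro sum_strict_mono) (auto simp: not_le)
    also have "(\<Sum>a0\<in>Gr. real (card (?C a0))) = (\<Sum>a\<in>Gr. real (card {a0\<in>Gr. a0 \<in> Cl a}))" proof -
      have "(\<Sum>a0\<in>Gr. card (?C a0)) = (\<Sum>a\<in>Gr. card {a0\<in>Gr. a0 \<in> Cl a})"
        using fGr sum.swap_restrict[of Gr Gr "\<lambda>_ _. 1::nat" "\<lambda>a0 a. a0 \<in> Cl a"] by simp
      thus ?thesis unfolding of_nat_sum[symmetric] by simp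
    qed
    also have "\<dots> \<le> (\<Sum>a\<in>Gr. q1 * ?c)"
    proof (rule sum_mono)
      fix a assume "a \<in> Gr"
      have "card {a0\<in>Gr. a0 \<in> Cl a} \<le> card (Cl a)" by (intro card_mono) (auto simp: Cl_def)
      thus "real (card {a0\<in>Gr. a0 \<in> Cl a}) \<le> q1 * ?c" using cCl[of a] by linarith
    qed
    finally show False by simp
  qed
  then obtain a0 where a0: "a0 \<in> Gr" "card (?C a0) \<le> q1 * ?c" by blast
  obtain c where c: "c < length (?Ps a0)" "?Ps a0 ! c = piece a0 i"
    using piece_in[OF a0(1)] by (auto simp: in_set_conv_nth)
  have st: "start (claims M v x a0) c = piece a0 i" unfolding start_def using c by simp
  define n where "n = selects M v x a0 c"
  let ?E = "{a. a < ng \<and> core a i = digit M0 a n}"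
  have dig: "digit M0 a n = select a0 (claims M v x a) (phi a0 (core a i))" if "a < ng" for a
    unfolding n_def selects_def st using select_less that hint_piece by (subst digit_enc) auto
  have right: "digit M0 a n = core a i" if a: "a \<in> Gr" "a0 \<notin> Cl a" for a proof -
    have "a < ng" "a0 < ng" using a a0 unfolding Gr_def by auto
    have ex: "find (\<lambda>pk. phi a0 (pk mod M0) = phi a0 (core a i)) (?Ps a) \<noteq> None"
      using piece_in[OF a(1)] piece_mod by (auto simp: find_None_iff)
    then obtain pk where pk: "find (\<lambda>pk. phi a0 (pk mod M0) = phi a0 (core a i)) (?Ps a) = Some pk" by blast
    hence "pk \<in> set (?Ps a)" "phi a0 (pk mod M0) = phi a0 (core a i)" using find_Some_nth by fast+
    hence "pk mod M0 = core a i" using a(2) \<open>a0 < ng\<close> unfolding Cl_def by auto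
    thus ?thesis using dig[OF \<open>a < ng\<close>] pk unfolding select_def by simp
  qed
  have "th2 \<le> card ?E" proof -
    have "card Gr \<le> card ((?C a0) \<union> ?E)"
    proof (rule card_mono)
      show "Gr \<subseteq> (?C a0) \<union> ?E"
      proof
        fix a assume a: "a \<in> Gr"
        hence "a < ng" unfolding Gr_def by simp
        thus "a \<in> (?C a0) \<union> ?E"
          using right[OF a] a by (cases "a0 \<in> Cl a") auto
      qed
    qed (use fGr in auto)
    also have "\<dots> \<le> card (?C a0) + card ?E" by (rule card_Un_le)
    finally have "real (card Gr) \<le> real (card (?C a0)) + real (card ?E)" by linarith
    hence "real th2 \<le> real (card ?E)" using Grbig a0(2) by (simp add: algebra_simps)
    thus ?thesis by simp
  qed
  hence "i \<in> set (finals n)" unfolding finals_def using i by auto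
  then obtain c' where c': "c' < length (finals n)" "finals n ! c' = i" by (auto simp: in_set_conv_nth)
  have "cand M v x a0 c c' = Suc i" unfolding cand_def final_def n_def[symmetric] using c' by simp
  moreover have "a0 < ng" using a0 unfolding Gr_def by simp
  moreover have "c < q1" using c(1) length_pieces by (rule less_le_trans)
  moreover have "c' < q2" using c'(1) length_finals by (rule less_le_trans)
  ultimately show ?thesis using vR unfolding x_def by blast
qed

end

section \<open>Straight-line programs and their interpreter\<close>

type_synonym cell = "nat \<times> nat"

text \<open>A cell is an array identifier together with an index. A function occurring in an instruction is
  given to the machine as a table, so any function on words may be used.\<close>

datatype sl_instr =
    Fn cell "nat => nat => nat" cell cell
  | LdW cell nat cell
  | LdR cell nat cell
  | StR nat cell cell
  | StW nat cell cell
  | OpR real_op cell cell cell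
  | Less cell cell cell
  | In cell nat
  | Out cell cell

record sl_state =
  wm :: "nat => nat => nat"
  rm :: "nat => nat => real"
  om :: "nat => real"

definition setw :: "cell => nat => sl_state => sl_state" where
  "setw x v s = s\<lparr>wm := (wm s)(fst x := (wm s (fst x))(snd x := v))\<rparr>"

definition setr :: "cell => real => sl_state => sl_state" where
  "setr x v s = s\<lparr>rm := (rm s)(fst x := (rm s (fst x))(snd x := v))\<rparr>"

abbreviation getw :: "sl_state => cell => nat" where "getw s x \<equiv> wm s (fst x) (snd x)"
abbreviation getr :: "sl_state => cell => real" where "getr s x \<equiv> rm s (fst x) (snd x)"

fun sl_exec :: "nat => real vec => sl_instr => sl_state => sl_state" where
  "sl_exec V y (Fn x f a b) s = setw x (f (getw s a) (getw s b) mod V) s"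
| "sl_exec V y (LdW x n a) s = setw x (wm s n (getw s a)) s"
| "sl_exec V y (LdR x n a) s = setr x (rm s n (getw s a)) s"
| "sl_exec V y (StR n a x) s = setr (n, getw s a) (getr s x) s"
| "sl_exec V y (StW n a x) s = setw (n, getw s a) (getw s x) s"
| "sl_exec V y (OpR f x a b) s = setr x (real_op_val f (getr s a) (getr s b)) s"
| "sl_exec V y (Less x a b) s = setw x (if getr s a < getr s b then 1 else 0) s"
| "sl_exec V y (In x c) s = setr x (if c < dim_vec y then y $ c else 0) s"
| "sl_exec V y (Out a x) s = s\<lparr>om := (om s)(getw s a := getr s x)\<rparr>"

definition sl_run :: "nat => real vec => sl_instr list => sl_state => sl_state" where
  "sl_run V y code s = foldl (\<lambda>s i. sl_exec V y i s) s code"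

definition sl_init :: sl_state where
  "sl_init = \<lparr>wm = (\<lambda>_ _. 0), rm = (\<lambda>_ _. 0), om = (\<lambda>_. 0)\<rparr>"

text \<open>Sixteen arrays are interleaved above sixteen registers, so access with a computed index
  takes one multiplication by the constant 16.\<close>

definition adr :: "cell => nat" where "adr x = 16 * snd x + fst x + 16"

text \<open>Division is excluded by \<open>cells_ok\<close>; its code is a filler.\<close>

fun opcode :: "real_op => nat" where
  "opcode RAdd = 5" | "opcode RSub = 6" | "opcode RMul = 7" | "opcode RDiv = 7"

text \<open>For computed indices the field holds n + 16, the offset to which 16 times the index is
  added. \<open>base\<close> is the start of the function table of the instruction.\<close>

fun encoding :: "nat => sl_instr => nat list" where
  "encoding base (Fn x f a b) = [0, adr x, adr a, adr b, base]"
| "encoding base (LdW x n a) = [1, adr x, adr a, n + 16, 0]"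
| "encoding base (LdR x n a) = [2, adr x, adr a, n + 16, 0]"
| "encoding base (StR n a x) = [3, adr x, adr a, n + 16, 0]"
| "encoding base (StW n a x) = [4, adr x, adr a, n + 16, 0]"
| "encoding base (OpR f x a b) = [opcode f, adr x, adr a, adr b, 0]"
| "encoding base (Less x a b) = [8, adr x, adr a, adr b, 0]"
| "encoding base (In x c) = [9, adr x, c, 0, 0]"
| "encoding base (Out a x) = [10, adr x, adr a, 0, 0]"

fun fn_of :: "sl_instr => nat => nat => nat" where
  "fn_of (Fn x f a b) = f"
| "fn_of _ = (\<lambda>_ _. 0)"

fun cells_ok :: "nat => sl_instr => bool" where
  "cells_ok V (Fn x f a b) \<longleftrightarrow> fst x < 16 \<and> fst a < 16 \<and> fst b < 16 \<and> snd x < V \<and> snd a < V \<and> snd b < V"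
| "cells_ok V (LdW x n a) \<longleftrightarrow> fst x < 16 \<and> n < 16 \<and> fst a < 16 \<and> snd x < V \<and> snd a < V"
| "cells_ok V (LdR x n a) \<longleftrightarrow> fst x < 16 \<and> n < 16 \<and> fst a < 16 \<and> snd x < V \<and> snd a < V"
| "cells_ok V (StR n a x) \<longleftrightarrow> fst x < 16 \<and> n < 16 \<and> fst a < 16 \<and> snd x < V \<and> snd a < V"
| "cells_ok V (StW n a x) \<longleftrightarrow> fst x < 16 \<and> n < 16 \<and> fst a < 16 \<and> snd x < V \<and> snd a < V"
| "cells_ok V (OpR f x a b) \<longleftrightarrow> f \<noteq> RDiv \<and> fst x < 16 \<and> fst a < 16 \<and> fst b < 16 \<and> snd x < V \<and> snd a < V \<and> snd b < V"
| "cells_ok V (Less x a b) \<longleftrightarrow> fst x < 16 \<and> fst a < 16 \<and> fst b < 16 \<and> snd x < V \<and> snd a < V \<and> snd b < V"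
| "cells_ok V (In x c) \<longleftrightarrow> fst x < 16 \<and> snd x < V \<and> c < V"
| "cells_ok V (Out a x) \<longleftrightarrow> fst a < 16 \<and> fst x < 16 \<and> snd a < V \<and> snd x < V"

text \<open>Word registers of the interpreter: 0 instruction pointer, 1 end of the code, 2 \<open>V\<close>,
  3, 4, 13 the constants 1, 0, 16, 5 to 9 the fields of the current instruction, 10 to 12 scratch.\<close>

definition interpreter :: "instr list" where
  "interpreter = [
    WConst 3 1, WConst 4 0, WConst 13 16, ReadWordTable 1 4, ReadWordTable 2 3, WConst 0 8,
    JumpWLess 0 1 8, JumpWLess 4 3 100,
    ReadWordTable 5 0, WArith WAdd 0 0 3, ReadWordTable 6 0, WArith WAdd 0 0 3,
    ReadWordTable 7 0, WArith WAdd 0 0 3, ReadWordTable 8 0, WArith WAdd 0 0 3,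
    ReadWordTable 9 0, WConst 12 4, WArith WAdd 0 0 12,
    WConst 12 1, JumpWLess 5 12 43, WConst 12 2, JumpWLess 5 12 51, WConst 12 3, JumpWLess 5 12 57,
    WConst 12 4, JumpWLess 5 12 63, WConst 12 5, JumpWLess 5 12 69, WConst 12 6, JumpWLess 5 12 75,
    WConst 12 7, JumpWLess 5 12 80, WConst 12 8, JumpWLess 5 12 85, WConst 12 9, JumpWLess 5 12 90,
    WConst 12 10, JumpWLess 5 12 97,
    WLoad 10 7, RLoad 0 6, Emit 10 0, JumpWLess 4 3 6,
    WLoad 10 7, WArith WMul 10 10 2, WLoad 11 8, WArith WAdd 10 10 11, WArith WAdd 10 10 9,
    ReadWordTable 11 10, WStore 6 11, JumpWLess 4 3 6,
    WLoad 10 7, WArith WMul 10 10 13, WArith WAdd 10 10 8, WLoad 11 10, WStore 6 11, JumpWLess 4 3 6,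
    WLoad 10 7, WArith WMul 10 10 13, WArith WAdd 10 10 8, RLoad 0 10, RStore 6 0, JumpWLess 4 3 6,
    WLoad 10 7, WArith WMul 10 10 13, WArith WAdd 10 10 8, RLoad 0 6, RStore 10 0, JumpWLess 4 3 6,
    WLoad 10 7, WArith WMul 10 10 13, WArith WAdd 10 10 8, WLoad 11 6, WStore 10 11, JumpWLess 4 3 6,
    RLoad 0 7, RLoad 1 8, RArith RAdd 0 0 1, RStore 6 0, JumpWLess 4 3 6,
    RLoad 0 7, RLoad 1 8, RArith RSub 0 0 1, RStore 6 0, JumpWLess 4 3 6,
    RLoad 0 7, RLoad 1 8, RArith RMul 0 0 1, RStore 6 0, JumpWLess 4 3 6,
    RLoad 0 7, RLoad 1 8, WConst 11 1, JumpRLess 0 1 95, WConst 11 0, WStore 6 11, JumpWLess 4 3 6,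
    ReadMeasurement 0 7, RStore 6 0, JumpWLess 4 3 6]"

lemma length_interpreter: "length interpreter = 100" by (simp add: interpreter_def)

text \<open>The bound on \<open>wb\<close> lets every address fit into a word: code in blocks of
  eight words, a table of V * V values per instruction, and sixteen arrays of length
  \<open>V\<close>.\<close>

locale compiled =
  fixes code :: "sl_instr list" and V wb :: nat and y :: "real vec"
  assumes ok: "\<And>i. i \<in> set code ==> cells_ok V i" and V: "V \<ge> 1"
    and wb: "8 * (length code + 2) + length code * (V * V) + 16 * V + 64 < 2 ^ wb"
begin

lemma wb1: "8 * (length code + 2) + 16 * V + 64 < 2 ^ wb"
proof -
  have "0 \<le> length code * (V * V)" by simp
  thus ?thesis using wb by linarith
qed

definition fbase :: nat where "fbase = 8 * (length code + 2)"

text \<open>Words 0 and 1 hold the end of the code and \<open>V\<close>; the instructions follow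
  from word 8 on, then the function tables row by row. The tables are fixed in advance, so their
  size does not count as time.\<close>

definition table :: "nat => nat" where
  "table n = (if n = 0 then 8 * (length code + 1) else if n = 1 then V
     else if n < fbase then
       (if n div 8 - 1 < length code \<and> n mod 8 < 5
        then encoding (fbase + (n div 8 - 1) * (V * V)) (code ! (n div 8 - 1)) ! (n mod 8) else 0)
     else (let q = n - fbase in
       if q div (V * V) < length code then fn_of (code ! (q div (V * V))) (q mod (V * V) div V) (q mod V) mod V else 0))"

definition pre :: preprocessed where
  "pre = \<lparr>word_bits = wb, word_table = table, real_table = (\<lambda>_. 0)\<rparr>"

definition sg :: "config => config" where "sg = step interpreter pre y"

lemma adr_less: "fst x < 16 ==> snd x < V ==> adr x < 2 ^ wb" using wb1 unfolding adr_def by linarith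

lemma small: "n \<le> 64 ==> n < 2 ^ wb" for n :: nat using wb1 by linarith

lemma encoding_less:
  assumes "i \<in> set code" "b < fbase + length code * (V * V)" "f < 5"
  shows "encoding b i ! f < 2 ^ wb" proof -
  have b: "b < 2 ^ wb" using assms(2) wb unfolding fbase_def by linarith
  have V': "V < 2 ^ wb" using wb1 by linarith
  have adr: "n < 16 ==> k < V ==> adr (n, k) < 2 ^ wb" for n k by (rule adr_less) auto
  have opc: "opcode g < 2 ^ wb" for g by (cases g) (auto intro: small)
  have c: "n < 16 ==> n + 16 < 2 ^ wb" for n :: nat by (rule small) simp
  have c': "n < V ==> n < 2 ^ wb" for n :: nat using V' by simp
  have num: "0 < (2::nat) ^ wb" "Suc 0 < 2 ^ wb" "2 < (2::nat) ^ wb" "3 < (2::nat) ^ wb" "4 < (2::nat) ^ wb" "8 < (2::nat) ^ wb"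
    "9 < (2::nat) ^ wb" "10 < (2::nat) ^ wb" using small by auto
  have f: "f = 0 \<or> f = 1 \<or> f = 2 \<or> f = 3 \<or> f = 4" using assms(3) by auto
  show ?thesis using ok[OF assms(1)] f num b by (cases i) (auto intro: adr opc c c')
qed

lemma table_less: "table n < 2 ^ wb"
proof -
  have "8 * (length code + 1) \<le> 8 * (length code + 2) + 16 * V + 64" by simp
  hence "8 * (length code + 1) < 2 ^ wb" using wb1 by (rule le_less_trans)
  moreover have "V < 2 ^ wb" using wb1 by linarith
  ultimately have 1: "8 * (length code + 1) < 2 ^ wb" "V < 2 ^ wb" by auto
  have 0: "0 < (2::nat) ^ wb" by simp
  have 2: "encoding (fbase + (n div 8 - 1) * (V * V)) (code ! (n div 8 - 1)) ! (n mod 8) < 2 ^ wb"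
    if "n div 8 - 1 < length code" "n mod 8 < 5"
  proof (rule encoding_less)
    have "Suc (n div 8 - 1) * (V * V) \<le> length code * (V * V)" using that by (intro mult_le_mono1) simp
    moreover have "V * V > 0" using V by simp
    ultimately show "fbase + (n div 8 - 1) * (V * V) < fbase + length code * (V * V)" using that by (simp del: mult_Suc)
  qed (use that in auto)
  have 3: "a mod V < 2 ^ wb" for a proof -
    have "a mod V < V" using V by simp
    thus ?thesis using 1(2) by (rule less_trans)
  qed
  show ?thesis unfolding table_def Let_def using 0 1 2 3 by simp
qed

lemma table_code:
  assumes "j < length code" "f < 5"
  shows "table (8 * (j + 1) + f) = encoding (fbase + j * (V * V)) (code ! j) ! f" proof -
  have "(8 * (j + 1) + f) div 8 = j + 1" "(8 * (j + 1) + f) mod 8 = f" using assms by presburger+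
  moreover have "8 * (j + 1) + f < fbase" using assms unfolding fbase_def by presburger
  moreover have "8 * (j + 1) + f \<noteq> 0" "8 * (j + 1) + f \<noteq> 1" by simp_all
  ultimately show ?thesis unfolding table_def using assms by simp
qed

lemma table_fn:
  assumes "j < length code" "p < V" "q < V"
  shows "table (fbase + j * (V * V) + p * V + q) = fn_of (code ! j) p q mod V"
    and "fbase + j * (V * V) + p * V + q < 2 ^ wb"
proof -
  define n where "n = fbase + j * (V * V) + p * V + q"
  have pq: "p * V + q < V * V" proof -
    have "p * V + q < Suc p * V" using assms by simp
    also have "\<dots> \<le> V * V" using assms by (intro mult_le_mono1) simp
    finally show ?thesis .
  qed
  have n: "n - fbase = (p * V + q) + j * (V * V)" "\<not> n < fbase" "n \<noteq> 0" "n \<noteq> 1" unfolding n_def fbase_def by auto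
  have "(b + j * W) div W = j \<and> (b + j * W) mod W = b" if "b < W" for b W :: nat using that by simp
  from this[OF pq] have "(n - fbase) div (V * V) = j" "(n - fbase) mod (V * V) = p * V + q" unfolding n by auto
  moreover have "(n - fbase) mod V = q" proof -
    have "n - fbase = (p + j * V) * V + q" unfolding n by (simp add: algebra_simps)
    thus ?thesis using assms by simp
  qed
  moreover have "(p * V + q) div V = p" using assms by simp
  ultimately show "table (fbase + j * (V * V) + p * V + q) = fn_of (code ! j) p q mod V"
    unfolding n_def[symmetric] table_def Let_def using n assms by simp
  have "n < fbase + Suc j * (V * V)" unfolding n_def using pq by simp
  also have "\<dots> \<le> fbase + length code * (V * V)" using assms by (intro add_left_mono mult_le_mono1) simp
  also have "\<dots> < 2 ^ wb" using wb unfolding fbase_def by linarith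
  finally show "fbase + j * (V * V) + p * V + q < 2 ^ wb" unfolding n_def .
qed

text \<open>Simulation invariant before instruction \<open>j\<close>. That all stored words stay
  below \<open>V\<close> keeps lookups inside the function tables and makes the reduction modulo 2 ^
  wb harmless.\<close>

definition rel :: "nat => sl_state => config => bool" where
  "rel j s c \<longleftrightarrow> pc c = 6 \<and> words c 0 = 8 * (j + 1) \<and> words c 1 = 8 * (length code + 1) \<and> words c 2 = V \<and>
     words c 3 = 1 \<and> words c 4 = 0 \<and> words c 13 = 16 \<and>
     (\<forall>x. fst x < 16 --> words c (adr x) = getw s x) \<and> (\<forall>x. fst x < 16 --> reals c (adr x) = getr s x) \<and>
     emitted c = om s \<and> (\<forall>a i. wm s a i < V)"

lemma step_at: "pc c = p ==> p < 100 ==> sg c = exec pre y (interpreter ! p) c"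
  unfolding sg_def step_def halted_def length_interpreter by simp

lemma wb_pre [simp]: "word_bits pre = wb" "word_table pre = table" by (simp_all add: pre_def)

lemma table_mod [simp]: "table n mod 2 ^ wb = table n" using table_less by simp

lemma funpow_unfold:
  "(f ^^ 4) x = f (f (f (f x)))" "(f ^^ 5) x = f (f (f (f (f x))))" "(f ^^ 6) x = f (f (f (f (f (f x)))))"
  "(f ^^ 8) x = f (f (f (f (f (f (f (f x)))))))"
  "(f ^^ 12) x = f (f (f (f (f (f (f (f (f (f (f (f x)))))))))))" by (simp_all add: numeral_eq_Suc)

lemma fetch:
  assumes "rel j s c" "j < length code"
  shows "(sg ^^ 12) c = c\<lparr>pc := 19, words := (words c)(5 := table (8 * (j + 1)),
     6 := table (8 * (j + 1) + 1), 7 := table (8 * (j + 1) + 2), 8 := table (8 * (j + 1) + 3),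
     9 := table (8 * (j + 1) + 4), 12 := 4, 0 := 8 * (j + 2))\<rparr>"
proof -
  define q where "q = 8 * (j + 1)"
  have c: "pc c = 6" "words c 0 = q" "words c 1 = 8 * (length code + 1)" "words c 3 = 1" using assms(1) unfolding rel_def q_def by auto
  have lt: "q < 8 * (length code + 1)" using assms(2) unfolding q_def by simp
  have "q + 8 \<le> 8 * (length code + 2) + 16 * V + 64" using assms(2) unfolding q_def by presburger
  hence b: "q + 8 < 2 ^ wb" using wb1 by (rule le_less_trans)
  have m: "Suc q mod 2 ^ wb = Suc q" "Suc (Suc q) mod 2 ^ wb = Suc (Suc q)"
    "Suc (Suc (Suc q)) mod 2 ^ wb = Suc (Suc (Suc q))"
    "Suc (Suc (Suc (Suc q))) mod 2 ^ wb = Suc (Suc (Suc (Suc q)))"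
    "(8 + q) mod 2 ^ wb = q + 8" "4 mod 2 ^ wb = (4::nat)" using b by simp_all
  have s6: "sg c = c\<lparr>pc := 8\<rparr>" using lt c by (subst step_at[OF c(1)]) (simp_all add: interpreter_def)
  have "(sg ^^ 12) c = c\<lparr>pc := 19, words := (words c)(5 := table q,
     6 := table (Suc q), 7 := table (Suc (Suc q)), 8 := table (Suc (Suc (Suc q))),
     9 := table (Suc (Suc (Suc (Suc q)))), 12 := 4, 0 := q + 8)\<rparr>" unfolding funpow_unfold s6
    by (simp add: step_at interpreter_def set_word_def c m)
  moreover have "Suc (Suc q) = q + 2" "Suc (Suc (Suc q)) = q + 3" "Suc (Suc (Suc (Suc q))) = q + 4" "Suc q = q + 1" by simp_all
  moreover have "q + 8 = 8 * (j + 2)" unfolding q_def by simp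
  ultimately show ?thesis unfolding q_def by (simp only:)
qed

definition handler :: "nat => nat" where
  "handler t = [43, 51, 57, 63, 69, 75, 80, 85, 90, 97, 39] ! t"

lemma small_mod: "n \<le> 64 ==> n mod 2 ^ wb = n" for n :: nat using small by simp

lemma wb0: "wb \<noteq> 0" using small[of 1] by (auto intro: ccontr)

text \<open>The opcode is compared with 1, 2, ..., 10 in turn, two steps each. The handler of opcode
  10 stands directly behind the chain.\<close>

lemma dispatch:
  assumes "pc c = 19" "words c 5 = t" "t \<le> 10"
  shows "\<exists>n\<le>20. \<exists>v. (sg ^^ n) c = c\<lparr>pc := handler t, words := (words c)(12 := v)\<rparr>" proof -
  have chain: "\<exists>v. (sg ^^ (2 * k)) c = c\<lparr>pc := 19 + 2 * k, words := (words c)(12 := v)\<rparr>" if "k \<le> t" for k using that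
  proof (induction k)
    case 0
    have "c = c\<lparr>pc := 19 + 2 * 0, words := (words c)(12 := words c 12)\<rparr>" using assms(1) by simp
    thus ?case by (intro exI[of _ "words c 12"]) simp
  next
    case (Suc k)
    obtain v where v: "(sg ^^ (2 * k)) c = c\<lparr>pc := 19 + 2 * k, words := (words c)(12 := v)\<rparr>"
      using Suc.IH[OF Suc_leD[OF Suc.prems]] by blast
    have k: "Suc k \<le> t" "k \<le> 9" using Suc.prems assms(3) by auto
    have "(sg ^^ (2 * Suc k)) c = sg (sg ((sg ^^ (2 * k)) c))" by simp
    also have "k = 0 \<or> k = 1 \<or> k = 2 \<or> k = 3 \<or> k = 4 \<or> k = 5 \<or> k = 6 \<or> k = 7 \<or> k = 8 \<or> k = 9" using k(2) by auto
    hence "sg (sg ((sg ^^ (2 * k)) c)) = c\<lparr>pc := 19 + 2 * Suc k, words := (words c)(12 := k + 1)\<rparr>"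
      unfolding v using assms(2) k(1) wb0 by (elim disjE) (simp_all add: step_at interpreter_def set_word_def small_mod numeral_2_eq_2[symmetric])
    finally show ?case by blast
  qed
  from chain[OF order_refl] obtain v
    where v: "(sg ^^ (2 * t)) c = c\<lparr>pc := 19 + 2 * t, words := (words c)(12 := v)\<rparr>" by blast
  show ?thesis
  proof (cases "t = 10")
    case True
    hence "(sg ^^ 20) c = c\<lparr>pc := handler t, words := (words c)(12 := v)\<rparr>" using v unfolding handler_def by simp
    thus ?thesis by blast
  next
    case False
    have "(sg ^^ (2 * Suc t)) c = sg (sg ((sg ^^ (2 * t)) c))" by simp
    also have "t = 0 \<or> t = 1 \<or> t = 2 \<or> t = 3 \<or> t = 4 \<or> t = 5 \<or> t = 6 \<or> t = 7 \<or> t = 8 \<or> t = 9"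
      using assms(3) False by presburger
    hence "sg (sg ((sg ^^ (2 * t)) c)) = c\<lparr>pc := handler t, words := (words c)(12 := t + 1)\<rparr>"
      unfolding v handler_def using assms(2) wb0
      by (elim disjE) (simp_all add: step_at interpreter_def set_word_def small_mod numeral_2_eq_2[symmetric])
    finally have "(sg ^^ (2 * Suc t)) c = c\<lparr>pc := handler t, words := (words c)(12 := t + 1)\<rparr>" .
    moreover have "2 * Suc t \<le> 20" using assms(3) False by simp
    ultimately show ?thesis by blast
  qed
qed

end

section \<open>Simulation of the single instructions\<close>

context compiled
begin

text \<open>The state in which a handler starts: like \<open>rel\<close>, except that the
  instruction pointer already refers to the next instruction.\<close>

definition ready :: "nat => sl_state => config => bool" where
  "ready j s c \<longleftrightarrow> words c 0 = 8 * (j + 2) \<and> words c 1 = 8 * (length code + 1) \<and> words c 2 = V \<and>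
     words c 3 = 1 \<and> words c 4 = 0 \<and> words c 13 = 16 \<and>
     (\<forall>x. fst x < 16 --> words c (adr x) = getw s x) \<and> (\<forall>x. fst x < 16 --> reals c (adr x) = getr s x) \<and>
     emitted c = om s \<and> (\<forall>a i. wm s a i < V)"

lemma adr_ge: "n < 16 ==> adr x \<noteq> n" "n < 16 ==> n \<noteq> adr x" unfolding adr_def by simp_all

lemma adr_inj: "fst x < 16 ==> fst x' < 16 ==> adr x = adr x' \<longleftrightarrow> x = x'"
proof -
  assume *: "fst x < 16" "fst x' < 16"
  have "fst z < 16 ==> adr z mod 16 = fst z \<and> adr z div 16 = snd z + 1" for z :: cell unfolding adr_def by simp
  thus ?thesis using * by (metis add_right_cancel prod_eqI)
qed

lemma decoded:
  assumes "rel j s c" "j < length code"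
  shows "\<exists>n\<le>32. pc ((sg ^^ n) c) = handler (encoding (fbase + j * (V * V)) (code ! j) ! 0) \<and> ready j s ((sg ^^ n) c) \<and>
    (\<forall>f\<in>{1..4}. words ((sg ^^ n) c) (5 + f) = encoding (fbase + j * (V * V)) (code ! j) ! f)"
proof -
  define c1 where "c1 = (sg ^^ 12) c"
  have c1: "c1 = c\<lparr>pc := 19, words := (words c)(5 := table (8 * (j + 1)),
     6 := table (8 * (j + 1) + 1), 7 := table (8 * (j + 1) + 2), 8 := table (8 * (j + 1) + 3),
     9 := table (8 * (j + 1) + 4), 12 := 4, 0 := 8 * (j + 2))\<rparr>" unfolding c1_def by (rule fetch[OF assms])
  have t: "table (8 * (j + 1) + f) = encoding (fbase + j * (V * V)) (code ! j) ! f" if "f < 5" for f by (rule table_code[OF assms(2) that])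
  define opc where "opc = encoding (fbase + j * (V * V)) (code ! j) ! 0"
  have opc: "opc \<le> 10" unfolding opc_def
  proof (cases "code ! j")
    case (OpR f x a b)
    thus "encoding (fbase + j * (V * V)) (code ! j) ! 0 \<le> 10" by (cases f) auto
  qed auto
  have p: "pc c1 = 19" "words c1 5 = opc" unfolding c1 opc_def using t[of 0] by simp_all
  obtain n v where n: "n \<le> 20" "(sg ^^ n) c1 = c1\<lparr>pc := handler opc, words := (words c1)(12 := v)\<rparr>"
    using dispatch[OF p opc] by blast
  define c2 where "c2 = (sg ^^ (n + 12)) c"
  have c2: "c2 = c1\<lparr>pc := handler opc, words := (words c1)(12 := v)\<rparr>" proof -
    have "c2 = (sg ^^ n) c1" unfolding c2_def c1_def by (simp add: funpow_add)
    thus ?thesis using n(2) by (rule trans)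
  qed
  have "words c2 (5 + f) = encoding (fbase + j * (V * V)) (code ! j) ! f" if "f \<in> {1..4}" for f proof -
    have "f = 1 \<or> f = 2 \<or> f = 3 \<or> f = 4" using that unfolding atLeastAtMost_iff by presburger
    thus ?thesis unfolding c2 c1 using t[of 1] t[of 2] t[of 3] t[of 4] by (elim disjE) (simp_all del: One_nat_def)
  qed
  moreover have "pc c2 = handler opc" unfolding c2 by simp
  moreover have "ready j s c2" using assms(1) unfolding ready_def rel_def c2 c1 by (simp add: adr_ge)
  ultimately show ?thesis using n(1) unfolding c2_def opc_def by (intro exI[of _ "n + 12"]) simp
qed

lemma finish_w:
  assumes "ready j s c" "fst x < 16" "v < V"
    and "c' = c\<lparr>pc := 6, words := (words c)(10 := p, 11 := q, adr x := v)\<rparr>"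
  shows "rel (Suc j) (setw x v s) c'" using assms unfolding ready_def rel_def setw_def by (cases x) (auto simp: adr_ge adr_inj)

lemma finish_r:
  assumes "ready j s c" "fst x < 16"
    and "pc c' = 6" "emitted c' = emitted c" "\<And>n. n \<noteq> 10 ==> words c' n = words c n"
    and "\<And>n. 16 \<le> n ==> reals c' n = (if n = adr x then v else reals c n)"
  shows "rel (Suc j) (setr x v s) c'" proof -
  have "16 \<le> adr z" for z by (simp add: adr_def)
  thus ?thesis using assms unfolding ready_def rel_def setr_def by (cases x) (auto simp: adr_ge adr_inj)
qed

lemma wless: "ready j s c ==> getw s x < V" by (simp add: ready_def)
lemma wmod: "n < V ==> n mod 2 ^ wb = n" for n using wb1 by simp
lemma amod: "n < V ==> m < 16 ==> n * 16 mod 2 ^ wb = n * 16 \<and> (n * 16 + (m + 16)) mod 2 ^ wb = adr (m, n)" for n m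
proof -
  assume "n < V" "m < 16"
  hence "n * 16 + (m + 16) \<le> 8 * (length code + 2) + 16 * V + 64" by simp
  hence "n * 16 + (m + 16) < 2 ^ wb" using wb1 by (rule le_less_trans)
  thus ?thesis unfolding adr_def by (simp add: ac_simps)
qed

lemma ready_cell: "ready j s c ==> fst x < 16 ==> words c (adr x) = getw s x"
  "ready j s c ==> fst x < 16 ==> reals c (adr x) = getr s x"
  "ready j s c ==> words c 2 = V" "ready j s c ==> words c 3 = 1" "ready j s c ==> words c 4 = 0"
  "ready j s c ==> words c 13 = 16" by (cases x; simp add: ready_def)+

lemma exec_Fn:
  assumes r: "ready j s c" and p: "pc c = 43" and I: "code ! j = Fn x f a b" and j: "j < length code"
    and w: "words c 6 = adr x" "words c 7 = adr a" "words c 8 = adr b" "words c 9 = fbase + j * (V * V)"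
    and ok': "fst x < 16" "fst a < 16" "fst b < 16"
  shows "rel (Suc j) (sl_exec V y (code ! j) s) ((sg ^^ 8) c)" proof -
  define A where "A = getw s a"
  define B where "B = getw s b"
  have AB: "A < V" "B < V" unfolding A_def B_def using wless[OF r] by auto
  note T = table_fn[OF j AB]
  define bs where "bs = fbase + j * (V * V)"
  define z where "z = fbase + j * (V * V) + A * V + B"
  have z: "z < 2 ^ wb" unfolding z_def by (rule T(2))
  have v: "table z = f A B mod V" unfolding z_def T(1) I by simp
  have m: "A mod 2 ^ wb = A" "B mod 2 ^ wb = B" "A * V mod 2 ^ wb = A * V" "(A * V + B) mod 2 ^ wb = A * V + B"
    "(A * V + B + bs) mod 2 ^ wb = z"
  proof -
    have "A * V \<le> z" "A * V + B \<le> z" "A * V + B + bs = z" unfolding z_def bs_def by simp_all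
    thus "A * V mod 2 ^ wb = A * V" "(A * V + B) mod 2 ^ wb = A * V + B"
      "(A * V + B + bs) mod 2 ^ wb = z" using z by simp_all
  qed (use AB wmod in auto)
  note rc = ready_cell[OF r]
  have e: "(sg ^^ 8) c = c\<lparr>pc := 6, words := (words c)(10 := z, 11 := table z, adr x := table z)\<rparr>" unfolding funpow_unfold
    using p w[folded bs_def] ok' rc(1)[of a, folded A_def] rc(1)[of b, folded B_def] rc(3-6) m
    by (simp add: step_at interpreter_def set_word_def adr_ge)
  have "f A B mod V < V" using V by simp
  from finish_w[OF r ok'(1) this e[unfolded v]] show ?thesis unfolding I by (simp add: A_def B_def)
qed

lemma exec_LdW:
  assumes r: "ready j s c" and p: "pc c = 51"
    and w: "words c 6 = adr x" "words c 7 = adr a" "words c 8 = n + 16"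
    and ok': "fst x < 16" "fst a < 16" "n < 16"
  shows "rel (Suc j) (sl_exec V y (LdW x n a) s) ((sg ^^ 6) c)" proof -
  define A where "A = getw s a"
  have A: "A < V" unfolding A_def using wless[OF r] by auto
  define v where "v = wm s n A"
  have v: "v < V" unfolding v_def using r by (simp add: ready_def)
  have m: "A mod 2 ^ wb = A" "A * 16 mod 2 ^ wb = A * 16" "(A * 16 + (n + 16)) mod 2 ^ wb = adr (n, A)" "v mod 2 ^ wb = v"
    using wmod A v amod ok' by simp_all
  note rc = ready_cell[OF r]
  have e: "(sg ^^ 6) c = c\<lparr>pc := 6, words := (words c)(10 := adr (n, A), 11 := v, adr x := v)\<rparr>" unfolding funpow_unfold
    using p w ok' rc(1)[of a, folded A_def] rc(1)[of "(n, A)"] rc(3-6) m unfolding v_def by (simp add: step_at interpreter_def set_word_def adr_ge)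
  from finish_w[OF r ok'(1) v e] show ?thesis by (simp add: A_def v_def)
qed

lemma exec_LdR:
  assumes r: "ready j s c" and p: "pc c = 57"
    and w: "words c 6 = adr x" "words c 7 = adr a" "words c 8 = n + 16"
    and ok': "fst x < 16" "fst a < 16" "n < 16"
  shows "rel (Suc j) (sl_exec V y (LdR x n a) s) ((sg ^^ 6) c)" proof -
  define A where "A = getw s a"
  have A: "A < V" unfolding A_def using wless[OF r] by auto
  have m: "A mod 2 ^ wb = A" "A * 16 mod 2 ^ wb = A * 16" "(A * 16 + (n + 16)) mod 2 ^ wb = adr (n, A)" using wmod A amod ok' by simp_all
  note rc = ready_cell[OF r]
  have e: "(sg ^^ 6) c = c\<lparr>pc := 6, words := (words c)(10 := adr (n, A)), reals := (reals c)(0 := rm s n A, adr x := rm s n A)\<rparr>"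
    unfolding funpow_unfold using p w ok' rc(1)[of a, folded A_def] rc(2)[of "(n, A)"] rc(3-6) m
    by (simp add: step_at interpreter_def set_word_def set_real_def adr_ge)
  have "rel (Suc j) (setr x (rm s n A) s) ((sg ^^ 6) c)" unfolding e by (rule finish_r[OF r ok'(1)]) (auto simp: adr_ge)
  thus ?thesis by (simp add: A_def)
qed

lemma exec_StR:
  assumes r: "ready j s c" and p: "pc c = 63"
    and w: "words c 6 = adr x" "words c 7 = adr a" "words c 8 = n + 16"
    and ok': "fst x < 16" "fst a < 16" "n < 16"
  shows "rel (Suc j) (sl_exec V y (StR n a x) s) ((sg ^^ 6) c)" proof -
  define A where "A = getw s a"
  have A: "A < V" unfolding A_def using wless[OF r] by auto
  have m: "A mod 2 ^ wb = A" "A * 16 mod 2 ^ wb = A * 16" "(A * 16 + (n + 16)) mod 2 ^ wb = adr (n, A)" using wmod A amod ok' by simp_all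
  note rc = ready_cell[OF r]
  have e: "(sg ^^ 6) c = c\<lparr>pc := 6, words := (words c)(10 := adr (n, A)), reals := (reals c)(0 := getr s x, adr (n, A) := getr s x)\<rparr>"
    unfolding funpow_unfold using p w ok' rc(1)[of a, folded A_def] rc(2)[of x] rc(3-6) m
    by (simp add: step_at interpreter_def set_word_def set_real_def adr_ge)
  have nA: "fst (n, A) < 16" using ok' by simp
  have "rel (Suc j) (setr (n, A) (getr s x) s) ((sg ^^ 6) c)" unfolding e by (rule finish_r[OF r nA]) (auto simp: adr_ge)
  thus ?thesis by (simp add: A_def)
qed

lemma exec_StW:
  assumes r: "ready j s c" and p: "pc c = 69"
    and w: "words c 6 = adr x" "words c 7 = adr a" "words c 8 = n + 16"
    and ok': "fst x < 16" "fst a < 16" "n < 16"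
  shows "rel (Suc j) (sl_exec V y (StW n a x) s) ((sg ^^ 6) c)" proof -
  define A where "A = getw s a"
  have A: "A < V" unfolding A_def using wless[OF r] by auto
  define v where "v = getw s x"
  have v: "v < V" unfolding v_def using wless[OF r] by auto
  have m: "A mod 2 ^ wb = A" "A * 16 mod 2 ^ wb = A * 16" "(A * 16 + (n + 16)) mod 2 ^ wb = adr (n, A)" "v mod 2 ^ wb = v"
    using wmod A v amod ok' by simp_all
  note rc = ready_cell[OF r]
  have e: "(sg ^^ 6) c = c\<lparr>pc := 6, words := (words c)(10 := adr (n, A), 11 := v, adr (n, A) := v)\<rparr>" unfolding funpow_unfold
    using p w ok' rc(1)[of a, folded A_def] rc(1)[of x, folded v_def] rc(3-6) m by (simp add: step_at interpreter_def set_word_def adr_ge)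
  have "fst (n, A) < 16" using ok' by simp
  from finish_w[OF r this v e] show ?thesis by (simp add: A_def v_def)
qed

lemma exec_OpR:
  assumes r: "ready j s c" and f: "f \<noteq> RDiv" and p: "pc c = handler (opcode f)"
    and w: "words c 6 = adr x" "words c 7 = adr a" "words c 8 = adr b"
    and ok': "fst x < 16" "fst a < 16" "fst b < 16"
  shows "rel (Suc j) (sl_exec V y (OpR f x a b) s) ((sg ^^ 5) c)" proof -
  define v where "v = real_op_val f (getr s a) (getr s b)"
  note rc = ready_cell[OF r]
  have e: "(sg ^^ 5) c = c\<lparr>pc := 6, reals := (reals c)(0 := v, 1 := getr s b, adr x := v)\<rparr>" unfolding funpow_unfold v_def
    using p w ok' f rc(2)[of a] rc(2)[of b] rc(3-6) by (cases f) (simp_all add: handler_def step_at interpreter_def set_real_def adr_ge fun_upd_twist)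
  have "rel (Suc j) (setr x v s) ((sg ^^ 5) c)" unfolding e by (rule finish_r[OF r ok'(1)]) (auto simp: adr_ge)
  thus ?thesis by (simp add: v_def)
qed

lemma exec_In:
  assumes r: "ready j s c" and p: "pc c = 97"
    and w: "words c 6 = adr x" "words c 7 = k"
    and ok': "fst x < 16"
  shows "rel (Suc j) (sl_exec V y (In x k) s) ((sg ^^ 3) c)" proof -
  define v where "v = (if k < dim_vec y then y $ k else 0)"
  note rc = ready_cell[OF r]
  have f3: "(f ^^ 3) z = f (f (f z))" for f :: "config => config" and z by (simp add: numeral_eq_Suc)
  have e: "(sg ^^ 3) c = c\<lparr>pc := 6, reals := (reals c)(0 := v, adr x := v)\<rparr>" unfolding f3 v_def using p w ok' rc(3-6)
    by (simp add: handler_def step_at interpreter_def set_real_def adr_ge)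
  have "rel (Suc j) (setr x v s) ((sg ^^ 3) c)" unfolding e by (rule finish_r[OF r ok'(1)]) (auto simp: adr_ge)
  thus ?thesis by (simp add: v_def)
qed

lemma exec_Out:
  assumes r: "ready j s c" and p: "pc c = 39"
    and w: "words c 6 = adr x" "words c 7 = adr a"
    and ok': "fst x < 16" "fst a < 16"
  shows "rel (Suc j) (sl_exec V y (Out a x) s) ((sg ^^ 4) c)" proof -
  define A where "A = getw s a"
  have A: "A < V" unfolding A_def using wless[OF r] by auto
  have m: "A mod 2 ^ wb = A" using wmod A by simp
  note rc = ready_cell[OF r]
  have "(sg ^^ 4) c = c\<lparr>pc := 6, words := (words c)(10 := A),
      reals := (reals c)(0 := getr s x), emitted := (emitted c)(A := getr s x)\<rparr>" unfolding funpow_unfold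
    using p w ok' rc(1)[of a, folded A_def] rc(2)[of x] rc(3-6) m by (simp add: step_at interpreter_def set_word_def set_real_def adr_ge)
  thus ?thesis using r unfolding rel_def ready_def by (simp add: adr_ge A_def)
qed

lemma exec_Less:
  assumes r: "ready j s c" and p: "pc c = 90"
    and w: "words c 6 = adr x" "words c 7 = adr a" "words c 8 = adr b"
    and ok': "fst x < 16" "fst a < 16" "fst b < 16" and V2: "V \<ge> 2"
  shows "\<exists>n\<le>7. rel (Suc j) (sl_exec V y (Less x a b) s) ((sg ^^ n) c)" proof -
  note rc = ready_cell[OF r]
  have f7: "(f ^^ 7) z = f (f (f (f (f (f (f z))))))" for f :: "config => config" and z by (simp add: numeral_eq_Suc)
  define v :: nat where "v = (if getr s a < getr s b then 1 else 0)"
  have m: "Suc 0 mod 2 ^ wb = Suc 0" using small_mod[of 1] by simp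
  have "\<exists>n\<le>7. (sg ^^ n) c = c\<lparr>pc := 6, words := (words c)(11 := v, adr x := v), reals := (reals c)(0 := getr s a, 1 := getr s b)\<rparr>"
  proof (cases "getr s a < getr s b")
    case True
    hence "(sg ^^ 6) c = c\<lparr>pc := 6, words := (words c)(11 := v, adr x := v), reals := (reals c)(0 := getr s a, 1 := getr s b)\<rparr>"
      unfolding funpow_unfold v_def using p w ok' rc(2)[of a] rc(2)[of b] rc(3-6) m
      by (simp add: step_at interpreter_def set_word_def set_real_def adr_ge)
    thus ?thesis by (intro exI[of _ 6]) simp
  next
    case False
    hence "(sg ^^ 7) c = c\<lparr>pc := 6, words := (words c)(11 := v, adr x := v), reals := (reals c)(0 := getr s a, 1 := getr s b)\<rparr>"
      unfolding f7 v_def using p w ok' rc(2)[of a] rc(2)[of b] rc(3-6) m by (simp add: step_at interpreter_def set_word_def set_real_def adr_ge)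
    thus ?thesis by (intro exI[of _ 7]) simp
  qed
  moreover have "rel (Suc j) (setw x v s) (c\<lparr>pc := 6, words := (words c)(11 := v, adr x := v), reals := (reals c)(0 := getr s a, 1 := getr s b)\<rparr>)"
  proof -
    have "v < V" unfolding v_def using V2 by simp
    thus ?thesis using r ok' unfolding ready_def rel_def setw_def by (cases x) (auto simp: adr_ge adr_inj)
  qed
  ultimately show ?thesis unfolding v_def by auto
qed

lemma one_instruction:
  assumes "rel j s c" "j < length code" "V \<ge> 2"
  shows "\<exists>n\<le>40. rel (Suc j) (sl_exec V y (code ! j) s) ((sg ^^ n) c)" proof -
  define F where "F = encoding (fbase + j * (V * V)) (code ! j)"
  obtain n where n: "n \<le> 32" "pc ((sg ^^ n) c) = handler (F ! 0)" "ready j s ((sg ^^ n) c)"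
    "\<And>f. f \<in> {1..4} ==> words ((sg ^^ n) c) (5 + f) = F ! f" using decoded[OF assms(1,2)] unfolding F_def by blast
  define c' where "c' = (sg ^^ n) c"
  let ?r = "\<lambda>k. rel (Suc j) (sl_exec V y (code ! j) s) ((sg ^^ k) c')"
  have r: "ready j s c'" unfolding c'_def by (rule n(3))
  have w: "words c' 6 = F ! 1" "words c' 7 = F ! 2" "words c' 8 = F ! 3" "words c' 9 = F ! 4"
    using n(4)[of 1] n(4)[of 2] n(4)[of 3] n(4)[of 4] unfolding c'_def by simp_all
  have p: "pc c' = handler (F ! 0)" unfolding c'_def by (rule n(2))
  have ok': "cells_ok V (code ! j)" using ok assms(2) by simp
  have "\<exists>k\<le>8. ?r k"
  proof (cases "code ! j")
    case (Fn x f a b)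
    hence "?r 8"
      using p w ok' unfolding F_def by (intro exec_Fn[OF r _ Fn assms(2)]) (simp_all add: handler_def)
    thus ?thesis by blast
  next
    case (LdW x m a)
    hence "?r 6"
      using p w ok' unfolding F_def LdW by (intro exec_LdW[OF r]) (simp_all add: handler_def)
    thus ?thesis by (intro exI[of _ 6]) simp
  next
    case (LdR x m a)
    hence "?r 6"
      using p w ok' unfolding F_def LdR by (intro exec_LdR[OF r]) (simp_all add: handler_def)
    thus ?thesis by (intro exI[of _ 6]) simp
  next
    case (StR m a x)
    hence "?r 6"
      using p w ok' unfolding F_def StR by (intro exec_StR[OF r]) (simp_all add: handler_def)
    thus ?thesis by (intro exI[of _ 6]) simp
  next
    case (StW m a x)
    hence "?r 6"
      using p w ok' unfolding F_def StW by (intro exec_StW[OF r]) (simp_all add: handler_def)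
    thus ?thesis by (intro exI[of _ 6]) simp
  next
    case (OpR f x a b)
    hence "?r 5" using p w ok' unfolding F_def OpR by (intro exec_OpR[OF r]) simp_all
    thus ?thesis by (intro exI[of _ 5]) simp
  next
    case (Less x a b)
    hence "\<exists>k\<le>7. ?r k"
      using p w ok' assms(3) unfolding F_def Less by (intro exec_Less[OF r]) (simp_all add: handler_def)
    then obtain k where "k \<le> 7" "?r k" by blast
    thus ?thesis by (intro exI[of _ k]) simp
  next
    case (In x m)
    hence "?r 3"
      using p w ok' unfolding F_def In by (intro exec_In[OF r]) (simp_all add: handler_def)
    thus ?thesis by (intro exI[of _ 3]) simp
  next
    case (Out a x)
    hence "?r 4"
      using p w ok' unfolding F_def Out by (intro exec_Out[OF r]) (simp_all add: handler_def)
    thus ?thesis by (intro exI[of _ 4]) simp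
  qed
  then obtain k where k: "k \<le> 8" "?r k" by blast
  have "(sg ^^ (k + n)) c = (sg ^^ k) c'" unfolding c'_def by (simp add: funpow_add)
  hence "rel (Suc j) (sl_exec V y (code ! j) s) ((sg ^^ (k + n)) c)" using k(2) by simp
  moreover have "k + n \<le> 40" using k n by simp
  ultimately show ?thesis by blast
qed

lemma started: "\<exists>n\<le>6. rel 0 sl_init ((sg ^^ n) init_config)"
proof -
  have t: "table 0 = 8 * (length code + 1)" "table (Suc 0) = V" unfolding table_def by simp_all
  have m: "Suc 0 mod 2 ^ wb = Suc 0" "0 mod 2 ^ wb = (0::nat)" "16 mod 2 ^ wb = (16::nat)" "8 mod 2 ^ wb = (8::nat)"
    using small_mod[of 1] small_mod[of 16] small_mod[of 8] by simp_all
  have wb: "wb \<noteq> 0" using small_mod[of 1] by (cases "wb = 0") auto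
  have e: "(sg ^^ 6) init_config = init_config\<lparr>pc := 6, words := (\<lambda>_. 0)(3 := 1, 4 := 0, 13 := 16, 1 := table 0, 2 := table 1, 0 := 8)\<rparr>"
    unfolding funpow_unfold using wb by (simp add: init_config_def step_at interpreter_def set_word_def m)
  have "rel 0 sl_init ((sg ^^ 6) init_config)" unfolding e using V by (simp add: rel_def sl_init_def init_config_def t adr_ge)
  thus ?thesis by (intro exI[of _ 6]) simp
qed

text \<open>Per instruction, fetching and dispatching take at most 32 steps and the handler at most
  8; the remaining 8 steps are start and exit.\<close>

theorem interpreter_correct:
  assumes "V \<ge> 2"
  shows "\<exists>n\<le>40 * length code + 8. halted interpreter (run interpreter pre y n) \<and>
     emitted (run interpreter pre y n) = om (sl_run V y code sl_init)"
proof -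
  have "\<exists>n\<le>40 * j + 6. rel j (sl_run V y (take j code) sl_init) ((sg ^^ n) init_config)" if "j \<le> length code" for j using that
  proof (induction j)
    case 0 thus ?case using started by (simp add: sl_run_def)
  next
    case (Suc j)
    then obtain n where n: "n \<le> 40 * j + 6" "rel j (sl_run V y (take j code) sl_init) ((sg ^^ n) init_config)" by auto
    obtain k where k: "k \<le> 40" "rel (Suc j) (sl_exec V y (code ! j) (sl_run V y (take j code) sl_init)) ((sg ^^ k) ((sg ^^ n) init_config))"
      using one_instruction[OF n(2) _ assms] Suc.prems by auto
    have "sl_exec V y (code ! j) (sl_run V y (take j code) sl_init) = sl_run V y (take (Suc j) code) sl_init"
      using Suc.prems by (simp add: sl_run_def take_Suc_conv_app_nth)
    moreover have "(sg ^^ k) ((sg ^^ n) init_config) = (sg ^^ (k + n)) init_config" by (simp add: funpow_add)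
    ultimately have "rel (Suc j) (sl_run V y (take (Suc j) code) sl_init) ((sg ^^ (k + n)) init_config)" using k(2) by simp
    moreover have "k + n \<le> 40 * Suc j + 6" using k n by simp
    ultimately show ?case by blast
  qed
  from this[of "length code"] obtain n where n: "n \<le> 40 * length code + 6"
    "rel (length code) (sl_run V y code sl_init) ((sg ^^ n) init_config)" by auto
  define c where "c = (sg ^^ n) init_config"
  have c: "pc c = 6" "words c 0 = words c 1" "words c 3 = 1" "words c 4 = 0" "emitted c = om (sl_run V y code sl_init)"
    using n(2) unfolding c_def rel_def by simp_all
  have "sg (sg c) = c\<lparr>pc := 100\<rparr>" using c by (simp add: step_at interpreter_def)
  moreover have "(sg ^^ (2 + n)) init_config = sg (sg c)" unfolding c_def by (simp add: numeral_2_eq_2)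
  ultimately have e: "run interpreter pre y (2 + n) = c\<lparr>pc := 100\<rparr>" unfolding run_def sg_def by simp
  have "halted interpreter (run interpreter pre y (2 + n))" unfolding e halted_def length_interpreter by simp
  moreover have "emitted (run interpreter pre y (2 + n)) = om (sl_run V y code sl_init)" unfolding e using c(5) by simp
  moreover have "2 + n \<le> 40 * length code + 8" using n(1) by simp
  ultimately show ?thesis by blast
qed

end

section \<open>Array programs\<close>

text \<open>The language has no control flow. Loops are unrolled when a program is generated, and
  choices are expressed by computed indices.\<close>

datatype wexp = Cst nat | Ld nat wexp | Ap "nat => nat => nat" wexp wexp
datatype rexp = RL nat wexp | RI nat | RO real_op rexp rexp
datatype cmd = WS nat wexp wexp | RS nat wexp rexp | BS nat wexp rexp rexp | EM wexp rexp

fun wev :: "nat => (nat => nat => nat) => wexp => nat" where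
  "wev V w (Cst n) = n mod V"
| "wev V w (Ld a e) = w a (wev V w e)"
| "wev V w (Ap f e e') = f (wev V w e) (wev V w e') mod V"

fun rev' :: "nat => real vec => sl_state => rexp => real" where
  "rev' V y s (RL a e) = rm s a (wev V (wm s) e)"
| "rev' V y s (RI n) = (if n < dim_vec y then y $ n else 0)"
| "rev' V y s (RO f r r') = real_op_val f (rev' V y s r) (rev' V y s r')"

fun cexec :: "nat => real vec => cmd => sl_state => sl_state" where
  "cexec V y (WS a e e') s = setw (a, wev V (wm s) e) (wev V (wm s) e') s"
| "cexec V y (RS a e r) s = setr (a, wev V (wm s) e) (rev' V y s r) s"
| "cexec V y (BS a e r r') s = setw (a, wev V (wm s) e) (if rev' V y s r < rev' V y s r' then 1 else 0) s"
| "cexec V y (EM e r) s = s\<lparr>om := (om s)(wev V (wm s) e := rev' V y s r)\<rparr>"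

definition crun :: "nat => real vec => cmd list => sl_state => sl_state" where
  "crun V y cs s = foldl (\<lambda>s c. cexec V y c s) s cs"

lemma crun_simps [simp]: "crun V y [] s = s" "crun V y (c # cs) s = crun V y cs (cexec V y c s)"
  "crun V y (cs @ cs') s = crun V y cs' (crun V y cs s)" by (simp_all add: crun_def)

lemma sl_run_simps [simp]: "sl_run V y [] s = s" "sl_run V y (c # cs) s = sl_run V y cs (sl_exec V y c s)"
  "sl_run V y (cs @ cs') s = sl_run V y cs' (sl_run V y cs s)" by (simp_all add: sl_run_def)

lemma set_simps [simp]: "wm (setw x v s) = (wm s)(fst x := (wm s (fst x))(snd x := v))" "rm (setw x v s) = rm s"
  "om (setw x v s) = om s" "rm (setr x r s) = (rm s)(fst x := (rm s (fst x))(snd x := r))" "wm (setr x r s) = wm s"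
  "om (setr x r s) = om s" by (simp_all add: setw_def setr_def)

fun wsize :: "wexp => nat" where
  "wsize (Cst n) = 1" | "wsize (Ld a e) = wsize e + 1" | "wsize (Ap f e e') = wsize e + wsize e' + 1"

fun rsize :: "rexp => nat" where
  "rsize (RL a e) = wsize e + 1" | "rsize (RI n) = 1" | "rsize (RO f r r') = rsize r + rsize r' + 1"

fun csize :: "cmd => nat" where
  "csize (WS a e e') = wsize e + wsize e' + 1"
| "csize (RS a e r) = wsize e + rsize r + 1"
| "csize (BS a e r r') = wsize e + rsize r + rsize r' + 2"
| "csize (EM e r) = wsize e + rsize r + 1"

fun wok :: "wexp => bool" where
  "wok (Cst n) \<longleftrightarrow> True" | "wok (Ld a e) \<longleftrightarrow> 0 < a \<and> a < 16 \<and> wok e" | "wok (Ap f e e') \<longleftrightarrow> wok e \<and> wok e'"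

fun rok :: "nat => rexp => bool" where
  "rok V (RL a e) \<longleftrightarrow> 0 < a \<and> a < 16 \<and> wok e" | "rok V (RI n) \<longleftrightarrow> n < V"
| "rok V (RO f r r') \<longleftrightarrow> f \<noteq> RDiv \<and> rok V r \<and> rok V r'"

fun cok :: "nat => cmd => bool" where
  "cok V (WS a e e') \<longleftrightarrow> 0 < a \<and> a < 16 \<and> wok e \<and> wok e'"
| "cok V (RS a e r) \<longleftrightarrow> 0 < a \<and> a < 16 \<and> wok e \<and> rok V r"
| "cok V (BS a e r r') \<longleftrightarrow> 0 < a \<and> a < 16 \<and> wok e \<and> rok V r \<and> rok V r'"
| "cok V (EM e r) \<longleftrightarrow> wok e \<and> rok V r"

text \<open>The value is left in scratch cell \<open>q\<close>; the cells above form an expression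
  stack.\<close>

fun compw :: "nat => wexp => sl_instr list" where
  "compw q (Cst n) = [Fn (0, q) (\<lambda>_ _. n) (0, q) (0, q)]"
| "compw q (Ld a e) = compw q e @ [LdW (0, q) a (0, q)]"
| "compw q (Ap f e e') = compw q e @ compw (Suc q) e' @ [Fn (0, q) f (0, q) (0, Suc q)]"

fun compr :: "nat => rexp => sl_instr list" where
  "compr q (RL a e) = compw q e @ [LdR (0, q) a (0, q)]"
| "compr q (RI n) = [In (0, q) n]"
| "compr q (RO f r r') = compr q r @ compr (Suc q) r' @ [OpR f (0, q) (0, q) (0, Suc q)]"

fun comp :: "cmd => sl_instr list" where
  "comp (WS a e e') = compw 0 e @ compw 1 e' @ [StW a (0, 0) (0, 1)]"
| "comp (RS a e r) = compw 0 e @ compr 1 r @ [StR a (0, 0) (0, 1)]"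
| "comp (BS a e r r') = compw 0 e @ compr 1 r @ compr 2 r' @ [Less (0, 1) (0, 1) (0, 2), StW a (0, 0) (0, 1)]"
| "comp (EM e r) = compw 0 e @ compr 1 r @ [Out (0, 0) (0, 1)]"

lemma length_compw: "length (compw q e) = wsize e" by (induction q e rule: compw.induct) auto
lemma length_compr: "length (compr q r) = rsize r" by (induction q r rule: compr.induct) (auto simp: length_compw)
lemma length_comp: "length (comp c) = csize c" by (cases c) (auto simp: length_compw length_compr)

text \<open>Array 0 is the scratch memory of compiled code.\<close>

definition agree :: "sl_state => sl_state => bool" where
  "agree s t \<longleftrightarrow> (\<forall>n>0. wm s n = wm t n \<and> rm s n = rm t n) \<and> om s = om t"

text \<open>The scratch cells below \<open>q\<close> hold pending operands, which the evaluation of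
  a subexpression at level \<open>q\<close> must preserve.\<close>

definition scratch :: "nat => sl_state => sl_state => bool" where
  "scratch q s t \<longleftrightarrow> agree s t \<and> (\<forall>p<q. wm s 0 p = wm t 0 p \<and> rm s 0 p = rm t 0 p)"

lemma scratchI: "scratch q s s" by (simp add: scratch_def agree_def)
lemma scratch_trans: "scratch q s t ==> scratch p t u ==> q \<le> p ==> scratch q s u" by (simp add: scratch_def agree_def)
lemma agree_wev: "agree s t ==> wok e ==> wev V (wm s) e = wev V (wm t) e" by (induction e) (auto simp: agree_def)
lemma agree_rev: "agree s t ==> rok V' r ==> rev' V y s r = rev' V y t r"
proof (induction r)
  case (RL a e)
  thus ?case using agree_wev[of s t e V] by (simp add: agree_def)
qed auto
lemma scratch_wev: "scratch q s t ==> wok e ==> wev V (wm s) e = wev V (wm t) e" unfolding scratch_def using agree_wev by blast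
lemma scratch_rev: "scratch q s t ==> rok V' r ==> rev' V y s r = rev' V y t r" unfolding scratch_def using agree_rev by blast
lemma scratch_get: "scratch q s t ==> p < q ==> wm s 0 p = wm t 0 p \<and> rm s 0 p = rm t 0 p" unfolding scratch_def by blast

lemma scratch_set: "scratch q s t ==> q \<le> p ==> scratch q s (setw (0, p) v t)"
  "scratch q s t ==> q \<le> p ==> scratch q s (setr (0, p) r t)" by (auto simp: scratch_def agree_def)

lemma agree_set: "agree s t ==> agree (setw x v s) (setw x v t)"
  "agree s t ==> agree (setr x r s) (setr x r t)"
  "agree s t ==> agree s (setw (0, p) v t)" by (auto simp: agree_def)

lemma agree_trans: "agree s t ==> agree t u ==> agree s u" by (simp add: agree_def)

lemma scratch_agree: "scratch q s t ==> agree s t" by (simp add: scratch_def)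

lemma compw_correct:
  "wok e ==> scratch q s (sl_run V y (compw q e) s) \<and> rm (sl_run V y (compw q e) s) = rm s \<and>
     wm (sl_run V y (compw q e) s) 0 q = wev V (wm s) e"
proof (induction q e arbitrary: s rule: compw.induct)
  case (1 q n)
  thus ?case by (simp add: scratch_def agree_def)
next
  case (2 q a e)
  define t where "t = sl_run V y (compw q e) s"
  have t: "scratch q s t" "rm t = rm s" "wm t 0 q = wev V (wm s) e" using 2 unfolding t_def by auto
  have a: "wm t a = wm s a" using t(1) 2(2) by (simp add: scratch_def agree_def)
  have r: "sl_run V y (compw q (Ld a e)) s = setw (0, q) (wm t a (wm t 0 q)) t" by (simp add: t_def[symmetric])
  show ?case unfolding r using scratch_set(1)[OF t(1) le_refl] t(2,3) a by simp
next
  case (3 q f e e')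
  define t where "t = sl_run V y (compw q e) s"
  define u where "u = sl_run V y (compw (Suc q) e') t"
  have t: "scratch q s t" "rm t = rm s" "wm t 0 q = wev V (wm s) e" using 3 unfolding t_def by auto
  have u: "scratch (Suc q) t u" "rm u = rm t" "wm u 0 (Suc q) = wev V (wm t) e'" using 3 unfolding u_def by auto
  have e': "wev V (wm t) e' = wev V (wm s) e'" using scratch_wev[OF t(1)] 3(3) by simp
  have q: "wm u 0 q = wm t 0 q" using scratch_get[OF u(1), of q] by simp
  have su: "scratch q s u" by (rule scratch_trans[OF t(1) u(1)]) simp
  have r: "sl_run V y (compw q (Ap f e e')) s = setw (0, q) (f (wm u 0 q) (wm u 0 (Suc q)) mod V) u" by (simp add: t_def[symmetric] u_def[symmetric])
  show ?case unfolding r using scratch_set(1)[OF su le_refl] t(2,3) u(2,3) e' q by simp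
qed

lemma compr_correct:
  "rok V' r ==> scratch q s (sl_run V y (compr q r) s) \<and> rm (sl_run V y (compr q r) s) 0 q = rev' V y s r"
proof (induction q r arbitrary: s rule: compr.induct)
  case (1 q a e)
  define t where "t = sl_run V y (compw q e) s"
  have t: "scratch q s t" "rm t = rm s" "wm t 0 q = wev V (wm s) e" using compw_correct 1 unfolding t_def by auto
  have r: "sl_run V y (compr q (RL a e)) s = setr (0, q) (rm t a (wm t 0 q)) t" by (simp add: t_def[symmetric])
  show ?case unfolding r using scratch_set(2)[OF t(1) le_refl] t(2,3) by simp
next
  case (2 q n)
  thus ?case using scratch_set(2)[OF scratchI[of q s] le_refl] by simp
next
  case (3 q f e e')
  define t where "t = sl_run V y (compr q e) s"
  define u where "u = sl_run V y (compr (Suc q) e') t"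
  have t: "scratch q s t" "rm t 0 q = rev' V y s e" using 3 unfolding t_def by auto
  have u: "scratch (Suc q) t u" "rm u 0 (Suc q) = rev' V y t e'" using 3 unfolding u_def by auto
  have e': "rev' V y t e' = rev' V y s e'" using scratch_rev[OF t(1), of V' e'] 3(3) by simp
  have q: "rm u 0 q = rm t 0 q" using scratch_get[OF u(1), of q] by simp
  have su: "scratch q s u" by (rule scratch_trans[OF t(1) u(1)]) simp
  have r: "sl_run V y (compr q (RO f e e')) s = setr (0, q) (real_op_val f (rm u 0 q) (rm u 0 (Suc q))) u"
    by (simp add: t_def[symmetric] u_def[symmetric])
  show ?case unfolding r using scratch_set(2)[OF su le_refl] t(2) u(2) e' q by simp
qed

lemma comp_correct:
  assumes "cok V' c" "agree s t"
  shows "agree (cexec V y c s) (sl_run V y (comp c) t)"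
proof (cases c)
  case (WS a e e')
  define t1 where "t1 = sl_run V y (compw 0 e) t"
  define t2 where "t2 = sl_run V y (compw 1 e') t1"
  have ok: "wok e" "wok e'" using assms WS by auto
  have t1: "scratch 0 t t1" "wm t1 0 0 = wev V (wm t) e" using compw_correct ok unfolding t1_def by auto
  have t2: "scratch 1 t1 t2" "wm t2 0 1 = wev V (wm t1) e'" using compw_correct ok unfolding t2_def by auto
  have s: "scratch 0 t t2" by (rule scratch_trans[OF t1(1) t2(1)]) simp
  have v: "wm t2 0 0 = wev V (wm s) e" "wm t2 0 1 = wev V (wm s) e'"
    using scratch_get[OF t2(1), of 0] t1 t2 scratch_wev[OF t1(1)] ok agree_wev[OF assms(2)] by simp_all
  have r: "sl_run V y (comp c) t = setw (a, wm t2 0 0) (wm t2 0 1) t2"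
    unfolding WS by (simp add: t1_def[symmetric] t2_def[symmetric] del: One_nat_def)
  show ?thesis unfolding r v unfolding WS cexec.simps by (rule agree_set(1)[OF agree_trans[OF assms(2) scratch_agree[OF s]]])
next
  case (RS a e r)
  define t1 where "t1 = sl_run V y (compw 0 e) t"
  define t2 where "t2 = sl_run V y (compr 1 r) t1"
  have ok: "wok e" "rok V' r" using assms RS by auto
  have t1: "scratch 0 t t1" "wm t1 0 0 = wev V (wm t) e" using compw_correct ok unfolding t1_def by auto
  have t2: "scratch 1 t1 t2" "rm t2 0 1 = rev' V y t1 r" using compr_correct[OF ok(2)] unfolding t2_def by auto
  have s: "scratch 0 t t2" by (rule scratch_trans[OF t1(1) t2(1)]) simp
  have v: "wm t2 0 0 = wev V (wm s) e" "rm t2 0 1 = rev' V y s r"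
    using scratch_get[OF t2(1), of 0] t1 t2 scratch_rev[OF t1(1) ok(2)] ok agree_wev[OF assms(2)] agree_rev[OF assms(2) ok(2)] by simp_all
  have r: "sl_run V y (comp c) t = setr (a, wm t2 0 0) (rm t2 0 1) t2"
    unfolding RS by (simp add: t1_def[symmetric] t2_def[symmetric] del: One_nat_def)
  show ?thesis unfolding r v unfolding RS cexec.simps by (rule agree_set(2)[OF agree_trans[OF assms(2) scratch_agree[OF s]]])
next
  case (BS a e r r')
  define t1 where "t1 = sl_run V y (compw 0 e) t"
  define t2 where "t2 = sl_run V y (compr 1 r) t1"
  define t3 where "t3 = sl_run V y (compr 2 r') t2"
  have ok: "wok e" "rok V' r" "rok V' r'" using assms BS by auto
  have t1: "scratch 0 t t1" "wm t1 0 0 = wev V (wm t) e" using compw_correct ok unfolding t1_def by auto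
  have t2: "scratch 1 t1 t2" "rm t2 0 1 = rev' V y t1 r" using compr_correct[OF ok(2)] unfolding t2_def by auto
  have t3: "scratch 2 t2 t3" "rm t3 0 2 = rev' V y t2 r'" using compr_correct[OF ok(3)] unfolding t3_def by auto
  have s2: "scratch 0 t t2" by (rule scratch_trans[OF t1(1) t2(1)]) simp
  have s: "scratch 0 t t3" by (rule scratch_trans[OF s2 t3(1)]) simp
  have v: "wm t3 0 0 = wev V (wm s) e" "rm t3 0 1 = rev' V y s r" "rm t3 0 2 = rev' V y s r'"
    using scratch_get[OF t2(1), of 0] scratch_get[OF t3(1), of 0] scratch_get[OF t3(1), of 1] t1 t2 t3
      scratch_rev[OF t1(1) ok(2)] scratch_rev[OF s2 ok(3)] ok agree_wev[OF assms(2)] agree_rev[OF assms(2) ok(2)]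
      agree_rev[OF assms(2) ok(3)] by simp_all
  have e3: "sl_run V y (comp c) t = setw (a, wm t3 0 0) (if rm t3 0 1 < rm t3 0 2 then 1 else 0)
      (setw (0, 1) (if rm t3 0 1 < rm t3 0 2 then 1 else 0) t3)"
    unfolding BS by (simp add: t1_def[symmetric] t2_def[symmetric] t3_def[symmetric] del: One_nat_def)
  show ?thesis unfolding e3 v unfolding BS cexec.simps by (rule agree_set(1)[OF agree_set(3)[OF agree_trans[OF assms(2) scratch_agree[OF s]]]])
next
  case (EM e r)
  define t1 where "t1 = sl_run V y (compw 0 e) t"
  define t2 where "t2 = sl_run V y (compr 1 r) t1"
  have ok: "wok e" "rok V' r" using assms EM by auto
  have t1: "scratch 0 t t1" "wm t1 0 0 = wev V (wm t) e" using compw_correct ok unfolding t1_def by auto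
  have t2: "scratch 1 t1 t2" "rm t2 0 1 = rev' V y t1 r" using compr_correct[OF ok(2)] unfolding t2_def by auto
  have s: "scratch 0 t t2" by (rule scratch_trans[OF t1(1) t2(1)]) simp
  have v: "wm t2 0 0 = wev V (wm s) e" "rm t2 0 1 = rev' V y s r"
    using scratch_get[OF t2(1), of 0] t1 t2 scratch_rev[OF t1(1) ok(2)] ok agree_wev[OF assms(2)] agree_rev[OF assms(2) ok(2)] by simp_all
  have r: "sl_run V y (comp c) t = t2\<lparr>om := (om t2)(wm t2 0 0 := rm t2 0 1)\<rparr>"
    unfolding EM by (simp add: t1_def[symmetric] t2_def[symmetric] del: One_nat_def)
  have "agree s t2" by (rule agree_trans[OF assms(2) scratch_agree[OF s]])
  thus ?thesis unfolding r v unfolding EM cexec.simps by (simp add: agree_def)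
qed

lemma compile_correct:
  "(\<And>c. c \<in> set cs ==> cok V c) ==> agree s t ==> agree (crun V y cs s) (sl_run V y (concat (map comp cs)) t)"
proof (induction cs arbitrary: s t)
  case (Cons c cs)
  thus ?case using comp_correct[of V c s t] by simp
qed simp

lemma compw_ok: "wok e ==> q + wsize e \<le> V ==> i \<in> set (compw q e) ==> cells_ok V i"
proof (induction q e rule: compw.induct)
  case (3 q f e e')
  have "0 < wsize e'" by (cases e') auto
  thus ?case using 3 by auto
next
  case (2 q a e)
  have "0 < wsize e" by (cases e) auto
  thus ?case using 2 by auto
qed auto

lemma compr_ok: "rok V r ==> q + rsize r \<le> V ==> i \<in> set (compr q r) ==> cells_ok V i"
proof (induction q r rule: compr.induct)
  case (1 q a e)
  thus ?case using compw_ok[of e q V i] by auto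
next
  case (3 q f e e')
  have "0 < rsize e'" by (cases e') auto
  thus ?case using 3 by auto
qed auto

lemma comp_ok: "cok V c ==> csize c \<le> V ==> i \<in> set (comp c) ==> cells_ok V i"
proof -
  assume *: "cok V c" "csize c \<le> V" "i \<in> set (comp c)"
  have w: "0 < wsize e" for e by (cases e) auto
  have r: "0 < rsize e" for e by (cases e) auto
  show ?thesis
  proof (cases c)
    case (WS a e e')
    thus ?thesis using * w[of e] w[of e'] compw_ok[of e 0 V i] compw_ok[of e' 1 V i] by auto
  next
    case (RS a e e')
    thus ?thesis using * w[of e] r[of e'] compw_ok[of e 0 V i] compr_ok[of V e' 1 i] by auto
  next
    case (BS a e e' e'')
    thus ?thesis using * w[of e] r[of e'] r[of e''] compw_ok[of e 0 V i] compr_ok[of V e' 1 i] compr_ok[of V e'' 2 i] by auto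
  next
    case (EM e e')
    thus ?thesis using * w[of e] r[of e'] compw_ok[of e 0 V i] compr_ok[of V e' 1 i] by auto
  qed
qed

text \<open>\<open>Q\<close> bounds the compiled size of a command and thereby the scratch cells
  that it uses; hence the requirement \<open>Q \<le> V\<close>.\<close>

theorem array_program_runs:
  assumes ok: "\<And>c. c \<in> set cs ==> cok V c \<and> csize c \<le> Q" and Q: "Q \<le> V" and V: "2 \<le> V"
    and wb: "length cs * Q \<le> n" "8 * (n + 2) + n * (V * V) + 16 * V + 64 < 2 ^ wb"
  shows "\<exists>A. word_bits A = wb \<and> (\<forall>y. halted interpreter (run interpreter A y (40 * n + 8)) \<and>
     emitted (run interpreter A y (40 * n + 8)) = om (crun V y cs sl_init))"
proof -
  define code where "code = concat (map comp cs)"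
  have "length code \<le> length cs * Q" unfolding code_def length_concat map_map comp_def
    using ok by (induction cs) (auto simp: length_comp intro!: add_mono)
  hence len: "length code \<le> n" using wb by simp
  have code_ok: "cells_ok V i" if i: "i \<in> set code" for i proof -
    obtain c where "c \<in> set cs" "i \<in> set (comp c)" using i unfolding code_def by auto
    thus ?thesis using comp_ok[of V c i] ok[of c] Q by simp
  qed
  have wb': "8 * (length code + 2) + length code * (V * V) + 16 * V + 64 < 2 ^ wb" proof -
    have "8 * (length code + 2) \<le> 8 * (n + 2)" "length code * (V * V) \<le> n * (V * V)" using len by simp_all
    thus ?thesis using wb(2) by linarith
  qed
  have cl: "compiled code V wb" by unfold_locales (use code_ok V wb' in auto)
  \<comment> \<open>The number of steps depends on the outcome of comparisons, but a halted
    configuration is fixed, so one time bound serves every input.\<close>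
  have stay: "run P A y t = run P A y t'" if h: "halted P (run P A y t')" "t' \<le> t" for P A t t' y proof -
    obtain q where q: "t = q + t'" using h(2) le_Suc_ex by (metis add.commute)
    define c where "c = run P A y t'"
    have "step P A y c = c" using h(1) unfolding c_def[symmetric] step_def by simp
    hence "(step P A y ^^ q) c = c" by (induction q) simp_all
    thus ?thesis unfolding c_def unfolding q run_def by (simp add: funpow_add)
  qed
  have "halted interpreter (run interpreter (compiled.pre code V wb) y (40 * n + 8)) \<and>
     emitted (run interpreter (compiled.pre code V wb) y (40 * n + 8)) = om (crun V y cs sl_init)" for y
  proof -
    obtain q where q: "q \<le> 40 * length code + 8" "halted interpreter (run interpreter (compiled.pre code V wb) y q)"
     "emitted (run interpreter (compiled.pre code V wb) y q) = om (sl_run V y code sl_init)" using compiled.interpreter_correct[OF cl V] by blast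
    have "q \<le> 40 * n + 8" using q(1) len by linarith
    from stay[OF q(2) this] have e: "run interpreter (compiled.pre code V wb) y (40 * n + 8) = run interpreter (compiled.pre code V wb) y q" .
    have "agree (crun V y cs sl_init) (sl_run V y code sl_init)" unfolding code_def
      by (rule compile_correct) (use ok in \<open>auto simp: agree_def\<close>)
    thus ?thesis unfolding e using q unfolding agree_def by simp
  qed
  moreover have "word_bits (compiled.pre code V wb) = wb" by (simp add: compiled.pre_def[OF cl])
  ultimately show ?thesis by blast
qed

section \<open>The decoding program\<close>

text \<open>The invariant rule for loops unrolled at generation time, where the round number is a
  constant in the commands.\<close>

lemma crun_loop:
  assumes "I 0 s" "\<And>n s. n < m ==> I n s ==> I (Suc n) (crun V y (f n) s)"
  shows "I m (crun V y (concat (map f [0..<m])) s)" proof -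
  have "n \<le> m ==> I n (crun V y (concat (map f [0..<n])) s)" for n by (induction n) (use assms in auto)
  thus ?thesis by simp
qed

definition fn1 :: "(nat => nat) => wexp => wexp" where "fn1 f e = Ap (\<lambda>a b. f a) e (Cst 0)"
definition entry :: "nat => nat => wexp" where "entry a c = Ld a (Cst c)"

lemma wev_fn1 [simp]: "wev V w (fn1 f e) = f (wev V w e) mod V" by (simp add: fn1_def)
lemma wev_entry: "c < V ==> wev V w (entry a c) = w a c" by (simp add: entry_def)

text \<open>Word arrays: 2 candidates, 3 support of the current approximation, 4 winners of the tournament tree,
  5 measured bits, 7 selected items, 8 and 9 comparisons. Real arrays: 2 residual measurements, 3 current
  approximation, 4 keys, 5 improved estimates, 7, 8, 9 temporaries, 10 zeros. Items are stored with index
  \<open>Suc i\<close>; index 0 stands for no item.\<close>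

locale decoder =
  fixes N k d B H V nc :: nat and h :: "nat => nat => nat" and bt :: "nat => nat => bool"
    and prog :: "cmd list" and \<theta> :: real and y :: "real vec"
  assumes d: "d > 0" and B: "B > 0" and h_less: "\<And>e i. h e i < B" and NH: "N < 2 ^ H"
    and V: "2 * d * B < V" "2 * 2 ^ H \<le> V" "nc < V" "k < V" "d * d < V"
    and prog_frame: "\<And>s. (\<forall>a. a \<notin> {1, 2, 6} --> wm (crun V y prog s) a = wm s a) \<and>
        rm (crun V y prog s) = rm s \<and> om (crun V y prog s) = om s"
    and prog_range: "\<And>s c. \<forall>q. wm s 5 q \<le> 1 ==> c < nc ==> wm (crun V y prog s) 2 c \<le> N"
    and prog_finds: "\<And>s i. \<forall>q. wm s 5 q \<le> 1 ==> i < N ==>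
        real (card {e. e < d \<and> (wm s 5 (e * B + h e i) = 1) \<noteq> bt e i}) < \<theta> * d ==>
        \<exists>c<nc. wm (crun V y prog s) 2 c = Suc i"
begin

subsection \<open>The tournament tree\<close>

text \<open>Heap numbering: leaf \<open>i\<close> has number 2 ^ H + i, halving leads to the parent,
  and the root is 1.\<close>

definition anc :: "nat => nat => nat" where "anc t i = (2 ^ H + i) div 2 ^ t"

lemma anc_Suc: "anc (Suc t) i = anc t i div 2" unfolding anc_def by (simp add: div_mult2_eq[symmetric] mult.commute)

lemma anc_bounds: "i < 2 ^ H ==> t \<le> H ==> 2 ^ (H - t) \<le> anc t i \<and> anc t i < 2 * 2 ^ (H - t)"
proof -
  assume a: "i < 2 ^ H" "t \<le> H"
  have e: "(2::nat) ^ H = 2 ^ (H - t) * 2 ^ t" using a(2) by (simp flip: power_add)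
  have "2 ^ (H - t) * 2 ^ t div 2 ^ t \<le> (2 ^ H + i) div 2 ^ t" using e by (intro div_le_mono) simp
  moreover have "(2 ^ H + i) div 2 ^ t < 2 * 2 ^ (H - t)" using a(1) e by (intro less_mult_imp_div_less) (simp add: mult.assoc mult.commute)
  ultimately show ?thesis unfolding anc_def by simp
qed

text \<open>The numbers of one level lie between consecutive powers of two, so a number determines
  its level.\<close>

lemma anc_level: "i < 2 ^ H ==> j < 2 ^ H ==> t \<le> H ==> t' \<le> H ==> anc t i div 2 = anc t' j div 2 ==> t = t'"
proof -
  have "False" if a: "i < 2 ^ H" "j < 2 ^ H" "t < t'" "t' \<le> H" "anc t i div 2 = anc t' j div 2" for i j t t' proof -
    have 1: "2 ^ (H - t) \<le> anc t i" "anc t' j < 2 * 2 ^ (H - t')" using anc_bounds a by auto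
    have "H - t = Suc (H - t') + (t' - t - 1)" using a by simp
    hence "(2::nat) ^ (H - t) = 2 ^ Suc (H - t') * 2 ^ (t' - t - 1)" by (simp only: power_add)
    hence 2: "(2::nat) * 2 ^ (H - t') \<le> 2 ^ (H - t)" by simp
    have "even ((2::nat) * 2 ^ (H - t'))" by simp
    hence "anc t' j div 2 < 2 ^ (H - t')" using 1 by linarith
    moreover have "2 ^ (H - t') \<le> anc t i div 2" using 1 2 by linarith
    ultimately show False using a by simp
  qed
  thus "i < 2 ^ H ==> j < 2 ^ H ==> t \<le> H ==> t' \<le> H ==> anc t i div 2 = anc t' j div 2 ==> t = t'"
    by (cases t t' rule: linorder_cases) (auto, metis)
qed

lemma anc_root: "i < 2 ^ H ==> anc H i = 1" using anc_bounds[of i H] by simp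
lemma anc_less_V: "i < 2 ^ H ==> t \<le> H ==> anc t i < V"
proof -
  assume "i < 2 ^ H" "t \<le> H"
  hence "anc t i \<le> 2 ^ H + i" "i < 2 ^ H" unfolding anc_def by simp_all
  thus ?thesis using V by linarith
qed

definition member :: "nat => nat => bool" where "member i p \<longleftrightarrow> i \<le> N \<and> (\<exists>t\<le>H. anc t i = p)"

definition inside :: "(nat => nat) => bool" where "inside W \<longleftrightarrow> (\<forall>p. W p = 0 \<or> member (W p) p)"

definition node_ok :: "(nat => nat) => (nat => real) => nat => bool" where
  "node_ok W K p \<longleftrightarrow> (\<forall>i. member i p --> K i \<le> K (W p))"

lemma member_child:
  assumes t: "Suc t \<le> H" and i: "i \<le> N" and m: "member j (anc (Suc t) i)"
  shows "member j (2 * anc (Suc t) i) \<or> member j (2 * anc (Suc t) i + 1)" proof -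
  obtain t' where t': "t' \<le> H" "anc t' j = anc (Suc t) i" "j \<le> N" using m unfolding member_def by auto
  have "t' = Suc t" using anc_level[of j i t' "Suc t"] t' t i NH by simp
  hence "anc t j div 2 = anc (Suc t) i" using t' by (simp add: anc_Suc)
  hence "anc t j = 2 * anc (Suc t) i \<or> anc t j = 2 * anc (Suc t) i + 1" by linarith
  thus ?thesis unfolding member_def using t' t by (metis Suc_leD)
qed

lemma child_member:
  assumes t: "Suc t \<le> H" and i: "i \<le> N" and f: "f \<le> 1" and m: "member j (2 * anc (Suc t) i + f)"
  shows "member j (anc (Suc t) i)" proof -
  obtain t' where t': "t' \<le> H" "anc t' j = 2 * anc (Suc t) i + f" "j \<le> N" using m unfolding member_def by auto
  have e: "anc t' j div 2 = anc t i div 2" using t'(2) f by (simp add: anc_Suc)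
  have "t' = t" using anc_level[OF _ _ _ _ e] t' t i NH by simp
  hence "anc (Suc t) j = anc (Suc t) i" using e by (simp add: anc_Suc)
  thus ?thesis unfolding member_def using t t' by blast
qed

text \<open>The outcome of the comparison, 0 or 1, is added to the number of the left child; this
  replaces a branch.\<close>

definition upd :: "wexp => nat => cmd list" where
  "upd E t = [BS 9 (Cst 0) (RL 4 (Ld 4 (fn1 (\<lambda>i. 2 * anc (Suc t) i) E))) (RL 4 (Ld 4 (fn1 (\<lambda>i. 2 * anc (Suc t) i + 1) E))),
     WS 4 (fn1 (anc (Suc t)) E) (Ld 4 (Ap (\<lambda>i f. 2 * anc (Suc t) i + f) E (Ld 9 (Cst 0))))]"

definition update :: "wexp => cmd list" where
  "update E = WS 4 (fn1 (anc 0) E) E # concat (map (upd E) [0..<H])"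

definition keysok :: "(nat => real) => bool" where "keysok K \<longleftrightarrow> K 0 = 0 \<and> (\<forall>i. 0 \<le> K i)"

text \<open>The key of \<open>i\<close> matters only to the nodes between its leaf and the root,
  which are recomputed from the bottom up; therefore correctness is presupposed only off this
  path.\<close>

lemma update_effect:
  assumes E: "E = entry a c" "a \<in> {2, 3, 7}" "c < V" and i: "wm s a c = i" "i \<le> N"
    and I: "inside (wm s 4)" and ok: "\<And>p. (\<And>t. t \<le> H ==> p \<noteq> anc t i) ==> node_ok (wm s 4) (rm s 4) p"
    and s': "s' = crun V y (update E) s"
  shows "rm s' = rm s \<and> om s' = om s \<and> (\<forall>a. a \<noteq> 4 \<and> a \<noteq> 9 --> wm s' a = wm s a) \<and> inside (wm s' 4) \<and> (\<forall>p. node_ok (wm s' 4) (rm s' 4) p)"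
proof -
  define K where "K = rm s 4"
  \<comment> \<open>After \<open>t\<close> levels only the path nodes above level \<open>t\<close>
    may still be wrong.\<close>
  define J where "J t u \<longleftrightarrow> rm u = rm s \<and> om u = om s \<and> (\<forall>a. a \<noteq> 4 \<and> a \<noteq> 9 --> wm u a = wm s a) \<and> inside (wm u 4) \<and>
    (\<forall>p. (\<forall>t'. t < t' \<and> t' \<le> H --> p \<noteq> anc t' i) --> node_ok (wm u 4) K p)" for t and u :: sl_state
  have iH: "i < 2 ^ H" using i NH by simp
  have V0: "V > 0" using V by simp
  define s1 where "s1 = cexec V y (WS 4 (fn1 (anc 0) E) E) s"
  have s1: "s1 = setw (4, anc 0 i) i s" unfolding s1_def using E i anc_less_V[OF iH, of 0] by (simp add: wev_entry)
  have "J 0 s1" unfolding J_def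
  proof (intro conjI allI impI)
    show "rm s1 = rm s" "om s1 = om s" unfolding s1 by simp_all
    show "wm s1 a = wm s a" if "a \<noteq> 4 \<and> a \<noteq> 9" for a unfolding s1 using that by simp
    show "inside (wm s1 4)" using I i unfolding s1 inside_def member_def by auto
    show "node_ok (wm s1 4) K p" if p: "\<forall>t'. 0 < t' \<and> t' \<le> H --> p \<noteq> anc t' i" for p
    proof (cases "p = anc 0 i")
      case True
      have "j = i" if m: "member j p" for j proof -
        obtain t where t: "t \<le> H" "anc t j = anc 0 i" "j \<le> N" using m True unfolding member_def by auto
        have "t = 0" using anc_level[of j i t 0] t i NH by simp
        thus "j = i" using t unfolding anc_def by simp
      qed
      thus ?thesis using True unfolding node_ok_def s1 by auto
    next
      case False
      hence "p \<noteq> anc t i" if "t \<le> H" for t using p that by (cases "t = 0") auto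
      hence "node_ok (wm s 4) K p" unfolding K_def by (rule ok)
      thus ?thesis using False unfolding node_ok_def s1 by simp
    qed
  qed
  hence "J H (crun V y (concat (map (upd E) [0..<H])) s1)"
  proof (rule crun_loop[where I = J])
    fix t u assume t: "t < H" and J: "J t u"
    define p where "p = anc (Suc t) i"
    have pV: "2 * p + f < V" if f: "f \<le> 1" for f proof -
      have pp: "p < 2 * 2 ^ (H - Suc t)" unfolding p_def using anc_bounds[OF iH, of "Suc t"] t by simp
      have e: "(2::nat) * 2 ^ (H - Suc t) = 2 ^ (H - t)" using t by (simp flip: power_Suc add: Suc_diff_Suc)
      have "(2::nat) ^ (H - t) \<le> 2 ^ H" by (simp add: power_increasing)
      hence "2 * p + f < 2 * 2 ^ H" using pp e f by linarith
      thus ?thesis using V by linarith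
    qed
    have Ku: "rm u 4 = K" using J unfolding J_def K_def by simp
    define wl where "wl = wm u 4 (2 * p)"
    define wr where "wr = wm u 4 (2 * p + 1)"
    define f :: nat where "f = (if K wl < K wr then 1 else 0)"
    have ua: "wm u a = wm s a" using J E(2) unfolding J_def by auto
    have Ei: "wev V (wm u) E = i" using E i ua by (simp add: wev_entry)
    have Ei': "wev V (wm (setw (9, 0) f u)) E = i" using E i ua by (auto simp: wev_entry)
    have r: "crun V y (upd E t) u = setw (4, p) (wm u 4 (2 * p + f)) (setw (9, 0) f u)" proof -
      have "p < V" using pV[of 0] by simp
      moreover have "f \<le> 1" unfolding f_def by simp
      ultimately show ?thesis using pV[of 0] pV[of 1] pV[of f] V0 Ei Ei' unfolding upd_def
        by (simp add: p_def[symmetric] Ku wl_def[symmetric] wr_def[symmetric, simplified] f_def[symmetric])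
    qed
    define w where "w = wm u 4 (2 * p + f)"
    define u' where "u' = crun V y (upd E t) u"
    have u': "u' = setw (4, p) w (setw (9, 0) f u)" unfolding u'_def w_def by (rule r)
    have f1: "f \<le> 1" unfolding f_def by simp
    have ins: "inside (wm u 4)" using J unfolding J_def by blast
    have win: "w = 0 \<or> member w p" proof -
      have "w = 0 \<or> member w (2 * p + f)" using ins unfolding inside_def w_def by blast
      thus ?thesis using child_member[OF _ i(2) f1, of t w] t unfolding p_def by auto
    qed
    have best: "K wl \<le> K w" "K wr \<le> K w" unfolding w_def f_def wl_def wr_def by auto
    have chok: "node_ok (wm u 4) K q" if q: "q = 2 * p \<or> q = 2 * p + 1" for q proof -
      have "q \<noteq> anc t' i" if t': "t < t'" "t' \<le> H" for t'
      proof
        assume qe: "q = anc t' i"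
        have "q div 2 = p" using q by auto
        hence "anc t' i div 2 = anc t i div 2" using qe unfolding p_def by (simp add: anc_Suc)
        hence "t' = t" using anc_level[OF iH iH, of t' t] t t' by simp
        thus False using t' by simp
      qed
      thus ?thesis using J unfolding J_def by blast
    qed
    have "J (Suc t) u'" unfolding J_def
    proof (intro conjI allI impI)
      show "rm u' = rm s" "om u' = om s" unfolding u' using J unfolding J_def by simp_all
      show "wm u' a = wm s a" if "a \<noteq> 4 \<and> a \<noteq> 9" for a unfolding u' using that J unfolding J_def by simp
      show "inside (wm u' 4)" using ins win unfolding u' inside_def by auto
      show "node_ok (wm u' 4) K q" if q: "\<forall>t'. Suc t < t' \<and> t' \<le> H --> q \<noteq> anc t' i" for q
      proof (cases "q = p")
        case True
        have "K j \<le> K w" if "member j p" for j proof -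
          have "member j (2 * p) \<or> member j (2 * p + 1)" using member_child[of t i j] t i(2) that unfolding p_def by simp
          thus ?thesis
          proof
            assume "member j (2 * p)"
            hence "K j \<le> K wl" using chok[of "2 * p"] unfolding node_ok_def wl_def by blast
            thus ?thesis using best by linarith
          next
            assume "member j (2 * p + 1)"
            hence "K j \<le> K wr" using chok[of "2 * p + 1"] unfolding node_ok_def wr_def by blast
            thus ?thesis using best by linarith
          qed
        qed
        thus ?thesis unfolding node_ok_def u' True by simp
      next
        case False
        have "q \<noteq> anc t' i" if "t < t'" "t' \<le> H" for t' using q False that unfolding p_def by (cases "t' = Suc t") auto
        hence "node_ok (wm u 4) K q" using J unfolding J_def by blast
        thus ?thesis using False unfolding node_ok_def u' by simp
      qed
    qed
    thus "J (Suc t) (crun V y (upd E t) u)" unfolding u'_def .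
  qed
  moreover have "s' = crun V y (concat (map (upd E) [0..<H])) s1" unfolding s' update_def s1_def by simp
  ultimately have J: "J H s'" by simp
  hence "node_ok (wm s' 4) K p" for p unfolding J_def by simp
  thus ?thesis using J unfolding J_def K_def by auto
qed

lemma root_best:
  assumes "\<forall>p. node_ok W K p" "i \<le> N"
  shows "K i \<le> K (W 1)" proof -
  have "member i 1" unfolding member_def using assms(2) anc_root[of i] NH by (intro conjI exI[of _ H]) auto
  thus ?thesis using assms(1) unfolding node_ok_def by blast
qed

end

section \<open>Medians and bucket measurements\<close>

definition is_median :: "nat => (nat => real) => real => bool" where
  "is_median d f v \<longleftrightarrow> 2 * card {e. e < d \<and> f e < v} \<le> d \<and> 2 * card {e. e < d \<and> v < f e} \<le> d"

lemma least_value_exists: "finite A ==> A \<noteq> {} ==> \<exists>a\<in>A. \<forall>b\<in>A. (f a :: real) \<le> f b"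
proof (induction rule: finite_ne_induct)
  case (insert x F)
  then obtain a where a: "a \<in> F" "\<forall>b\<in>F. f a \<le> f b" by blast
  show ?case
  proof (cases "f x \<le> f a")
    case True
    thus ?thesis using a by (intro bexI[of _ x]) auto
  next
    case False
    thus ?thesis using a by (intro bexI[of _ a]) auto
  qed
qed simp

text \<open>The greatest value that has at most half of the values below it; if more than half were
  above, the least of those would do as well.\<close>

lemma median_exists:
  assumes d: "d > 0"
  shows "\<exists>e<d. is_median d f (f e)" proof -
  let ?L = "\<lambda>u. {e'. e' < d \<and> f e' < f u}"
  define A where "A = {e. e < d \<and> 2 * card (?L e) \<le> d}"
  have fA: "finite A" unfolding A_def by simp
  have "A \<noteq> {}" proof -
    obtain e where e: "e < d" "\<forall>e'\<in>{..<d}. f e \<le> f e'" using least_value_exists[of "{..<d}" f] d by blast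
    hence "(?L e) = {}" by (auto simp: not_less)
    hence z: "card (?L e) = 0" by (simp only: card.empty)
    hence "e \<in> A" unfolding A_def mem_Collect_eq z using e by simp
    thus ?thesis by blast
  qed
  from least_value_exists[OF fA this, of "\<lambda>e. - f e"]
  obtain e where e: "e \<in> A" "\<And>e'. e' \<in> A ==> f e' \<le> f e" by auto
  have "2 * card {e'. e' < d \<and> f e < f e'} \<le> d"
  proof (rule ccontr)
    assume g: "\<not> 2 * card {e'. e' < d \<and> f e < f e'} \<le> d"
    define U where "U = {e'. e' < d \<and> f e < f e'}"
    have fU: "finite U" unfolding U_def by simp
    have "card U \<noteq> 0" using g unfolding U_def by linarith
    hence "U \<noteq> {}" by auto
    from least_value_exists[OF fU this, of f] obtain u where u: "u \<in> U" "\<forall>b\<in>U. f u \<le> f b" by blast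
    have dj: "(?L u) \<inter> U = {}" using u(2) by (auto simp: disjoint_iff not_less)
    have sub: "(?L u) \<union> U \<subseteq> {..<d}" unfolding U_def by auto
    have "card ((?L u) \<union> U) = card (?L u) + card U" by (rule card_Un_disjoint[OF _ fU dj]) simp
    moreover have "card ((?L u) \<union> U) \<le> card {..<d}" by (rule card_mono[OF _ sub]) simp
    ultimately have "card (?L u) + card U \<le> d" by simp
    hence "2 * card (?L u) \<le> d" using g unfolding U_def by linarith
    hence "u \<in> A" using u(1) unfolding A_def U_def by blast
    hence "f u \<le> f e" by (rule e(2))
    thus False using u(1) unfolding U_def by simp
  qed
  thus ?thesis using e(1) unfolding A_def is_median_def by blast
qed

text \<open>At least half of the values are beyond the median as seen from \<open>z\<close>, or
  equal to it. They are at least as far from \<open>z\<close> as the median, so their own error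
  bounds apply to it.\<close>

lemma median_error:
  assumes m: "is_median d f v" and n: "\<And>e. e < d ==> \<bar>f e - z\<bar> \<le> n e"
  shows "real d / 2 \<le> card {e. e < d \<and> \<bar>v - z\<bar> \<le> n e}" proof -
  let ?G = "{e. e < d \<and> \<bar>v - z\<bar> \<le> n e}"
  define Bad where "Bad = (if z \<le> v then {e. e < d \<and> f e < v} else {e. e < d \<and> v < f e})"
  have b: "2 * card Bad \<le> d" using m unfolding Bad_def is_median_def by simp
  have "{..<d} - Bad \<subseteq> ?G"
  proof
    fix e assume e: "e \<in> {..<d} - Bad"
    hence "\<bar>v - z\<bar> \<le> \<bar>f e - z\<bar>" unfolding Bad_def by (auto split: if_splits)
    thus "e \<in> ?G" using e n[of e] by force
  qed
  hence "card ({..<d} - Bad) \<le> card ?G" by (intro card_mono) auto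
  moreover have "d - card Bad \<le> card ({..<d} - Bad)" using diff_card_le_card_Diff[of Bad "{..<d}"] unfolding Bad_def by auto
  ultimately have "d \<le> 2 * card ?G" using b by linarith
  hence "real d \<le> real (2 * card ?G)" unfolding of_nat_le_iff .
  thus ?thesis by simp
qed

fun wsum :: "wexp list => wexp" where
  "wsum [] = Cst 0" | "wsum (e # es) = Ap (+) e (wsum es)"

lemma wev_wsum: "wev V w (wsum es) = sum_list (map (wev V w) es) mod V" by (induction es) (auto simp: mod_add_right_eq)

lemma sum_list_indicator: "sum_list (map (\<lambda>e. if P e then 1 else 0 :: nat) [0..<d]) = card {e. e < d \<and> P e}"
proof -
  have "sum_list (map (\<lambda>e. if P e then 1 else 0 :: nat) [0..<d]) = (\<Sum>e\<in>{..<d}. if P e then 1 else 0)"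
    by (simp add: sum_list_sum_nth atLeast0LessThan)
  also have "\<dots> = (\<Sum>e\<in>{e. e < d \<and> P e}. 1)" by (rule sum.mono_neutral_cong_right) auto
  finally show ?thesis by simp
qed

context decoder
begin

subsection \<open>Measurements\<close>

definition mcell :: "nat => nat => nat => nat" where "mcell e b c = (e * B + b) * 2 + c"

lemma mcell_less: "e < d ==> b < B ==> c < 2 ==> mcell e b c < 2 * d * B"
proof -
  assume a: "e < d" "b < B" "c < 2"
  have "Suc e * B \<le> d * B" using a by (intro mult_le_mono1) simp
  hence "e * B + b + 1 \<le> d * B" using a by simp
  thus ?thesis unfolding mcell_def using a by simp
qed

lemma mcell_inj: "b < B ==> b' < B ==> c < 2 ==> c' < 2 ==> mcell e b c = mcell e' b' c' \<longleftrightarrow> e = e' \<and> b = b' \<and> c = c'"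
proof -
  assume a: "b < B" "b' < B" "c < 2" "c' < 2"
  have m: "mcell e b c mod 2 = c \<and> mcell e b c div 2 div B = e \<and> mcell e b c div 2 mod B = b"
    if "b < B" "c < 2" for e b c
  proof -
    have q: "(q * 2 + c) mod 2 = c" "(q * 2 + c) div 2 = q" for q using that by auto
    show ?thesis unfolding mcell_def q using that by simp
  qed
  show ?thesis
  proof
    assume eq: "mcell e b c = mcell e' b' c'"
    show "e = e' \<and> b = b' \<and> c = c'" using m[OF a(1,3), of e] m[OF a(2,4), of e'] unfolding eq by (elim conjE) (intro conjI; presburger)
  qed simp
qed

definition sel :: "nat => nat => nat => nat set" where
  "sel e b c = {l. l < N \<and> h e l = b \<and> (c = 0 \<or> bt e l)}"

text \<open>The measurements of the residual are maintained incrementally. Only genuine cells are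
  constrained, which leaves cell 2 * d * B free as a dummy.\<close>

definition resid :: "(nat => real) => sl_state => bool" where
  "resid x s \<longleftrightarrow> (\<forall>e<d. \<forall>b<B. \<forall>c<2. rm s 2 (mcell e b c) = (\<Sum>l\<in>sel e b c. x l - rm s 3 (Suc l)))"

text \<open>The cell affected by a change of item i - 1. For an item with bit 0 the second
  measurement is redirected to the dummy cell just behind the measurements, so the update needs no
  branch.\<close>

definition loc :: "nat => nat => nat => nat" where
  "loc c e i = (if c = 0 \<or> bt e (i - 1) then mcell e (h e (i - 1)) c else 2 * d * B)"

lemma loc_less: "e < d ==> c < 2 ==> loc c e i < V" using mcell_less[OF _ h_less, of e c e "i - 1"] V(1) unfolding loc_def by auto

lemma loc_mcell: "e' < d ==> b < B ==> c' < 2 ==> c < 2 ==>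
  mcell e' b c' = loc c e i \<longleftrightarrow> e' = e \<and> c' = c \<and> h e (i - 1) = b \<and> (c = 0 \<or> bt e (i - 1))"
  using mcell_less[of e' b c'] mcell_inj[OF _ h_less, of b c' c e' e e "i - 1"] unfolding loc_def by auto

definition cadd :: "wexp => nat => cmd list" where
  "cadd E p = [RS 2 (fn1 (loc (p mod 2) (p div 2)) E)
     (RO RSub (RL 2 (fn1 (loc (p mod 2) (p div 2)) E)) (RL 7 (Cst 0)))]"

definition commit :: "nat => wexp => cmd list" where
  "commit T E = RS 7 (Cst 0) (RO RSub (RL T E) (RL 3 E)) # RS 3 E (RL T E) # concat (map (cadd E) [0..<2 * d])"

lemma commit_effect:
  assumes E: "E = entry a c" "c < V" and i: "wm s a c = i"
    and T: "T \<noteq> 7" "T \<noteq> 3" "T \<noteq> 2" and s': "s' = crun V y (commit T E) s"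
  shows "wm s' = wm s \<and> om s' = om s \<and> (\<forall>a. a \<noteq> 2 \<and> a \<noteq> 3 \<and> a \<noteq> 7 --> rm s' a = rm s a) \<and>
     rm s' 3 = (rm s 3)(i := rm s T i) \<and>
     (\<forall>e<d. \<forall>b<B. \<forall>c<2. rm s' 2 (mcell e b c) =
        rm s 2 (mcell e b c) - (if h e (i - 1) = b \<and> (c = 0 \<or> bt e (i - 1)) then rm s T i - rm s 3 i else 0))"
proof -
  have V0: "V > 0" using V by simp
  define \<delta> where "\<delta> = rm s T i - rm s 3 i"
  have Ei: "wev V (wm u) E = i" if "wm u = wm s" for u using that E i by (simp add: wev_entry)
  define s1 where "s1 = setr (3, i) (rm s T i) (setr (7, 0) \<delta> s)"
  let ?s = "\<lambda>e b c. h e (i - 1) = b \<and> (c = 0 \<or> bt e (i - 1))"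
  define J where "J n u \<longleftrightarrow> wm u = wm s \<and> om u = om s \<and> (\<forall>a. a \<noteq> 2 \<and> a \<noteq> 3 \<and> a \<noteq> 7 --> rm u a = rm s a) \<and>
     rm u 3 = (rm s 3)(i := rm s T i) \<and> rm u 7 0 = \<delta> \<and>
     (\<forall>e<d. \<forall>b<B. \<forall>c<2. rm u 2 (mcell e b c) =
        rm s 2 (mcell e b c) - (if 2 * e + c < n \<and> (?s e b c) then \<delta> else 0))" for n and u :: sl_state
  have "J 0 s1" unfolding J_def s1_def by simp
  hence "J (2 * d) (crun V y (concat (map (cadd E) [0..<2 * d])) s1)"
  proof (rule crun_loop[where I = J])
    fix n u assume n: "n < 2 * d" and J: "J n u"
    define e0 where "e0 = n div 2"
    define c0 where "c0 = n mod 2"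
    have e0: "e0 < d" "c0 < 2" "n = 2 * e0 + c0" using n unfolding e0_def c0_def by auto
    define q where "q = loc c0 e0 i"
    have r: "crun V y (cadd E n) u = setr (2, q) (rm u 2 q - \<delta>) u" using J Ei[of u] loc_less[OF e0(1,2), of i] V0 unfolding J_def cadd_def
      by (simp add: q_def e0_def[symmetric] c0_def[symmetric])
    show "J (Suc n) (crun V y (cadd E n) u)" unfolding J_def r
    proof (intro conjI allI impI)
      fix e b c :: nat assume c: "e < d" "b < B" "c < 2"
      have lt: "2 * e + c < Suc n \<longleftrightarrow> 2 * e + c < n \<or> e = e0 \<and> c = c0"       proof -
        have "c = 0 \<or> c = 1" "c0 = 0 \<or> c0 = 1" using c(3) e0(2) by auto
        thus ?thesis unfolding e0(3) by (elim disjE) (simp, arith)+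
      qed
      have nn: "\<not> 2 * e0 + c0 < n" using e0 by simp
      have m: "mcell e b c = q \<longleftrightarrow> e = e0 \<and> c = c0 \<and> (?s e b c)"
        unfolding q_def using loc_mcell[OF c(1,2,3) e0(2)] by auto
      have Ju: "rm u 2 (mcell e b c) = rm s 2 (mcell e b c) -
          (if 2 * e + c < n \<and> (?s e b c) then \<delta> else 0)" using J c unfolding J_def by blast
      show "rm (setr (2, q) (rm u 2 q - \<delta>) u) 2 (mcell e b c) = rm s 2 (mcell e b c) -
          (if 2 * e + c < Suc n \<and> (?s e b c) then \<delta> else 0)"
      proof (cases "mcell e b c = q")
        case True
        hence 1: "e = e0" "c = c0" "(?s e b c)" using m by blast+
        hence "\<not> 2 * e + c < n" using nn by simp
        hence 2: "rm u 2 (mcell e b c) = rm s 2 (mcell e b c)" using Ju by simp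
        have 3: "2 * e + c < Suc n" unfolding lt using 1 by blast
        have "rm (setr (2, q) (rm u 2 q - \<delta>) u) 2 (mcell e b c) = rm u 2 (mcell e b c) - \<delta>" using True by simp
        thus ?thesis unfolding 2 using 1(3) 3 by simp
      next
        case False
        hence "\<not> (e = e0 \<and> c = c0 \<and> (?s e b c))" using m by blast
        hence "(2 * e + c < Suc n \<and> (?s e b c)) \<longleftrightarrow>
           (2 * e + c < n \<and> (?s e b c))" unfolding lt by blast
        moreover have "rm (setr (2, q) (rm u 2 q - \<delta>) u) 2 (mcell e b c) = rm u 2 (mcell e b c)" using False by simp
        ultimately show ?thesis unfolding Ju by simp
      qed
    qed (use J in \<open>auto simp: J_def\<close>)
  qed
  moreover have "s' = crun V y (concat (map (cadd E) [0..<2 * d])) s1"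
    unfolding s' commit_def s1_def \<delta>_def using Ei[of s] Ei[of "setr (7, 0) \<delta> s"] V0 T by (simp add: \<delta>_def)
  ultimately have J: "J (2 * d) s'" by simp
  have "2 * e + c < 2 * d" if "e < d" "c < 2" for e c using that by simp
  thus ?thesis using J unfolding J_def \<delta>_def by auto
qed

lemma commit_resid:
  assumes E: "E = entry a c" "c < V" and i: "wm s a c = i" "i \<le> N"
    and T: "T \<noteq> 7" "T \<noteq> 3" "T \<noteq> 2" and s': "s' = crun V y (commit T E) s"
    and r: "resid x s" and 0: "rm s T 0 = 0" "rm s 3 0 = 0"
  shows "resid x s'" unfolding resid_def
proof (intro allI impI)
  fix e b c' :: nat assume c: "e < d" "b < B" "c' < 2"
  note ef = commit_effect[OF E i(1) T s']
  define \<delta> where "\<delta> = rm s T i - rm s 3 i"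
  have m: "rm s' 2 (mcell e b c') = rm s 2 (mcell e b c') - (if h e (i - 1) = b \<and> (c' = 0 \<or> bt e (i - 1)) then \<delta> else 0)"
    using ef c unfolding \<delta>_def by blast
  have X: "rm s' 3 (Suc l) = rm s 3 (Suc l) + (if i = Suc l then \<delta> else 0)" for l using ef unfolding \<delta>_def by simp
  have fin: "finite (sel e b c')" unfolding sel_def by simp
  have "(\<Sum>l\<in>sel e b c'. x l - rm s' 3 (Suc l)) = (\<Sum>l\<in>sel e b c'. x l - rm s 3 (Suc l)) - (\<Sum>l\<in>sel e b c'. if i = Suc l then \<delta> else 0)"
    unfolding X sum_subtractf[symmetric] by (intro sum.cong) auto
  also have "(\<Sum>l\<in>sel e b c'. if i = Suc l then \<delta> else 0) = (if h e (i - 1) = b \<and> (c' = 0 \<or> bt e (i - 1)) then \<delta> else 0)"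
  proof (cases i)
    case 0
    \<comment> \<open>Index 0 is treated as if it were an item, but its value is always 0, so
      nothing is subtracted.\<close>
    hence z: "\<delta> = 0" unfolding \<delta>_def using assms by simp
    show ?thesis unfolding z by simp
  next
    case (Suc i0)
    hence "(\<Sum>l\<in>sel e b c'. if i = Suc l then \<delta> else 0) = (\<Sum>l\<in>sel e b c'. if l = i0 then \<delta> else 0)"
      by (intro sum.cong) auto
    also have "\<dots> = (if i0 \<in> sel e b c' then \<delta> else 0)" using fin by simp
    finally show ?thesis using Suc i unfolding sel_def by simp
  qed
  finally show "rm s' 2 (mcell e b c') = (\<Sum>l\<in>sel e b c'. x l - rm s' 3 (Suc l))" unfolding m using r c unfolding resid_def by simp
qed

definition flag :: "nat => wexp" where
  "flag e = Ap (\<lambda>a b. if 2 * a \<le> d \<and> 2 * b \<le> d then 1 else 0)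
     (wsum (map (\<lambda>e'. Ld 8 (Cst (e' * d + e))) [0..<d])) (wsum (map (\<lambda>e'. Ld 8 (Cst (e * d + e'))) [0..<d]))"

text \<open>A median is selected without branching: all pairs of values are compared, and value
  \<open>e\<close> is written to position \<open>flag e\<close> of a temporary, so position 1
  receives a median. The estimate at index 0 is reset, as it belongs to no item. Squares are the
  keys because they order the estimates by absolute value.\<close>

definition est :: "wexp => cmd list" where
  "est E = concat (map (\<lambda>e. [RS 8 (Cst e) (RL 2 (fn1 (loc 0 e) E))]) [0..<d])
  @ concat (map (\<lambda>q. [BS 8 (Cst q) (RL 8 (Cst (q div d))) (RL 8 (Cst (q mod d)))]) [0..<d * d])
  @ concat (map (\<lambda>e. [RS 9 (flag e) (RL 8 (Cst e))]) [0..<d])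
  @ [RS 5 E (RO RAdd (RL 3 E) (RL 9 (Cst 1))), RS 5 (Cst 0) (RL 10 (Cst 0)), RS 4 E (RO RMul (RL 5 E) (RL 5 E))]
  @ update E"

definition tree :: "sl_state => bool" where
  "tree s \<longleftrightarrow> inside (wm s 4) \<and> (\<forall>p. node_ok (wm s 4) (rm s 4) p)"

definition estimate :: "sl_state => nat => real => bool" where
  "estimate s i v \<longleftrightarrow> is_median d (\<lambda>e. rm s 2 (mcell e (h e (i - 1)) 0)) v"

lemma dV: "d < V"
proof -
  have "d * 1 \<le> d * d" using d by (intro mult_le_mono2) simp
  hence "d \<le> d * d" by (simp only: mult_1_right)
  thus ?thesis using V(5) by (rule le_less_trans)
qed

lemma est_effect:
  assumes E: "E = entry a c" "a \<in> {2, 3, 7}" "c < V" and i: "wm s a c = i" "i \<le> N"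
    and T: "tree s" and 0: "rm s 10 0 = 0" "rm s 4 0 = 0" and s': "s' = crun V y (est E) s"
  shows "\<exists>v. estimate s i v \<and> rm s' 5 = (rm s 5)(i := rm s 3 i + v, 0 := 0) \<and> rm s' 4 = (rm s 4)(i := (rm s' 5 i)\<^sup>2) \<and>
     (\<forall>a. a \<notin> {4, 5, 8, 9} --> rm s' a = rm s a) \<and> (\<forall>a. a \<notin> {4, 8, 9} --> wm s' a = wm s a) \<and> om s' = om s \<and> tree s'"
proof -
  have V1: "0 < V" "1 < V" using V d dV by simp_all
  define f where "f e = rm s 2 (mcell e (h e (i - 1)) 0)" for e
  have l0: "loc 0 e i = mcell e (h e (i - 1)) 0" for e unfolding loc_def by simp
  have Ei: "wev V (wm u) E = i" if "wm u a = wm s a" for u using that E i by (simp add: wev_entry)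
  define s1 where "s1 = crun V y (concat (map (\<lambda>e. [RS 8 (Cst e) (RL 2 (fn1 (loc 0 e) E))]) [0..<d])) s"
  define J1 where "J1 n u \<longleftrightarrow> wm u = wm s \<and> om u = om s \<and> (\<forall>a. a \<noteq> 8 --> rm u a = rm s a) \<and> (\<forall>e<n. rm u 8 e = f e)" for n and u :: sl_state
  have J1: "J1 d s1" unfolding s1_def
  proof (rule crun_loop[where I = J1])
    show "J1 0 s" unfolding J1_def by simp
    fix n u assume n: "n < d" and J: "J1 n u"
    have "crun V y [RS 8 (Cst n) (RL 2 (fn1 (loc 0 n) E))] u = setr (8, n) (f n) u"
      using n J Ei[of u] loc_less[of n 0 i] l0[of n] dV unfolding J1_def f_def by simp
    thus "J1 (Suc n) (crun V y [RS 8 (Cst n) (RL 2 (fn1 (loc 0 n) E))] u)" using J unfolding J1_def by (simp add: less_Suc_eq)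
  qed
  define s2 where "s2 = crun V y (concat (map (\<lambda>q. [BS 8 (Cst q) (RL 8 (Cst (q div d))) (RL 8 (Cst (q mod d)))]) [0..<d * d])) s1"
  define J2 where "J2 n u \<longleftrightarrow> rm u = rm s1 \<and> om u = om s \<and> (\<forall>a. a \<noteq> 8 --> wm u a = wm s a) \<and>
      (\<forall>q<n. wm u 8 q = (if f (q div d) < f (q mod d) then 1 else 0))" for n and u :: sl_state
  have J2: "J2 (d * d) s2" unfolding s2_def
  proof (rule crun_loop[where I = J2])
    show "J2 0 s1" using J1 unfolding J1_def J2_def by simp
    fix n u assume n: "n < d * d" and J: "J2 n u"
    have nd: "n div d < d" "n mod d < d" using n d by (auto simp: less_mult_imp_div_less)
    have nm: "n mod d mod V = n mod d" using less_trans[OF nd(2) dV] by simp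
    have "crun V y [BS 8 (Cst n) (RL 8 (Cst (n div d))) (RL 8 (Cst (n mod d)))] u = setw (8, n) (if f (n div d) < f (n mod d) then 1 else 0) u"
      using n J nd(1) nm d dV V(5) J1 unfolding J1_def J2_def by simp
    thus "J2 (Suc n) (crun V y [BS 8 (Cst n) (RL 8 (Cst (n div d))) (RL 8 (Cst (n mod d)))] u)" using J unfolding J2_def by (simp add: less_Suc_eq)
  qed
  have fl: "wev V (wm u) (flag e) = (if is_median d f (f e) then 1 else 0)" if u: "wm u = wm s2" and e: "e < d" for u e proof -
    have ix: "e' * d + e'' < d * d" if "e' < d" "e'' < d" for e' e'' proof -
      have "Suc e' * d \<le> d * d" using that by (intro mult_le_mono1) simp
      thus ?thesis using that by simp
    qed
    have w8: "wev V (wm u) (Ld 8 (Cst (e' * d + e''))) = (if f e' < f e'' then 1 else 0)" if "e' < d" "e'' < d" for e' e'' proof -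
      have "(e' * d + e'') mod V = e' * d + e''" using ix[OF that] V(5) by simp
      moreover have "(e' * d + e'') div d = e'" "(e' * d + e'') mod d = e''" using that by auto
      ultimately show ?thesis using J2 ix[OF that] u unfolding J2_def by simp
    qed
    have cd: "card {e'. e' < d \<and> P e'} mod V = card {e'. e' < d \<and> P e'}" for P proof -
      have "card {e'. e' < d \<and> P e'} \<le> card {..<d}" by (intro card_mono) auto
      thus ?thesis using dV by simp
    qed
    have "wev V (wm u) (wsum (map (\<lambda>e'. Ld 8 (Cst (e' * d + e))) [0..<d])) =
        sum_list (map (\<lambda>e'. wev V (wm u) (Ld 8 (Cst (e' * d + e)))) [0..<d]) mod V" unfolding wev_wsum by (simp add: comp_def)
    also have "map (\<lambda>e'. wev V (wm u) (Ld 8 (Cst (e' * d + e)))) [0..<d] = map (\<lambda>e'. if f e' < f e then 1 else 0) [0..<d]"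
      using w8 e by (intro map_cong) auto
    finally have 1: "wev V (wm u) (wsum (map (\<lambda>e'. Ld 8 (Cst (e' * d + e))) [0..<d])) = card {e'. e' < d \<and> f e' < f e}"
      unfolding sum_list_indicator cd .
    have "wev V (wm u) (wsum (map (\<lambda>e'. Ld 8 (Cst (e * d + e'))) [0..<d])) =
        sum_list (map (\<lambda>e'. wev V (wm u) (Ld 8 (Cst (e * d + e')))) [0..<d]) mod V" unfolding wev_wsum by (simp add: comp_def)
    also have "map (\<lambda>e'. wev V (wm u) (Ld 8 (Cst (e * d + e')))) [0..<d] = map (\<lambda>e'. if f e < f e' then 1 else 0) [0..<d]"
      using w8 e by (intro map_cong) auto
    finally have 2: "wev V (wm u) (wsum (map (\<lambda>e'. Ld 8 (Cst (e * d + e'))) [0..<d])) = card {e'. e' < d \<and> f e < f e'}"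
      unfolding sum_list_indicator cd .
    show ?thesis unfolding flag_def wev.simps 1 2 is_median_def using V1 by simp
  qed
  define s3 where "s3 = crun V y (concat (map (\<lambda>e. [RS 9 (flag e) (RL 8 (Cst e))]) [0..<d])) s2"
  \<comment> \<open>Values that are not medians go to position 0; position 1 holds a median as soon
    as one has been met.\<close>
  define J3 where "J3 n u \<longleftrightarrow> wm u = wm s2 \<and> om u = om s \<and> (\<forall>a. a \<noteq> 9 --> rm u a = rm s2 a) \<and>
      ((\<exists>e<n. is_median d f (f e)) --> is_median d f (rm u 9 1))" for n and u :: sl_state
  have J3: "J3 d s3" unfolding s3_def
  proof (rule crun_loop[where I = J3])
    show "J3 0 s2" using J2 unfolding J2_def J3_def by simp
    fix n u assume n: "n < d" and J: "J3 n u"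
    have "crun V y [RS 9 (flag n) (RL 8 (Cst n))] u = setr (9, if is_median d f (f n) then 1 else 0) (f n) u"
      using n J J2 dV fl[OF _ n, of u] J1 unfolding J1_def J2_def J3_def by simp
    thus "J3 (Suc n) (crun V y [RS 9 (flag n) (RL 8 (Cst n))] u)" using J unfolding J3_def by (auto simp: less_Suc_eq)
  qed
  define v where "v = rm s3 9 (Suc 0)"
  have v: "is_median d f v" using J3 median_exists[OF d, of f] unfolding J3_def v_def One_nat_def by blast
  define w where "w = (if i = 0 then 0 else rm s 3 i + v)"
  have w3: "wm s3 a = wm s a" if "a \<noteq> 8" for a using that J2 J3 unfolding J2_def J3_def by simp
  have r3: "rm s3 a = rm s a" if "a \<noteq> 8" "a \<noteq> 9" for a using that J1 J2 J3 unfolding J1_def J2_def J3_def by simp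
  have Ei3: "wev V (wm u) E = i" if "wm u = wm s3" for u using Ei[of u] that w3 E(2) by auto
  define s4 where "s4 = crun V y [RS 5 E (RO RAdd (RL 3 E) (RL 9 (Cst 1))), RS 5 (Cst 0) (RL 10 (Cst 0)), RS 4 E (RO RMul (RL 5 E) (RL 5 E))] s3"
  have s4: "s4 = setr (4, i) (w * w) (setr (5, 0) 0 (setr (5, i) (rm s 3 i + v) s3))"
    unfolding s4_def using Ei3[of s3] Ei3[of "setr (5, i) (rm s 3 i + v) s3"] Ei3[of "setr (5, 0) 0 (setr (5, i) (rm s 3 i + v) s3)"] r3 V1 0
      v_def unfolding w_def by simp
  have r4: "rm s4 5 = (rm s 5)(i := rm s 3 i + v, 0 := 0)" "rm s4 4 = (rm s 4)(i := w * w)" "rm s4 5 i = w"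
    "\<And>a. a \<notin> {4, 5, 8, 9} ==> rm s4 a = rm s a" "\<And>a. a \<noteq> 8 ==> wm s4 a = wm s a" "om s4 = om s"
    using r3 w3 J3 unfolding s4 w_def J3_def by auto
  have a4: "wm s4 a c = i" using r4(5)[of a] E(2) i(1) by auto
  have in4: "inside (wm s4 4)" using T r4(5)[of 4] unfolding tree_def by simp
  have nd4: "node_ok (wm s4 4) (rm s4 4) p" if p: "\<And>t. t \<le> H ==> p \<noteq> anc t i" for p proof -
    have o: "node_ok (wm s 4) (rm s 4) p" using T unfolding tree_def by blast
    have n: "\<not> member i p" using p unfolding member_def by blast
    have W: "wm s4 4 = wm s 4" using r4(5)[of 4] by simp
    show ?thesis unfolding node_ok_def
    proof (intro allI impI)
      fix j assume j: "member j p"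
      hence ji: "j \<noteq> i" using n by blast
      have K: "rm s 4 j \<le> rm s 4 (wm s 4 p)" using o j unfolding node_ok_def by blast
      show "rm s4 4 j \<le> rm s4 4 (wm s4 4 p)"
      proof (cases "wm s 4 p = i")
        case True
        \<comment> \<open>Off the path of \<open>i\<close> the winner can be \<open>i\<close> only
          as the placeholder 0, whose key remains 0.\<close>
        hence "i = 0" using T n unfolding tree_def inside_def by metis
        hence "w = 0" unfolding w_def by simp
        thus ?thesis using K True ji r4(2) W \<open>i = 0\<close> \<open>w = 0\<close> 0(2) by simp
      next
        case False
        thus ?thesis using K ji r4(2) W by simp
      qed
    qed
  qed
  have s'4: "s' = crun V y (update E) s4" unfolding s' est_def s1_def s2_def s3_def s4_def by simp
  note up = update_effect[OF E a4 i(2) in4 nd4 s'4]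
  have "rm s' = rm s4" using up by blast
  thus ?thesis using up r4 v unfolding estimate_def f_def tree_def by (intro exI[of _ v]) (auto simp: power2_eq_square)
qed

end

section \<open>The commands of a round and their effects\<close>

context decoder
begin

definition noise :: "(nat => real) => nat => nat => real" where
  "noise z e i = (\<Sum>l\<in>{l. l < N \<and> l \<noteq> i \<and> h e l = h e i}. \<bar>z l\<bar>)"

text \<open>The item occurs in exactly one of the two parts of its bucket, that of bit 0 or that of
  bit 1. All other items together weigh less than the item itself, so the part containing it is the
  larger one in absolute value.\<close>

lemma sel_noise:
  assumes i: "i < N"
  shows "\<bar>(\<Sum>l\<in>sel e (h e i) 0. z l) - z i\<bar> \<le> noise z e i"
    and "noise z e i < \<bar>z i\<bar> ==>
       \<bar>(\<Sum>l\<in>sel e (h e i) 0. z l) - (\<Sum>l\<in>sel e (h e i) 1. z l)\<bar> < \<bar>\<Sum>l\<in>sel e (h e i) 1. z l\<bar> \<longleftrightarrow> bt e i"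
proof -
  let ?s = "\<lambda>c. \<Sum>l\<in>sel e (h e i) c. z l"
  define O0 where "O0 = {l. l < N \<and> l \<noteq> i \<and> h e l = h e i \<and> \<not> bt e l}"
  define O1 where "O1 = {l. l < N \<and> l \<noteq> i \<and> h e l = h e i \<and> bt e l}"
  have fin: "finite O0" "finite O1" unfolding O0_def O1_def by simp_all
  have i0: "i \<notin> O0" "i \<notin> O1" "O0 \<inter> O1 = {}" unfolding O0_def O1_def by auto
  have s0: "sel e (h e i) 0 = insert i (O0 \<union> O1)" unfolding sel_def O0_def O1_def using i by auto
  have s1: "sel e (h e i) 1 = (if bt e i then insert i O1 else O1)" unfolding sel_def O0_def O1_def using i by auto
  have n: "noise z e i = (\<Sum>l\<in>O0. \<bar>z l\<bar>) + (\<Sum>l\<in>O1. \<bar>z l\<bar>)" proof -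
    have "{l. l < N \<and> l \<noteq> i \<and> h e l = h e i} = O0 \<union> O1" unfolding O0_def O1_def by auto
    thus ?thesis unfolding noise_def using fin i0(3) by (simp add: sum.union_disjoint)
  qed
  have a: "\<bar>\<Sum>l\<in>O0. z l\<bar> \<le> (\<Sum>l\<in>O0. \<bar>z l\<bar>)" "\<bar>\<Sum>l\<in>O1. z l\<bar> \<le> (\<Sum>l\<in>O1. \<bar>z l\<bar>)" by (rule sum_abs)+
  have S0: "?s 0 = z i + ((\<Sum>l\<in>O0. z l) + (\<Sum>l\<in>O1. z l))"
    unfolding s0 using fin i0 by (simp add: sum.union_disjoint)
  have S1: "?s 1 = (if bt e i then z i else 0) + (\<Sum>l\<in>O1. z l)" unfolding s1 using fin i0 by simp
  show "\<bar>?s 0 - z i\<bar> \<le> noise z e i" unfolding S0 n using a by linarith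
  show "\<bar>?s 0 - ?s 1\<bar> < \<bar>?s 1\<bar> \<longleftrightarrow> bt e i"
    if nz: "noise z e i < \<bar>z i\<bar>"
  proof -
    have num: "\<bar>(t + (p + q)) - (t + q)\<bar> < \<bar>t + q\<bar>" "\<not> \<bar>(t + (p + q)) - (0 + q)\<bar> < \<bar>0 + q\<bar>"
      if "\<bar>p\<bar> \<le> a" "\<bar>q\<bar> \<le> b" "a + b < \<bar>t\<bar>" for p q a b t :: real using that by linarith+
    show ?thesis unfolding S0 S1 using num[OF a nz[unfolded n]] by (cases "bt e i") (simp_all only: if_True if_False simp_thms)
  qed
qed

subsection \<open>One round\<close>

text \<open>The entries to be estimated in a round: first the candidates, then the \<open>k\<close>
  items of the current support, which have to compete again.\<close>

definition ea :: "nat => nat" where "ea n = (if n < nc then 2 else 3)"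
definition ec :: "nat => nat" where "ec n = (if n < nc then n else n - nc)"
definition ent :: "nat => wexp" where "ent n = entry (ea n) (ec n)"
definition eid :: "sl_state => nat => nat" where "eid s n = wm s (ea n) (ec n)"

lemma ec_V: "n < nc + k ==> ec n < V" unfolding ec_def using V by auto
lemma ea_cases: "ea n = 2 \<or> ea n = 3" unfolding ea_def by auto

text \<open>Entries may repeat: a second estimate of an item is again a median of the same residual
  measurements.\<close>

lemma estimates_effect:
  assumes T: "tree s" and 0: "rm s 10 0 = 0" "\<And>i. rm s 4 i = 0" "\<And>i. rm s 5 i = 0"
    and r: "\<forall>n<nc + k. eid s n \<le> N"
    and s': "s' = crun V y (concat (map (\<lambda>n. est (ent n)) [0..<nc + k])) s"
  shows "(\<forall>a. a \<notin> {4, 8, 9} --> wm s' a = wm s a) \<and> (\<forall>a. a \<notin> {4, 5, 8, 9} --> rm s' a = rm s a) \<and> om s' = om s \<and>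
    tree s' \<and> rm s' 5 0 = 0 \<and> (\<forall>i. rm s' 4 i = (rm s' 5 i)\<^sup>2) \<and> (\<forall>i. i \<notin> eid s ` {..<nc + k} --> rm s' 5 i = 0) \<and>
    (\<forall>i\<in>eid s ` {..<nc + k}. i = 0 \<or> (\<exists>v. estimate s i v \<and> rm s' 5 i = rm s 3 i + v))"
proof -
  define J where "J n u \<longleftrightarrow> (\<forall>a. a \<notin> {4, 8, 9} --> wm u a = wm s a) \<and> (\<forall>a. a \<notin> {4, 5, 8, 9} --> rm u a = rm s a) \<and> om u = om s \<and>
    tree u \<and> rm u 5 0 = 0 \<and> (\<forall>i. rm u 4 i = (rm u 5 i)\<^sup>2) \<and> (\<forall>i. i \<notin> eid s ` {..<n} --> rm u 5 i = 0) \<and>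
    (\<forall>i\<in>eid s ` {..<n}. i = 0 \<or> (\<exists>v. estimate s i v \<and> rm u 5 i = rm s 3 i + v))" for n and u :: sl_state
  have "J 0 s" unfolding J_def using T 0 by simp
  hence "J (nc + k) (crun V y (concat (map (\<lambda>n. est (ent n)) [0..<nc + k])) s)"
  proof (rule crun_loop[where I = J])
    fix n u assume n: "n < nc + k" and J: "J n u"
    define i where "i = eid s n"
    define u' where "u' = crun V y (est (ent n)) u"
    have w: "wm u a = wm s a" if "a \<notin> {4, 8, 9}" for a using J that unfolding J_def by blast
    have r': "rm u a = rm s a" if "a \<notin> {4, 5, 8, 9}" for a using J that unfolding J_def by blast
    have ui: "wm u (ea n) (ec n) = i" unfolding i_def eid_def using w[of "ea n"] ea_cases[of n] by auto
    have iN: "i \<le> N" unfolding i_def using r n by blast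
    have ea: "ea n \<in> {2, 3, 7}" using ea_cases[of n] by auto
    have z: "rm u 10 0 = 0" "rm u 4 0 = 0" using r'[of 10] 0 J unfolding J_def by auto
    have Tu: "tree u" using J unfolding J_def by blast
    obtain v where vv: "estimate u i v \<and> rm u' 5 = (rm u 5)(i := rm u 3 i + v, 0 := 0) \<and> rm u' 4 = (rm u 4)(i := (rm u' 5 i)\<^sup>2) \<and>
     (\<forall>a. a \<notin> {4, 5, 8, 9} --> rm u' a = rm u a) \<and> (\<forall>a. a \<notin> {4, 8, 9} --> wm u' a = wm u a) \<and> om u' = om u \<and> tree u'"
      using est_effect[OF ent_def ea ec_V[OF n] ui iN Tu z u'_def] by (rule exE)
    note c1 = conjunct2[OF vv] note c2 = conjunct2[OF c1] note c3 = conjunct2[OF c2]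
    note c4 = conjunct2[OF c3] note c5 = conjunct2[OF c4]
    note v = conjunct1[OF vv] conjunct1[OF c1] conjunct1[OF c2] conjunct1[OF c3] conjunct1[OF c4] conjunct1[OF c5] conjunct2[OF c5]
    have es: "estimate s i v" using v(1) r'[of 2] unfolding estimate_def by simp
    have r3: "rm u 3 = rm s 3" using r'[of 3] by simp
    have J2: "\<forall>i. rm u 4 i = (rm u 5 i)\<^sup>2" "\<forall>i. i \<notin> eid s ` {..<n} --> rm u 5 i = 0"
      "\<forall>i\<in>eid s ` {..<n}. i = 0 \<or> (\<exists>v. estimate s i v \<and> rm u 5 i = rm s 3 i + v)" using J unfolding J_def by - (elim conjE, assumption)+
    have im: "eid s ` {..<Suc n} = insert i (eid s ` {..<n})" unfolding i_def lessThan_Suc by simp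
    have K: "rm u' 4 q = (rm u' 5 q)\<^sup>2" for q
    proof (cases "q = i")
      case False
      have "q = 0 ==> rm u 4 q = 0" using z(2) by simp
      thus ?thesis using False J2(1) unfolding v(3) v(2) by auto
    qed (simp add: v(3))
    show "J (Suc n) (crun V y (est (ent n)) u)" unfolding u'_def[symmetric] J_def
    proof (intro conjI allI impI ballI)
      show "wm u' a = wm s a" if "a \<notin> {4, 8, 9}" for a using v(5)[rule_format, OF that] w[OF that] by (rule trans)
      show "rm u' a = rm s a" if "a \<notin> {4, 5, 8, 9}" for a using v(4)[rule_format, OF that] r'[OF that] by (rule trans)
      show "om u' = om s" using v(6) J unfolding J_def by simp
      show "tree u'" by (rule v(7))
      show "rm u' 5 0 = 0" unfolding v(2) by simp
      show "rm u' 4 q = (rm u' 5 q)\<^sup>2" for q by (rule K)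
      show "rm u' 5 q = 0" if "q \<notin> eid s ` {..<Suc n}" for q using that J2(2) unfolding im v(2) by auto
      show "q = 0 \<or> (\<exists>v. estimate s q v \<and> rm u' 5 q = rm s 3 q + v)" if "q \<in> eid s ` {..<Suc n}" for q
      proof (cases "q = 0")
        case q0: False
        show ?thesis
        proof (cases "q = i")
          case True
          thus ?thesis using es q0 r3 unfolding v(2) by auto
        next
          case False
          have "q \<in> eid s ` {..<n}" using that False unfolding im insert_iff by (simp only: simp_thms)
          hence "q = 0 \<or> (\<exists>v. estimate s q v \<and> rm u 5 q = rm s 3 q + v)" by (rule J2(3)[rule_format])
          then obtain v' where v': "estimate s q v'" "rm u 5 q = rm s 3 q + v'" using q0 by (elim disjE exE conjE) (rule notE)
          have "rm u' 5 q = rm u 5 q" unfolding v(2) using False q0 by simp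
          thus ?thesis using v' by (intro disjI2 exI[of _ v'] conjI) simp_all
        qed
      qed simp
    qed
  qed
  hence "J (nc + k) s'" unfolding s' .
  thus ?thesis unfolding J_def .
qed

definition ext :: "nat => cmd list" where
  "ext j = [WS 7 (Cst j) (Ld 4 (Cst 1)), RS 4 (entry 7 j) (RL 10 (Cst 0))] @ update (entry 7 j)"

text \<open>Each extraction takes the greatest key and sets it to 0. Once the greatest key is 0, all
  are, which is the first alternative; until then the extracted items are distinct and differ from
  the placeholder 0.\<close>

lemma extract_effect:
  assumes T: "tree s" "keysok (rm s 4)" and 0: "rm s 10 0 = 0" "\<forall>i>N. rm s 4 i = 0"
    and s': "s' = crun V y (concat (map ext [0..<k])) s" and E: "E = wm s' 7 ` {..<k}"
  shows "(\<forall>a. a \<notin> {4, 7, 9} --> wm s' a = wm s a) \<and> (\<forall>a. a \<noteq> 4 --> rm s' a = rm s a) \<and> om s' = om s \<and> inside (wm s' 4) \<and>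
    (\<forall>j<k. wm s' 7 j \<le> N) \<and> (\<forall>i. rm s 4 i = 0 --> rm s' 4 i = 0) \<and>
    ((\<forall>i. i \<notin> E --> rm s 4 i = 0) \<or> card E = k \<and> 0 \<notin> E \<and> (\<forall>i w. i \<notin> E --> w \<in> E --> rm s 4 i \<le> rm s 4 w))"
proof -
  define K where "K = rm s 4"
  have K0: "K 0 = 0" "\<And>i. 0 \<le> K i" using T(2) unfolding K_def keysok_def by blast+
  define J where "J j u \<longleftrightarrow> (\<forall>a. a \<notin> {4, 7, 9} --> wm u a = wm s a) \<and> (\<forall>a. a \<noteq> 4 --> rm u a = rm s a) \<and> om u = om s \<and> tree u \<and>
    (\<forall>j'<j. wm u 7 j' \<le> N) \<and> rm u 4 = (\<lambda>i. if i \<in> wm u 7 ` {..<j} then 0 else K i) \<and>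
    ((\<forall>i. rm u 4 i = 0) \<or> card (wm u 7 ` {..<j}) = j \<and> 0 \<notin> wm u 7 ` {..<j} \<and>
      (\<forall>i w. i \<notin> wm u 7 ` {..<j} --> w \<in> wm u 7 ` {..<j} --> K i \<le> K w))" for j and u :: sl_state
  have "J 0 s" unfolding J_def K_def using T 0 by auto
  hence "J k (crun V y (concat (map ext [0..<k])) s)"
  proof (rule crun_loop[where I = J])
    fix j u assume j: "j < k" and J: "J j u"
    define r where "r = wm u 4 1"
    define u1 where "u1 = setr (4, r) 0 (setw (7, j) r u)"
    define A where "A = wm u 7 ` {..<j}"
    define u' where "u' = crun V y (ext j) u"
    have V0: "0 < V" "j < V" using V j by simp_all
    have V1: "1 < V" proof -
      have "2 * 2 ^ H \<ge> (2::nat)" by simp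
      thus ?thesis using V(2) by linarith
    qed
    have z10: "rm u 10 0 = 0" using J 0 unfolding J_def by simp
    have u'1: "u' = crun V y (update (entry 7 j)) u1" unfolding u'_def ext_def u1_def using V0 V1 z10 by (simp add: wev_entry r_def)
    have Tu: "inside (wm u 4)" "\<And>p. node_ok (wm u 4) (rm u 4) p" using J unfolding J_def tree_def by blast+
    have rN: "r \<le> N" using Tu(1) unfolding inside_def member_def r_def by (metis le0)
    have Ku: "rm u 4 = (\<lambda>i. if i \<in> A then 0 else K i)" using J unfolding J_def A_def by blast
    have Ku0: "rm u 4 0 = 0" "\<And>i. 0 \<le> rm u 4 i" unfolding Ku using K0 by auto
    have i1: "wm u1 7 j = r" "inside (wm u1 4)" unfolding u1_def using Tu by simp_all
    have nd: "node_ok (wm u1 4) (rm u1 4) p" if p: "\<And>t. t \<le> H ==> p \<noteq> anc t r" for p unfolding node_ok_def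
    proof (intro allI impI)
      fix q assume q: "member q p"
      have n: "\<not> member r p" using p unfolding member_def by blast
      hence qr: "q \<noteq> r" using q by blast
      have W: "wm u1 4 p = wm u 4 p" unfolding u1_def by simp
      have le: "rm u 4 q \<le> rm u 4 (wm u 4 p)" using Tu(2)[of p] q unfolding node_ok_def by blast
      have "rm u1 4 (wm u 4 p) = rm u 4 (wm u 4 p)"
      proof (cases "wm u 4 p = r")
        case True
        hence "r = 0" using Tu(1) n unfolding inside_def by metis
        thus ?thesis using True Ku0 unfolding u1_def by simp
      qed (simp add: u1_def)
      moreover have "rm u1 4 q = rm u 4 q" unfolding u1_def using qr by simp
      ultimately show "rm u1 4 q \<le> rm u1 4 (wm u1 4 p)" unfolding W using le by simp
    qed
    have in7: "(7::nat) \<in> {2, 3, 7}" by simp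
    note up = update_effect[OF refl in7 V0(2) i1(1) rN i1(2) nd u'1]
    have r': "rm u' = rm u1" "om u' = om u" using up unfolding u1_def by simp_all
    have w': "wm u' a = wm u1 a" if "a \<noteq> 4" "a \<noteq> 9" for a using up that by blast
    have T': "tree u'" unfolding tree_def using up by blast
    have w7: "wm u' 7 = (wm u 7)(j := r)" using w'[of 7] unfolding u1_def by simp
    have im: "wm u' 7 ` {..<Suc j} = insert r A" unfolding w7 A_def lessThan_Suc by auto
    have K': "rm u' 4 = (\<lambda>i. if i \<in> insert r A then 0 else K i)" unfolding r' u1_def using Ku by auto
    have top: "rm u 4 i \<le> rm u 4 r" for i
    proof (cases "i \<le> N")
      case True
      thus ?thesis using root_best[of "wm u 4" "rm u 4" i] Tu(2) unfolding r_def by blast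
    next
      case False
      hence "K i = 0" unfolding K_def using 0(2) by simp
      hence "rm u 4 i = 0" unfolding Ku by simp
      thus ?thesis using Ku0(2)[of r] by simp
    qed
    have dich: "(\<forall>i. rm u' 4 i = 0) \<or> card (insert r A) = Suc j \<and> 0 \<notin> insert r A \<and>
      (\<forall>i w. i \<notin> insert r A --> w \<in> insert r A --> K i \<le> K w)"
    proof (cases "rm u 4 r = 0")
      case True
      have "rm u 4 i = 0" for i using top[of i] True Ku0(2)[of i] by simp
      hence "rm u' 4 i = 0" for i unfolding K' using Ku by (metis insert_iff)
      thus ?thesis by blast
    next
      case False
      hence rA: "r \<notin> A" unfolding Ku by auto
      have r0: "r \<noteq> 0"
      proof
        assume "r = 0"
        thus False using False Ku0(1) by simp
      qed
      have "(\<forall>i. rm u 4 i = 0) \<or> card A = j \<and> 0 \<notin> A \<and> (\<forall>i w. i \<notin> A --> w \<in> A --> K i \<le> K w)"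
        using J unfolding J_def A_def[symmetric] by (elim conjE) assumption
      hence o': "card A = j \<and> 0 \<notin> A \<and> (\<forall>i w. i \<notin> A --> w \<in> A --> K i \<le> K w)"
      proof
        assume "\<forall>i. rm u 4 i = 0"
        thus ?thesis using False by simp
      qed
      have o: "card A = j" "0 \<notin> A" "\<And>i w. i \<notin> A ==> w \<in> A ==> K i \<le> K w" using o' by blast+
      have "finite A" unfolding A_def by simp
      hence "card (insert r A) = Suc j" using rA o by simp
      moreover have "K i \<le> K w" if "i \<notin> insert r A" "w \<in> insert r A" for i w
      proof (cases "w = r")
        case True
        have "K i = rm u 4 i" "K r = rm u 4 r" unfolding Ku using that rA by auto
        thus ?thesis using top[of i] True by simp
      next
        case False
        thus ?thesis using o(3) that by blast
      qed
      ultimately show ?thesis using r0 o(2) by blast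
    qed
    show "J (Suc j) (crun V y (ext j) u)" unfolding u'_def[symmetric] J_def im
    proof (intro conjI allI impI)
      show "wm u' a = wm s a" if "a \<notin> {4, 7, 9}" for a using w'[of a] that J unfolding J_def u1_def by simp
      show "rm u' a = rm s a" if "a \<noteq> 4" for a using that J unfolding J_def r' u1_def by simp
      show "om u' = om s" using r' J unfolding J_def by simp
      show "wm u' 7 j' \<le> N" if "j' < Suc j" for j' using that rN J unfolding w7 J_def by (auto simp: less_Suc_eq)
    qed (use T' K' dich in blast)+
  qed
  hence J: "J k s'" unfolding s' .
  have K4: "rm s' 4 = (\<lambda>i. if i \<in> E then 0 else K i)" using J unfolding J_def E by blast
  have "\<forall>i. i \<notin> E --> rm s 4 i = 0" if "\<forall>i. rm s' 4 i = 0"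
  proof (intro allI impI)
    fix i assume "i \<notin> E"
    hence "rm s' 4 i = K i" unfolding K4 by simp
    thus "rm s 4 i = 0" using that unfolding K_def by simp
  qed
  moreover have "\<forall>i. rm s 4 i = 0 --> rm s' 4 i = 0" unfolding K4 K_def by simp
  ultimately show ?thesis using J unfolding J_def E[symmetric] K_def tree_def by blast
qed

text \<open>Serves twice in a round: with the zeros of array 10 it removes the old approximation,
  with the estimates in array 5 it installs the new one.\<close>

lemma commits_effect:
  assumes a: "a \<in> {3, 7}" and T: "T \<in> {5, 10}" and r: "\<forall>j<k. wm s a j \<le> N" and x: "resid x s" and 0: "rm s T 0 = 0" "rm s 3 0 = 0"
    and s': "s' = crun V y (concat (map (\<lambda>j. commit T (entry a j)) [0..<k])) s"
  shows "wm s' = wm s \<and> om s' = om s \<and> (\<forall>a. a \<noteq> 2 \<and> a \<noteq> 3 \<and> a \<noteq> 7 --> rm s' a = rm s a) \<and> resid x s' \<and>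
     rm s' 3 = (\<lambda>i. if i \<in> wm s a ` {..<k} then rm s T i else rm s 3 i)"
proof -
  define J where "J j u \<longleftrightarrow> wm u = wm s \<and> om u = om s \<and> (\<forall>a. a \<noteq> 2 \<and> a \<noteq> 3 \<and> a \<noteq> 7 --> rm u a = rm s a) \<and> resid x u \<and>
     rm u 3 = (\<lambda>i. if i \<in> wm s a ` {..<j} then rm s T i else rm s 3 i)" for j and u :: sl_state
  have T': "T \<noteq> 7" "T \<noteq> 3" "T \<noteq> 2" using T by auto
  have "J 0 s" unfolding J_def using x by auto
  hence "J k (crun V y (concat (map (\<lambda>j. commit T (entry a j)) [0..<k])) s)"
  proof (rule crun_loop[where I = J])
    fix j u assume j: "j < k" and J: "J j u"
    have jV: "j < V" using V j by simp
    have w: "wm u a j = wm s a j" "wm s a j \<le> N" using J r j unfolding J_def by simp_all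
    have uT: "rm u T = rm s T" using J T' unfolding J_def by blast
    have z: "rm u T 0 = 0" "rm u 3 0 = 0" using J 0 unfolding uT unfolding J_def by auto
    have xr: "resid x u" using J unfolding J_def by blast
    define u' where "u' = crun V y (commit T (entry a j)) u"
    note ef = commit_effect[OF refl jV w(1) T' u'_def]
    have rs: "resid x u'" by (rule commit_resid[OF refl jV w T' u'_def xr z])
    have im: "wm s a ` {..<Suc j} = insert (wm s a j) (wm s a ` {..<j})" unfolding lessThan_Suc by simp
    have "rm u' 3 = (rm u 3)(wm s a j := rm s T (wm s a j))" using ef unfolding uT by blast
    hence "rm u' 3 = (\<lambda>i. if i \<in> wm s a ` {..<Suc j} then rm s T i else rm s 3 i)" using J unfolding J_def im by auto
    thus "J (Suc j) (crun V y (commit T (entry a j)) u)" unfolding u'_def[symmetric] J_def using ef rs J unfolding J_def by auto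
  qed
  thus ?thesis unfolding s'[symmetric] unfolding J_def by (elim conjE) (intro conjI; assumption)
qed

text \<open>The test of \<open>sel_noise\<close> for every bucket, with absolute values compared
  through their squares.\<close>

definition bits :: "cmd list" where
  "bits = concat (map (\<lambda>q. let y1 = RL 2 (Cst (q * 2 + 1)); y0 = RO RSub (RL 2 (Cst (q * 2))) y1
     in [BS 5 (Cst q) (RO RMul y0 y0) (RO RMul y1 y1)]) [0..<d * B])"

lemma bits_effect:
  assumes s': "s' = crun V y bits s"
  shows "rm s' = rm s \<and> om s' = om s \<and> (\<forall>a. a \<noteq> 5 --> wm s' a = wm s a) \<and>
    ((\<forall>q. wm s 5 q \<le> 1) --> (\<forall>q. wm s' 5 q \<le> 1)) \<and>
    (\<forall>q<d * B. wm s' 5 q = (if \<bar>rm s 2 (q * 2) - rm s 2 (q * 2 + 1)\<bar> < \<bar>rm s 2 (q * 2 + 1)\<bar> then 1 else 0))"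
proof -
  let ?b = "\<lambda>q. if \<bar>rm s 2 (q * 2) - rm s 2 (q * 2 + 1)\<bar> < \<bar>rm s 2 (q * 2 + 1)\<bar> then 1 else 0"
  define J where "J n u \<longleftrightarrow> rm u = rm s \<and> om u = om s \<and> (\<forall>a. a \<noteq> 5 --> wm u a = wm s a) \<and>
    ((\<forall>q. wm s 5 q \<le> 1) --> (\<forall>q. wm u 5 q \<le> 1)) \<and>
    (\<forall>q<n. wm u 5 q = ?b q)" for n and u :: sl_state
  have sq: "a * a < b * b \<longleftrightarrow> \<bar>a\<bar> < \<bar>b\<bar>" for a b :: real
    using abs_le_square_iff[of b a] by (simp add: power2_eq_square not_le[symmetric])
  have "J 0 s" unfolding J_def by simp
  hence "J (d * B) (crun V y bits s)" unfolding bits_def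
  proof (rule crun_loop[where I = J])
    fix n u assume n: "n < d * B" and J: "J n u"
    have v: "n mod V = n" "n * 2 mod V = n * 2" "(n * 2 + 1) mod V = n * 2 + 1" proof -
      have "n * 2 + 1 < V" using n V(1) by linarith
      thus "n mod V = n" "n * 2 mod V = n * 2" "(n * 2 + 1) mod V = n * 2 + 1" by simp_all
    qed
    define f :: nat where "f = ?b n"
    have f: "f \<le> 1" unfolding f_def by simp
    have e: "crun V y (let y1 = RL 2 (Cst (n * 2 + 1)); y0 = RO RSub (RL 2 (Cst (n * 2))) y1
     in [BS 5 (Cst n) (RO RMul y0 y0) (RO RMul y1 y1)]) u = setw (5, n) f u" unfolding Let_def f_def using v J by (simp add: sq J_def)
    have J5: "(\<forall>q. wm s 5 q \<le> 1) --> (\<forall>q. wm u 5 q \<le> 1)" using J unfolding J_def by (elim conjE) assumption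
    have "J (Suc n) (setw (5, n) f u)" unfolding J_def
    proof (intro conjI allI impI)
      fix q assume "\<forall>q. wm s 5 q \<le> 1"
      thus "wm (setw (5, n) f u) 5 q \<le> 1" using J5 f by simp
    next
      fix q assume "q < Suc n"
      thus "wm (setw (5, n) f u) 5 q = ?b q"
        using J unfolding J_def by (cases "q = n") (simp_all add: f_def)
    qed (use J in \<open>simp_all add: J_def\<close>)
    thus "J (Suc n) (crun V y (let y1 = RL 2 (Cst (n * 2 + 1)); y0 = RO RSub (RL 2 (Cst (n * 2))) y1
     in [BS 5 (Cst n) (RO RMul y0 y0) (RO RMul y1 y1)]) u)" unfolding e .
  qed
  thus ?thesis unfolding s'[symmetric] unfolding J_def by (elim conjE) (intro conjI; assumption)
qed

text \<open>Only the entries of this round can have become nonzero, so the arrays are cleared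
  without a pass over all items.\<close>

definition resets :: "cmd list" where
  "resets = concat (map (\<lambda>n. [RS 4 (ent n) (RL 10 (Cst 0)), RS 5 (ent n) (RL 10 (Cst 0))]) [0..<nc + k])"

lemma resets_effect:
  assumes s': "s' = crun V y resets s" and 0: "rm s 10 0 = 0"
  shows "wm s' = wm s \<and> om s' = om s \<and> (\<forall>a. a \<noteq> 4 \<and> a \<noteq> 5 --> rm s' a = rm s a) \<and>
    (\<forall>a\<in>{4, 5}. rm s' a = (\<lambda>i. if i \<in> eid s ` {..<nc + k} then 0 else rm s a i))"
proof -
  define J where "J n u \<longleftrightarrow> wm u = wm s \<and> om u = om s \<and> (\<forall>a. a \<noteq> 4 \<and> a \<noteq> 5 --> rm u a = rm s a) \<and>
    (\<forall>a\<in>{4, 5}. rm u a = (\<lambda>i. if i \<in> eid s ` {..<n} then 0 else rm s a i))" for n and u :: sl_state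
  have "J 0 s" unfolding J_def by simp
  hence "J (nc + k) (crun V y resets s)" unfolding resets_def
  proof (rule crun_loop[where I = J])
    fix n u assume n: "n < nc + k" and J: "J n u"
    have "crun V y [RS 4 (ent n) (RL 10 (Cst 0)), RS 5 (ent n) (RL 10 (Cst 0))] u = setr (5, eid s n) 0 (setr (4, eid s n) 0 u)"
      using n J ec_V[OF n] 0 V(1) unfolding J_def ent_def eid_def by (simp add: wev_entry)
    thus "J (Suc n) (crun V y [RS 4 (ent n) (RL 10 (Cst 0)), RS 5 (ent n) (RL 10 (Cst 0))] u)" using J unfolding J_def by (auto simp: lessThan_Suc)
  qed
  thus ?thesis unfolding s'[symmetric] unfolding J_def by (elim conjE) (intro conjI; assumption)
qed

definition copies :: "cmd list" where
  "copies = concat (map (\<lambda>j. [WS 3 (Cst j) (entry 7 j)]) [0..<k])"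

lemma copies_effect:
  assumes s': "s' = crun V y copies s"
  shows "rm s' = rm s \<and> om s' = om s \<and> (\<forall>a. a \<noteq> 3 --> wm s' a = wm s a) \<and> (\<forall>j<k. wm s' 3 j = wm s 7 j)"
proof -
  define J where "J n u \<longleftrightarrow> rm u = rm s \<and> om u = om s \<and> (\<forall>a. a \<noteq> 3 --> wm u a = wm s a) \<and> (\<forall>j<n. wm u 3 j = wm s 7 j)" for n and u :: sl_state
  have "J 0 s" unfolding J_def by simp
  hence "J k (crun V y copies s)" unfolding copies_def
  proof (rule crun_loop[where I = J])
    fix n u assume n: "n < k" and J: "J n u"
    have "crun V y [WS 3 (Cst n) (entry 7 n)] u = setw (3, n) (wm s 7 n) u" using n V J unfolding J_def by (simp add: wev_entry)
    thus "J (Suc n) (crun V y [WS 3 (Cst n) (entry 7 n)] u)" using J unfolding J_def by (auto simp: less_Suc_eq)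
  qed
  thus ?thesis unfolding s'[symmetric] unfolding J_def by (elim conjE) (intro conjI; assumption)
qed

end

section \<open>A complete round and the correctness of the program\<close>

context decoder
begin

text \<open>Invariant between rounds. The tournament tree keeps winners of the previous round; since
  all keys are 0, each of them is a valid winner.\<close>

definition base :: "(nat => real) => sl_state => bool" where
  "base x s \<longleftrightarrow> resid x s \<and> (\<forall>i. rm s 3 i \<noteq> 0 --> i \<in> wm s 3 ` {..<k} \<and> 0 < i \<and> i \<le> N) \<and> (\<forall>j<k. wm s 3 j \<le> N) \<and>
    (\<forall>i. rm s 4 i = 0) \<and> (\<forall>i. rm s 5 i = 0) \<and> (\<forall>i. rm s 10 i = 0) \<and> inside (wm s 4) \<and> (\<forall>q. wm s 5 q \<le> 1)"

definition ests :: "cmd list" where "ests = concat (map (\<lambda>n. est (ent n)) [0..<nc + k])"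
definition exts :: "cmd list" where "exts = concat (map ext [0..<k])"
definition commits :: "nat => nat => cmd list" where "commits T a = concat (map (\<lambda>j. commit T (entry a j)) [0..<k])"

definition round :: "cmd list" where
  "round = bits @ prog @ ests @ exts @ commits 10 3 @ commits 5 7 @ resets @ copies"

lemma resid_cong: "resid x s ==> rm t 2 = rm s 2 ==> rm t 3 = rm s 3 ==> resid x t" unfolding resid_def by simp

text \<open>Provides the step required by \<open>iteration_converges\<close>. An estimated item has
  a median as its estimate, whose error is at most the noise in half of the buckets. An item that
  was not found has at least \<theta> * d wrong bits, and each wrong bit means that the noise in
  that bucket is at least the item; there the estimate 0 is accurate enough.\<close>

lemma round_effect:
  assumes b: "base x s" and s8: "s8 = crun V y round s"
  shows "base x s8 \<and> om s8 = om s \<and> (\<exists>u S'. largest_k N k u S' \<and> (\<forall>i<N. rm s8 3 (Suc i) = (if i \<in> S' then u i else 0)) \<and>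
    (\<forall>i<N. noise_dominated N d h (min \<theta> (1/2)) (\<lambda>l. x l - rm s 3 (Suc l)) i \<bar>u i - x i\<bar>))"
proof -
  have b1: "resid x s" and b2: "\<And>i. rm s 3 i \<noteq> 0 ==> i \<in> wm s 3 ` {..<k}" and b3: "\<And>j. j < k ==> wm s 3 j \<le> N"
    and b4: "\<And>i. rm s 4 i = 0" and b5: "\<And>i. rm s 5 i = 0" and b10: "\<And>i. rm s 10 i = 0" and bi: "inside (wm s 4)"
    and b1': "\<forall>q. wm s 5 q \<le> 1" and b20: "rm s 3 0 = 0" using b unfolding base_def by blast+
  define s1 where "s1 = crun V y bits s"
  define s2 where "s2 = crun V y prog s1"
  define s3 where "s3 = crun V y ests s2"
  define s4 where "s4 = crun V y exts s3"
  define s5 where "s5 = crun V y (commits 10 3) s4"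
  define s6 where "s6 = crun V y (commits 5 7) s5"
  define s7 where "s7 = crun V y resets s6"
  have s8': "s8 = crun V y copies s7" unfolding s8 round_def s1_def s2_def s3_def s4_def s5_def s6_def s7_def by simp
  note e1 = bits_effect[OF s1_def]
  have r1: "rm s1 = rm s" and o1: "om s1 = om s" and w1: "\<And>a. a \<noteq> 5 ==> wm s1 a = wm s a" and bt1: "\<forall>q. wm s1 5 q \<le> 1"
    and bt1': "\<forall>q<d * B. wm s1 5 q = (if \<bar>rm s 2 (q * 2) - rm s 2 (q * 2 + 1)\<bar> < \<bar>rm s 2 (q * 2 + 1)\<bar> then 1 else 0)"
    using e1 b1' by blast+
  note e2 = prog_frame[of s1, folded s2_def]
  have r2: "rm s2 = rm s" and o2: "om s2 = om s" and w2: "\<And>a. a \<notin> {1, 2, 6} ==> wm s2 a = wm s1 a" using e2 r1 o1 by simp_all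
  have w23: "wm s2 3 = wm s 3" "wm s2 4 = wm s 4" using w2[of 3] w2[of 4] w1[of 3] w1[of 4] by simp_all
  have eidN: "eid s2 n \<le> N" if n: "n < nc + k" for n
  proof (cases "n < nc")
    case True
    thus ?thesis unfolding eid_def ea_def ec_def using prog_range[OF bt1 True] s2_def by simp
  next
    case False
    thus ?thesis unfolding eid_def ea_def ec_def using b3[of "n - nc"] n w23 by simp
  qed
  have t2: "tree s2" unfolding tree_def node_ok_def r2 w23 using bi b4 by simp
  define I where "I = eid s2 ` {..<nc + k}"
  have z2: "rm s2 10 0 = 0" "\<And>i. rm s2 4 i = 0" "\<And>i. rm s2 5 i = 0" unfolding r2 using b4 b5 b10 by simp_all
  have eidN': "\<forall>n<nc + k. eid s2 n \<le> N" using eidN by blast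
  note e3 = estimates_effect[OF t2 z2 eidN' s3_def[unfolded ests_def], folded I_def, unfolded r2 o2]
  note w3 = e3[THEN conjunct1, rule_format]
  note e3_1 = e3[THEN conjunct2]
  note r3 = e3_1[THEN conjunct1, rule_format]
  note e3_2 = e3_1[THEN conjunct2]
  note o3 = e3_2[THEN conjunct1, rule_format]
  note e3_3 = e3_2[THEN conjunct2]
  note t3 = e3_3[THEN conjunct1, rule_format]
  note e3_4 = e3_3[THEN conjunct2]
  note u0 = e3_4[THEN conjunct1, rule_format]
  note e3_5 = e3_4[THEN conjunct2]
  note K3 = e3_5[THEN conjunct1, rule_format]
  note e3_6 = e3_5[THEN conjunct2]
  note out = e3_6[THEN conjunct1, rule_format]
  note est3 = e3_6[THEN conjunct2, rule_format]
  define U where "U = rm s3 5"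
  have IN: "i \<le> N" if "i \<in> I" for i using that eidN unfolding I_def by blast
  have ks: "keysok (rm s3 4)" unfolding keysok_def K3 u0 by simp
  have bigK': "rm s3 4 i = 0" if "i > N" for i proof -
    have "i \<notin> I" using IN[of i] that by auto
    thus ?thesis unfolding K3 using out by simp
  qed
  define E where "E = wm s4 7 ` {..<k}"
  have z3: "rm s3 10 0 = 0" using r3[of 10] b10 by simp
  have bigK: "\<forall>i>N. rm s3 4 i = 0" using bigK' by blast
  note e4 = extract_effect[OF t3 ks z3 bigK s4_def[unfolded exts_def] E_def, unfolded o3]
  note w4 = e4[THEN conjunct1, rule_format]
  note e4_1 = e4[THEN conjunct2]
  note r4 = e4_1[THEN conjunct1, rule_format]
  note e4_2 = e4_1[THEN conjunct2]
  note o4 = e4_2[THEN conjunct1, rule_format]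
  note e4_3 = e4_2[THEN conjunct2]
  note i4 = e4_3[THEN conjunct1, rule_format]
  note e4_4 = e4_3[THEN conjunct2]
  note E4 = e4_4[THEN conjunct1, rule_format]
  note e4_5 = e4_4[THEN conjunct2]
  note k4 = e4_5[THEN conjunct1, rule_format]
  note dich = e4_5[THEN conjunct2]
  have w43: "wm s4 3 = wm s 3" "wm s4 2 = wm s2 2" using w4[of 3] w3[of 3] w23 w4[of 2] w3[of 2] by simp_all
  have r42: "rm s4 2 = rm s 2" "rm s4 3 = rm s 3" "rm s4 10 = rm s 10" "rm s4 5 = U"
    using r4[of 2] r3[of 2] r4[of 3] r3[of 3] r4[of 10] r3[of 10] r4[of 5] unfolding U_def by simp_all
  have x4: "resid x s4" using b1 r42(1,2) by (rule resid_cong)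
  have a1: "(3::nat) \<in> {3, 7}" "(10::nat) \<in> {5, 10}" "\<forall>j<k. wm s4 3 j \<le> N" "rm s4 10 0 = 0" "rm s4 3 0 = 0"
    unfolding w43 r42 using b3 b10 b20 by simp_all
  note e5 = commits_effect[OF a1(1-3) x4 a1(4,5) s5_def[unfolded commits_def]]
  note w5 = e5[THEN conjunct1, rule_format]
  note e5_1 = e5[THEN conjunct2]
  note o5 = e5_1[THEN conjunct1, unfolded o4]
  note e5_2 = e5_1[THEN conjunct2]
  note r5' = e5_2[THEN conjunct1, rule_format]
  note e5_3 = e5_2[THEN conjunct2]
  note x5 = e5_3[THEN conjunct1, rule_format]
  note X5 = e5_3[THEN conjunct2, rule_format]
  have r5: "\<And>a. a \<noteq> 2 ==> a \<noteq> 3 ==> a \<noteq> 7 ==> rm s5 a = rm s4 a" using r5' by blast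
  have X50: "rm s5 3 i = 0" for i unfolding X5 w43 r42 using b10[of i] b2[of i] by auto
  have r55: "rm s5 5 = U" using r5[of 5] r42 by simp
  have a2: "(7::nat) \<in> {3, 7}" "(5::nat) \<in> {5, 10}" "\<forall>j<k. wm s5 7 j \<le> N" "rm s5 5 0 = 0" "rm s5 3 0 = 0"
    unfolding w5 r55 X50 using E4 u0 unfolding U_def by simp_all
  note e6 = commits_effect[OF a2(1-3) x5 a2(4,5) s6_def[unfolded commits_def]]
  note w6' = e6[THEN conjunct1, rule_format]
  note e6_1 = e6[THEN conjunct2]
  note o6 = e6_1[THEN conjunct1, unfolded o5]
  note e6_2 = e6_1[THEN conjunct2]
  note r6' = e6_2[THEN conjunct1, rule_format]
  note e6_3 = e6_2[THEN conjunct2]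
  note x6 = e6_3[THEN conjunct1, rule_format]
  note X6 = e6_3[THEN conjunct2, rule_format]
  have w6: "wm s6 = wm s4" using w6' w5 by simp
  have r6: "\<And>a. a \<noteq> 2 ==> a \<noteq> 3 ==> a \<noteq> 7 ==> rm s6 a = rm s5 a" using r6' by blast
  have X6': "rm s6 3 i = (if i \<in> E then U i else 0)" for i unfolding X6 r55 X50 w5 E_def by simp
  have z6: "rm s6 10 = rm s 10" "rm s6 4 = rm s4 4" "rm s6 5 = U" using r6[of 10] r5[of 10] r42 r6[of 4] r5[of 4] r6[of 5] r55 by simp_all
  have eid6: "eid s6 = eid s2" unfolding eid_def w6 using w43 w23 ea_cases by (intro ext) metis
  have z610: "rm s6 10 0 = 0" unfolding z6 by (rule b10)
  note e7 = resets_effect[OF s7_def z610, unfolded w6 o6 eid6, folded I_def]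
  note w7 = e7[THEN conjunct1, rule_format]
  note e7_1 = e7[THEN conjunct2]
  note o7 = e7_1[THEN conjunct1, rule_format]
  note e7_2 = e7_1[THEN conjunct2]
  note r7' = e7_2[THEN conjunct1, rule_format]
  note r74 = e7_2[THEN conjunct2, rule_format]
  have r7: "\<And>a. a \<noteq> 4 ==> a \<noteq> 5 ==> rm s7 a = rm s6 a" using r7' by blast
  have z7: "rm s7 4 i = 0" "rm s7 5 i = 0" for i proof -
    have "i \<notin> I ==> rm s4 4 i = 0" using k4[of i] K3[of i] out[of i] by simp
    thus "rm s7 4 i = 0" using r74[of 4] z6 by simp
    show "rm s7 5 i = 0" using r74[of 5] z6 out[of i] unfolding U_def by simp
  qed
  note e8 = copies_effect[OF s8', unfolded o7 w7]
  note r8 = e8[THEN conjunct1, rule_format]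
  note e8_1 = e8[THEN conjunct2]
  note o8 = e8_1[THEN conjunct1, rule_format]
  note e8_2 = e8_1[THEN conjunct2]
  note w8 = e8_2[THEN conjunct1, rule_format]
  note S8 = e8_2[THEN conjunct2, rule_format]
  have im8: "wm s8 3 ` {..<k} = E" unfolding E_def using S8 by (intro image_cong) auto
  have X8: "rm s8 3 i = (if i \<in> E then U i else 0)" for i unfolding r8 using r7[of 3] X6' by simp
  have r82: "rm s8 2 = rm s6 2" "rm s8 3 = rm s6 3" unfolding r8 using r7[of 2] r7[of 3] by simp_all
  have EN: "i \<le> N" if "i \<in> E" for i using that E4 unfolding E_def by blast
  have base8: "base x s8" unfolding base_def
  proof (intro conjI allI impI)
    show "resid x s8" using x6 r82 by (rule resid_cong)
    show "i \<in> wm s8 3 ` {..<k}" if "rm s8 3 i \<noteq> 0" for i using that unfolding im8 X8 by (cases "i \<in> E") simp_all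
    show "0 < i" if nz: "rm s8 3 i \<noteq> 0" for i
    proof (rule ccontr)
      assume "\<not> 0 < i"
      hence "i = 0" by simp
      thus False using nz u0 unfolding X8 U_def by (simp split: if_splits)
    qed
    show "i \<le> N" if "rm s8 3 i \<noteq> 0" for i using that EN[of i] unfolding X8 by (cases "i \<in> E") simp_all
    show "wm s8 3 j \<le> N" if "j < k" for j using S8[OF that] E4[OF that] by simp
    show "rm s8 4 i = 0" "rm s8 5 i = 0" for i unfolding r8 by (rule z7)+
    show "rm s8 10 i = 0" for i unfolding r8 using r7[of 10] z6 b10 by simp
    show "inside (wm s8 4)" using w8[of 4] i4 by simp
    show "wm s8 5 q \<le> 1" for q proof -
      have "wm s8 5 = wm s1 5" using w8[of 5] w4[of 5] w3[of 5] w2[of 5] by simp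
      thus ?thesis using bt1 by simp
    qed
  qed
  define u where "u i = U (Suc i)" for i
  define S' where "S' = {i. Suc i \<in> E}"
  define z where "z l = x l - rm s 3 (Suc l)" for l
  let ?g = "\<lambda>i. {e. e < d \<and> \<bar>u i - x i\<bar> \<le> noise z e i}"
  have fE: "finite E" "card E \<le> k" unfolding E_def using card_image_le[of "{..<k}" "wm s4 7"] by simp_all
  have SE: "Suc ` S' \<subseteq> E" unfolding S'_def by auto
  have largest: "largest_k N k u S'" unfolding largest_k_def
  proof (intro conjI)
    show "S' \<subseteq> {..<N}" using EN unfolding S'_def by fastforce
    have cS: "card S' = card (Suc ` S')" by (simp add: card_image)
    show "card S' \<le> k" using card_mono[OF fE(1) SE] fE(2) cS by simp
    show "(\<forall>j\<in>{..<N} - S'. u j = 0) \<or> card S' = k \<and> (\<forall>j\<in>{..<N} - S'. \<forall>w\<in>S'. \<bar>u j\<bar> \<le> \<bar>u w\<bar>)"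
      using dich
    proof
      assume a: "\<forall>i. i \<notin> E --> rm s3 4 i = 0"
      have "u j = 0" if "j \<notin> S'" for j proof -
        have "rm s3 4 (Suc j) = 0" using a that unfolding S'_def by simp
        thus ?thesis unfolding K3 u_def U_def by simp
      qed
      thus ?thesis by blast
    next
      assume a: "card E = k \<and> 0 \<notin> E \<and> (\<forall>i w. i \<notin> E --> w \<in> E --> rm s3 4 i \<le> rm s3 4 w)"
      have "Suc ` S' = E"
      proof
        show "E \<subseteq> Suc ` S'"
        proof
          fix i assume i: "i \<in> E"
          hence "i \<noteq> 0" using a by metis
          then obtain j where "i = Suc j" by (cases i) auto
          thus "i \<in> Suc ` S'" using i unfolding S'_def by blast
        qed
      qed (rule SE)
      hence "card S' = k" using a cS by simp
      moreover have "\<bar>u j\<bar> \<le> \<bar>u w\<bar>" if "j \<notin> S'" "w \<in> S'" for j w proof -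
        have "rm s3 4 (Suc j) \<le> rm s3 4 (Suc w)" using a that unfolding S'_def by blast
        thus ?thesis unfolding K3 u_def U_def by (simp only: abs_le_square_iff)
      qed
      ultimately show ?thesis by blast
    qed
  qed
  have nd: "noise_dominated N d h (min \<theta> (1/2)) z i \<bar>u i - x i\<bar>" if i: "i < N" for i
  proof (cases "Suc i \<in> I")
    case True
    then obtain v where v: "estimate s2 (Suc i) v" "U (Suc i) = rm s 3 (Suc i) + v" using est3[OF True] unfolding U_def by auto
    define f where "f e = (\<Sum>l\<in>sel e (h e i) 0. z l)" for e
    have "estimate s2 (Suc i) v \<longleftrightarrow> is_median d (\<lambda>e. rm s 2 (mcell e (h e i) 0)) v" unfolding estimate_def r2 by simp
    also have "\<dots> \<longleftrightarrow> is_median d f v" proof -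
      have "rm s 2 (mcell e (h e i) 0) = f e" if "e < d" for e using b1 that h_less unfolding resid_def f_def z_def by simp
      hence "{e. e < d \<and> rm s 2 (mcell e (h e i) 0) < v} = {e. e < d \<and> f e < v}"
        "{e. e < d \<and> v < rm s 2 (mcell e (h e i) 0)} = {e. e < d \<and> v < f e}" by auto
      thus ?thesis unfolding is_median_def by simp
    qed
    finally have m: "is_median d f v" using v(1) by simp
    have "real d / 2 \<le> card {e. e < d \<and> \<bar>v - z i\<bar> \<le> noise z e i}"
      by (rule median_error[OF m]) (unfold f_def, rule sel_noise(1)[OF i])
    moreover have "u i - x i = v - z i" unfolding u_def v z_def by simp
    moreover have "min \<theta> (1/2) * real d \<le> 1/2 * real d" by (intro mult_right_mono) auto
    ultimately show ?thesis unfolding noise_dominated_def noise_def by simp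
  next
    case False
    have ui: "u i = 0" unfolding u_def U_def by (rule out[OF False])
    have sub: "wm s 3 j \<in> I" if "j < k" for j proof -
      have e: "eid s2 (nc + j) = wm s 3 j" unfolding eid_def ea_def ec_def by (simp add: w23)
      have "nc + j \<in> {..<nc + k}" using that by simp
      from imageI[OF this, of "eid s2"] show ?thesis unfolding I_def e .
    qed
    \<comment> \<open>The current support is among the entries, so an item without estimate is
      absent from the approximation and its residual is its full value.\<close>
    have "rm s 3 (Suc i) = 0"
    proof (rule ccontr)
      assume "rm s 3 (Suc i) \<noteq> 0"
      from b2[OF this] obtain j where "j < k" "Suc i = wm s 3 j" by auto
      thus False using sub[of j] False by simp
    qed
    hence zi: "z i = x i" unfolding z_def by simp
    define Bad where "Bad = {e. e < d \<and> (wm s1 5 (e * B + h e i) = 1) \<noteq> bt e i}"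
    have "\<not> (\<exists>c<nc. wm s2 2 c = Suc i)"
    proof
      assume "\<exists>c<nc. wm s2 2 c = Suc i"
      then obtain c where c: "c < nc" "wm s2 2 c = Suc i" by blast
      hence e: "eid s2 c = Suc i" unfolding eid_def ea_def ec_def by simp
      have "c \<in> {..<nc + k}" using c(1) by simp
      from imageI[OF this, of "eid s2"] show False using False unfolding I_def e by (rule notE[rotated])
    qed
    hence "\<not> real (card Bad) < \<theta> * d" using prog_finds[OF bt1 i] unfolding s2_def Bad_def by (rule contrapos_nn)
    hence bad: "\<theta> * d \<le> card Bad" by simp
    have "Bad \<subseteq> (?g i)"
    proof
      fix e assume e: "e \<in> Bad"
      hence ed: "e < d" unfolding Bad_def by simp
      have q: "e * B + h e i < d * B" proof -
        have "Suc e * B \<le> d * B" using ed by (intro mult_le_mono1) simp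
        thus ?thesis using h_less[of e i] by simp
      qed
      have cells: "rm s 2 ((e * B + h e i) * 2) = (\<Sum>l\<in>sel e (h e i) 0. z l)" "rm s 2 ((e * B + h e i) * 2 + 1) = (\<Sum>l\<in>sel e (h e i) 1. z l)"
      proof -
        have "rm s 2 (mcell e (h e i) 0) = (\<Sum>l\<in>sel e (h e i) 0. z l)" "rm s 2 (mcell e (h e i) 1) = (\<Sum>l\<in>sel e (h e i) 1. z l)"
          using b1 ed h_less unfolding resid_def z_def by simp_all
        thus "rm s 2 ((e * B + h e i) * 2) = (\<Sum>l\<in>sel e (h e i) 0. z l)" "rm s 2 ((e * B + h e i) * 2 + 1) = (\<Sum>l\<in>sel e (h e i) 1. z l)"
          unfolding mcell_def by simp_all
      qed
      have "(wm s1 5 (e * B + h e i) = 1) \<longleftrightarrow> \<bar>(\<Sum>l\<in>sel e (h e i) 0. z l) - (\<Sum>l\<in>sel e (h e i) 1. z l)\<bar> < \<bar>\<Sum>l\<in>sel e (h e i) 1. z l\<bar>"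
        using bt1'[rule_format, OF q] unfolding cells by simp
      hence "\<not> noise z e i < \<bar>z i\<bar>" using sel_noise(2)[OF i, of z e] e unfolding Bad_def by blast
      thus "e \<in> (?g i)" using ed zi ui by simp
    qed
    hence "card Bad \<le> card (?g i)" by (intro card_mono) auto
    hence "\<theta> * d \<le> card (?g i)" using bad by linarith
    moreover have "min \<theta> (1/2) * real d \<le> \<theta> * real d" by (intro mult_right_mono) auto
    ultimately show ?thesis unfolding noise_dominated_def noise_def by simp
  qed
  have "\<forall>i<N. rm s8 3 (Suc i) = (if i \<in> S' then u i else 0)" unfolding X8 S'_def u_def by simp
  thus ?thesis using base8 o8 largest nd unfolding z_def by blast
qed

subsection \<open>The whole program\<close>

definition loads :: "cmd list" where "loads = concat (map (\<lambda>q. [RS 2 (Cst q) (RI q)]) [0..<2 * d * B])"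

text \<open>Entries that stand for no item are emitted at position \<open>N\<close>, past the end of
  the decoded vector.\<close>

definition slot :: "nat => nat" where "slot i = (if i = 0 then N else i - 1)"

definition emits :: "cmd list" where
  "emits = concat (map (\<lambda>j. [EM (fn1 slot (entry 3 j)) (RL 3 (entry 3 j))]) [0..<k])"

definition program :: "nat => cmd list" where
  "program J = loads @ concat (replicate J round) @ emits"

lemma loads_effect:
  assumes dim: "dim_vec y = 2 * d * B" and m: "\<And>e b c. e < d ==> b < B ==> c < 2 ==> y $ mcell e b c = (\<Sum>l\<in>sel e b c. x l)"
  shows "base x (crun V y loads sl_init) \<and> om (crun V y loads sl_init) = (\<lambda>_. 0) \<and> rm (crun V y loads sl_init) 3 = (\<lambda>_. 0)"
proof -
  define J where "J n u \<longleftrightarrow> wm u = (\<lambda>_ _. 0) \<and> om u = (\<lambda>_. 0) \<and> (\<forall>a. a \<noteq> 2 --> rm u a = (\<lambda>_. 0)) \<and> (\<forall>q<n. rm u 2 q = y $ q)" for n and u :: sl_state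
  define s where "s = crun V y loads sl_init"
  have "J 0 sl_init" unfolding J_def sl_init_def by simp
  hence "J (2 * d * B) s" unfolding s_def loads_def
  proof (rule crun_loop[where I = J])
    fix n u assume n: "n < 2 * d * B" and J: "J n u"
    have "n < V" using n V(1) by linarith
    hence "crun V y [RS 2 (Cst n) (RI n)] u = setr (2, n) (y $ n) u" using n dim by simp
    thus "J (Suc n) (crun V y [RS 2 (Cst n) (RI n)] u)" using J unfolding J_def by (simp add: less_Suc_eq)
  qed
  hence w: "wm s = (\<lambda>_ _. 0)" and o: "om s = (\<lambda>_. 0)" and r: "\<And>a. a \<noteq> 2 ==> rm s a = (\<lambda>_. 0)"
    and r2: "\<And>q. q < 2 * d * B ==> rm s 2 q = y $ q" unfolding J_def by blast+
  have "resid x s" unfolding resid_def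
  proof (intro allI impI)
    fix e b c :: nat assume c: "e < d" "b < B" "c < 2"
    show "rm s 2 (mcell e b c) = (\<Sum>l\<in>sel e b c. x l - rm s 3 (Suc l))" using r2[OF mcell_less[OF c]] m[OF c] r[of 3] by simp
  qed
  hence "base x s" unfolding base_def using w r by (simp add: inside_def)
  thus ?thesis using o r[of 3] unfolding s_def by simp
qed

lemma emits_effect:
  assumes r: "\<And>j. j < k ==> wm s 3 j \<le> N" and o: "om s = (\<lambda>_. 0)" and X: "\<And>i. rm s 3 i \<noteq> 0 ==> i \<in> wm s 3 ` {..<k}" and i: "i < N"
  shows "om (crun V y emits s) i = rm s 3 (Suc i)" proof -
  define J where "J n u \<longleftrightarrow> wm u = wm s \<and> rm u = rm s \<and> (\<forall>i<N. om u i = (if Suc i \<in> wm s 3 ` {..<n} then rm s 3 (Suc i) else 0))" for n and u :: sl_state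
  have "J 0 s" unfolding J_def using o by simp
  hence "J k (crun V y emits s)" unfolding emits_def
  proof (rule crun_loop[where I = J])
    fix n u assume n: "n < k" and J: "J n u"
    define q where "q = wm s 3 n"
    define p where "p = slot q"
    have NV: "N < V" using NH V by linarith
    have "p \<le> N" using r[OF n, folded q_def] unfolding p_def slot_def by (auto split: if_split)
    hence pV: "p < V" using NV by (rule le_less_trans)
    have e: "crun V y [EM (fn1 slot (entry 3 n)) (RL 3 (entry 3 n))] u = u\<lparr>om := (om u)(p := rm s 3 q)\<rparr>"
      using J n V(4) pV unfolding J_def by (simp add: wev_entry q_def[symmetric] p_def[symmetric])
    have im: "wm s 3 ` {..<Suc n} = insert q (wm s 3 ` {..<n})" unfolding q_def lessThan_Suc by simp
    have Ji: "\<forall>i<N. om u i = (if Suc i \<in> wm s 3 ` {..<n} then rm s 3 (Suc i) else 0)" using J unfolding J_def by (elim conjE) assumption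
    have "((om u)(p := rm s 3 q)) i = (if Suc i \<in> insert q (wm s 3 ` {..<n}) then rm s 3 (Suc i) else 0)" if i: "i < N" for i
    proof (cases "i = p")
      case True
      hence "q = Suc i" using i unfolding p_def slot_def by (auto split: if_splits)
      thus ?thesis using True by simp
    next
      case False
      hence "q \<noteq> Suc i" unfolding p_def slot_def by auto
      thus ?thesis using False Ji[rule_format, OF i] by simp
    qed
    thus "J (Suc n) (crun V y [EM (fn1 slot (entry 3 n)) (RL 3 (entry 3 n))] u)" unfolding e J_def im using J unfolding J_def by simp
  qed
  hence "\<forall>i<N. om (crun V y emits s) i = (if Suc i \<in> wm s 3 ` {..<k} then rm s 3 (Suc i) else 0)"
    unfolding J_def by (elim conjE) assumption
  from this[rule_format, OF i] show ?thesis using X[of "Suc i"] by auto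
qed

theorem program_correct:
  fixes x :: "nat => real" and \<eta> \<epsilon> :: real
  assumes dim: "dim_vec y = 2 * d * B" and m: "\<And>e b c. e < d ==> b < B ==> c < 2 ==> y $ mcell e b c = (\<Sum>l\<in>sel e b c. x l)"
    and ex: "expanding N (6 * k) \<eta> d h" and k: "0 < k" "2 * k \<le> N" and \<theta>: "0 < \<theta>"
    and \<eta>: "0 \<le> \<eta>" "128 * \<eta> \<le> \<epsilon> * min \<theta> (1/2)" and \<epsilon>: "0 < \<epsilon>" "\<epsilon> \<le> 1"
    and J: "(4 * real k + 1) * (1/4) ^ J \<le> \<epsilon> / 4"
    and S: "S \<subseteq> {..<N}" "card S \<le> k"
  shows "(\<Sum>i<N. \<bar>om (crun V y (program J) sl_init) i - x i\<bar>) \<le> (1 + \<epsilon>) * (\<Sum>i\<in>{..<N} - S. \<bar>x i\<bar>)"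
proof -
  define st where "st j = crun V y (concat (replicate j round)) (crun V y loads sl_init)" for j
  have stS: "st (Suc j) = crun V y round (st j)" for j proof -
    have "concat (replicate (Suc j) round) = concat (replicate j round) @ round" by (induction j) simp_all
    thus ?thesis unfolding st_def by simp
  qed
  have b: "base x (st j) \<and> om (st j) = (\<lambda>_. 0)" for j
  proof (induction j)
    case 0
    thus ?case using loads_effect[OF dim m] unfolding st_def by simp
  next
    case (Suc j)
    thus ?case using round_effect[OF _ stS, of x j] by simp
  qed
  define X where "X j i = rm (st j) 3 (Suc i)" for j i
  have X0: "X 0 i = 0" for i unfolding X_def st_def using loads_effect[OF dim m] by simp
  have "(\<Sum>i<N. \<bar>X J i - x i\<bar>) \<le> (1 + \<epsilon>) * (\<Sum>i\<in>{..<N} - S. \<bar>x i\<bar>)"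
  proof (rule iteration_converges[where X = X and J = J and x = x, OF ex k d \<eta> _ \<epsilon> X0 _ J S])
    show "0 < min \<theta> (1/2)" using \<theta> by simp
  next
    fix j assume "j < J"
    show "\<exists>u S'. largest_k N k u S' \<and> (\<forall>i<N. X (Suc j) i = (if i \<in> S' then u i else 0)) \<and>
        (\<forall>i<N. noise_dominated N d h (min \<theta> (1/2)) (\<lambda>l. x l - X j l) i \<bar>u i - x i\<bar>)"
      using round_effect[OF _ stS, of x j] b[of j] unfolding X_def by blast
  qed
  moreover have "om (crun V y (program J) sl_init) i = X J i" if "i < N" for i proof -
    have bJ: "base x (st J)" "om (st J) = (\<lambda>_. 0)" using b[of J] by simp_all
    have "om (crun V y emits (st J)) i = rm (st J) 3 (Suc i)"
      by (rule emits_effect[OF _ bJ(2) _ that]) (use bJ(1) in \<open>unfold base_def, blast+\<close>)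
    thus ?thesis unfolding program_def X_def st_def by simp
  qed
  ultimately show ?thesis by simp
qed

end

section \<open>The error of the best k-term approximation\<close>

lemma magnitude_rank_card:
  "card {i. i < dim_vec x \<and> magnitude_rank x i < k} \<le> k"
proof -
  let ?S = "{i. i < dim_vec x \<and> magnitude_rank x i < k}"
  define R where "R j i \<longleftrightarrow> \<bar>x $ j\<bar> > \<bar>x $ i\<bar> \<or> \<bar>x $ j\<bar> = \<bar>x $ i\<bar> \<and> j < i" for i j
  have m: "magnitude_rank x j < magnitude_rank x i" if "R j i" "j < dim_vec x" for i j proof -
    have "{l. l < dim_vec x \<and> R l j} \<subseteq> {l. l < dim_vec x \<and> R l i}" using that(1) unfolding R_def by auto
    moreover have "j \<in> {l. l < dim_vec x \<and> R l i} - {l. l < dim_vec x \<and> R l j}" using that unfolding R_def by auto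
    ultimately have "{l. l < dim_vec x \<and> R l j} \<subset> {l. l < dim_vec x \<and> R l i}" by blast
    thus ?thesis unfolding magnitude_rank_def R_def[symmetric] by (intro psubset_card_mono) auto
  qed
  \<comment> \<open>Ties are broken by index, so the order is total and the rank injective.\<close>
  have tot: "i = j \<or> R i j \<or> R j i" for i j unfolding R_def by (cases "i = j") (auto simp: neq_iff)
  have "inj_on (magnitude_rank x) ?S"
  proof (rule inj_onI)
    fix i j assume *: "i \<in> ?S" "j \<in> ?S"
      "magnitude_rank x i = magnitude_rank x j"
    thus "i = j" using tot[of i j] m[of i j] m[of j i] by auto
  qed
  moreover have "magnitude_rank x ` ?S \<subseteq> {..<k}" by auto
  ultimately have "card ?S \<le> card {..<k}" by (intro card_inj_on_le) auto
  thus ?thesis by simp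
qed

lemma best_approx_error:
  "l1_norm (best_approx k x - x) = (\<Sum>i\<in>{..<dim_vec x} - {i. i < dim_vec x \<and> magnitude_rank x i < k}. \<bar>x $ i\<bar>)"
proof -
  have "l1_norm (best_approx k x - x) = (\<Sum>i<dim_vec x. if magnitude_rank x i < k then 0 else \<bar>x $ i\<bar>)"
    unfolding l1_norm_def best_approx_def by (intro sum.cong) auto
  also have "\<dots> = (\<Sum>i\<in>{..<dim_vec x} - {i. i < dim_vec x \<and> magnitude_rank x i < k}. \<bar>x $ i\<bar>)"
    by (rule sum.mono_neutral_cong_right) auto
  finally show ?thesis .
qed

section \<open>Length of the program, the measurement matrix and the recovery system\<close>

lemma wsize_wsum: "\<forall>e\<in>set es. wsize e = 2 ==> wsize (wsum es) = 3 * length es + 1" by (induction es) auto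

lemma wok_wsum: "\<forall>e\<in>set es. wok e ==> wok (wsum es)" by (induction es) auto

lemma length_loop: "(\<And>n. length (f n) = l) ==> length (concat (map f [0..<m])) = m * l" by (induction m) auto

context decoder
begin

lemma length_update: "length (update E) = 1 + 2 * H" unfolding update_def using length_loop[of "upd E" 2 H] by (simp add: upd_def)

lemma length_est: "length (est E) = d * d + 2 * d + 4 + 2 * H" unfolding est_def by (simp add: length_update length_loop[where l = 1])

lemma length_round:
  "length round = d * B + length prog + (nc + k) * (d * d + 2 * d + 4 + 2 * H) + k * (3 + 2 * H) + 2 * (k * (2 + 2 * d)) +
     2 * (nc + k) + k"
proof -
  have b: "length bits = d * B" unfolding bits_def by (subst length_loop[where l = 1]) (simp_all add: Let_def)
  have e: "length ests = (nc + k) * (d * d + 2 * d + 4 + 2 * H)" unfolding ests_def by (rule length_loop) (rule length_est)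
  have x: "length exts = k * (3 + 2 * H)" unfolding exts_def by (rule length_loop) (simp add: ext_def length_update)
  have c: "length (commits T a) = k * (2 + 2 * d)" for T a
    unfolding commits_def by (rule length_loop) (simp add: commit_def cadd_def length_loop[where l = 1])
  have r: "length resets = (nc + k) * 2" unfolding resets_def by (rule length_loop) simp
  have p: "length copies = k * 1" unfolding copies_def by (rule length_loop) simp
  show ?thesis unfolding round_def by (simp add: b e x c r p)
qed

lemma length_program: "length (program J) = 2 * d * B + J * length round + k"
proof -
  have "length loads = 2 * d * B * 1" unfolding loads_def by (rule length_loop) simp
  moreover have "length emits = k * 1" unfolding emits_def by (rule length_loop) simp
  moreover have "length (concat (replicate J round)) = J * length round" by (induction J) auto
  ultimately show ?thesis unfolding program_def by simp
qed

definition good :: "nat => cmd => bool" where "good Q c \<longleftrightarrow> cok V c \<and> csize c \<le> Q"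

lemma good_loop: "(\<And>n. n < m ==> list_all (good Q) (f n)) ==> list_all (good Q) (concat (map f [0..<m]))" by (induction m) auto

lemma program_good:
  assumes p: "list_all (good Q) prog" and Q: "6 * d + 40 \<le> Q"
  shows "list_all (good Q) (program J)" proof -
  have u: "list_all (good Q) (update (entry a c))" if "0 < a" "a < 16" for a c unfolding update_def using Q that
    by (auto simp: good_def fn1_def entry_def upd_def list_all_iff)
  have fl: "wsize (flag e) = 6 * d + 3" "wok (flag e)" for e proof -
    have w: "wsize (wsum (map (\<lambda>e'. Ld 8 (Cst (f e'))) [0..<d])) = 3 * d + 1" "wok (wsum (map (\<lambda>e'. Ld 8 (Cst (f e'))) [0..<d]))" for f
      using wsize_wsum[of "map (\<lambda>e'. Ld 8 (Cst (f e'))) [0..<d]"] wok_wsum[of "map (\<lambda>e'. Ld 8 (Cst (f e'))) [0..<d]"] by auto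
    show "wsize (flag e) = 6 * d + 3" "wok (flag e)" unfolding flag_def by (simp_all add: w)
  qed
  have es: "list_all (good Q) (est (entry a c))" if "0 < a" "a < 16" for a c unfolding est_def using Q that u[OF that]
    by (auto simp: good_def fn1_def entry_def fl list_all_iff)
  have ea16: "0 < ea n" "ea n < 16" for n using ea_cases[of n] by auto
  have 1: "list_all (good Q) ests" unfolding ests_def ent_def by (intro good_loop es ea16)
  have 2: "list_all (good Q) exts" unfolding exts_def ext_def using u[of 7] Q by (intro good_loop) (auto simp: good_def entry_def)
  have 3: "list_all (good Q) (commits T a)" if "0 < a" "a < 16" "0 < T" "T < 16" for T a unfolding commits_def commit_def using that Q
    by (intro good_loop) (auto simp: good_def entry_def cadd_def fn1_def list_all_iff)
  have 4: "list_all (good Q) resets" unfolding resets_def ent_def using Q ea16 by (intro good_loop) (auto simp: good_def entry_def)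
  have 5: "list_all (good Q) copies" unfolding copies_def using Q by (intro good_loop) (auto simp: good_def entry_def)
  have 6: "list_all (good Q) bits" unfolding bits_def using Q by (intro good_loop) (auto simp: good_def Let_def)
  have 7: "list_all (good Q) loads" unfolding loads_def using Q V(1) by (intro good_loop) (auto simp: good_def)
  have 8: "list_all (good Q) emits" unfolding emits_def using Q by (intro good_loop) (auto simp: good_def fn1_def entry_def)
  have 9: "list_all (good Q) round" unfolding round_def using 1 2 3[of 3 10] 3[of 7 5] 4 5 6 p by simp
  have "list_all (good Q) (concat (replicate J round))" using 9 by (induction J) auto
  thus ?thesis unfolding program_def using 7 8 by simp
qed

definition measure_mat :: "real mat" where
  "measure_mat = mat (2 * d * B) N (\<lambda>(r, l). if l \<in> sel (r div 2 div B) (r div 2 mod B) (r mod 2) then 1 else 0)"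

lemma measured:
  assumes x: "x \<in> carrier_vec N" and c: "e < d" "b < B" "c < 2"
  shows "(measure_mat *\<^sub>v x) $ mcell e b c = (\<Sum>l\<in>sel e b c. x $ l)" proof -
  define r where "r = mcell e b c"
  have r: "r < 2 * d * B" unfolding r_def by (rule mcell_less[OF c])
  have q: "(n * 2 + c) mod 2 = c" "(n * 2 + c) div 2 = n" for n using c(3) by auto
  have rr: "r div 2 div B = e" "r div 2 mod B = b" "r mod 2 = c" unfolding r_def mcell_def q using c by simp_all
  have dx: "dim_vec x = N" using x by simp
  have "(measure_mat *\<^sub>v x) $ r = row measure_mat r \<bullet> x" using r unfolding measure_mat_def by simp
  also have "\<dots> = (\<Sum>l\<in>{0..<N}. row measure_mat r $ l * x $ l)" unfolding scalar_prod_def dx by simp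
  also have "\<dots> = (\<Sum>l\<in>{0..<N}. (if l \<in> sel e b c then 1 else 0) * x $ l)"
    using r by (intro sum.cong) (simp_all add: measure_mat_def rr)
  also have "\<dots> = (\<Sum>l\<in>sel e b c. x $ l)" by (rule sum.mono_neutral_cong_right) (auto simp: sel_def)
  finally show ?thesis unfolding r_def .
qed

text \<open>The program is generated from the parameters alone. The hypothesis for all
  \<open>y'\<close> allows the analysis to be instantiated with the measurements of each
  signal.\<close>

theorem recovery_system:
  fixes \<eta> \<epsilon> :: real
  assumes all: "\<And>y'. decoder N k d B H V nc h bt prog \<theta> y'"
    and ex: "expanding N (6 * k) \<eta> d h" and k: "0 < k" "2 * k \<le> N" and \<theta>: "0 < \<theta>"
    and \<eta>: "0 \<le> \<eta>" "128 * \<eta> \<le> \<epsilon> * min \<theta> (1/2)" and \<epsilon>: "0 < \<epsilon>" "\<epsilon> \<le> 1"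
    and J: "(4 * real k + 1) * (1/4) ^ J \<le> \<epsilon> / 4"
    and prog: "list_all (good Q) prog" and Q: "6 * d + 40 \<le> Q" "Q \<le> V"
    and n: "length (program J) * Q \<le> n" and wb: "8 * (n + 2) + n * (V * V) + 16 * V + 64 < 2 ^ wb"
  shows "\<exists>\<Phi> A. sparse_recovery_system N k \<epsilon> \<Phi> interpreter A (40 * n + 8) \<and> word_bits A = wb \<and> dim_row \<Phi> = 2 * d * B"
proof -
  have ok: "cok V c \<and> csize c \<le> Q" if "c \<in> set (program J)" for c
    using program_good[OF prog Q(1), of J] that unfolding list_all_iff good_def by blast
  have "2 \<le> V" using Q by linarith
  from array_program_runs[OF ok Q(2) this n wb] obtain A where A: "word_bits A = wb"
    "\<And>y. halted interpreter (run interpreter A y (40 * n + 8)) \<and>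
      emitted (run interpreter A y (40 * n + 8)) = om (crun V y (program J) sl_init)" by blast
  have "sparse_recovery_system N k \<epsilon> measure_mat interpreter A (40 * n + 8)" unfolding sparse_recovery_system_def
  proof (intro conjI ballI)
    show "dim_col measure_mat = N" unfolding measure_mat_def by simp
    fix x :: "real vec" assume x: "x \<in> carrier_vec N"
    hence dx: "dim_vec x = N" by simp
    define yy where "yy = measure_mat *\<^sub>v x"
    define c where "c = run interpreter A yy (40 * n + 8)"
    define S where "S = {i. i < N \<and> magnitude_rank x i < k}"
    have S: "S \<subseteq> {..<N}" "card S \<le> k" unfolding S_def using magnitude_rank_card[of x k] dx by auto
    have dim: "dim_vec yy = 2 * d * B" unfolding yy_def measure_mat_def by simp
    have m: "yy $ mcell e b c = (\<Sum>l\<in>sel e b c. x $ l)" if "e < d" "b < B" "c < 2" for e b c unfolding yy_def by (rule measured[OF x that])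
    have "(\<Sum>i<N. \<bar>om (crun V yy (program J) sl_init) i - x $ i\<bar>) \<le> (1 + \<epsilon>) * (\<Sum>i\<in>{..<N} - S. \<bar>x $ i\<bar>)"
      by (rule decoder.program_correct[OF all dim m ex k \<theta> \<eta> \<epsilon> J S])
    moreover have "l1_norm (vec N (emitted c) - x) = (\<Sum>i<N. \<bar>om (crun V yy (program J) sl_init) i - x $ i\<bar>)"
      unfolding l1_norm_def c_def using A(2)[of yy] dx by (intro sum.cong) auto
    moreover have "l1_norm (best_approx k x - x) = (\<Sum>i\<in>{..<N} - S. \<bar>x $ i\<bar>)" unfolding best_approx_error dx S_def ..
    ultimately show "let c = run interpreter A (measure_mat *\<^sub>v x) (40 * n + 8) in halted interpreter c \<and>
        l1_norm (vec N (emitted c) - x) \<le> (1 + \<epsilon>) * l1_norm (best_approx k x - x)"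
      unfolding Let_def yy_def[symmetric] c_def[symmetric] using A(2)[of yy] unfolding c_def by simp
  qed
  thus ?thesis using A(1) unfolding measure_mat_def by (intro exI[of _ measure_mat] exI[of _ A]) (simp add: measure_mat_def)
qed

end

section \<open>Identification from the measured bits\<close>

lemma card_blocks:
  fixes n s :: nat
  shows "card {e. e < n * s \<and> P e} = (\<Sum>w<n. card {r. r < s \<and> P (w * s + r)})"
proof (induction n)
  case (Suc n)
  have u: "{e. e < Suc n * s \<and> P e} = {e. e < n * s \<and> P e} \<union> (\<lambda>r. n * s + r) ` {r. r < s \<and> P (n * s + r)}" (is "?A = ?B \<union> ?C")
  proof
    show "?A \<subseteq> ?B \<union> ?C"
    proof
      fix e assume e: "e \<in> ?A"
      show "e \<in> ?B \<union> ?C"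
      proof (cases "e < n * s")
        case False
        hence "e = n * s + (e - n * s)" "e - n * s < s" using e by auto
        thus ?thesis using e by (metis (mono_tags, lifting) Un_iff image_eqI mem_Collect_eq)
      qed (use e in simp)
    qed
  qed auto
  have "card ?A = card ?B + card ?C" unfolding u by (rule card_Un_disjoint) auto
  moreover have "card ?C = card {r. r < s \<and> P (n * s + r)}" by (rule card_image) (simp add: inj_on_def)
  ultimately show ?case using Suc by simp
qed simp

lemma digits_determine:
  "(\<And>j. j < n ==> digit 2 j a = digit 2 j b) ==> a mod 2 ^ n = b mod 2 ^ n"
proof (induction n)
  case (Suc n)
  have m: "c mod 2 ^ Suc n = 2 ^ n * digit 2 n c + c mod 2 ^ n" for c :: nat
    unfolding digit_def using mod_mult2_eq[of c "2 ^ n" 2] by (simp add: mult.commute)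
  show ?case unfolding m using Suc by simp
qed simp

fun ench :: "nat => wexp list => wexp" where
  "ench q [] = Cst 0" | "ench q (e # es) = Ap (\<lambda>a b. a + q * b) e (ench q es)"

lemma wev_ench: "wev V w (ench q es) = enc q (map (wev V w) es) mod V"
proof (induction es)
  case (Cons e es)
  have "(a + q * (b mod V)) mod V = (a + q * b) mod V" for a b :: nat by (metis mod_add_right_eq mod_mult_right_eq)
  thus ?case using Cons by simp
qed simp

lemma wsize_ench: "\<forall>e\<in>set es. wsize e \<le> c ==> wsize (ench q es) \<le> length es * (c + 1) + 1" by (induction es) auto

lemma wok_ench: "\<forall>e\<in>set es. wok e ==> wok (ench q es)" by (induction es) auto

lemma wsize_fn1 [simp]: "wsize (fn1 f e) = wsize e + 2" and wok_fn1 [simp]: "wok (fn1 f e) = wok e" by (simp_all add: fn1_def)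

text \<open>\<open>Y\<close> layers share links and codes but have their own addresses; they raise
  the number of hash functions to what expansion requires. Hash function \<open>e\<close> belongs to
  node \<open>e div s\<close> and carries bit \<open>e mod s\<close> of its message, encoded by
  \<open>ecc\<close> in \<open>s8\<close> symbols of eight bits. Since \<open>H\<close> is applied
  to the address, the buckets that hold a message are known from node and address alone.\<close>

locale layered = item_code R D Bv K l link N G m ng L M0 F q1 q2 th1 th2 z et1 et2 et3 sym phi core g
  for R D Bv K l :: nat and link N G m ng L M0 F q1 q2 th1 th2 z et1 et2 et3 sym phi core g +
  fixes Y s8 B V :: nat and H ecc :: "nat => nat => nat"
  assumes H_less: "\<And>e x. H e x < B" and Y: "Y > 0" and s8: "s8 > 0"
    and ecc_less: "\<And>p a. ecc p a < 256" and ecc_exp: "expanding (G ^ Suc D) 2 (1/4) s8 ecc"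
    and V: "2 ^ (8 * s8) \<le> V" "Y * R * G < V" "G ^ Suc D \<le> V" "G ^ (m * L) \<le> V" "M0 ^ ng \<le> V" "F \<le> V" "N < V"
      "Y * R * (8 * s8) * B < V" "Y * R * G * ng * q1 * q2 < V"
begin

definition s :: nat where "s = 8 * s8"

lemma item_code_layer: "item_code R D Bv K l link N G m ng L M0 F q1 q2 th1 th2 z et1 et2 et3 sym phi core (\<lambda>v. g (y * R + v))"
  by unfold_locales (fact Rm m L DL z g_less sym_less sym_exp q1 phi_less phi_exp core_less core_exp q2 th2)+

definition lmsg :: "nat => nat => nat => nat" where
  "lmsg y v i = enc G (sym (v mod m) (piece (v div m) i) # map (\<lambda>r. g (y * R + nbr r v) i) [0..<D])"

lemma lmsg_less: "lmsg y v i < G ^ Suc D" using item_code.msg_less[OF item_code_layer, of y v i]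
  unfolding item_code.msg_def[OF item_code_layer] lmsg_def .

definition bitof :: "nat => nat => nat" where "bitof a r = digit 2 (r mod 8) (ecc (r div 8) a)"

definition bt :: "nat => nat => bool" where
  "bt e i \<longleftrightarrow> bitof (lmsg (e div s div R) (e div s mod R) i) (e mod s) = 1"

definition h :: "nat => nat => nat" where "h e i = H e (g (e div s) i)"

text \<open>Unique decoding by exhaustive search, tabulated in advance.\<close>

definition dec :: "nat => nat" where
  "dec n = (case find (\<lambda>a. 4 * card {r. r < s \<and> digit 2 r n \<noteq> bitof a r} < s8) [0..<G ^ Suc D] of None => 0 | Some a => a)"

text \<open>Two encoded messages differ in at least half of the symbols, and each differing symbol
  contains a differing bit.\<close>

lemma bits_differ:
  assumes "a < G ^ Suc D" "b < G ^ Suc D" "a \<noteq> b"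
  shows "s8 \<le> 2 * card {r. r < s \<and> bitof a r \<noteq> bitof b r}" proof -
  let ?N = "{p. p < s8 \<and> ecc p a \<noteq> ecc p b}"
  let ?A = "{p. p < s8 \<and> ecc p a = ecc p b}"
  let ?R = "{r. r < s \<and> bitof a r \<noteq> bitof b r}"
  have "real (card ?A) \<le> 2 * (1/4) * s8" by (rule pair_agreement_bound[OF ecc_exp assms])
  hence agree: "2 * card ?A \<le> s8" by linarith
  have "?A \<union> ?N = {..<s8}" by auto
  moreover have "card (?A \<union> ?N) =
      card ?A + card ?N" by (rule card_Un_disjoint) auto
  ultimately have dis: "s8 \<le> 2 * card ?N" using agree by simp
  have "?N \<subseteq> (\<lambda>r. r div 8) ` ?R"
  proof
    fix p assume p: "p \<in> ?N"
    have "\<exists>j<8. digit 2 j (ecc p a) \<noteq> digit 2 j (ecc p b)"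
    proof (rule ccontr)
      assume "\<not> ?thesis"
      hence "ecc p a mod 2 ^ 8 = ecc p b mod 2 ^ 8" by (intro digits_determine) auto
      thus False using p ecc_less[of p a] ecc_less[of p b] by simp
    qed
    then obtain j where j: "j < 8" "digit 2 j (ecc p a) \<noteq> digit 2 j (ecc p b)" by blast
    have d: "(p * 8 + j) div 8 = p" "(p * 8 + j) mod 8 = j" using j(1) by auto
    have "p * 8 + j \<in> ?R" using p j unfolding bitof_def mem_Collect_eq d s_def by simp
    from imageI[OF this, of "\<lambda>r. r div 8"] show "p \<in> (\<lambda>r. r div 8) ` ?R" unfolding d .
  qed
  hence "card ?N \<le> card ((\<lambda>r. r div 8) ` ?R)"
    by (intro card_mono) auto
  also have "\<dots> \<le> card ?R" by (rule card_image_le) simp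
  finally show ?thesis using dis by linarith
qed

text \<open>Two messages that pass the test would differ in fewer than s8 / 2 bits.\<close>

lemma dec_correct:
  assumes a: "a < G ^ Suc D" and c: "4 * card {r. r < s \<and> digit 2 r n \<noteq> bitof a r} < s8"
  shows "dec n = a" proof -
  let ?r = "\<lambda>a. {r. r < s \<and> digit 2 r n \<noteq> bitof a r}"
  define P where "P = (\<lambda>a. 4 * card (?r a) < s8)"
  have "a \<in> set [0..<G ^ Suc D]" "P a" using a c unfolding P_def by simp_all
  hence "find P [0..<G ^ Suc D] \<noteq> None" unfolding find_None_iff by blast
  then obtain b where b': "find P [0..<G ^ Suc D] = Some b" by blast
  note b = b'[unfolded P_def]
  note bb = find_Some_nth[OF b]
  have "b = a"
  proof (rule ccontr)
    assume ne: "b \<noteq> a"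
    have "{r. r < s \<and> bitof a r \<noteq> bitof b r} \<subseteq> (?r a) \<union> (?r b)" by auto
    hence "card {r. r < s \<and> bitof a r \<noteq> bitof b r} \<le> card ((?r a) \<union> (?r b))"
      by (intro card_mono) auto
    also have "\<dots> \<le> card (?r a) + card (?r b)" by (rule card_Un_le)
    finally show False using bits_differ[OF a _ ne[symmetric]] c bb by simp
  qed
  thus ?thesis unfolding dec_def b by simp
qed

definition bitsexp :: "nat => wexp" where
  "bitsexp n = ench 2 (map (\<lambda>r. Ld 5 (Cst ((n div G * s + r) * B + H (n div G * s + r) (n mod G)))) [0..<s])"

lemma bit_index_less: "w < Y * R ==> r < s ==> (w * s + r) * B + H (w * s + r) x < Y * R * s * B"
proof -
  assume a: "w < Y * R" "r < s"
  have "Suc w * s \<le> Y * R * s" using a by (intro mult_le_mono1) simp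
  hence "Suc (w * s + r) \<le> Y * R * s" using a by simp
  hence "Suc (w * s + r) * B \<le> Y * R * s * B" by (rule mult_le_mono1)
  thus ?thesis using H_less[of "w * s + r" x] by simp
qed

lemma bitsexp_digit:
  assumes w: "w < Y * R" and x: "x < G" and r: "r < s" and W: "\<And>q. W 5 q \<le> 1"
  shows "digit 2 r (wev V W (bitsexp (w * G + x))) = W 5 ((w * s + r) * B + H (w * s + r) x)" proof -
  have e: "(w * G + x) div G = w" "(w * G + x) mod G = x" using x by auto
  define xs where "xs = map (\<lambda>r. W 5 ((w * s + r) * B + H (w * s + r) x)) [0..<s]"
  have "map (wev V W) (map (\<lambda>r. Ld 5 (Cst ((w * s + r) * B + H (w * s + r) x))) [0..<s]) = xs" unfolding xs_def map_map
  proof (rule map_cong)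
    fix r assume "r \<in> set [0..<s]"
    hence "(w * s + r) * B + H (w * s + r) x < V" using bit_index_less[OF w, of r x] V(8) unfolding s_def[symmetric] by simp
    thus "(wev V W \<circ> (\<lambda>r. Ld 5 (Cst ((w * s + r) * B + H (w * s + r) x)))) r = W 5 ((w * s + r) * B + H (w * s + r) x)" by simp
  qed simp
  hence v: "wev V W (bitsexp (w * G + x)) = enc 2 xs mod V" unfolding bitsexp_def e wev_ench by simp
  have xl: "\<And>a. a \<in> set xs ==> a < 2" unfolding xs_def using W by (auto simp: less_Suc_eq_le numeral_2_eq_2)
  have "enc 2 xs < 2 ^ length xs" using xl by (rule enc_less)
  hence "enc 2 xs < V" using V(1) unfolding xs_def s_def by simp
  moreover have "digit 2 r (enc 2 xs) = xs ! r" by (rule digit_enc) (use xl r in \<open>auto simp: xs_def\<close>)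
  moreover have "xs ! r = W 5 ((w * s + r) * B + H (w * s + r) x)" using r unfolding xs_def by simp
  ultimately show ?thesis unfolding v by simp
qed

definition decodes :: "cmd list" where
  "decodes = concat (map (\<lambda>n. [WS 1 (Cst n) (fn1 dec (bitsexp n))]) [0..<Y * R * G])"

lemma dec_less: "dec n < V"
proof -
  have "dec n < G ^ Suc D"
  proof (cases "find (\<lambda>a. 4 * card {r. r < s \<and> digit 2 r n \<noteq> bitof a r} < s8) [0..<G ^ Suc D]")
    case None
    thus ?thesis unfolding dec_def using G0 by simp
  next
    case (Some a)
    thus ?thesis unfolding dec_def using find_Some_nth[OF Some] by simp
  qed
  thus ?thesis using V(3) by simp
qed

lemma decodes_effect:
  assumes s': "s' = crun V y decodes st"
  shows "rm s' = rm st \<and> om s' = om st \<and> (\<forall>a. a \<noteq> 1 --> wm s' a = wm st a) \<and>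
    (\<forall>n<Y * R * G. wm s' 1 n = dec (wev V (wm st) (bitsexp n)))"
proof -
  define J where "J n u \<longleftrightarrow> rm u = rm st \<and> om u = om st \<and> (\<forall>a. a \<noteq> 1 --> wm u a = wm st a) \<and>
    (\<forall>q<n. wm u 1 q = dec (wev V (wm st) (bitsexp q)))" for n and u :: sl_state
  have stable: "wev V W (bitsexp n) = wev V W' (bitsexp n)" if "W 5 = W' 5" for W W' n
    unfolding bitsexp_def wev_ench map_map comp_def using that by simp
  have "J 0 st" unfolding J_def by simp
  hence "J (Y * R * G) s'" unfolding s' decodes_def
  proof (rule crun_loop[where I = J])
    fix n u assume n: "n < Y * R * G" and J: "J n u"
    have u5: "wm u 5 = wm st 5" using J unfolding J_def by simp
    have "n < V" using n V(2) by linarith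
    hence "crun V y [WS 1 (Cst n) (fn1 dec (bitsexp n))] u = setw (1, n) (dec (wev V (wm st) (bitsexp n))) u"
      using dec_less stable[of "wm u" "wm st" n] u5 by simp
    thus "J (Suc n) (crun V y [WS 1 (Cst n) (fn1 dec (bitsexp n))] u)" using J unfolding J_def by (simp add: less_Suc_eq)
  qed
  thus ?thesis unfolding J_def .
qed

text \<open>The nodes of the walk are known when the program is generated; only the address is
  computed, with one lookup in the decoded messages per step.\<close>

fun walkexp :: "nat => nat => wexp => nat list => wexp" where
  "walkexp y v e [] = e"
| "walkexp y v e (r # ws) = walkexp y (nbr r v) (fn1 (digit G (Suc r)) (Ld 1 (fn1 (\<lambda>x. (y * R + v) * G + x) e))) ws"

lemma walkexp_size: "wsize (walkexp y v e ws) = wsize e + 5 * length ws" by (induction y v e ws rule: walkexp.induct) auto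

lemma walkexp_ok: "wok e ==> wok (walkexp y v e ws)" by (induction y v e ws rule: walkexp.induct) auto

definition mem :: "(nat => nat => nat) => nat => nat => nat => nat" where
  "mem W y v x = W 1 ((y * R + v) * G + x)"

lemma mem_index: "y < Y ==> v < R ==> x < G ==> (y * R + v) * G + x < Y * R * G"
proof -
  assume a: "y < Y" "v < R" "x < G"
  have "Suc y * R \<le> Y * R" using a by (intro mult_le_mono1) simp
  hence "Suc (y * R + v) * G \<le> Y * R * G" using a by (intro mult_le_mono1) simp
  thus ?thesis using a by simp
qed

lemma GV: "G \<le> V"
proof -
  have "G \<le> G ^ Suc D" using G0 by (intro self_le_power) simp_all
  thus ?thesis using V(3) by (rule order_trans)
qed

lemma walkexp_value:
  assumes "y < Y" "v < R" "set ws \<subseteq> {..<D}" "wev V W e < G"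
  shows "wev V W (walkexp y v e ws) = gwalk (mem W y) v (wev V W e) ws \<and> gwalk (mem W y) v (wev V W e) ws < G" using assms
proof (induction ws arbitrary: v e)
  case (Cons r ws)
  have r: "r < D" using Cons.prems by auto
  define e' where "e' = fn1 (digit G (Suc r)) (Ld 1 (fn1 (\<lambda>x. (y * R + v) * G + x) e))"
  have d: "digit G (Suc r) q < G" for q using G0 by (rule digit_less)
  have "digit G (Suc r) q < V" for q using d[of q] GV by simp
  moreover have "(y * R + v) * G + wev V W e < V" using mem_index[OF Cons.prems(1,2,4)] V(2) by simp
  ultimately have e': "wev V W e' = digit G (Suc r) (mem W y v (wev V W e))" unfolding e'_def mem_def by simp
  have "wev V W (walkexp y (nbr r v) e' ws) = gwalk (mem W y) (nbr r v) (wev V W e') ws \<and> gwalk (mem W y) (nbr r v) (wev V W e') ws < G"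
  proof (rule Cons.IH[OF Cons.prems(1) nbr_less[OF r]])
    show "set ws \<subseteq> {..<D}" using Cons.prems(3) by simp
    show "wev V W e' < G" unfolding e' by (rule d)
  qed
  thus ?case unfolding e' by (simp add: e'_def)
qed simp

definition claimexp :: "nat => nat => nat => nat => nat => wexp" where
  "claimexp y v x u j = (if j < length (wordsto v u)
     then fn1 (digit G 0) (Ld 1 (fn1 (\<lambda>x. (y * R + u) * G + x) (walkexp y v (Cst x) (wordsto v u ! j)))) else Cst 0)"

definition claimsexp :: "nat => nat => nat => nat => wexp" where
  "claimsexp y v x a = ench G (map (\<lambda>q. claimexp y v x (a * m + q div L) (q mod L)) [0..<m * L])"

definition selectexp :: "nat => nat => nat => nat => nat => nat => wexp" where
  "selectexp y v x a c a' = Ap (select a) (claimsexp y v x a') (fn1 (\<lambda>n. hint a' (start n c)) (claimsexp y v x a))"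

definition candexp :: "nat => nat => nat => nat => nat => nat => wexp" where
  "candexp y v x a c c' = fn1 (\<lambda>n. final n c') (ench M0 (map (selectexp y v x a c) [0..<ng]))"

lemma words_in: "j < length (wordsto v u) ==> set (wordsto v u ! j) \<subseteq> {..<D} \<and> length (wordsto v u ! j) = l"
proof -
  assume "j < length (wordsto v u)"
  hence "wordsto v u ! j \<in> set (wordsto v u)" by (rule nth_mem)
  thus ?thesis unfolding wordsto_def by (auto simp: set_n_lists)
qed

lemma claimexp_value:
  assumes "y < Y" "v < R" "x < G" "u < R"
  shows "wev V W (claimexp y v x u j) = claim (mem W y) v x u j"
proof (cases "j < length (wordsto v u)")
  case True
  have xV: "x mod V = x" using assms(3) GV by simp
  have wx: "wev V W (Cst x) < G" using assms(3) xV by simp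
  note w = walkexp_value[OF assms(1,2) conjunct1[OF words_in[OF True]] wx]
  have xx: "wev V W (Cst x) = x" using xV by simp
  define x' where "x' = gwalk (mem W y) v x (wordsto v u ! j)"
  have x': "wev V W (walkexp y v (Cst x) (wordsto v u ! j)) = x'" "x' < G" using w unfolding xx x'_def by simp_all
  have i: "(y * R + u) * G + x' < V" using mem_index[OF assms(1,4) x'(2)] V(2) by simp
  have d: "digit G 0 q < V" for q using digit_less[OF G0, of 0 q] GV by simp
  show ?thesis unfolding claimexp_def claim_def if_P[OF True] x'_def[symmetric] using x' i d by (simp add: mem_def)
qed (simp add: claimexp_def claim_def)

lemma claimsexp_value:
  assumes "y < Y" "v < R" "x < G" "a < ng"
  shows "wev V W (claimsexp y v x a) = claims (mem W y) v x a" proof -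
  have me: "map (wev V W) (map (\<lambda>q. claimexp y v x (a * m + q div L) (q mod L)) [0..<m * L]) =
      map (\<lambda>q. claim (mem W y) v x (a * m + q div L) (q mod L)) [0..<m * L]" unfolding map_map
  proof (rule map_cong)
    fix q assume "q \<in> set [0..<m * L]"
    hence "q div L < m" by (simp add: less_mult_imp_div_less)
    hence "a * m + q div L < Suc a * m" by simp
    also have "Suc a * m \<le> ng * m" using assms(4) by (intro mult_le_mono1) simp
    finally have "a * m + q div L < R" unfolding Rm .
    thus "(wev V W \<circ> (\<lambda>q. claimexp y v x (a * m + q div L) (q mod L))) q = claim (mem W y) v x (a * m + q div L) (q mod L)"
      using claimexp_value[OF assms(1-3)] by simp
  qed simp
  have "wev V W (claimsexp y v x a) = claims (mem W y) v x a mod V" unfolding claimsexp_def wev_ench claims_def me ..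
  moreover have "claims (mem W y) v x a < V" using claims_less[of "mem W y" v x a] V(4) by simp
  ultimately show ?thesis by simp
qed

lemma candexp_value:
  assumes "y < Y" "v < R" "x < G" "a < ng"
  shows "wev V W (candexp y v x a c c') = cand (mem W y) v x a c c'" proof -
  have hF: "hint a' q < V" for a' q using digit_less[OF F0, of a' "q div M0"] V(6) unfolding hint_def by simp
  have M0V: "M0 \<le> V" if "ng > 0" proof -
    have "M0 ^ 1 \<le> M0 ^ ng" using that M00 by (intro power_increasing) auto
    thus ?thesis using V(5) by simp
  qed
  have me: "map (wev V W) (map (selectexp y v x a c) [0..<ng]) =
      map (\<lambda>a'. select a (claims (mem W y) v x a') (hint a' (start (claims (mem W y) v x a) c))) [0..<ng]" unfolding map_map
  proof (rule map_cong)
    fix a' assume "a' \<in> set [0..<ng]"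
    hence a': "a' < ng" by simp
    have sV: "select a q t < V" for q t using select_less[of a q t] M0V a' by simp
    show "(wev V W \<circ> selectexp y v x a c) a' = select a (claims (mem W y) v x a') (hint a' (start (claims (mem W y) v x a) c))"
      unfolding comp_def selectexp_def using claimsexp_value[OF assms(1-3) a', of W] claimsexp_value[OF assms, of W] hF sV by simp
  qed simp
  have "wev V W (ench M0 (map (selectexp y v x a c) [0..<ng])) = selects (mem W y) v x a c mod V" unfolding wev_ench selects_def me ..
  moreover have "selects (mem W y) v x a c < V" using selects_less[of "mem W y" v x a c] V(5) by simp
  moreover have "final (selects (mem W y) v x a c) c' < V" using cand_le[of "mem W y" v x a c c'] V(7) unfolding cand_def by simp
  ultimately show ?thesis unfolding candexp_def cand_def by simp
qed

definition nc :: nat where "nc = Y * R * G * ng * q1 * q2"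

definition candof :: "nat => wexp" where
  "candof n = candexp (n div q2 div q1 div ng div G div R) (n div q2 div q1 div ng div G mod R) (n div q2 div q1 div ng mod G)
     (n div q2 div q1 mod ng) (n div q2 mod q1) (n mod q2)"

definition finds :: "cmd list" where "finds = concat (map (\<lambda>n. [WS 2 (Cst n) (candof n)]) [0..<nc])"

definition prog :: "cmd list" where "prog = decodes @ finds"

lemma length_prog: "length prog = Y * R * G + nc"
  unfolding prog_def decodes_def finds_def using length_loop[of "\<lambda>n. [WS 1 (Cst n) (fn1 dec (bitsexp n))]" 1 "Y * R * G"]
    length_loop[of "\<lambda>n. [WS 2 (Cst n) (candof n)]" 1 nc] by simp

text \<open>Candidates are computed from array 1 alone, so storing them in array 2 does not disturb
  later ones.\<close>

lemma cand_stable: "W 1 = W' 1 ==> wev V W (candof n) = wev V W' (candof n)"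
proof -
  assume e: "W 1 = W' 1"
  have w: "wev V W (walkexp y v (Cst x) ws) = wev V W' (walkexp y v (Cst x) ws)" for y v x ws proof -
    have "wev V W a = wev V W' a ==> wev V W (walkexp y v a ws) = wev V W' (walkexp y v a ws)" for a
      by (induction y v a ws rule: walkexp.induct) (auto simp: e[unfolded One_nat_def])
    thus ?thesis by simp
  qed
  have "wev V W (claimexp y v x u j) = wev V W' (claimexp y v x u j)" for y v x u j unfolding claimexp_def using w e by simp
  hence "wev V W (claimsexp y v x a) = wev V W' (claimsexp y v x a)" for y v x a unfolding claimsexp_def wev_ench map_map comp_def by simp
  hence "wev V W (selectexp y v x a c a') = wev V W' (selectexp y v x a c a')" for y v x a c a' unfolding selectexp_def by simp
  thus ?thesis unfolding candof_def candexp_def wev_fn1 wev_ench map_map comp_def by simp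
qed

lemma finds_effect:
  assumes s': "s' = crun V y finds st"
  shows "rm s' = rm st \<and> om s' = om st \<and> (\<forall>a. a \<noteq> 2 --> wm s' a = wm st a) \<and>
    (\<forall>n<nc. wm s' 2 n = wev V (wm st) (candof n))"
proof -
  define J where "J n u \<longleftrightarrow> rm u = rm st \<and> om u = om st \<and> (\<forall>a. a \<noteq> 2 --> wm u a = wm st a) \<and>
    (\<forall>q<n. wm u 2 q = wev V (wm st) (candof q))" for n and u :: sl_state
  have "J 0 st" unfolding J_def by simp
  hence "J nc s'" unfolding s' finds_def
  proof (rule crun_loop[where I = J])
    fix n u assume n: "n < nc" and J: "J n u"
    have u1: "wm u 1 = wm st 1" using J unfolding J_def by simp
    have "n < V" using n V(9) unfolding nc_def by linarith
    hence "crun V y [WS 2 (Cst n) (candof n)] u = setw (2, n) (wev V (wm st) (candof n)) u" using cand_stable[of "wm u" "wm st" n] u1 by simp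
    thus "J (Suc n) (crun V y [WS 2 (Cst n) (candof n)] u)" using J unfolding J_def by (simp add: less_Suc_eq)
  qed
  thus ?thesis unfolding J_def .
qed

lemma pos: "R > 0" "G > 0" "ng > 0" "m > 0"
proof -
  show "R > 0" using z by simp
  thus "ng > 0" "m > 0" using Rm by (simp_all add: m)
qed (rule G0)

lemma candof_range: "n < nc ==> wev V W (candof n) \<le> N"
proof -
  assume n: "n < nc"
  have dm: "a < b * c ==> a div c < b" for a b c :: nat by (simp add: less_mult_imp_div_less)
  have "n div q2 div q1 div ng div G div R < Y" using n unfolding nc_def by (intro dm)
  thus ?thesis unfolding candof_def using candexp_value[of "n div q2 div q1 div ng div G div R" "n div q2 div q1 div ng div G mod R"
      "n div q2 div q1 div ng mod G" "n div q2 div q1 mod ng" W "n div q2 mod q1" "n mod q2"] pos cand_le by simp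
qed

lemma candof_index:
  assumes "y < Y" "v < R" "x < G" "a < ng" "c < q1" "c' < q2"
  shows "\<exists>n<nc. candof n = candexp y v x a c c'" proof -
  have step: "p * b + q < a * b" if "p < a" "q < b" for p q a b :: nat proof -
    have "Suc p * b \<le> a * b" using that by (intro mult_le_mono1) simp
    thus ?thesis using that by simp
  qed
  define n where "n = ((((y * R + v) * G + x) * ng + a) * q1 + c) * q2 + c'"
  have "n < nc" unfolding n_def nc_def by (intro step assms)
  moreover have dm: "(p * b + q) div b = p" "(p * b + q) mod b = q" if "q < b" for p q b :: nat using that by auto
  have "candof n = candexp y v x a c c'" unfolding candof_def n_def
    by (simp only: dm[OF assms(6)] dm[OF assms(5)] dm[OF assms(4)] dm[OF assms(3)] dm[OF assms(2)])
  ultimately show ?thesis by blast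
qed

text \<open>A message is misread only if at least s8 / 4 of its bits are wrong. If each layer had
  more than \<open>z\<close> misread messages, there would be Y * (z + 1) * s8 / 4 wrong bits; so
  some layer meets the hypothesis of \<open>item_found\<close>.\<close>

theorem prog_correct:
  assumes W: "\<forall>q. wm st 5 q \<le> 1"
  shows "\<And>c. c < nc ==> wm (crun V yv prog st) 2 c \<le> N"
    and "\<And>i. i < N ==> 4 * card {e. e < Y * R * s \<and> (wm st 5 (e * B + h e i) = 1) \<noteq> bt e i} < Y * (z + 1) * s8 ==>
      \<exists>c<nc. wm (crun V yv prog st) 2 c = Suc i"
proof -
  define s1 where "s1 = crun V yv decodes st"
  define s2 where "s2 = crun V yv finds s1"
  have s2: "crun V yv prog st = s2" unfolding prog_def s1_def s2_def by simp
  note e1 = decodes_effect[OF s1_def] and e2 = finds_effect[OF s2_def]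
  have c2: "wm s2 2 n = wev V (wm s1) (candof n)" if "n < nc" for n using e2 that by blast
  show "wm (crun V yv prog st) 2 c \<le> N" if "c < nc" for c unfolding s2 c2[OF that] by (rule candof_range[OF that])
  fix i assume i: "i < N" and bad: "4 * card {e. e < Y * R * s \<and> (wm st 5 (e * B + h e i) = 1) \<noteq> bt e i} < Y * (z + 1) * s8"
  define wr where "wr e \<longleftrightarrow> (wm st 5 (e * B + h e i) = 1) \<noteq> bt e i" for e
  define nb where "nb w = card {r. r < s \<and> wr (w * s + r)}" for w
  let ?M = "\<lambda>y. {v. v < R \<and> mem (wm s1) y v (g (y * R + v) i) \<noteq> lmsg y v i}"
  let ?L = "\<lambda>y. {v. v < R \<and> s8 \<le> 4 * nb (y * R + v)}"
  let ?N = "{w. w < Y * R \<and> s8 \<le> 4 * nb w}"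
  have decoded: "mem (wm s1) y v (g (y * R + v) i) = lmsg y v i" if y: "y < Y" and v: "v < R" and n: "4 * nb (y * R + v) < s8" for y v proof -
    define w where "w = y * R + v"
    define x where "x = g w i"
    have x: "x < G" unfolding x_def by (rule g_less)
    have wl: "w < Y * R" proof -
      have "Suc y * R \<le> Y * R" using y by (intro mult_le_mono1) simp
      thus ?thesis unfolding w_def using v by simp
    qed
    have W1: "\<And>q. wm st 5 q \<le> 1" using W by blast
    let ?D = "{r. r < s \<and> digit 2 r (wev V (wm st) (bitsexp (w * G + x))) \<noteq> bitof (lmsg y v i) r}"
    let ?b = "(wev V (wm st) (bitsexp (w * G + x)))"
    have "mem (wm s1) y v x = dec ?b" using e1 mem_index[OF y v x] unfolding mem_def w_def by blast
    also have "\<dots> = lmsg y v i"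
    proof (rule dec_correct[OF lmsg_less])
      have "?D \<subseteq> {r. r < s \<and> wr (w * s + r)}"
      proof
        fix r assume "r \<in> ?D"
        hence r: "r < s" and ne: "digit 2 r ?b \<noteq> bitof (lmsg y v i) r" by auto
        have q: "(w * s + r) div s = w" "(w * s + r) mod s = r" "w div R = y" "w mod R = v" using r v unfolding w_def by auto
        have hh: "h (w * s + r) i = H (w * s + r) x" unfolding h_def q x_def ..
        have dg: "digit 2 r ?b = wm st 5 ((w * s + r) * B + H (w * s + r) x)"
          by (rule bitsexp_digit[OF wl x r]) (rule W1)
        have b2: "bitof (lmsg y v i) r < 2" unfolding bitof_def by (rule digit_less) simp
        have "bt (w * s + r) i \<longleftrightarrow> bitof (lmsg y v i) r = 1" unfolding bt_def q ..
        hence "wr (w * s + r)" unfolding wr_def hh using ne W1[of "(w * s + r) * B + H (w * s + r) x"] b2 unfolding dg by linarith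
        thus "r \<in> {r. r < s \<and> wr (w * s + r)}" using r by simp
      qed
      hence "card ?D \<le> nb w"
        unfolding nb_def by (intro card_mono) auto
      thus "4 * card ?D < s8"
        using n unfolding w_def by linarith
    qed
    finally show ?thesis unfolding x_def w_def .
  qed
  have "\<exists>y<Y. card (?M y) \<le> z"
  proof (rule ccontr)
    assume "\<not> ?thesis"
    hence big: "z + 1 \<le> card (?M y)" if "y < Y" for y using that by force
    have "card {e. e < Y * R * s \<and> wr e} = (\<Sum>w<Y * R. nb w)" unfolding nb_def by (rule card_blocks)
    have "Y * (z + 1) = (\<Sum>y<Y. z + 1)" by simp
    also have "\<dots> \<le> (\<Sum>y<Y. card (?L y))"
    proof (rule sum_mono)
      fix y assume "y \<in> {..<Y}"
      hence y: "y < Y" by simp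
      have "(?M y) \<subseteq> (?L y)"
        using decoded[OF y] by (auto simp: not_less[symmetric])
      hence "card (?M y) \<le> card (?L y)"
        by (intro card_mono) auto
      thus "z + 1 \<le> card (?L y)" using big[OF y] by linarith
    qed
    also have "\<dots> = card ?N" by (rule card_blocks[symmetric])
    finally have "Y * (z + 1) * s8 \<le> card ?N * s8" by (rule mult_le_mono1)
    also have "\<dots> = (\<Sum>w\<in>?N. s8)" by simp
    also have "\<dots> \<le> (\<Sum>w\<in>?N. 4 * nb w)" by (intro sum_mono) auto
    also have "\<dots> \<le> (\<Sum>w<Y * R. 4 * nb w)" by (intro sum_mono2) auto
    also have "\<dots> = 4 * card {e. e < Y * R * s \<and> wr e}"
      unfolding \<open>card {e. e < Y * R * s \<and> wr e} = (\<Sum>w<Y * R. nb w)\<close> by (simp add: sum_distrib_left)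
    finally show False using bad unfolding wr_def by linarith
  qed
  then obtain y where y: "y < Y" "card (?M y) \<le> z" by blast
  have "\<exists>v<R. \<exists>a<ng. \<exists>c<q1. \<exists>c'<q2. cand (mem (wm s1) y) v (g (y * R + v) i) a c c' = Suc i"
    by (rule item_code.item_found[OF item_code_layer i, of "mem (wm s1) y" y])
      (use y(2) in \<open>simp add: item_code.msg_def[OF item_code_layer] lmsg_def\<close>)
  then obtain v a c c' where f: "v < R" "a < ng" "c < q1" "c' < q2" "cand (mem (wm s1) y) v (g (y * R + v) i) a c c' = Suc i" by blast
  obtain n where n: "n < nc" "candof n = candexp y v (g (y * R + v) i) a c c'" using candof_index[OF y(1) f(1) g_less f(2-4)] by blast
  have "wm s2 2 n = Suc i" unfolding c2[OF n(1)] n(2) candexp_value[OF y(1) f(1) g_less f(2)] by (rule f(5))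
  thus "\<exists>c<nc. wm (crun V yv prog st) 2 c = Suc i" unfolding s2 using n(1) by blast
qed

lemma prog_frame: "(\<forall>a. a \<notin> {1, 2, 6} --> wm (crun V y prog st) a = wm st a) \<and> rm (crun V y prog st) = rm st \<and> om (crun V y prog st) = om st"
  using decodes_effect[OF refl, of y st] finds_effect[OF refl, of y "crun V y decodes st"] unfolding prog_def by simp

lemma prog_size:
  assumes Q: "24 * s8 + 5 \<le> Q" "ng * (2 * (m * L * (5 * l + 7)) + 6) + 5 \<le> Q" and c: "c \<in> set prog"
  shows "cok V c \<and> csize c \<le> Q" proof -
  have b: "wsize (bitsexp n) \<le> s * 3 + 1" "wok (bitsexp n)" for n proof -
    have "wsize (bitsexp n) \<le> length (map (\<lambda>r. Ld 5 (Cst ((n div G * s + r) * B + H (n div G * s + r) (n mod G)))) [0..<s]) * (2 + 1) + 1"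
      unfolding bitsexp_def by (rule wsize_ench) simp
    thus "wsize (bitsexp n) \<le> s * 3 + 1" by simp
    show "wok (bitsexp n)" unfolding bitsexp_def by (rule wok_ench) simp
  qed
  have cl: "wsize (claimexp y v x u j) \<le> 5 * l + 6" "wok (claimexp y v x u j)" for y v x u j
    using words_in[of j v u] by (auto simp: claimexp_def walkexp_size intro!: walkexp_ok)
  have cs: "wsize (claimsexp y v x a) \<le> m * L * (5 * l + 7) + 1" "wok (claimsexp y v x a)" for y v x a proof -
    have "wsize (claimsexp y v x a) \<le> length (map (\<lambda>q. claimexp y v x (a * m + q div L) (q mod L)) [0..<m * L]) * ((5 * l + 6) + 1) + 1"
      unfolding claimsexp_def by (rule wsize_ench) (use cl(1) in auto)
    thus "wsize (claimsexp y v x a) \<le> m * L * (5 * l + 7) + 1" by (simp add: add.commute)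
    show "wok (claimsexp y v x a)" unfolding claimsexp_def by (rule wok_ench) (use cl(2) in auto)
  qed
  define q where "q = 2 * (m * L * (5 * l + 7)) + 5"
  have se: "wsize (selectexp y v x a c a') \<le> q" "wok (selectexp y v x a c a')" for y v x a c a'
    using cs(1)[of y v x a] cs(1)[of y v x a'] cs(2) unfolding selectexp_def q_def by simp_all
  have ca: "wsize (candof n) \<le> ng * (q + 1) + 3" "wok (candof n)" for n proof -
    have "wsize (ench M0 (map (selectexp y v x a c) [0..<ng])) \<le> length (map (selectexp y v x a c) [0..<ng]) * (q + 1) + 1" for y v x a c
      by (rule wsize_ench) (use se(1) in auto)
    thus "wsize (candof n) \<le> ng * (q + 1) + 3" unfolding candof_def candexp_def by simp
    show "wok (candof n)" unfolding candof_def candexp_def wok_fn1 by (rule wok_ench) (use se(2) in auto)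
  qed
  have "(\<exists>n. c = WS 1 (Cst n) (fn1 dec (bitsexp n))) \<or> (\<exists>n. c = WS 2 (Cst n) (candof n))"
    using c unfolding prog_def decodes_def finds_def by auto
  thus ?thesis
  proof (elim disjE exE)
    fix n assume e: "c = WS 1 (Cst n) (fn1 dec (bitsexp n))"
    have "csize c \<le> s * 3 + 5" unfolding e using b(1)[of n] by simp
    also have "s * 3 + 5 \<le> Q" using Q(1) unfolding s_def by simp
    finally show ?thesis using b(2)[of n] unfolding e by simp
  next
    fix n assume e: "c = WS 2 (Cst n) (candof n)"
    have "csize c \<le> ng * (q + 1) + 5" unfolding e using ca(1)[of n] by simp
    also have "ng * (q + 1) + 5 \<le> Q" using Q(2) unfolding q_def by (simp add: add.commute)
    finally show ?thesis using ca(2)[of n] unfolding e by simp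
  qed
qed

end

text \<open>The condition on \<open>B\<close> is hardest for sets of size \<open>K\<close>, the one
  on \<open>N\<close> for single items; taking both extremes, one number \<open>x\<close> serves all
  sizes.\<close>

lemma expanding_family_exists:
  fixes N K B d :: nat and \<eta> x :: real and g :: "nat => nat => nat"
  assumes \<eta>: "\<eta> > 0" and N: "N > 0" and K: "K > 0" and x: "exp 1 \<le> x" "x \<le> \<eta> * B / (2 * real K)"
    and l: "ln (4 * exp 1 * N) \<le> \<eta> * d / 2 * ln x"
  shows "\<exists>h. (\<forall>e x. h e x < B) \<and> (\<forall>S\<subseteq>{..<N}. card S \<le> K -->
     (\<Sum>e<d. real (card (g e ` S))) - \<eta> * d * card S \<le> (\<Sum>e<d. real (card (h e ` g e ` S))))"
proof (rule expanding_hash_exists[OF \<eta>])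
  have x0: "x > 0" using x(1) less_le_trans[OF exp_gt_zero] by blast
  hence "\<eta> * B / (2 * real K) > 0" using x(2) by linarith
  thus "B > 0" using \<eta> by (cases "B = 0") auto
  fix s :: nat assume s: "1 \<le> s" "s \<le> K"
  have "\<eta> * B / (2 * real K) \<le> \<eta> * B / (2 * real s)" using s \<eta> by (intro divide_left_mono) auto
  hence xs: "x \<le> \<eta> * B / (2 * real s)" using x(2) by linarith
  have "4 * exp 1 * real N / real s \<le> 4 * exp 1 * N / 1" using s N by (intro divide_left_mono) auto
  hence "ln (4 * exp 1 * N / real s) \<le> ln (4 * exp 1 * N)" using s N by (intro ln_mono) auto
  also have "\<dots> \<le> \<eta> * d / 2 * ln x" by (rule l)
  also have "\<dots> \<le> \<eta> * d / 2 * ln (\<eta> * B / (2 * real s))" using xs x0 \<eta> by (intro mult_left_mono ln_mono) auto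
  finally show "exp 1 \<le> \<eta> * B / (2 * real s) \<and> ln (4 * exp 1 * N / real s) \<le> \<eta> * d / 2 * ln (\<eta> * B / (2 * real s))"
    using xs x(1) by linarith
qed

lemma expander_exists:
  fixes N K B d :: nat and \<eta> x :: real
  assumes "\<eta> > 0" "N > 0" "K > 0" "exp 1 \<le> x" "x \<le> \<eta> * B / (2 * real K)" "ln (4 * exp 1 * N) \<le> \<eta> * d / 2 * ln x"
  shows "\<exists>h. (\<forall>e x. h e x < B) \<and> expanding N K \<eta> d h"
  using expanding_family_exists[OF assms, of "\<lambda>_ x. x"] unfolding expanding_def by (auto simp: algebra_simps)

text \<open>The losses of the two stages add up: \<eta> / 2 for the addresses and \<eta> / 2 for the
  buckets.\<close>

lemma expanding_compose:
  fixes n s :: nat and \<eta> :: real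
  assumes g: "expanding N K (\<eta> / 2) n g"
    and H: "\<And>S. S \<subseteq> {..<N} ==> card S \<le> K ==> (\<Sum>e<n * s. real (card (g (e div s) ` S))) - \<eta> / 2 * (n * s) * card S \<le>
      (\<Sum>e<n * s. real (card (H e ` g (e div s) ` S)))"
  shows "expanding N K \<eta> (n * s) (\<lambda>e i. H e (g (e div s) i))" unfolding expanding_def
proof (intro allI impI)
  fix S :: "nat set" assume S: "S \<subseteq> {..<N}" "card S \<le> K"
  have "(\<Sum>e<n * s. f (e div s)) = s * (\<Sum>w<n. f w)" for f :: "nat => real"
  proof (induction n)
    case (Suc n)
    have "{..<Suc n * s} = {..<n * s} \<union> (\<lambda>r. n * s + r) ` {..<s}"
    proof (intro equalityI subsetI)
      fix e assume "e \<in> {..<Suc n * s}"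
      thus "e \<in> {..<n * s} \<union> (\<lambda>r. n * s + r) ` {..<s}" by (cases "e < n * s") (auto intro!: image_eqI[of _ _ "e - n * s"])
    qed auto
    moreover have "(\<Sum>e\<in>{..<n * s} \<union> (\<lambda>r. n * s + r) ` {..<s}. f (e div s)) =
       (\<Sum>e<n * s. f (e div s)) + (\<Sum>e\<in>(\<lambda>r. n * s + r) ` {..<s}. f (e div s))" by (rule sum.union_disjoint) auto
    moreover have "(\<Sum>e\<in>(\<lambda>r. n * s + r) ` {..<s}. f (e div s)) = (\<Sum>r<s. f n)" by (subst sum.reindex) (auto simp: inj_on_def)
    ultimately show ?case using Suc by (simp add: algebra_simps)
  qed simp
  hence "(\<Sum>e<n * s. real (card (g (e div s) ` S))) = s * (\<Sum>w<n. real (card (g w ` S)))" .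
  moreover have "real s * ((1 - \<eta> / 2) * n * card S) \<le> s * (\<Sum>w<n. real (card (g w ` S)))"
    using expandingD[OF g S] by (intro mult_left_mono) auto
  ultimately have "real s * ((1 - \<eta> / 2) * n * card S) - \<eta> / 2 * (n * s) * card S \<le> (\<Sum>e<n * s. real (card (H e ` g (e div s) ` S)))"
    using H[OF S] by linarith
  moreover have "real s * ((1 - \<eta> / 2) * n * card S) - \<eta> / 2 * (n * s) * card S = (1 - \<eta>) * (n * s) * card S"
    by (simp add: algebra_simps)
  ultimately show "(1 - \<eta>) * real (n * s) * card S \<le> (\<Sum>e<n * s. real (card ((\<lambda>i. H e (g (e div s) i)) ` S)))"
    by (simp add: image_image)
qed

context layered
begin

theorem layered_system:
  fixes k Hh J Q n wb :: nat and \<eta> \<epsilon> \<theta> :: real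
  assumes ex: "expanding N (6 * k) \<eta> (Y * R * s) h" and k: "0 < k" "2 * k \<le> N" and \<theta>: "0 < \<theta>" "\<theta> \<le> 1/2" "32 * \<theta> * R \<le> z + 1"
    and \<eta>: "0 \<le> \<eta>" "128 * \<eta> \<le> \<epsilon> * \<theta>" and \<epsilon>: "0 < \<epsilon>" "\<epsilon> \<le> 1"
    and J: "(4 * real k + 1) * (1/4) ^ J \<le> \<epsilon> / 4" and Hh: "N < 2 ^ Hh"
    and Vd: "2 * (Y * R * s) * B < V" "2 * 2 ^ Hh \<le> V" "k < V" "Y * R * s * (Y * R * s) < V"
    and Q: "24 * s8 + 5 \<le> Q" "ng * (2 * (m * L * (5 * l + 7)) + 6) + 5 \<le> Q" "6 * (Y * R * s) + 40 \<le> Q" "Q \<le> V"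
    and n: "(2 * (Y * R * s) * B + J * ((Y * R * s) * B + (Y * R * G + nc) +
       (nc + k) * ((Y * R * s) * (Y * R * s) + 2 * (Y * R * s) + 4 + 2 * Hh) + k * (3 + 2 * Hh) + 2 * (k * (2 + 2 * (Y * R * s))) + 2 * (nc + k) + k) + k) * Q \<le> n"
    and wb: "8 * (n + 2) + n * (V * V) + 16 * V + 64 < 2 ^ wb"
  shows "\<exists>\<Phi> A. sparse_recovery_system N k \<epsilon> \<Phi> interpreter A (40 * n + 8) \<and> word_bits A = wb \<and> dim_row \<Phi> = 2 * (Y * R * s) * B"
proof -
  define d where "d = Y * R * s"
  have s0: "s > 0" unfolding s_def using s8 by simp
  have d0: "d > 0" unfolding d_def using Y pos s0 by simp
  have B0: "B > 0" using H_less[of 0 0] by simp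
  have dc: "decoder N k d B Hh V nc h bt prog \<theta> y" for y
  proof
    show "h e i < B" for e i unfolding h_def by (rule H_less)
    show "2 * d * B < V" "d * d < V" unfolding d_def using Vd by simp_all
    show "nc < V" unfolding nc_def by (rule V(9))
    show "(\<forall>a. a \<notin> {1, 2, 6} --> wm (crun V y prog st) a = wm st a) \<and> rm (crun V y prog st) = rm st \<and> om (crun V y prog st) = om st" for st
      by (rule prog_frame)
    show "wm (crun V y prog st) 2 c \<le> N" if "\<forall>q. wm st 5 q \<le> 1" "c < nc" for st c by (rule prog_correct(1)[OF that])
    show "\<exists>c<nc. wm (crun V y prog st) 2 c = Suc i" if W: "\<forall>q. wm st 5 q \<le> 1" and i: "i < N"
      and bad: "real (card {e. e < d \<and> (wm st 5 (e * B + h e i) = 1) \<noteq> bt e i}) < \<theta> * d" for st i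
    proof (rule prog_correct(2)[OF W i])
      define c where "c = card {e. e < d \<and> (wm st 5 (e * B + h e i) = 1) \<noteq> bt e i}"
      have "4 * real c < 4 * (\<theta> * d)" using bad unfolding c_def by simp
      \<comment> \<open>Four times a fraction \<theta> of the d = Y * R * 8 * s8 bits; the
        hypothesis 32 * \<theta> * R \<le> z + 1 is tailored to this product.\<close>
      also have "\<dots> = (32 * \<theta> * R) * (Y * s8)" unfolding d_def s_def by simp
      also have "\<dots> \<le> real (z + 1) * real (Y * s8)" using \<theta>(3) by (intro mult_right_mono) auto
      finally have "real (4 * c) < real (Y * (z + 1) * s8)" by (simp add: algebra_simps)
      hence "4 * c < Y * (z + 1) * s8" by (simp only: of_nat_less_iff)
      thus "4 * card {e. e < Y * R * s \<and> (wm st 5 (e * B + h e i) = 1) \<noteq> bt e i} < Y * (z + 1) * s8" unfolding c_def d_def .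
    qed
  qed (use d0 B0 Hh Vd in auto)
  interpret dec: decoder N k d B Hh V nc h bt prog \<theta> "vec 0 (\<lambda>_. 0)" by (rule dc)
  have "min \<theta> (1/2) = \<theta>" using \<theta> by simp
  hence \<eta>': "128 * \<eta> \<le> \<epsilon> * min \<theta> (1/2)" using \<eta> by simp
  have good: "list_all (dec.good Q) prog" unfolding list_all_iff dec.good_def using prog_size[OF Q(1,2)] by blast
  have len: "length (dec.program J) * Q \<le> n" unfolding dec.length_program dec.length_round length_prog by (rule n[folded d_def])
  have Q3: "6 * d + 40 \<le> Q" unfolding d_def by (rule Q(3))
  show ?thesis using dec.recovery_system[OF dc _ k \<theta>(1) \<eta>(1) \<eta>' \<epsilon> J good Q3 Q(4) len wb] ex unfolding d_def by blast
qed

end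

section \<open>Choice of the parameters\<close>

text \<open>If the range of a hash function is at least the square of the factor divided out for
  collisions, at least its square root remains, and the logarithm in the expansion condition is half
  of ln g.\<close>

lemma sqrt_le_ratio: "0 < T ==> T \<le> sqrt g ==> 0 \<le> g ==> sqrt g \<le> g / T" for T g :: real
proof -
  assume a: "0 < T" "T \<le> sqrt g" "0 \<le> g"
  have "sqrt g * T \<le> sqrt g * sqrt g" using a by (intro mult_left_mono) auto
  thus ?thesis using a by (simp add: pos_le_divide_eq)
qed

text \<open>With x = 8 * D * K / s, the number 4 * exp 1 * R / s is at most x ^ 4 whatever
  \<open>K\<close> is. As \<eta> * D / 2 = D / 8, degree 32 is enough for every size.\<close>

lemma link_exists:
  fixes D K :: nat
  assumes D: "32 \<le> D" and K: "K > 0"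
  shows "\<exists>link. (\<forall>r v. link r v < 64 * D * K) \<and> expanding (D * (64 * D * K)) K (1/4) D link"
proof (rule expanding_exists)
  show "(0::real) < 1/4" by simp
  show "64 * D * K > 0" using D K by simp
  fix s :: nat assume s: "1 \<le> s" "s \<le> K"
  define x where "x = (1/4::real) * real (64 * D * K) / (2 * real s)"
  have "1 \<le> real K / real s" using s by simp
  hence "8 * real D * 1 \<le> 8 * real D * (K / s)" by (intro mult_left_mono) auto
  hence x: "8 * real D \<le> x" unfolding x_def by (simp add: field_simps)
  have D': "32 \<le> real D" using D by simp
  have x0: "256 \<le> x" using x D' by linarith
  have e: "exp 1 \<le> (3::real)" by (rule exp_le)
  have "4 * exp 1 * real (D * (64 * D * K)) / real s = 4 * exp 1 * (8 * real D * x)" unfolding x_def using s by (simp add: field_simps)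
  also have "\<dots> \<le> 4 * 3 * (8 * real D * x)" using e x0 by (intro mult_right_mono mult_left_mono) auto
  also have "\<dots> \<le> 4 * 3 * (x * x)" using x x0 by (intro mult_left_mono mult_right_mono) auto
  also have "\<dots> \<le> x * (x * x)" using x0 by (intro mult_right_mono) auto
  also have "\<dots> \<le> x ^ 4" proof -
    have "x ^ 3 \<le> x ^ 4" using x0 by (intro power_increasing) auto
    thus ?thesis by (simp add: power3_eq_cube)
  qed
  finally have b: "4 * exp 1 * real (D * (64 * D * K)) / real s \<le> x ^ 4" .
  have "0 < 4 * exp 1 * real (D * (64 * D * K)) / real s" using D K s by simp
  hence "ln (4 * exp 1 * real (D * (64 * D * K)) / real s) \<le> ln (x ^ 4)" using b by (intro ln_mono) auto
  also have "\<dots> = 4 * ln x" using x0 by (simp add: ln_realpow)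
  also have "\<dots> \<le> 1/4 * real D / 2 * ln x" using D' x0 by (intro mult_right_mono) auto
  finally show "exp 1 \<le> 1/4 * real (64 * D * K) / (2 * real s) \<and>
     ln (4 * exp 1 * real (D * (64 * D * K)) / real s) \<le> 1/4 * real D / 2 * ln (1/4 * real (64 * D * K) / (2 * real s))"
    using e x0 unfolding x_def by linarith
qed

text \<open>Walks reach K = (D / 4) ^ l = Lm ^ (b - 1) nodes, and there are D ^ l = Lm * K of them;
  hence lists of length 2 * Lm. With Lm ^ 2 groups, z = K and R = 64 * D ^ 2 * K, the tolerated
  fraction of wrong bits is \<theta> = 1 / (2048 * D ^ 2), and 262144 = 128 * 2048 links it to
  \<eta>.\<close>

locale parameters =
  fixes b l N k G M0 F Y s8 B V Hh J Q n wb :: nat and \<eta> \<epsilon> xg :: real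
  fixes D Lm R m q1 nc d :: nat
  defines "D \<equiv> 4 ^ b" and "Lm \<equiv> 4 ^ l"
  defines "R \<equiv> 64 * D ^ 2 * (Lm ^ (b - 3) * Lm ^ 2)" and "m \<equiv> 64 * D ^ 2 * Lm ^ (b - 3)" and "q1 \<equiv> 1024 * D ^ 2 * Lm"
  defines "nc \<equiv> Y * R * G * Lm ^ 2 * q1 * (1024 * D ^ 2)" and "d \<equiv> Y * R * (8 * s8)"
  assumes b: "4 \<le> b" and l: "b + 3 \<le> l" and k: "0 < k" "2 * k \<le> N" and \<epsilon>: "0 < \<epsilon>" "\<epsilon> \<le> 1"
    and \<eta>: "\<eta> > 0" "262144 * D ^ 2 * \<eta> \<le> \<epsilon>" and Ys: "Y > 0" "s8 > 0"
    and sym: "1024 * real D ^ 2 * (real q1 + 1) \<le> sqrt G" "ln (4 * exp 1 * (real M0 * real F ^ (Lm ^ 2))) \<le> real Lm ^ (b - 3) / 32 * ln G"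
    and phi: "4 * (2 ^ 20 * real D ^ 4 * Lm) * exp (1 + 2 * (2 ^ 20 * real D ^ 4 / Lm) * ln (4 * exp 1 * M0)) \<le> F"
    and core: "2048 * real D ^ 2 * (1024 * real D ^ 2 + 1) \<le> sqrt M0" "4096 * real D ^ 2 * ln (4 * exp 1 * N) \<le> real Lm ^ 2 * ln M0"
    and ecc: "4 * ln (4 * exp 1 * real (G ^ Suc D)) \<le> s8"
    and g: "exp 1 \<le> xg" "24 * k * xg \<le> \<eta> * G" "4 * ln (4 * exp 1 * N) \<le> \<eta> * (Y * R) * ln xg"
    and H: "24 * exp 1 * k \<le> \<eta> * B" "4 * ln (4 * exp 1 * N) \<le> \<eta> * d"
    and J: "(4 * real k + 1) * (1/4) ^ J \<le> \<epsilon> / 4" and Hh: "N < 2 ^ Hh"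
    and V: "2 ^ (8 * s8) \<le> V" "Y * R * G < V" "G ^ Suc D \<le> V" "G ^ (m * (2 * Lm)) \<le> V" "M0 ^ (Lm ^ 2) \<le> V" "F \<le> V"
      "2 * d * B < V" "nc < V" "2 * 2 ^ Hh \<le> V" "k < V" "d * d < V"
    and Q: "24 * s8 + 5 \<le> Q" "Lm ^ 2 * (2 * (m * (2 * Lm) * (5 * l + 7)) + 6) + 5 \<le> Q" "6 * d + 40 \<le> Q" "Q \<le> V"
    and n: "(2 * d * B + J * (d * B + (Y * R * G + nc) +
       (nc + k) * (d * d + 2 * d + 4 + 2 * Hh) + k * (3 + 2 * Hh) + 2 * (k * (2 + 2 * d)) + 2 * (nc + k) + k) + k) * Q \<le> n"
    and wb: "8 * (n + 2) + n * (V * V) + 16 * V + 64 < 2 ^ wb"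
begin

lemma D_large: "256 \<le> D"
proof -
  have "(4::nat) ^ 4 \<le> 4 ^ b" using b by (intro power_increasing) auto
  thus ?thesis unfolding D_def by simp
qed

lemma Lm_mult: "Lm = 64 * D * 4 ^ (l - b - 3)"
proof -
  have "l = 3 + b + (l - b - 3)" using l by simp
  hence "(4::nat) ^ l = 4 ^ 3 * 4 ^ b * 4 ^ (l - b - 3)" by (metis power_add)
  thus ?thesis unfolding Lm_def D_def by simp
qed

lemma Lm_pos: "Lm > 0" unfolding Lm_def by simp

lemma item_code_exists:
  "\<exists>link sym phi core. \<forall>g. (\<forall>v i. g v i < G) --> item_code R D (64 * D * (Lm ^ (b - 3) * Lm ^ 2)) (Lm ^ (b - 3) * Lm ^ 2) l link
     N G m (Lm ^ 2) (2 * Lm) M0 F q1 (1024 * D ^ 2) (Lm ^ (b - 3) div 4) (Lm ^ 2 div (512 * D ^ 2)) (Lm ^ (b - 3) * Lm ^ 2)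
     (1 / (512 * real D ^ 2)) (1 / (2 ^ 20 * real D ^ 4 * Lm)) (1 / (1024 * real D ^ 2)) sym phi core g"
proof -
  let ?t2 = "(Lm ^ 2 div (512 * D ^ 2))"
  define P where "P = Lm ^ (b - 3)"
  define K where "K = P * Lm ^ 2"
  have D0: "0 < D" "32 \<le> D" using D_large by simp_all
  have L0: "0 < Lm" by (rule Lm_pos)
  have P0: "0 < P" unfolding P_def using L0 by simp
  have K0: "0 < K" unfolding K_def using P0 L0 by simp
  have rD: "0 < real D" "0 < real Lm" using D0 L0 by simp_all
  obtain link where link: "\<forall>r v. link r v < 64 * D * K" "expanding (D * (64 * D * K)) K (1/4) D link" using link_exists[OF D0(2) K0] by blast
  have RK: "R = D * (64 * D * K)" unfolding R_def K_def P_def by (simp add: power2_eq_square)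
  have N0: "N > 0" "M0 > 0" "F > 0" "G > 0" proof -
    show "N > 0" using k by simp
    have "0 < 2048 * real D ^ 2 * (1024 * real D ^ 2 + 1)" using rD by (simp add: add_pos_pos)
    hence "0 < sqrt M0" using core(1) by linarith
    thus "M0 > 0" by (cases "M0 = 0") auto
    have "0 < 4 * (2 ^ 20 * real D ^ 4 * Lm) * exp (1 + 2 * (2 ^ 20 * real D ^ 4 / Lm) * ln (4 * exp 1 * M0))" using rD by simp
    hence "0 < real F" using phi by linarith
    thus "F > 0" by simp
    have "0 < 1024 * real D ^ 2 * (real q1 + 1)" using rD by (simp add: add_nonneg_pos)
    hence "0 < sqrt G" using sym(1) by linarith
    thus "G > 0" by (cases "G = 0") auto
  qed
  have big: "exp 1 \<le> c" if "3 \<le> c" for c :: real using that exp_le by linarith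
  have D1: "1 \<le> real D ^ 2" using D0 by simp
  have m8: "1 / (512 * real D ^ 2) * real m = real P / 8" unfolding m_def P_def using rD by (simp add: field_simps)
  have "\<exists>sym. (\<forall>p c. sym p c < G) \<and> expanding (M0 * F ^ Lm ^ 2) (q1 + 1) (1 / (512 * real D ^ 2)) m sym"
  proof (rule expander_exists[where x = "sqrt G"])
    have "1024 * 1 * 1 \<le> 1024 * real D ^ 2 * (real q1 + 1)" using D1 by (intro mult_mono) auto
    thus "exp 1 \<le> sqrt G" using sym(1) by (intro big) linarith
    have "0 < 1024 * real D ^ 2 * (real q1 + 1)" using rD by (simp add: add_nonneg_pos)
    from sqrt_le_ratio[OF this sym(1)] have "sqrt G \<le> real G / (1024 * real D ^ 2 * (real q1 + 1))" by simp
    also have "\<dots> = 1 / (512 * real D ^ 2) * real G / (2 * real (q1 + 1))" by (simp add: algebra_simps)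
    finally show "sqrt G \<le> 1 / (512 * real D ^ 2) * real G / (2 * real (q1 + 1))" .
    have ls: "ln (sqrt G) = ln G / 2" using N0 by (simp add: ln_sqrt)
    show "ln (4 * exp 1 * real (M0 * F ^ Lm ^ 2)) \<le> 1 / (512 * real D ^ 2) * real m / 2 * ln (sqrt G)"
      unfolding m8 ls using sym(2) unfolding P_def by simp
  qed (use rD N0 in auto)
  then obtain sm where sm: "\<forall>p c. sm p c < G" "expanding (M0 * F ^ Lm ^ 2) (q1 + 1) (1 / (512 * real D ^ 2)) m sm" by blast
  define et2 where "et2 = 1 / (2 ^ 20 * real D ^ 4 * Lm)"
  have e2: "et2 > 0" unfolding et2_def using rD by simp
  have "\<exists>ph. (\<forall>a c. ph a c < F) \<and> expanding M0 2 et2 (Lm ^ 2) ph"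
  proof (rule expander_exists[where x = "exp (1 + 2 * (2 ^ 20 * real D ^ 4 / Lm) * ln (4 * exp 1 * M0))"])
    define X where "X = 2 * (2 ^ 20 * real D ^ 4 / Lm) * ln (4 * exp 1 * M0)"
    have "1 \<le> 4 * exp 1 * real M0" proof -
      have "1 \<le> exp (1::real)" by simp
      hence "1 \<le> 4 * exp (1::real)" by linarith
      hence "1 * 1 \<le> (4 * exp 1) * real M0" using N0 by (intro mult_mono) auto
      thus ?thesis by simp
    qed
    hence l0: "0 \<le> ln (4 * exp 1 * real M0)" by simp
    hence X0: "0 \<le> X" unfolding X_def by simp
    show "exp 1 \<le> exp (1 + 2 * (2 ^ 20 * real D ^ 4 / Lm) * ln (4 * exp 1 * M0))" using X0 unfolding X_def by simp
    show "exp (1 + 2 * (2 ^ 20 * real D ^ 4 / Lm) * ln (4 * exp 1 * M0)) \<le> et2 * real F / (2 * real 2)"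
      using phi rD unfolding et2_def by (simp add: field_simps)
    have "et2 * real (Lm ^ 2) / 2 * X = ln (4 * exp 1 * real M0)" unfolding X_def et2_def using rD by (simp add: field_simps power2_eq_square)
    hence "ln (4 * exp 1 * real M0) \<le> et2 * real (Lm ^ 2) / 2 * (1 + X)" using e2 by (simp add: distrib_left)
    thus "ln (4 * exp 1 * real M0) \<le> et2 * real (Lm ^ 2) / 2 * ln (exp (1 + 2 * (2 ^ 20 * real D ^ 4 / Lm) * ln (4 * exp 1 * M0)))"
      unfolding X_def by simp
  qed (use e2 N0 in auto)
  then obtain ph where ph: "\<forall>a c. ph a c < F" "expanding M0 2 et2 (Lm ^ 2) ph" by blast
  define et3 where "et3 = 1 / (1024 * real D ^ 2)"
  have e3: "et3 > 0" unfolding et3_def using rD by simp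
  have "\<exists>co. (\<forall>a c. co a c < M0) \<and> expanding N (1024 * D ^ 2 + 1) et3 (Lm ^ 2) co"
  proof (rule expander_exists[where x = "sqrt M0"])
    have "2048 * 1 * 1 \<le> 2048 * real D ^ 2 * (1024 * real D ^ 2 + 1)" using D1 by (intro mult_mono) auto
    thus "exp 1 \<le> sqrt M0" using core(1) by (intro big) linarith
    have "0 < 2048 * real D ^ 2 * (1024 * real D ^ 2 + 1)" using rD by (simp add: add_pos_pos)
    from sqrt_le_ratio[OF this core(1)] have "sqrt M0 \<le> real M0 / (2048 * real D ^ 2 * (1024 * real D ^ 2 + 1))" by simp
    also have "\<dots> = et3 * real M0 / (2 * real (1024 * D ^ 2 + 1))" unfolding et3_def by (simp add: algebra_simps)
    finally show "sqrt M0 \<le> et3 * real M0 / (2 * real (1024 * D ^ 2 + 1))" .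
    have ls: "ln (sqrt M0) = ln M0 / 2" using N0 by (simp add: ln_sqrt)
    show "ln (4 * exp 1 * real N) \<le> et3 * real (Lm ^ 2) / 2 * ln (sqrt M0)"
      unfolding et3_def ls using core(2) rD by (simp add: field_simps)
  qed (use e3 N0 in auto)
  then obtain co where co: "\<forall>a c. co a c < M0" "expanding N (1024 * D ^ 2 + 1) et3 (Lm ^ 2) co" by blast
  have l1: "l \<ge> 1" using b l by simp
  have "4 dvd P" unfolding P_def Lm_def power_mult[symmetric] by (rule dvd_power) (use l1 b in simp)
  hence P4: "real (P div 4) = real P / 4" by (simp add: real_of_nat_div)
  have d2: "Lm ^ 2 = 512 * D ^ 2 * (8 * (4 ^ (l - b - 3)) ^ 2)" unfolding Lm_mult by (simp add: power_mult_distrib)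
  have t2: "Lm ^ 2 div (512 * D ^ 2) = 8 * (4 ^ (l - b - 3)) ^ 2" unfolding d2 using D0 by simp
  have t2': "real ?t2 = real Lm ^ 2 / (512 * real D ^ 2)" proof -
    have "real (Lm ^ 2) = 512 * real D ^ 2 * real ?t2" unfolding t2 by (subst d2) simp
    thus ?thesis using rD by (simp add: field_simps)
  qed
  have ic: "item_code R D (64 * D * K) K l link N G m (Lm ^ 2) (2 * Lm) M0 F q1 (1024 * D ^ 2) (P div 4) ?t2 K
     (1 / (512 * real D ^ 2)) et2 et3 sm ph co g" if g: "\<forall>v i. g v i < G" for g
  proof
    show "R = D * (64 * D * K)" by (rule RK)
    show "8 < D" using D0 by simp
    show "4 dvd D" unfolding D_def using b by (intro dvd_power) simp
    have D4: "D div 4 = 4 ^ (b - 1)" unfolding D_def using b by (cases b) auto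
    have "(D div 4) ^ l = 4 ^ (l * (b - 1))" unfolding D4 by (simp add: power_mult[symmetric] mult.commute)
    also have "\<dots> = Lm ^ (b - 1)" unfolding Lm_def by (simp add: power_mult)
    also have "b - 1 = (b - 3) + 2" using b by simp
    also have "Lm ^ ((b - 3) + 2) = K" unfolding K_def P_def by (rule power_add)
    finally show Kl: "K = (D div 4) ^ l" by simp
    show "link r v < 64 * D * K" for r v using link by blast
    show "expanding R K (1 / 4) D link" unfolding RK by (rule link(2))
    show "R = Lm ^ 2 * m" unfolding R_def m_def by simp
    show "m > 0" unfolding m_def using D0 L0 by simp
    show "2 * Lm > 0" using L0 by simp
    have "D ^ l = (4 * (D div 4)) ^ l" using b unfolding D_def by (cases b) auto
    also have "\<dots> = Lm * K" unfolding power_mult_distrib Kl[symmetric] Lm_def ..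
    finally show "2 * D ^ l \<le> K * (2 * Lm + 1)" by simp
    show "1 \<le> K" "K \<le> K" using K0 by simp_all
    have "2 * K < 64 * D * (D * K)" proof -
      have "1 * 1 \<le> D * D" using D0 by (intro mult_le_mono) auto
      hence "2 < 64 * (D * D)" by linarith
      hence "K * 2 < K * (64 * (D * D))" using K0 by (rule mult_strict_left_mono)
      thus ?thesis by (simp add: ac_simps)
    qed
    thus "2 * K < R" unfolding RK by (simp add: ac_simps)
    show "g v i < G" for v i using g by blast
    show "sm p c < G" for p c using sm by blast
    show "expanding (M0 * F ^ Lm ^ 2) (q1 + 1) (1 / (512 * real D ^ 2)) m sm" by (rule sm(2))
    \<comment> \<open>The main terms of both sides agree exactly; the summand 1 in q1 + 1 makes the
      inequality strict.\<close>
    show "real (m * (2 * Lm)) < (real (P div 4) - 1 / (512 * real D ^ 2) * real m) * real (q1 + 1)" proof -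
      have 1: "(real (P div 4) - 1 / (512 * real D ^ 2) * real m) * real (q1 + 1) = real P / 8 * (1024 * real D ^ 2 * real Lm + 1)"
        unfolding m8 P4 q1_def by simp
      have 2: "real (m * (2 * Lm)) = real P / 8 * (1024 * real D ^ 2 * real Lm)" unfolding m_def P_def by simp
      show ?thesis unfolding 1 2 using P0 by simp
    qed
    show "ph a c < F" for a c using ph by blast
    show "expanding M0 2 et2 (Lm ^ 2) ph" by (rule ph(2))
    show "co a i < M0" for a i using co by blast
    show "expanding N (1024 * D ^ 2 + 1) et3 (Lm ^ 2) co" by (rule co(2))
    show "real (Lm ^ 2 * 1) < (real ?t2 - et3 * real (Lm ^ 2)) * real (1024 * D ^ 2 + 1)" proof -
      have e: "(real ?t2 - et3 * real (Lm ^ 2)) = real Lm ^ 2 / (1024 * real D ^ 2)"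
        unfolding t2' et3_def using rD by (simp add: field_simps)
      have "real Lm ^ 2 / (1024 * real D ^ 2) * real (1024 * D ^ 2 + 1) = real Lm ^ 2 + real Lm ^ 2 / (1024 * real D ^ 2)"
        using rD by (simp add: field_simps)
      thus ?thesis unfolding e using rD by simp
    qed
    show "1 \<le> Lm ^ 2 div (512 * D ^ 2)" unfolding t2 by simp
    \<comment> \<open>The budget K / 2 is split into K / 8 for the required agreement, K / 8 for
      groups with confusing hints and K / 4 for groups that are hardly reached.\<close>
    show "(real ?t2 + 2 * et2 * real q1 * real (Lm ^ 2)) * real m + real (Lm ^ 2 * (P div 4)) \<le> real K / 2"
    proof -
      have 1: "real ?t2 * real m = real K / 8" unfolding t2' m_def K_def P_def using rD by (simp add: field_simps)
      have 2: "2 * et2 * real q1 * real (Lm ^ 2) * real m = real K / 8"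
        unfolding et2_def q1_def m_def K_def P_def using rD by (simp add: field_simps power_def numeral_eq_Suc)
      have 3: "real (Lm ^ 2 * (P div 4)) = real K / 4" unfolding of_nat_mult P4 K_def by simp
      show ?thesis unfolding distrib_right 1 2 3 by simp
    qed
  qed
  show ?thesis using ic unfolding et2_def et3_def K_def P_def by blast
qed

theorem system_exists:
  "\<exists>\<Phi> A. sparse_recovery_system N k \<epsilon> \<Phi> interpreter A (40 * n + 8) \<and> word_bits A = wb \<and> dim_row \<Phi> = 2 * d * B"
proof -
  define K where "K = Lm ^ (b - 3) * Lm ^ 2"
  have D0: "0 < D" using D_large by simp
  have rD: "0 < real D" "0 < real Lm" using D0 Lm_pos by simp_all
  have k6: "0 < 6 * k" "N > 0" using k by simp_all
  obtain link sm ph co where ic: "\<And>g. \<forall>v i. g v i < G ==> item_code R D (64 * D * K) K l link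
     N G m (Lm ^ 2) (2 * Lm) M0 F q1 (1024 * D ^ 2) (Lm ^ (b - 3) div 4) (Lm ^ 2 div (512 * D ^ 2)) K
     (1 / (512 * real D ^ 2)) (1 / (2 ^ 20 * real D ^ 4 * Lm)) (1 / (1024 * real D ^ 2)) sm ph co g" using item_code_exists unfolding K_def by blast
  obtain gg where gg: "\<forall>v i. gg v i < G" "expanding N (6 * k) (\<eta> / 2) (Y * R) gg"
  proof -
    have "\<exists>gg. (\<forall>v i. gg v i < G) \<and> expanding N (6 * k) (\<eta> / 2) (Y * R) gg"
    proof (rule expander_exists[where x = xg])
      show "xg \<le> \<eta> / 2 * real G / (2 * real (6 * k))" using g(2) k by (simp add: field_simps)
      show "ln (4 * exp 1 * real N) \<le> \<eta> / 2 * real (Y * R) / 2 * ln xg" using g(3) by simp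
    qed (use \<eta> k6 g(1) in auto)
    thus thesis using that by blast
  qed
  have d: "d = Y * R * (8 * s8)" by (simp add: d_def)
  obtain HH where HH: "\<forall>e x. HH e x < B" "\<forall>S\<subseteq>{..<N}. card S \<le> 6 * k -->
     (\<Sum>e<d. real (card (gg (e div (8 * s8)) ` S))) - \<eta> / 2 * d * card S \<le> (\<Sum>e<d. real (card (HH e ` gg (e div (8 * s8)) ` S)))"
  proof -
    have "\<exists>h. (\<forall>e x. h e x < B) \<and> (\<forall>S\<subseteq>{..<N}. card S \<le> 6 * k -->
     (\<Sum>e<d. real (card (gg (e div (8 * s8)) ` S))) - \<eta> / 2 * d * card S \<le> (\<Sum>e<d. real (card (h e ` gg (e div (8 * s8)) ` S))))"
    proof (rule expanding_family_exists[where x = "exp 1"])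
      show "exp 1 \<le> \<eta> / 2 * real B / (2 * real (6 * k))" using H(1) k by (simp add: field_simps)
      show "ln (4 * exp 1 * real N) \<le> \<eta> / 2 * real d / 2 * ln (exp 1)" using H(2) by simp
    qed (use \<eta> k6 in auto)
    thus thesis using that by blast
  qed
  have ex: "expanding N (6 * k) \<eta> (Y * R * (8 * s8)) (\<lambda>e i. HH e (gg (e div (8 * s8)) i))"
  proof (rule expanding_compose[OF gg(2)])
    fix S :: "nat set" assume "S \<subseteq> {..<N}" "card S \<le> 6 * k"
    thus "(\<Sum>e<Y * R * (8 * s8). real (card (gg (e div (8 * s8)) ` S))) - \<eta> / 2 * real (Y * R * (8 * s8)) * card S \<le>
      (\<Sum>e<Y * R * (8 * s8). real (card (HH e ` gg (e div (8 * s8)) ` S)))" using HH(2) unfolding d by blast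
  qed
  have G0: "G > 0" using gg(1)[rule_format, of 0 0] by linarith
  obtain ec where ec: "\<forall>p a. ec p a < 256" "expanding (G ^ Suc D) 2 (1/4) s8 ec"
  proof -
    have "\<exists>h. (\<forall>e x. h e x < 256) \<and> expanding (G ^ Suc D) 2 (1/4) s8 h"
    proof (rule expander_exists[where x = 16])
      show "exp 1 \<le> (16::real)" using exp_le by linarith
      show "16 \<le> 1 / 4 * real 256 / (2 * real 2)" by simp
      have "exp (2::real) = exp 1 * exp 1" by (simp flip: exp_add)
      also have "\<dots> \<le> 3 * 3" using exp_le by (intro mult_mono) auto
      finally have "ln (exp 2) \<le> ln (16::real)" by (intro ln_mono) auto
      hence "2 \<le> ln (16::real)" by simp
      hence "1 / 4 * real s8 / 2 * 2 \<le> 1 / 4 * real s8 / 2 * ln 16" by (intro mult_left_mono) auto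
      thus "ln (4 * exp 1 * real (G ^ Suc D)) \<le> 1 / 4 * real s8 / 2 * ln 16" using ecc by linarith
    qed (use G0 in auto)
    thus thesis using that by blast
  qed
  have NV: "N < V" using Hh V(9) by linarith
  have dB: "Y * R * (8 * s8) * B < V" using V(7) unfolding d by simp
  have ncV: "Y * R * G * Lm ^ 2 * q1 * (1024 * D ^ 2) < V" using V(8) unfolding nc_def .
  have lay: "layered R D (64 * D * K) K l link N G m (Lm ^ 2) (2 * Lm) M0 F q1 (1024 * D ^ 2) (Lm ^ (b - 3) div 4) (Lm ^ 2 div (512 * D ^ 2)) K
     (1 / (512 * real D ^ 2)) (1 / (2 ^ 20 * real D ^ 4 * Lm)) (1 / (1024 * real D ^ 2)) sm ph co gg Y s8 B V HH ec"
    by (intro layered.intro layered_axioms.intro ic gg(1))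
      (use HH(1) Ys ec V(1-6) NV dB ncV in auto)
  interpret L: layered R D "64 * D * K" K l link N G m "Lm ^ 2" "2 * Lm" M0 F q1 "1024 * D ^ 2" "Lm ^ (b - 3) div 4" "Lm ^ 2 div (512 * D ^ 2)" K
     "1 / (512 * real D ^ 2)" "1 / (2 ^ 20 * real D ^ 4 * Lm)" "1 / (1024 * real D ^ 2)" sm ph co gg Y s8 B V HH ec by (rule lay)
  have s: "L.s = 8 * s8" by (rule L.s_def)
  have ds: "Y * R * L.s = d" unfolding s d ..
  have ncs: "L.nc = nc" unfolding L.nc_def nc_def ..
  have hh: "L.h = (\<lambda>e i. HH e (gg (e div (8 * s8)) i))" by (intro ext) (simp add: L.h_def s)
  have RK: "real R = 64 * real D ^ 2 * real K" unfolding R_def K_def by simp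
  have D1: "1 \<le> real D ^ 2" using D0 by simp
  have "\<exists>\<Phi> A. sparse_recovery_system N k \<epsilon> \<Phi> interpreter A (40 * n + 8) \<and> word_bits A = wb \<and> dim_row \<Phi> = 2 * (Y * R * L.s) * B"
  proof (rule L.layered_system[where k = k and Hh = Hh and J = J and Q = Q and n = n and \<eta> = \<eta> and \<theta> = "1 / (2048 * real D ^ 2)" and \<epsilon> = \<epsilon>])
    show "expanding N (6 * k) \<eta> (Y * R * L.s) L.h" unfolding hh s by (rule ex)
    show "0 < 1 / (2048 * real D ^ 2)" using rD by simp
    have "2 \<le> 2048 * real D ^ 2" using D1 by linarith
    thus "1 / (2048 * real D ^ 2) \<le> 1 / 2" using rD by (intro divide_left_mono mult_pos_pos) auto
    show "32 * (1 / (2048 * real D ^ 2)) * real R \<le> real (K + 1)" unfolding RK using rD by simp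
    show "128 * \<eta> \<le> \<epsilon> * (1 / (2048 * real D ^ 2))" using \<eta>(2) rD by (simp add: field_simps)
  qed (use k \<eta> \<epsilon> J Hh V Q n wb in \<open>unfold ds ncs, simp_all\<close>)
  thus ?thesis unfolding ds .
qed

end

subsection \<open>Polynomial growth\<close>

text \<open>\<open>K\<close> keeps one distinguished factor, such as k ^ (1 + mu), apart from the
  polynomial in \<open>w\<close>; in a product at most one factor may contain it.\<close>

definition poly_in :: "'x set => ('x => real) => ('x => real) => ('x => real) => bool" where
  "poly_in S w K f \<longleftrightarrow> (\<exists>C p. 0 \<le> C \<and> (\<forall>x\<in>S. 0 \<le> f x \<and> f x \<le> C * (K x * w x ^ p)))"

lemma poly_inI:
  assumes "0 \<le> C" "\<And>x. x \<in> S ==> 0 \<le> f x" "\<And>x. x \<in> S ==> f x \<le> C * (K x * w x ^ p)"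
  shows "poly_in S w K f" using assms unfolding poly_in_def by blast

lemma poly_in_le:
  assumes "poly_in S w K g" "\<And>x. x \<in> S ==> 0 \<le> f x" "\<And>x. x \<in> S ==> f x \<le> g x"
  shows "poly_in S w K f" proof -
  obtain C p where g: "0 \<le> C" "\<And>x. x \<in> S ==> 0 \<le> g x \<and> g x \<le> C * (K x * w x ^ p)" using assms(1) unfolding poly_in_def by blast
  show ?thesis
  proof (rule poly_inI[OF g(1) assms(2)])
    fix x assume x: "x \<in> S"
    show "f x \<le> C * (K x * w x ^ p)" using assms(3)[OF x] g(2)[OF x] by linarith
  qed
qed

locale growth =
  fixes S :: "'x set" and w K :: "'x => real"
  assumes w1: "\<And>x. x \<in> S ==> 1 \<le> w x" and K1: "\<And>x. x \<in> S ==> 1 \<le> K x"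
begin

abbreviation "pK \<equiv> poly_in S w K"
abbreviation "p1 \<equiv> poly_in S w (\<lambda>_. 1)"

lemma add:
  assumes "pK f" "pK g"
  shows "pK (\<lambda>x. f x + g x)" proof -
  obtain C p where f: "0 \<le> C" "\<And>x. x \<in> S ==> 0 \<le> f x \<and> f x \<le> C * (K x * w x ^ p)" using assms(1) unfolding poly_in_def by blast
  obtain C' q where g: "0 \<le> C'" "\<And>x. x \<in> S ==> 0 \<le> g x \<and> g x \<le> C' * (K x * w x ^ q)" using assms(2) unfolding poly_in_def by blast
  show ?thesis
  proof (rule poly_inI[where C = "C + C'" and p = "p + q"])
    show "0 \<le> C + C'" using f g by simp
    fix x assume x: "x \<in> S"
    show "0 \<le> f x + g x" using f(2)[OF x] g(2)[OF x] by simp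
    have "w x ^ p \<le> w x ^ (p + q)" "w x ^ q \<le> w x ^ (p + q)" using w1[OF x] by (intro power_increasing; simp)+
    hence "C * (K x * w x ^ p) \<le> C * (K x * w x ^ (p + q))" "C' * (K x * w x ^ q) \<le> C' * (K x * w x ^ (p + q))"
      using f(1) g(1) K1[OF x] by (intro mult_left_mono; simp)+
    thus "f x + g x \<le> (C + C') * (K x * w x ^ (p + q))" unfolding distrib_right using f(2)[OF x] g(2)[OF x] by linarith
  qed
qed

lemma mult:
  assumes "p1 f" "pK g"
  shows "pK (\<lambda>x. f x * g x)" proof -
  obtain C p where f: "0 \<le> C" "\<And>x. x \<in> S ==> 0 \<le> f x \<and> f x \<le> C * (1 * w x ^ p)" using assms(1) unfolding poly_in_def by blast
  obtain C' q where g: "0 \<le> C'" "\<And>x. x \<in> S ==> 0 \<le> g x \<and> g x \<le> C' * (K x * w x ^ q)" using assms(2) unfolding poly_in_def by blast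
  show ?thesis
  proof (rule poly_inI[where C = "C * C'" and p = "p + q"])
    show "0 \<le> C * C'" using f g by simp
    fix x assume x: "x \<in> S"
    show "0 \<le> f x * g x" using f(2)[OF x] g(2)[OF x] by simp
    have w0: "0 \<le> w x" "0 \<le> K x" using w1[OF x] K1[OF x] by simp_all
    have "f x * g x \<le> (C * (1 * w x ^ p)) * (C' * (K x * w x ^ q))" using f(2)[OF x] g(2)[OF x] f(1) w0 by (intro mult_mono) auto
    thus "f x * g x \<le> C * C' * (K x * w x ^ (p + q))" by (simp add: power_add ac_simps)
  qed
qed

lemma up:
  assumes "p1 f"
  shows "pK f" proof -
  obtain C p where f: "0 \<le> C" "\<And>x. x \<in> S ==> 0 \<le> f x \<and> f x \<le> C * (1 * w x ^ p)" using assms(1) unfolding poly_in_def by blast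
  show ?thesis
  proof (rule poly_inI[where C = C and p = p])
    fix x assume x: "x \<in> S"
    have "1 * w x ^ p \<le> K x * w x ^ p" using w1[OF x] K1[OF x] by (intro mult_right_mono) auto
    hence "C * (1 * w x ^ p) \<le> C * (K x * w x ^ p)" using f(1) by (rule mult_left_mono)
    thus "f x \<le> C * (K x * w x ^ p)" using f(2)[OF x] by linarith
  qed (use f in auto)
qed

lemma const: "0 \<le> c ==> pK (\<lambda>_. c)"
proof (rule up, rule poly_inI[where C = c and p = 0])
qed auto

lemma id_w: "pK w"
proof (rule up, rule poly_inI[where C = 1 and p = 1])
  fix x assume "x \<in> S"
  thus "0 \<le> w x" using w1[of x] by simp
qed auto

lemma id_K: "pK K"
proof (rule poly_inI[where C = 1 and p = 0])
  fix x assume "x \<in> S"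
  thus "0 \<le> K x" using K1[of x] by simp
qed auto

lemma bound: "pK f ==> \<exists>C p. 0 \<le> C \<and> (\<forall>x\<in>S. f x \<le> C * (K x * w x ^ p))" unfolding poly_in_def by blast

end

lemma (in growth) one: "growth S w (\<lambda>_. 1)" by unfold_locales (use w1 in auto)

lemma (in growth) power: "p1 f ==> p1 (\<lambda>x. f x ^ n)"
proof (induction n)
  case 0
  show ?case using growth.const[OF one, of 1] by simp
next
  case (Suc n)
  thus ?case using growth.mult[OF one, of f "\<lambda>x. f x ^ n"] by simp
qed

lemma real_nat_ceiling: "0 \<le> r ==> r \<le> real (nat \<lceil>r\<rceil>) \<and> real (nat \<lceil>r\<rceil>) \<le> r + 1" by linarith

lemma ln_4e: "0 < n ==> ln (4 * exp 1 * n) \<le> 3 + ln n" for n :: real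
proof -
  assume n: "0 < n"
  have "ln (4::real) = ln (2 * 2)" by simp
  also have "\<dots> = ln 2 + ln 2" by (rule ln_mult_pos) simp_all
  also have "\<dots> \<le> 1 + 1" using ln_le_minus_one[of 2] by linarith
  finally have "ln (4::real) \<le> 2" by simp
  moreover have "ln (4 * exp 1 * n) = ln 4 + 1 + ln n" using n by (simp add: ln_mult_pos)
  ultimately show ?thesis by linarith
qed

section \<open>The constants, the address range and the walk length\<close>

locale exponents =
  fixes \<beta> \<gamma> :: real
  assumes \<beta>: "\<beta> > 0" and \<gamma>: "\<gamma> > 0"
begin

text \<open>Capped at 1 so that k ^ (1 + mu) is at most k ^ 2, hence at most
  \<open>N\<close>.\<close>

definition mu :: real where "mu = min \<beta> 1"
text \<open>As ln u is at most g / (1 + mu), the share \<open>nu\<close> of g = ln G is left for the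
  expansion of the addresses.\<close>

definition nu :: real where "nu = mu / (1 + mu)"
text \<open>b - 2 \<ge> 1 / \<gamma> turns the loss \<open>Lm\<close> into a power \<gamma>; b \<ge>
  10 gives Lm ^ 8 \<le> Lm ^ (b - 2).\<close>

definition b :: nat where "b = max 10 (nat \<lceil>2 + 1 / \<gamma>\<rceil>)"
definition D :: nat where "D = 4 ^ b"
definition c0 :: real where "c0 = 262144 * real D ^ 2"
definition C2 :: real where "C2 = 2 ^ 41 * real D ^ 6"
definition A :: real where "A = 4 ^ (b - 2) * C2 + (64 * real D) ^ (b - 2)"
definition kap :: real where "kap = 2 ^ 42 * real D ^ 8"
text \<open>exp Z0 becomes the hidden constant in the lower bound on \<open>N\<close>. It makes ln N
  large enough for kap * Lm ^ 4 \<le> ln N.\<close>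

definition Z0 :: real where "Z0 = A * kap ^ 2 + 3"

abbreviation NN :: "nat \<times> nat \<times> real => nat" where "NN x \<equiv> fst x"
abbreviation kk :: "nat \<times> nat \<times> real => nat" where "kk x \<equiv> fst (snd x)"
abbreviation ep :: "nat \<times> nat \<times> real => real" where "ep x \<equiv> snd (snd x)"

definition S :: "(nat \<times> nat \<times> real) set" where "S = {x. admissible (exp Z0) (NN x) (kk x) (ep x)}"
definition Z :: "nat \<times> nat \<times> real => real" where "Z x = ln (NN x)"
definition eta :: "nat \<times> nat \<times> real => real" where "eta x = ep x / c0"
text \<open>The factor Z makes xg = G * Z / u at least Z, hence above exp 1; in the running time it
  is only logarithmic.\<close>

definition u :: "nat \<times> nat \<times> real => real" where "u x = 24 * c0 * (kk x * Z x / ep x)"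
definition G :: "nat \<times> nat \<times> real => nat" where "G x = nat \<lceil>u x powr (1 + mu)\<rceil>"
definition g :: "nat \<times> nat \<times> real => real" where "g x = ln (G x)"
text \<open>The least length at which a piece fits into the nodes of its group; the least one,
  because \<open>Lm\<close> is the loss in the number of rows.\<close>

definition l :: "nat \<times> nat \<times> real => nat" where "l x = (LEAST l. b + 3 \<le> l \<and> C2 * Z x / g x \<le> (4 ^ l) ^ (b - 2))"
definition Lm :: "nat \<times> nat \<times> real => nat" where "Lm x = 4 ^ l x"

lemma mu: "0 < mu" "mu \<le> 1" "mu \<le> \<beta>" unfolding mu_def using \<beta> by auto
lemma nu: "0 < nu" "nu \<le> 1" unfolding nu_def using mu by (auto simp: divide_le_eq)
lemma b: "10 \<le> b" "2 + 1 / \<gamma> \<le> b"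
proof -
  show "10 \<le> b" unfolding b_def by simp
  have "2 + 1 / \<gamma> \<le> real (nat \<lceil>2 + 1 / \<gamma>\<rceil>)" by linarith
  also have "\<dots> \<le> real b" unfolding b_def by simp
  finally show "2 + 1 / \<gamma> \<le> b" .
qed
lemma D1: "1 \<le> real D" unfolding D_def by simp
lemma c0: "1 \<le> c0"
proof -
  have "1 \<le> real D ^ 2" using D1 by simp
  thus ?thesis unfolding c0_def by linarith
qed
lemma C2: "1 \<le> C2"
proof -
  have "1 * 1 \<le> (2::real) ^ 41 * real D ^ 6" using D1 by (intro mult_mono one_le_power) auto
  thus ?thesis unfolding C2_def by simp
qed
lemma kap: "1 \<le> kap" "2 ^ 42 * real D ^ 8 \<le> kap"
proof -
  have "1 * 1 \<le> (2::real) ^ 42 * real D ^ 8" using D1 by (intro mult_mono one_le_power) auto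
  thus "1 \<le> kap" unfolding kap_def by simp
qed (simp add: kap_def)
lemma A: "1 \<le> A"
proof -
  have "1 * 1 \<le> 4 ^ (b - 2) * C2" using C2 by (intro mult_mono) auto
  moreover have "0 \<le> (64 * real D) ^ (b - 2)" by simp
  ultimately show ?thesis unfolding A_def by linarith
qed
lemma Z0: "3 \<le> Z0" "A * kap ^ 2 \<le> Z0" using A unfolding Z0_def by simp_all

context
  fixes x :: "nat \<times> nat \<times> real"
  assumes x: "x \<in> S"
begin

lemma adm: "2 \<le> kk x" "0 < ep x" "ep x \<le> 1" "exp Z0 * real (kk x) ^ 2 \<le> NN x" "exp Z0 * (kk x / ep x ^ 2) \<le> NN x"
proof -
  have a: "2 \<le> kk x" "0 < ep x" "ep x \<le> 1" "exp Z0 * max (real (kk x) ^ 2) (kk x / ep x ^ 2) \<le> NN x"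
    using x unfolding S_def admissible_def by simp_all
  thus "2 \<le> kk x" "0 < ep x" "ep x \<le> 1" by simp_all
  have "exp Z0 * real (kk x) ^ 2 \<le> exp Z0 * max (real (kk x) ^ 2) (kk x / ep x ^ 2)"
    "exp Z0 * (kk x / ep x ^ 2) \<le> exp Z0 * max (real (kk x) ^ 2) (kk x / ep x ^ 2)" by (intro mult_left_mono; simp)+
  thus "exp Z0 * real (kk x) ^ 2 \<le> NN x" "exp Z0 * (kk x / ep x ^ 2) \<le> NN x" using a(4) by linarith+
qed

lemma N_ge: "exp Z0 \<le> NN x" "real (kk x) ^ 2 \<le> NN x" "real (kk x) \<le> NN x" "2 * kk x \<le> NN x" "1 / ep x \<le> NN x" "1 \<le> real (NN x)"
proof -
  have e: "1 \<le> exp Z0" using Z0 by simp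
  have k: "2 \<le> real (kk x)" using adm(1) by simp
  have "1 * 1 \<le> real (kk x) ^ 2" using k by simp
  hence "exp Z0 * 1 \<le> exp Z0 * real (kk x) ^ 2" by (intro mult_left_mono) auto
  thus 1: "exp Z0 \<le> NN x" using adm(4) by linarith
  have "1 * real (kk x) ^ 2 \<le> exp Z0 * real (kk x) ^ 2" using e by (intro mult_right_mono) auto
  thus 2: "real (kk x) ^ 2 \<le> NN x" using adm(4) by linarith
  have "2 * real (kk x) \<le> real (kk x) * real (kk x)" using k by (intro mult_right_mono) auto
  hence 3: "2 * real (kk x) \<le> NN x" using 2 by (simp add: power2_eq_square)
  thus "real (kk x) \<le> NN x" using k by linarith
  show "2 * kk x \<le> NN x" using 3 by linarith
  have "ep x * ep x \<le> 1 * ep x" using adm by (intro mult_right_mono) auto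
  hence "1 / ep x \<le> 1 / ep x ^ 2" using adm by (intro divide_left_mono) (auto simp: power2_eq_square)
  also have "\<dots> \<le> kk x / ep x ^ 2" using k by (intro divide_right_mono) auto
  also have "\<dots> = 1 * (kk x / ep x ^ 2)" by simp
  also have "\<dots> \<le> exp Z0 * (kk x / ep x ^ 2)" using e by (intro mult_right_mono) auto
  also have "\<dots> \<le> NN x" by (rule adm)
  finally show "1 / ep x \<le> NN x" .
  show "1 \<le> real (NN x)" using 1 e by linarith
qed

lemma Z_ge: "Z0 \<le> Z x" "3 \<le> Z x" "Z x \<le> NN x" "exp (Z x) = NN x"
proof -
  have "ln (exp Z0) \<le> Z x" unfolding Z_def using N_ge by (intro ln_mono) auto
  thus "Z0 \<le> Z x" by simp
  thus "3 \<le> Z x" using Z0 by linarith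
  have "ln (real (NN x)) \<le> real (NN x) - 1" using N_ge by (intro ln_le_minus_one) auto
  thus "Z x \<le> NN x" unfolding Z_def by linarith
  show "exp (Z x) = NN x" unfolding Z_def using N_ge by simp
qed

lemma ln_k: "0 < ln (kk x)" "ln (kk x) \<le> Z x" "Z x \<le> 2 * ln (NN x / kk x)"
proof -
  have k: "2 \<le> real (kk x)" using adm(1) by simp
  show "0 < ln (kk x)" using k by simp
  show "ln (kk x) \<le> Z x" unfolding Z_def using N_ge k by (intro ln_mono) auto
  have "ln (real (kk x) ^ 2) \<le> Z x" unfolding Z_def using N_ge k by (intro ln_mono) auto
  hence "2 * ln (kk x) \<le> Z x" using k by (simp add: ln_realpow)
  moreover have "ln (NN x / kk x) = Z x - ln (kk x)" unfolding Z_def using N_ge k by (intro ln_divide_pos) auto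
  ultimately show "Z x \<le> 2 * ln (NN x / kk x)" by simp
qed

lemma eta: "0 < eta x" "eta x \<le> 1" "c0 * eta x = ep x"
proof -
  show "0 < eta x" unfolding eta_def using adm c0 by simp
  show "eta x \<le> 1" unfolding eta_def using adm c0 by (simp add: divide_le_eq)
  show "c0 * eta x = ep x" unfolding eta_def using c0 by simp
qed

lemma u: "24 * Z x \<le> u x" "real (kk x) \<le> u x" "72 \<le> u x"
proof -
  have k: "2 \<le> real (kk x)" using adm(1) by simp
  have e: "1 \<le> 1 / ep x" using adm by simp
  have Z3: "3 \<le> Z x" by (rule Z_ge)
  have eq: "u x = 24 * (c0 * (kk x * (Z x * (1 / ep x))))" unfolding u_def by simp
  have "1 * (1 * (Z x * 1)) \<le> c0 * (kk x * (Z x * (1 / ep x)))" using c0 k e Z3 by (intro mult_mono) auto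
  thus "24 * Z x \<le> u x" unfolding eq by linarith
  thus "72 \<le> u x" using Z3 by linarith
  have "1 * (real (kk x) * (1 * 1)) \<le> c0 * (kk x * (Z x * (1 / ep x)))" using c0 k e Z3 by (intro mult_mono) auto
  hence "real (kk x) \<le> c0 * (kk x * (Z x * (1 / ep x)))" by simp
  thus "real (kk x) \<le> u x" unfolding eq using k by linarith
qed

lemma G: "u x powr (1 + mu) \<le> G x" "u x \<le> G x" "G x \<le> 2 * u x powr (1 + mu)" "1 \<le> g x" "ln (kk x) \<le> g x" "72 \<le> real (G x)" "real (kk x) \<le> G x" "0 < G x"
proof -
  have p: "u x \<le> u x powr (1 + mu)" proof -
    have "u x powr 1 \<le> u x powr (1 + mu)" using u(3) mu by (intro powr_mono) auto
    thus ?thesis using u(3) by simp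
  qed
  note r = real_nat_ceiling[of "u x powr (1 + mu)", folded G_def]
  show 1: "u x powr (1 + mu) \<le> G x" using r by simp
  show 2: "u x \<le> G x" using 1 p by linarith
  show "G x \<le> 2 * u x powr (1 + mu)" using r p u(3) by auto
  show 3: "72 \<le> real (G x)" using 2 u(3) by linarith
  have "exp 1 \<le> real (G x)" using 3 exp_le by linarith
  hence "ln (exp 1) \<le> g x" unfolding g_def by (intro ln_mono) auto
  thus "1 \<le> g x" by simp
  show 4: "real (kk x) \<le> G x" using u(2) 2 by linarith
  thus "ln (kk x) \<le> g x" unfolding g_def using adm(1) by (intro ln_mono) auto
  show "0 < G x" using 3 by linarith
qed

lemma g_le: "g x \<le> (7 + 2 * ln (24 * c0)) * Z x"
proof -
  have k: "2 \<le> real (kk x)" using adm(1) by simp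
  have Z3: "3 \<le> Z x" by (rule Z_ge)
  have c: "1 \<le> 24 * c0" using c0 by simp
  have "g x \<le> ln (2 * u x powr (1 + mu))" unfolding g_def using G u(3) by (intro ln_mono) auto
  also have "\<dots> = ln 2 + (1 + mu) * ln (u x)" using u(3) by (simp add: ln_mult_pos ln_powr)
  also have "\<dots> \<le> 1 + 2 * ln (u x)" proof -
    have "(1 + mu) * ln (u x) \<le> 2 * ln (u x)" using mu u(3) by (intro mult_right_mono) auto
    thus ?thesis using ln_le_minus_one[of 2] by linarith
  qed
  also have "ln (u x) = ln (24 * c0) + (ln (kk x) + (ln (Z x) + ln (1 / ep x)))" proof -
    have "u x = (24 * c0) * (kk x * (Z x * (1 / ep x)))" unfolding u_def by simp
    have l4: "ln (p * (q * (r * t))) = ln p + (ln q + (ln r + ln t))" if "0 < p" "0 < q" "0 < r" "0 < t" for p q r t :: real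
      using that by (simp add: ln_mult_pos)
    show ?thesis unfolding \<open>u x = _\<close> by (rule l4) (use c k Z3 adm(2) in auto)
  qed
  finally have 1: "g x \<le> 1 + 2 * (ln (24 * c0) + (ln (kk x) + (ln (Z x) + ln (1 / ep x))))" .
  have l1: "ln (Z x) \<le> Z x" using ln_le_minus_one[of "Z x"] Z3 by linarith
  have l2: "ln (1 / ep x) \<le> Z x" unfolding Z_def using N_ge adm by (intro ln_mono) auto
  have l3: "ln (24 * c0) * 1 \<le> ln (24 * c0) * Z x" using c Z3 by (intro mult_left_mono) auto
  show ?thesis using 1 l1 l2 l3 ln_k(2) Z3 by (simp add: algebra_simps)
qed

text \<open>Either \<open>l x\<close> is the smallest admissible length, where Lm = 64 * D, or the
  length before it is too short, and one step changes Lm ^ (b - 2) by the factor 4 ^ (b -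
  2).\<close>

lemma l: "b + 3 \<le> l x" "C2 * Z x \<le> Lm x ^ (b - 2) * g x" "Lm x ^ (b - 2) \<le> 4 ^ (b - 2) * (C2 * Z x / g x) + (64 * real D) ^ (b - 2)"
proof -
  define P where "P l \<longleftrightarrow> b + 3 \<le> l \<and> C2 * Z x / g x \<le> (4 ^ l) ^ (b - 2)" for l :: nat
  have g0: "0 < g x" using G(4) by linarith
  obtain q :: nat where q: "C2 * Z x / g x \<le> real q" using real_arch_simple[of "C2 * Z x / g x"] by (rule exE)
  have "P (b + 3 + q)" unfolding P_def
  proof
    have "real q \<le> 4 ^ q" proof -
      have "real q < 2 ^ q" by (rule of_nat_less_two_power)
      moreover have "(2::real) ^ q \<le> 4 ^ q" by (rule power_mono) auto
      ultimately show ?thesis by linarith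
    qed
    also have "(4::real) ^ q \<le> 4 ^ (b + 3 + q)" by (intro power_increasing) auto
    also have "\<dots> \<le> (4 ^ (b + 3 + q)) ^ (b - 2)" using b by (intro self_le_power) auto
    finally show "C2 * Z x / g x \<le> (4 ^ (b + 3 + q)) ^ (b - 2)" using q by linarith
  qed simp
  hence P: "P (l x)" unfolding l_def P_def[symmetric] by (rule LeastI)
  thus 1: "b + 3 \<le> l x" unfolding P_def by simp
  have "C2 * Z x / g x \<le> real (Lm x ^ (b - 2))" using P unfolding P_def Lm_def by simp
  thus "C2 * Z x \<le> Lm x ^ (b - 2) * g x" using g0 by (simp add: pos_divide_le_eq)
  have q0: "0 \<le> C2 * Z x / g x" using C2 Z_ge(2) g0 by simp
  show "Lm x ^ (b - 2) \<le> 4 ^ (b - 2) * (C2 * Z x / g x) + (64 * real D) ^ (b - 2)"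
  proof (cases "l x = b + 3")
    case True
    have "real (Lm x) = 64 * real D" unfolding Lm_def True D_def by (simp add: power_add)
    hence e: "real (Lm x ^ (b - 2)) = (64 * real D) ^ (b - 2)" by simp
    have "0 \<le> 4 ^ (b - 2) * (C2 * Z x / g x)" using q0 by (intro mult_nonneg_nonneg) auto
    thus ?thesis unfolding e by linarith
  next
    case False
    then obtain l' where l': "l x = Suc l'" "b + 3 \<le> l'" using 1 by (cases "l x") auto
    have "\<not> P l'" using l'(1) not_less_Least[of l' P] unfolding l_def P_def[symmetric] by simp
    hence lt: "(4 ^ l') ^ (b - 2) < C2 * Z x / g x" using l'(2) unfolding P_def by simp
    have "real (Lm x ^ (b - 2)) = 4 ^ (b - 2) * (4 ^ l') ^ (b - 2)" unfolding Lm_def l' by (simp add: power_mult_distrib)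
    also have "\<dots> \<le> 4 ^ (b - 2) * (C2 * Z x / g x)" using lt by (intro mult_left_mono) auto
    finally have "real (Lm x ^ (b - 2)) \<le> 4 ^ (b - 2) * (C2 * Z x / g x)" .
    moreover have "0 \<le> (64 * real D) ^ (b - 2)" by (intro zero_le_power) simp
    ultimately show ?thesis by linarith
  qed
qed

text \<open>For the third claim, Lm ^ 8 \<le> Lm ^ (b - 2) \<le> A * Z and A * kap ^ 2 \<le> Z give
  (kap * Lm ^ 4) ^ 2 \<le> Z ^ 2.\<close>

lemma Lm: "1 \<le> real (Lm x)" "Lm x ^ (b - 2) \<le> A * (Z x / g x + 1)" "kap * real (Lm x) ^ 4 \<le> Z x" "Lm x ^ (b - 2) \<le> A * Z x"
proof -
  show L1: "1 \<le> real (Lm x)" unfolding Lm_def by simp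
  have g0: "1 \<le> g x" by (rule G)
  have Z3: "3 \<le> Z x" by (rule Z_ge)
  have t0: "0 \<le> Z x / g x" using g0 Z3 by simp
  have "4 ^ (b - 2) * (C2 * Z x / g x) = (4 ^ (b - 2) * C2) * (Z x / g x)" by simp
  also have "\<dots> \<le> A * (Z x / g x)"
  proof (rule mult_right_mono[OF _ t0])
    have "0 \<le> (64 * real D) ^ (b - 2)" by (intro zero_le_power) simp
    thus "4 ^ (b - 2) * C2 \<le> A" unfolding A_def by linarith
  qed
  finally have 1: "4 ^ (b - 2) * (C2 * Z x / g x) \<le> A * (Z x / g x)" .
  have p00: "0 \<le> 4 ^ (b - 2) * C2" using C2 by simp
  have 2: "(64 * real D) ^ (b - 2) \<le> A" unfolding A_def using p00 by linarith
  have "A * (Z x / g x + 1) = A * (Z x / g x) + A" by (simp add: distrib_left)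
  thus 3: "Lm x ^ (b - 2) \<le> A * (Z x / g x + 1)" using l(3) 1 2 by linarith
  have p0: "0 \<le> 4 ^ (b - 2) * C2" using C2 by simp
  have "Z x / g x \<le> Z x" using g0 Z3 by (simp add: divide_le_eq)
  hence "(4 ^ (b - 2) * C2) * (Z x / g x) \<le> (4 ^ (b - 2) * C2) * Z x" using p0 by (rule mult_left_mono)
  moreover have "(64 * real D) ^ (b - 2) * 1 \<le> (64 * real D) ^ (b - 2) * Z x" using Z3 by (intro mult_left_mono) auto
  moreover have "A * Z x = (4 ^ (b - 2) * C2) * Z x + (64 * real D) ^ (b - 2) * Z x" unfolding A_def by (rule distrib_right)
  moreover have "4 ^ (b - 2) * (C2 * Z x / g x) = (4 ^ (b - 2) * C2) * (Z x / g x)" by simp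
  ultimately show 4: "Lm x ^ (b - 2) \<le> A * Z x" using l(3) by linarith
  have "real (Lm x) ^ 8 \<le> real (Lm x) ^ (b - 2)" using L1 b by (intro power_increasing) auto
  hence "real (Lm x) ^ 8 \<le> A * Z x" using 4 by simp
  hence "kap ^ 2 * real (Lm x) ^ 8 \<le> kap ^ 2 * (A * Z x)" by (intro mult_left_mono) auto
  also have "\<dots> = (A * kap ^ 2) * Z x" by simp
  also have "\<dots> \<le> Z x * Z x" using Z0 Z_ge(1) Z3 by (intro mult_right_mono) auto
  finally have "kap ^ 2 * real (Lm x) ^ 8 \<le> Z x ^ 2" by (simp only: power2_eq_square)
  moreover have "(kap * real (Lm x) ^ 4) ^ 2 = kap ^ 2 * real (Lm x) ^ 8" by (simp add: power_mult_distrib flip: power_mult)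
  ultimately have "(kap * real (Lm x) ^ 4) ^ 2 \<le> Z x ^ 2" by simp
  thus "kap * real (Lm x) ^ 4 \<le> Z x" by (rule power2_le_imp_le) (use Z3 in simp)
qed

end

end

lemma half_exp_le_power: "exp (real n / 2) \<le> 2 ^ n"
proof -
  have "exp (1/2::real) ^ 2 = exp 1" by (simp add: power2_eq_square flip: exp_add)
  also have "\<dots> \<le> 2 ^ 2" using exp_le by simp
  finally have "exp (1/2::real) \<le> 2" by (rule power2_le_imp_le) simp
  hence "exp (1/2::real) ^ n \<le> 2 ^ n" by (intro power_mono) auto
  thus ?thesis by (simp flip: exp_of_nat_mult)
qed

text \<open>The logarithm of a core symbol is of order Z / L ^ 2. Each of the L ^ 2 hints takes
  about a fraction 1 / L of that, so the hints, of order Z / L in total, dominate the piece. Lower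
  order terms are covered by L ^ 4 \<le> Z.\<close>

lemma piece_fits:
  fixes d L Z M F P g :: real
  assumes d: "1 \<le> d" and L: "1 \<le> L" and Z: "3 \<le> Z" "L ^ 4 \<le> Z" and a: "a = 4096 * d ^ 2 * (Z + 3) / L ^ 2"
    and M: "1 \<le> M" "ln M \<le> a + 1" and X: "X = 2 * (2 ^ 20 * d ^ 4 / L) * ln (4 * exp 1 * M)"
    and F: "0 < F" "F \<le> 2 * (4 * (2 ^ 20 * d ^ 4 * L) * exp (1 + X))" and g: "2 ^ 41 * d ^ 6 * Z \<le> P * L * g"
    and n: "L ^ 2 = real n"
  shows "ln (4 * exp 1 * (M * F ^ n)) \<le> P / 32 * g" proof -
  have L2: "1 \<le> L ^ 2" "L ^ 2 \<le> L ^ 4" "L \<le> L ^ 2" using L power_increasing[of 2 4 L] power_increasing[of 1 2 L] by simp_all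
  have dp: "1 \<le> d ^ 2" "d ^ 2 \<le> d ^ 6" "d ^ 4 \<le> d ^ 6" "1 \<le> d ^ 4" "1 \<le> d ^ 6"
    using d power_increasing[of 2 6 d] power_increasing[of 4 6 d] by simp_all
  have a0: "0 \<le> a" unfolding a using d L Z by simp
  have La: "L ^ 2 * a \<le> 8192 * (d ^ 2 * Z)" proof -
    have "L ^ 2 * a = 4096 * d ^ 2 * (Z + 3)" unfolding a using L by simp
    also have "\<dots> \<le> 4096 * d ^ 2 * (2 * Z)" using Z d by (intro mult_left_mono) auto
    finally show ?thesis by simp
  qed
  have lM: "ln (4 * exp 1 * M) \<le> 4 + a" using ln_4e[of M] M by linarith
  have Xl: "L * X \<le> 2097152 * (d ^ 4 * (4 + a))" proof -
    have "L * X = 2097152 * (d ^ 4 * ln (4 * exp 1 * M))" unfolding X using L by simp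
    also have "\<dots> \<le> 2097152 * (d ^ 4 * (4 + a))" using lM d by (intro mult_left_mono) auto
    finally show ?thesis .
  qed
  have lF: "ln F \<le> 8388608 * (d ^ 4 * L) + X" proof -
    have c: "1 \<le> 8388608 * (d ^ 4 * L)" proof -
      have "1 * (1 * 1) \<le> (8388608::real) * (d ^ 4 * L)" using dp L by (intro mult_mono) auto
      thus ?thesis by simp
    qed
    have "ln F \<le> ln (8388608 * (d ^ 4 * L) * exp (1 + X))" using F by (intro ln_mono) auto
    also have "\<dots> = ln (8388608 * (d ^ 4 * L)) + (1 + X)" using c d L by (subst ln_mult_pos) auto
    also have "ln (8388608 * (d ^ 4 * L)) \<le> 8388608 * (d ^ 4 * L) - 1" using c by (intro ln_le_minus_one) linarith
    finally show ?thesis by simp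
  qed
  have F0: "0 < F ^ n" using F by simp
  have "ln (4 * exp 1 * (M * F ^ n)) \<le> 3 + ln (M * F ^ n)" using M F0 by (intro ln_4e) simp
  also have "ln (M * F ^ n) = ln M + L ^ 2 * ln F" using M F F0 by (simp add: ln_mult_pos ln_realpow n)
  finally have 1: "ln (4 * exp 1 * (M * F ^ n)) \<le> 4 + a + L ^ 2 * ln F" using M by linarith
  have "L ^ 2 * ln F \<le> L ^ 2 * (8388608 * (d ^ 4 * L) + X)" using lF by (intro mult_left_mono) auto
  hence 2: "ln (4 * exp 1 * (M * F ^ n)) \<le> 4 + a + L ^ 2 * (8388608 * (d ^ 4 * L) + X)" using 1 by linarith
  have "L * ln (4 * exp 1 * (M * F ^ n)) \<le> L * (4 + a + L ^ 2 * (8388608 * (d ^ 4 * L) + X))" using 2 L by (intro mult_left_mono) auto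
  also have "\<dots> = 4 * L + L * a + 8388608 * (d ^ 4 * L ^ 4) + L ^ 2 * (L * X)" by (simp add: algebra_simps power_numeral_reduce)
  also have "\<dots> \<le> 68719476736 * (d ^ 6 * Z)" proof -
    have dZ: "Z \<le> d ^ 6 * Z" "d ^ 2 * Z \<le> d ^ 6 * Z" "d ^ 4 * Z \<le> d ^ 6 * Z" using dp Z by (auto intro: mult_right_mono)
    have t1: "4 * L \<le> 4 * (d ^ 6 * Z)" using L2 Z dZ by linarith
    have "L * a \<le> L ^ 2 * a" using L2 a0 by (intro mult_right_mono) auto
    hence t2: "L * a \<le> 8192 * (d ^ 6 * Z)" using La dZ by linarith
    have "d ^ 4 * L ^ 4 \<le> d ^ 4 * Z" using Z d by (intro mult_left_mono) auto
    hence t3: "8388608 * (d ^ 4 * L ^ 4) \<le> 8388608 * (d ^ 6 * Z)" using dZ by linarith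
    have "L ^ 2 * (L * X) \<le> L ^ 2 * (2097152 * (d ^ 4 * (4 + a)))" using Xl by (intro mult_left_mono) auto
    also have "\<dots> = 8388608 * (d ^ 4 * L ^ 2) + 2097152 * (d ^ 4 * (L ^ 2 * a))" by (simp add: algebra_simps)
    also have "\<dots> \<le> 8388608 * (d ^ 4 * Z) + 2097152 * (d ^ 4 * (8192 * (d ^ 2 * Z)))" using L2 Z La d by (intro add_mono mult_left_mono) auto
    also have "d ^ 4 * (8192 * (d ^ 2 * Z)) = 8192 * (d ^ 6 * Z)" proof -
      have "d ^ 6 = d ^ 4 * d ^ 2" by (simp flip: power_add)
      thus ?thesis by simp
    qed
    finally have t4: "L ^ 2 * (L * X) \<le> 8388608 * (d ^ 6 * Z) + 2097152 * (8192 * (d ^ 6 * Z))" using dZ by linarith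
    have "0 \<le> d ^ 6 * Z" using d Z by simp
    thus ?thesis using t1 t2 t3 t4 by linarith
  qed
  also have "\<dots> = (2 ^ 41 * d ^ 6 * Z) / 32" by simp
  also have "\<dots> \<le> (P * L * g) / 32" using g by (intro divide_right_mono) auto
  also have "\<dots> = L * (P / 32 * g)" by simp
  finally show ?thesis using L by (simp add: mult_le_cancel_left)
qed

section \<open>The remaining parameters and their constraints\<close>

context exponents
begin

text \<open>Chosen so that the logarithms of the Lm ^ 2 core symbols sum to 4096 * D ^ 2 * (Z + 3),
  what the code for items requires.\<close>

definition aa where "aa x = 4096 * real D ^ 2 * (Z x + 3) / real (Lm x) ^ 2"
definition M0 where "M0 x = nat \<lceil>exp (aa x)\<rceil>"
definition XX where "XX x = 2 * (2 ^ 20 * real D ^ 4 / real (Lm x)) * ln (4 * exp 1 * real (M0 x))"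
definition FF where "FF x = nat \<lceil>4 * (2 ^ 20 * real D ^ 4 * real (Lm x)) * exp (1 + XX x)\<rceil>"
definition s8 where "s8 x = nat \<lceil>4 * (3 + (real D + 1) * g x)\<rceil>"
definition RR :: "nat \<times> nat \<times> real => nat" where "RR x = 64 * D ^ 2 * (Lm x ^ (b - 3) * Lm x ^ 2)"
definition mm :: "nat \<times> nat \<times> real => nat" where "mm x = 64 * D ^ 2 * Lm x ^ (b - 3)"
text \<open>As many layers as the expansion of the addresses requires. There is always at least one,
  and where one suffices the size of a single graph decides the number of rows.\<close>

definition YY where "YY x = nat \<lceil>4 * (Z x + 3) / (eta x * RR x * nu * g x)\<rceil>"
definition dd where "dd x = YY x * RR x * (8 * s8 x)"
definition BB where "BB x = nat \<lceil>72 * kk x / eta x\<rceil>"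
definition JJ where "JJ x = nat \<lceil>ln (20 * real (kk x) / ep x)\<rceil>"
text \<open>The factor 2 comes from using exp (n / 2) \<le> 2 ^ n in place of ln 2; the same holds
  for \<open>wb\<close>.\<close>

definition Hh where "Hh x = nat \<lceil>2 * Z x + 1\<rceil>"
definition nc where "nc x = YY x * RR x * G x * Lm x ^ 2 * (1024 * D ^ 2 * Lm x) * (1024 * D ^ 2)"
definition QQ where "QQ x = 24 * s8 x + 5 + (Lm x ^ 2 * (2 * (mm x * (2 * Lm x) * (5 * l x + 7)) + 6) + 5) + (6 * dd x + 40)"
definition VV where "VV x = 2 ^ (8 * s8 x) + YY x * RR x * G x + G x ^ Suc D + G x ^ (mm x * (2 * Lm x)) + M0 x ^ (Lm x ^ 2) + FF x +
   2 * dd x * BB x + nc x + 2 * 2 ^ Hh x + kk x + dd x * dd x + QQ x + 1"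
definition nn where "nn x = (2 * dd x * BB x + JJ x * (dd x * BB x + (YY x * RR x * G x + nc x) +
   (nc x + kk x) * (dd x * dd x + 2 * dd x + 4 + 2 * Hh x) + kk x * (3 + 2 * Hh x) + 2 * (kk x * (2 + 2 * dd x)) + 2 * (nc x + kk x) + kk x) + kk x) * QQ x"
definition EE where "EE x = 8 * (nn x + 2) + nn x * (VV x * VV x) + 16 * VV x + 64"
definition wb where "wb x = nat \<lceil>2 * ln (EE x)\<rceil> + 1"
definition xg where "xg x = eta x * G x / (24 * kk x)"

context
  fixes x :: "nat \<times> nat \<times> real"
  assumes x: "x \<in> S"
begin

lemma aa: "0 \<le> aa x" "real (Lm x) ^ 2 * aa x = 4096 * real D ^ 2 * (Z x + 3)" "4096 * real D ^ 2 * kap \<le> aa x"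
proof -
  have L: "1 \<le> real (Lm x)" "kap * real (Lm x) ^ 4 \<le> Z x" using Lm[OF x] by auto
  show "0 \<le> aa x" unfolding aa_def using Z_ge(2)[OF x] by simp
  show e: "real (Lm x) ^ 2 * aa x = 4096 * real D ^ 2 * (Z x + 3)" unfolding aa_def using L by simp
  have "real (Lm x) ^ 2 * (4096 * real D ^ 2 * kap) \<le> real (Lm x) ^ 2 * aa x" proof -
    have "real (Lm x) ^ 2 \<le> real (Lm x) ^ 4" using L by (intro power_increasing) auto
    hence "kap * real (Lm x) ^ 2 \<le> kap * real (Lm x) ^ 4" using kap by (intro mult_left_mono) auto
    hence "kap * real (Lm x) ^ 2 \<le> Z x + 3" using L by linarith
    hence "4096 * real D ^ 2 * (kap * real (Lm x) ^ 2) \<le> 4096 * real D ^ 2 * (Z x + 3)" by (intro mult_left_mono) auto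
    thus ?thesis unfolding e by (simp add: ac_simps)
  qed
  thus "4096 * real D ^ 2 * kap \<le> aa x" using L by (simp add: mult_le_cancel_left)
qed

lemma M0: "exp (aa x) \<le> M0 x" "1 \<le> real (M0 x)" "aa x \<le> ln (M0 x)" "ln (M0 x) \<le> aa x + 1" "2048 * real D ^ 2 * (1024 * real D ^ 2 + 1) \<le> sqrt (M0 x)"
proof -
  have e1: "1 \<le> exp (aa x)" using aa by simp
  note r = real_nat_ceiling[of "exp (aa x)", folded M0_def]
  show 1: "exp (aa x) \<le> M0 x" using r by simp
  show 2: "1 \<le> real (M0 x)" using 1 e1 by linarith
  have "ln (exp (aa x)) \<le> ln (M0 x)" using 1 by (intro ln_mono) auto
  thus "aa x \<le> ln (M0 x)" by simp
  have "exp (aa x) * 2 \<le> exp (aa x) * exp 1" using exp_ge_add_one_self[of 1] by (intro mult_left_mono) auto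
  hence "exp (aa x) * 2 \<le> exp (aa x + 1)" by (simp add: exp_add)
  moreover have "real (M0 x) \<le> exp (aa x) * 2" using r e1 by linarith
  ultimately have "real (M0 x) \<le> exp (aa x + 1)" by linarith
  hence "ln (M0 x) \<le> ln (exp (aa x + 1))" using 2 by (intro ln_mono) auto
  thus "ln (M0 x) \<le> aa x + 1" by simp
  have D2: "1 \<le> real D ^ 2" "real D ^ 2 \<le> real D ^ 8" using D1 power_increasing[of 2 8 "real D"] by simp_all
  have "1024 * real D ^ 2 + 1 \<le> 2 ^ 42 * real D ^ 8" using D2 by simp
  hence "1024 * real D ^ 2 + 1 \<le> kap" using kap by linarith
  hence "2048 * real D ^ 2 * (1024 * real D ^ 2 + 1) \<le> 2048 * real D ^ 2 * kap" by (intro mult_left_mono) auto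
  also have "\<dots> \<le> aa x / 2" using aa(3) by linarith
  also have "\<dots> \<le> exp (aa x / 2)" using exp_ge_add_one_self[of "aa x / 2"] by linarith
  also have "\<dots> = sqrt (exp (aa x))" by (rule real_sqrt_unique[symmetric]) (simp_all flip: exp_double)
  also have "\<dots> \<le> sqrt (M0 x)" using 1 by simp
  finally show "2048 * real D ^ 2 * (1024 * real D ^ 2 + 1) \<le> sqrt (M0 x)" .
qed

lemma FF: "4 * (2 ^ 20 * real D ^ 4 * real (Lm x)) * exp (1 + XX x) \<le> FF x" "1 \<le> real (FF x)"
  "real (FF x) \<le> 2 * (4 * (2 ^ 20 * real D ^ 4 * real (Lm x)) * exp (1 + XX x))"
proof -
  define t where "t = 4 * (2 ^ 20 * real D ^ 4 * real (Lm x)) * exp (1 + XX x)"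
  have "0 \<le> ln (4 * exp 1 * real (M0 x))" proof -
    have "1 \<le> exp (1::real)" by simp
    hence "1 \<le> 4 * exp (1::real)" by linarith
    hence "1 * 1 \<le> (4 * exp 1) * real (M0 x)" using M0(2) by (intro mult_mono) auto
    thus ?thesis by simp
  qed
  hence "0 \<le> XX x" unfolding XX_def by simp
  hence "1 \<le> exp (1 + XX x)" by simp
  moreover have "1 * 1 \<le> real D ^ 4 * real (Lm x)" using D1 Lm(1)[OF x] by (intro mult_mono one_le_power) auto
  ultimately have "1 * 1 \<le> (4 * (2 ^ 20 * real D ^ 4 * real (Lm x))) * exp (1 + XX x)" by (intro mult_mono) auto
  hence t1: "1 \<le> t" unfolding t_def by simp
  note r = real_nat_ceiling[of t, unfolded t_def, folded FF_def]
  show "t \<le> FF x" unfolding t_def using r t1 unfolding t_def by linarith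
  thus "1 \<le> real (FF x)" using t1 by linarith
  show "real (FF x) \<le> 2 * t" unfolding t_def using r t1 unfolding t_def by linarith
qed

lemma sym_fits: "ln (4 * exp 1 * (real (M0 x) * real (FF x) ^ (Lm x ^ 2))) \<le> real (Lm x) ^ (b - 3) / 32 * g x"
proof (rule piece_fits[where d = "real D" and L = "real (Lm x)" and Z = "Z x" and a = "aa x" and X = "XX x"])
  have L: "1 \<le> real (Lm x)" "kap * real (Lm x) ^ 4 \<le> Z x" using Lm[OF x] by auto
  have "1 * real (Lm x) ^ 4 \<le> kap * real (Lm x) ^ 4" using kap by (intro mult_right_mono) auto
  thus "real (Lm x) ^ 4 \<le> Z x" using L by linarith
  have "b - 2 = Suc (b - 3)" using b(1) by simp
  hence "real (Lm x ^ (b - 2)) = real (Lm x) ^ (b - 3) * real (Lm x)" by simp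
  thus "2 ^ 41 * real D ^ 6 * Z x \<le> real (Lm x) ^ (b - 3) * real (Lm x) * g x" using l(2)[OF x] unfolding C2_def by simp
  show "0 < real (FF x)" using FF by linarith
qed (use D1 Lm[OF x] Z_ge[OF x] M0 FF in \<open>simp_all add: aa_def XX_def\<close>)

lemma G_fits: "1024 * real D ^ 2 * (1024 * real D ^ 2 * real (Lm x) + 1) \<le> sqrt (G x)"
proof -
  have L: "1 \<le> real (Lm x)" "kap * real (Lm x) ^ 4 \<le> Z x" using Lm[OF x] by auto
  have D2: "1 \<le> real D ^ 2" using D1 by simp
  have "1 * 1 \<le> real D ^ 2 * real (Lm x)" using D2 L by (intro mult_mono) auto
  moreover have "1024 * real D ^ 2 * real (Lm x) = 1024 * (real D ^ 2 * real (Lm x))" by simp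
  ultimately have "1024 * real D ^ 2 * real (Lm x) + 1 \<le> 2048 * (real D ^ 2 * real (Lm x))" by linarith
  hence "1024 * real D ^ 2 * (1024 * real D ^ 2 * real (Lm x) + 1) \<le> 1024 * real D ^ 2 * (2048 * (real D ^ 2 * real (Lm x)))"
    by (rule mult_left_mono) simp
  also have "\<dots> = 2 ^ 21 * real D ^ 4 * real (Lm x)" proof -
    have "real D ^ 4 = real D ^ 2 * real D ^ 2" by (simp flip: power_add)
    thus ?thesis by simp
  qed
  also have "\<dots> \<le> sqrt (G x)"
  proof (rule real_le_rsqrt)
    have "(2 ^ 21 * real D ^ 4 * real (Lm x)) ^ 2 = kap * real (Lm x) ^ 2" unfolding kap_def by (simp add: power_mult_distrib flip: power_mult)
    also have "\<dots> \<le> kap * real (Lm x) ^ 4" using L kap by (intro mult_left_mono power_increasing) auto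
    also have "\<dots> \<le> Z x" by (rule L)
    also have "\<dots> \<le> G x" using u(1)[OF x] G(2)[OF x] Z_ge(2)[OF x] by linarith
    finally show "(2 ^ 21 * real D ^ 4 * real (Lm x)) ^ 2 \<le> G x" .
  qed
  finally show ?thesis .
qed

lemma ln_N: "ln (4 * exp 1 * real (NN x)) \<le> Z x + 3" using ln_4e[of "real (NN x)"] N_ge(6)[OF x] unfolding Z_def by linarith

lemma RR: "1 \<le> real (RR x)" "real (RR x) = 64 * real D ^ 2 * (real (Lm x) * real (Lm x) ^ (b - 2))"
proof -
  have "b - 2 = Suc (b - 3)" using b(1) by simp
  thus e: "real (RR x) = 64 * real D ^ 2 * (real (Lm x) * real (Lm x) ^ (b - 2))" unfolding RR_def by (simp add: power2_eq_square)
  have "1 * (1 * 1) \<le> (64 * real D ^ 2) * (real (Lm x) * real (Lm x) ^ (b - 2))"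
  proof (intro mult_mono one_le_power Lm(1)[OF x])
    have "1 \<le> real D ^ 2" using D1 by simp
    thus "1 \<le> 64 * real D ^ 2" by linarith
  qed auto
  thus "1 \<le> real (RR x)" unfolding e by simp
qed

text \<open>The constants in \<open>eta\<close> and \<open>u\<close> cancel to xg = G * Z / u, and
  the power 1 + mu in \<open>G\<close> leaves nu * g of the logarithm.\<close>

lemma xg: "exp 1 \<le> xg x" "nu * g x \<le> ln (xg x)" "24 * kk x * xg x \<le> eta x * G x"
proof -
  have k: "2 \<le> real (kk x)" using adm(1)[OF x] by simp
  have u0: "0 < u x" using u(3)[OF x] by linarith
  have Z3: "3 \<le> Z x" by (rule Z_ge[OF x])
  have e: "xg x = G x * Z x / u x" unfolding xg_def u_def eta_def using k Z3 c0 adm(2)[OF x] by (simp add: field_simps)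
  have "u x * Z x \<le> G x * Z x" using G(2)[OF x] Z3 by (intro mult_right_mono) auto
  hence "Z x \<le> xg x" unfolding e using u0 by (simp add: pos_le_divide_eq mult.commute)
  thus "exp 1 \<le> xg x" using Z3 exp_le by linarith
  have "ln (u x powr (1 + mu)) \<le> g x" unfolding g_def using G[OF x] u0 by (intro ln_mono) auto
  hence "(1 + mu) * ln (u x) \<le> g x" using u0 by (simp add: ln_powr)
  hence lu: "ln (u x) \<le> g x / (1 + mu)" using mu by (simp add: pos_le_divide_eq mult.commute)
  have "ln (xg x) = g x + ln (Z x) - ln (u x)" unfolding e g_def using u0 Z3 G(8)[OF x] by (simp add: ln_divide_pos ln_mult_pos)
  moreover have "0 \<le> ln (Z x)" using Z3 by simp
  moreover have "nu * g x = g x - g x / (1 + mu)" unfolding nu_def using mu by (simp add: field_simps)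
  ultimately show "nu * g x \<le> ln (xg x)" using lu by linarith
  show "24 * kk x * xg x \<le> eta x * G x" unfolding xg_def using k by simp
qed

lemma YY: "4 * (Z x + 3) \<le> eta x * real (YY x * RR x) * (nu * g x)" "YY x > 0"
  "real (YY x) \<le> 4 * (Z x + 3) / (eta x * RR x * nu * g x) + 1" "0 < eta x * RR x * nu * g x"
proof -
  have pos: "0 < eta x * RR x * nu * g x" using eta[OF x] RR(1) nu G(4)[OF x] by (intro mult_pos_pos) auto
  thus "0 < eta x * RR x * nu * g x" .
  have t: "0 < 4 * (Z x + 3) / (eta x * RR x * nu * g x)" using pos Z_ge(2)[OF x] by simp
  note r = real_nat_ceiling[of "4 * (Z x + 3) / (eta x * RR x * nu * g x)", folded YY_def]
  have 1: "4 * (Z x + 3) / (eta x * RR x * nu * g x) \<le> YY x" using r t by linarith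
  thus "YY x > 0" using t by linarith
  show "real (YY x) \<le> 4 * (Z x + 3) / (eta x * RR x * nu * g x) + 1" using r t by linarith
  have "4 * (Z x + 3) \<le> YY x * (eta x * RR x * nu * g x)" using 1 pos by (simp add: pos_divide_le_eq)
  thus "4 * (Z x + 3) \<le> eta x * real (YY x * RR x) * (nu * g x)" by (simp add: ac_simps)
qed

lemma s8: "4 * (3 + (real D + 1) * g x) \<le> s8 x" "nu * g x \<le> s8 x" "0 < s8 x" "real (s8 x) \<le> (17 + 4 * real D) * g x"
proof -
  have g1: "1 \<le> g x" by (rule G[OF x])
  have Dg: "0 \<le> real D * g x" using g1 by simp
  have p: "4 * (3 + (real D + 1) * g x) = 12 + 4 * (real D * g x) + 4 * g x" by (simp add: algebra_simps)
  note r = real_nat_ceiling[of "4 * (3 + (real D + 1) * g x)", folded s8_def]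
  show 1: "4 * (3 + (real D + 1) * g x) \<le> s8 x" using r p g1 Dg by linarith
  have "nu * g x \<le> 1 * g x" using nu g1 by (intro mult_right_mono) auto
  thus "nu * g x \<le> s8 x" using 1 p g1 Dg by linarith
  show "0 < s8 x" using 1 p g1 Dg by linarith
  have "real (s8 x) \<le> 13 + 4 * (real D * g x) + 4 * g x" using r p g1 Dg by linarith
  also have "\<dots> \<le> 17 * g x + 4 * (real D * g x)" using g1 by linarith
  finally show "real (s8 x) \<le> (17 + 4 * real D) * g x" by (simp add: algebra_simps)
qed

lemma parameters_hold:
  "parameters b (l x) (NN x) (kk x) (G x) (M0 x) (FF x) (YY x) (s8 x) (BB x) (VV x) (Hh x) (JJ x) (QQ x) (nn x) (wb x) (eta x) (ep x) (xg x)"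
  unfolding parameters_def D_def[symmetric] Lm_def[symmetric] RR_def[symmetric] mm_def[symmetric] dd_def[symmetric] nc_def[symmetric]
proof (intro conjI)
  have k: "2 \<le> real (kk x)" using adm(1)[OF x] by simp
  have lnN4: "4 * ln (4 * exp 1 * real (NN x)) \<le> 4 * (Z x + 3)" by (rule mult_left_mono[OF ln_N]) simp
  have eY: "0 \<le> eta x * real (YY x * RR x)" using eta(1)[OF x] by simp
  show "4 \<le> b" using b(1) by simp
  show "b + 3 \<le> l x" by (rule l(1)[OF x])
  show "0 < kk x" using adm(1)[OF x] by simp
  show "2 * kk x \<le> NN x" by (rule N_ge(4)[OF x])
  show "0 < ep x" "ep x \<le> 1" using adm[OF x] by auto
  show "0 < eta x" by (rule eta[OF x])
  show "real (262144 * D ^ 2) * eta x \<le> ep x" using eta(3)[OF x] unfolding c0_def by simp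
  show "0 < YY x" by (rule YY)
  show "0 < s8 x" by (rule s8)
  show "1024 * real D ^ 2 * (real (1024 * D ^ 2 * Lm x) + 1) \<le> sqrt (G x)" using G_fits by simp
  show "ln (4 * exp 1 * (real (M0 x) * real (FF x) ^ (Lm x)\<^sup>2)) \<le> real (Lm x) ^ (b - 3) / 32 * ln (real (G x))"
    using sym_fits unfolding g_def .
  show "4 * (2 ^ 20 * real D ^ 4 * real (Lm x)) * exp (1 + 2 * (2 ^ 20 * real D ^ 4 / real (Lm x)) * ln (4 * exp 1 * real (M0 x))) \<le> FF x"
    using FF(1) unfolding XX_def .
  show "2048 * (real D)\<^sup>2 * (1024 * (real D)\<^sup>2 + 1) \<le> sqrt (real (M0 x))" by (rule M0(5))
  show "4096 * (real D)\<^sup>2 * ln (4 * exp 1 * real (NN x)) \<le> (real (Lm x))\<^sup>2 * ln (real (M0 x))" proof -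
    have "4096 * (real D)\<^sup>2 * ln (4 * exp 1 * real (NN x)) \<le> 4096 * (real D)\<^sup>2 * (Z x + 3)" using ln_N by (intro mult_left_mono) auto
    also have "\<dots> = (real (Lm x))\<^sup>2 * aa x" by (rule aa(2)[symmetric])
    also have "\<dots> \<le> (real (Lm x))\<^sup>2 * ln (real (M0 x))" using M0(3) by (intro mult_left_mono) auto
    finally show ?thesis .
  qed
  show "4 * ln (4 * exp 1 * real (G x ^ Suc D)) \<le> real (s8 x)" proof -
    have e: "ln (real (G x ^ Suc D)) = (real D + 1) * g x" unfolding g_def of_nat_power using G(8)[OF x] by (subst ln_realpow) (auto simp: algebra_simps)
    have "ln (4 * exp 1 * real (G x ^ Suc D)) \<le> 3 + ln (real (G x ^ Suc D))" using G(8)[OF x] by (intro ln_4e) simp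
    hence "ln (4 * exp 1 * real (G x ^ Suc D)) \<le> 3 + (real D + 1) * g x" unfolding e .
    from mult_left_mono[OF this, of 4] have "4 * ln (4 * exp 1 * real (G x ^ Suc D)) \<le> 4 * (3 + (real D + 1) * g x)" by simp
    thus ?thesis using s8(1) by (rule order_trans)
  qed

  show "exp 1 \<le> xg x" by (rule xg)
  show "real (24 * kk x) * xg x \<le> eta x * real (G x)" using xg(3) by simp
  show "4 * ln (4 * exp 1 * real (NN x)) \<le> eta x * real (YY x * RR x) * ln (xg x)" proof -
    have "eta x * real (YY x * RR x) * (nu * g x) \<le> eta x * real (YY x * RR x) * ln (xg x)" using xg(2) eY by (rule mult_left_mono)
    from order_trans[OF YY(1) this] show ?thesis by (rule order_trans[OF lnN4])
  qed
  show "24 * exp 1 * real (kk x) \<le> eta x * real (BB x)" proof -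
    have "72 * kk x / eta x \<le> BB x" unfolding BB_def by linarith
    hence "72 * real (kk x) \<le> eta x * BB x" using eta(1)[OF x] by (simp add: pos_divide_le_eq mult.commute)
    moreover have "24 * exp 1 * real (kk x) \<le> 24 * 3 * real (kk x)" using exp_le by (intro mult_right_mono) auto
    ultimately show ?thesis by linarith
  qed
  show "4 * ln (4 * exp 1 * real (NN x)) \<le> eta x * real (dd x)" proof -
    have "eta x * real (YY x * RR x) * (nu * g x) \<le> eta x * real (YY x * RR x) * real (8 * s8 x)"
    proof (rule mult_left_mono[OF _ eY])
      show "nu * g x \<le> real (8 * s8 x)" using s8(2) by simp
    qed
    also have "\<dots> = eta x * real (dd x)" unfolding dd_def by simp
    finally have "eta x * real (YY x * RR x) * (nu * g x) \<le> eta x * real (dd x)" .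
    from order_trans[OF YY(1) this] show ?thesis by (rule order_trans[OF lnN4])
  qed
  show "(4 * real (kk x) + 1) * (1 / 4) ^ JJ x \<le> ep x / 4" proof -
    have p: "0 < 20 * real (kk x) / ep x" using k adm(2)[OF x] by simp
    have "ln (20 * real (kk x) / ep x) \<le> JJ x" unfolding JJ_def by linarith
    hence "exp (ln (20 * real (kk x) / ep x)) \<le> exp (JJ x)" unfolding exp_le_cancel_iff .
    hence "20 * real (kk x) / ep x \<le> exp (JJ x)" using p by (simp only: exp_ln)
    also have "exp (real (JJ x)) = exp 1 ^ JJ x" by (simp flip: exp_of_nat_mult)
    also have "\<dots> \<le> 4 ^ JJ x" using exp_le by (intro power_mono) auto
    finally have "20 * real (kk x) \<le> ep x * 4 ^ JJ x" using adm(2)[OF x] by (simp add: pos_divide_le_eq mult.commute)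
    moreover have "4 * (4 * r + 1) \<le> 20 * r" if "2 \<le> r" for r :: real using that by (simp add: distrib_left)
    hence "4 * (4 * real (kk x) + 1) \<le> 20 * real (kk x)" using k by blast
    ultimately have "4 * (4 * real (kk x) + 1) \<le> ep x * 4 ^ JJ x" by linarith
    thus ?thesis by (simp add: power_one_over field_simps)
  qed
  show "NN x < 2 ^ Hh x" proof -
    have "2 * Z x + 1 \<le> Hh x" unfolding Hh_def by linarith
    hence "Z x < Hh x / 2" by linarith
    hence "exp (Z x) < exp (real (Hh x) / 2)" by simp
    from less_le_trans[OF this half_exp_le_power] have "real (NN x) < real (2 ^ Hh x)" unfolding Z_ge(4)[OF x] by simp
    thus ?thesis by (simp only: of_nat_less_iff)
  qed
  show "8 * (nn x + 2) + nn x * (VV x * VV x) + 16 * VV x + 64 < 2 ^ wb x" proof -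
    have E: "1 \<le> real (EE x)" unfolding EE_def by simp
    have "2 * ln (EE x) + 1 \<le> wb x" unfolding wb_def using E by linarith
    hence "ln (EE x) < wb x / 2" by linarith
    hence "exp (ln (real (EE x))) < exp (real (wb x) / 2)" by simp
    from less_le_trans[OF this half_exp_le_power] have "real (EE x) < real (2 ^ wb x)" using E by simp
    hence "EE x < 2 ^ wb x" by (simp only: of_nat_less_iff)
    thus ?thesis unfolding EE_def .
  qed
qed (simp_all add: VV_def QQ_def nn_def)

end

end

section \<open>Number of rows and running time\<close>

context exponents
begin

definition cg :: real where "cg = 7 + 2 * ln (24 * c0)"
definition c1 :: real where "c1 = 17 + 4 * real D"
definition ww where "ww x = Z x / ep x"
definition KK where "KK x = real (kk x) powr (1 + mu)"

lemma cg: "0 \<le> cg" "0 \<le> c1" unfolding cg_def c1_def using c0 by simp_all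

lemma Lm_g:
  assumes x: "x \<in> S"
  shows "real (Lm x) ^ (b - 2) * g x \<le> A * (1 + cg) * Z x" proof -
  have g0: "1 \<le> g x" by (rule G[OF x])
  have "real (Lm x) ^ (b - 2) * g x \<le> A * (Z x / g x + 1) * g x" using Lm(2)[OF x] g0 by (intro mult_right_mono) auto
  also have "\<dots> = A * (Z x + g x)" using g0 by (simp add: field_simps)
  also have "\<dots> \<le> A * (Z x + cg * Z x)" using g_le[OF x] A unfolding cg_def by (intro mult_left_mono) auto
  finally show ?thesis by (simp add: algebra_simps)
qed

text \<open>The two summands are the two demands on the number of nodes: expansion of the addresses
  and one complete graph. They become the terms 1 / \<epsilon> and (log N / log k)^\<gamma> of the
  row bound.\<close>

lemma YY_RR:
  assumes x: "x \<in> S"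
  shows "real (YY x * RR x) \<le> 8 * Z x * c0 / (ep x * nu * g x) + RR x" "real (YY x) \<le> 8 * c0 / nu * ww x + 1" proof -
  have g0: "1 \<le> g x" by (rule G[OF x])
  have R: "1 \<le> real (RR x)" by (rule RR[OF x])
  have Z3: "3 \<le> Z x" by (rule Z_ge[OF x])
  have e: "0 < eta x" "0 < ep x" "0 < nu" "0 < c0" using eta[OF x] adm(2)[OF x] nu c0 by auto
  have "real (YY x) * RR x \<le> (4 * (Z x + 3) / (eta x * RR x * nu * g x) + 1) * RR x" using YY(3)[OF x] by (intro mult_right_mono) auto
  also have "\<dots> = 4 * (Z x + 3) * c0 / (ep x * nu * g x) + RR x" unfolding eta_def using R e g0 by (simp add: field_simps)
  also have "4 * (Z x + 3) * c0 / (ep x * nu * g x) \<le> 8 * Z x * c0 / (ep x * nu * g x)"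
  proof (intro divide_right_mono mult_right_mono)
    show "4 * (Z x + 3) \<le> 8 * Z x" using Z3 by simp
  qed (use e g0 in simp_all)
  finally show "real (YY x * RR x) \<le> 8 * Z x * c0 / (ep x * nu * g x) + RR x" by simp
  have "1 * 1 \<le> real (RR x) * g x" using R g0 by (intro mult_mono) auto
  hence "(eta x * nu) * 1 \<le> (eta x * nu) * (RR x * g x)" using e by (intro mult_left_mono) auto
  hence den: "eta x * nu \<le> eta x * RR x * nu * g x" by (simp add: ac_simps)
  have "4 * (Z x + 3) / (eta x * RR x * nu * g x) \<le> 8 * Z x / (eta x * nu)"
  proof (rule frac_le[OF _ _ _ den])
    show "0 \<le> 8 * Z x" using Z3 by simp
    show "4 * (Z x + 3) \<le> 8 * Z x" using Z3 by simp
    show "0 < eta x * nu" using e by simp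
  qed
  also have "\<dots> = 8 * c0 / nu * ww x" unfolding eta_def ww_def using e by (simp add: field_simps)
  finally show "real (YY x) \<le> 8 * c0 / nu * ww x + 1" using YY(3)[OF x] by linarith
qed

text \<open>Up to constants, \<open>Lm\<close> is at most the (b - 2)-th root of Z / g + 1; moreover
  g \<ge> ln k and 1 / (b - 2) \<le> \<gamma>.\<close>

lemma Lm_powr:
  assumes x: "x \<in> S"
  shows "real (Lm x) \<le> 2 * A * (Z x / ln (kk x)) powr \<gamma>" "1 \<le> Z x / ln (kk x)" proof -
  define t where "t = Z x / ln (kk x)"
  have lk: "0 < ln (kk x)" "ln (kk x) \<le> Z x" using ln_k[OF x] by auto
  show t1: "1 \<le> Z x / ln (kk x)" using lk by (simp add: le_divide_eq)
  have Z3: "3 \<le> Z x" by (rule Z_ge[OF x])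
  have "Z x / g x \<le> t" unfolding t_def using G(5)[OF x] lk Z3 by (intro divide_left_mono) auto
  hence "A * (Z x / g x + 1) \<le> A * (t + t)" using t1 A unfolding t_def by (intro mult_left_mono) auto
  hence p: "real (Lm x) ^ (b - 2) \<le> 2 * A * t" using Lm(2)[OF x] by simp
  define q where "q = 1 / (real b - 2)"
  have b8: "8 \<le> real b - 2" using b by linarith
  have q: "0 < q" "q \<le> 1" unfolding q_def using b8 by auto
  have qg: "q \<le> \<gamma>" proof -
    have "1 / \<gamma> \<le> real b - 2" using b by linarith
    hence "1 \<le> \<gamma> * (real b - 2)" using \<gamma> by (simp add: pos_divide_le_eq mult.commute)
    thus ?thesis unfolding q_def using b8 by (simp add: pos_divide_le_eq)
  qed
  have L1: "1 \<le> real (Lm x)" by (rule Lm[OF x])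
  have "real (Lm x) ^ (b - 2) = real (Lm x) powr (real b - 2)" using L1 b(1) by (simp add: powr_realpow[symmetric] of_nat_diff)
  hence "(real (Lm x) ^ (b - 2)) powr q = real (Lm x) powr ((real b - 2) * q)" by (simp add: powr_powr)
  also have "(real b - 2) * q = 1" unfolding q_def using b8 by simp
  finally have "real (Lm x) = (real (Lm x) ^ (b - 2)) powr q" using L1 by simp
  also have "\<dots> \<le> (2 * A * t) powr q" by (rule powr_mono2) (use p q in auto)
  also have "\<dots> = (2 * A) powr q * t powr q" by (rule powr_mult)
  also have "\<dots> \<le> (2 * A) powr 1 * t powr \<gamma>"
  proof (rule mult_mono)
    show "(2 * A) powr q \<le> (2 * A) powr 1" by (rule powr_mono) (use A q in auto)
    show "t powr q \<le> t powr \<gamma>" by (rule powr_mono) (use t1 qg in \<open>auto simp: t_def\<close>)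
  qed auto
  also have "(2 * A) powr 1 = 2 * A" using A by simp
  finally show "real (Lm x) \<le> 2 * A * (Z x / ln (kk x)) powr \<gamma>" unfolding t_def .
qed

lemma BB_le:
  assumes x: "x \<in> S"
  shows "real (BB x) \<le> 73 * c0 * (kk x / ep x)" proof -
  have e: "0 < ep x" "ep x \<le> 1" "0 < c0" using adm[OF x] c0 by auto
  have "1 / 1 \<le> kk x / ep x" by (rule frac_le) (use e adm(1)[OF x] in auto)
  hence "1 * 1 \<le> c0 * (kk x / ep x)" using c0 by (intro mult_mono) auto
  moreover have "72 * kk x / eta x = 72 * (c0 * (kk x / ep x))" unfolding eta_def using e by simp
  moreover have "0 \<le> 72 * kk x / eta x" using eta[OF x] by simp
  ultimately have "real (BB x) \<le> 72 * (c0 * (kk x / ep x)) + c0 * (kk x / ep x)"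
    using real_nat_ceiling[of "72 * kk x / eta x", folded BB_def] by linarith
  thus ?thesis by simp
qed

text \<open>Each node uses O(g) hash functions. The layers demanded by expansion contribute O(Z /
  \<epsilon>), and a single graph contributes a constant times Lm * (Lm ^ (b - 2) * g), which is
  O(Lm * Z).\<close>

lemma dd_le: "\<exists>C\<ge>0. \<forall>x\<in>S. real (dd x) \<le> C * (Z x * ((Z x / ln (kk x)) powr \<gamma> + 1 / ep x))"
proof (intro exI conjI ballI)
  define C where "C = 8 * c1 * (8 * c0 / nu + 64 * real D ^ 2 * (A * (1 + cg)) * (2 * A))"
  let ?a = "(64 * real D ^ 2 * (A * (1 + cg)) * (2 * A))"
  have C1: "0 \<le> 8 * c0 / nu" "0 \<le> 64 * real D ^ 2 * (A * (1 + cg)) * (2 * A)" using c0 nu A cg by auto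
  show "0 \<le> C" unfolding C_def by (rule mult_nonneg_nonneg[OF _ add_nonneg_nonneg[OF C1]]) (use cg in simp)
  fix x assume x: "x \<in> S"
  define t where "t = (Z x / ln (kk x)) powr \<gamma>"
  have t0: "0 \<le> t" unfolding t_def by simp
  have Z3: "3 \<le> Z x" by (rule Z_ge[OF x])
  have g0: "1 \<le> g x" by (rule G[OF x])
  have e: "0 < ep x" using adm[OF x] by auto
  have "real (dd x) = real (YY x * RR x) * (8 * real (s8 x))" unfolding dd_def by simp
  also have "\<dots> \<le> (8 * Z x * c0 / (ep x * nu * g x) + RR x) * (8 * (c1 * g x))"
  proof (rule mult_mono[OF YY_RR(1)[OF x]])
    show "8 * real (s8 x) \<le> 8 * (c1 * g x)" using s8(4)[OF x] unfolding c1_def by linarith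
    show "0 \<le> 8 * Z x * c0 / (ep x * nu * g x) + RR x" using YY_RR(1)[OF x] by (rule order_trans[OF of_nat_0_le_iff])
  qed simp
  also have "\<dots> = 8 * c1 * ((8 * c0 / nu) * (Z x * (1 / ep x)) + RR x * g x)" proof -
    have "(8 * p * q / (r * s * h) + R) * (8 * (c * h)) = 8 * c * ((8 * q / s) * (p * (1 / r)) + R * h)"
      if "0 < r" "0 < s" "0 < h" for p q r s h R c :: real using that by (simp add: field_simps)
    thus ?thesis using e nu(1) g0 by simp
  qed
  also have "\<dots> \<le> 8 * c1 * ((8 * c0 / nu) * (Z x * (1 / ep x)) + ?a * (Z x * t))" proof -
    have "RR x * g x = 64 * real D ^ 2 * (real (Lm x) * (real (Lm x) ^ (b - 2) * g x))" unfolding RR(2)[OF x] by simp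
    also have "\<dots> \<le> 64 * real D ^ 2 * ((2 * A * t) * (A * (1 + cg) * Z x))"
    proof (rule mult_left_mono)
      show "real (Lm x) * (real (Lm x) ^ (b - 2) * g x) \<le> (2 * A * t) * (A * (1 + cg) * Z x)"
      proof (rule mult_mono[OF Lm_powr(1)[OF x, folded t_def] Lm_g[OF x]])
        show "0 \<le> 2 * A * t" using A t0 by simp
        show "0 \<le> real (Lm x) ^ (b - 2) * g x" using g0 by simp
      qed
    qed simp
    also have "\<dots> = ?a * (Z x * t)" by (simp only: ac_simps)
    finally have "RR x * g x \<le> ?a * (Z x * t)" .
    hence "(8 * c0 / nu) * (Z x * (1 / ep x)) + RR x * g x \<le>
      (8 * c0 / nu) * (Z x * (1 / ep x)) + ?a * (Z x * t)" by (rule add_left_mono)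
    thus ?thesis by (rule mult_left_mono) (use cg in simp)
  qed
  also have "\<dots> \<le> C * (Z x * (t + 1 / ep x))" proof -
    have p: "0 \<le> Z x * (1 / ep x)" "0 \<le> Z x * t" using Z3 e t0 by auto
    have "a * P + q * Q \<le> (a + q) * (Q + P)" if "0 \<le> a" "0 \<le> q" "0 \<le> P" "0 \<le> Q" for a q P Q :: real
      using that by (simp add: algebra_simps)
    from this[OF C1 p] have "(8 * c0 / nu) * (Z x * (1 / ep x)) + ?a * (Z x * t) \<le>
       (8 * c0 / nu + 64 * real D ^ 2 * (A * (1 + cg)) * (2 * A)) * (Z x * (t + 1 / ep x))" unfolding distrib_left[of "Z x"] .
    hence "8 * c1 * ((8 * c0 / nu) * (Z x * (1 / ep x)) + ?a * (Z x * t)) \<le>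
       8 * c1 * ((8 * c0 / nu + 64 * real D ^ 2 * (A * (1 + cg)) * (2 * A)) * (Z x * (t + 1 / ep x)))" by (rule mult_left_mono) (use cg in simp)
    thus ?thesis unfolding C_def by (simp only: mult.assoc)
  qed
  finally show "real (dd x) \<le> C * (Z x * ((Z x / ln (kk x)) powr \<gamma> + 1 / ep x))" unfolding t_def .
qed

text \<open>Since N \<ge> k ^ 2, ln N may be replaced by 2 * ln (N / k).\<close>

lemma rows_le: "\<exists>C\<ge>0. \<forall>x\<in>S. real (2 * dd x * BB x) \<le>
    C * (kk x / ep x * ln (NN x / kk x) * ((Z x / ln (kk x)) powr \<gamma> + 1 / ep x))"
proof -
  obtain C where C: "0 \<le> C" "\<And>x. x \<in> S ==> real (dd x) \<le> C * (Z x * ((Z x / ln (kk x)) powr \<gamma> + 1 / ep x))" using dd_le by blast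
  show ?thesis
  proof (intro exI[of _ "292 * c0 * C"] conjI ballI)
    show "0 \<le> 292 * c0 * C" using c0 C by auto
    fix x assume x: "x \<in> S"
    define t where "t = (Z x / ln (kk x)) powr \<gamma> + 1 / ep x"
    have e: "0 < ep x" using adm[OF x] by auto
    have t0: "0 \<le> t" unfolding t_def using e by simp
    have Zl: "Z x \<le> 2 * ln (NN x / kk x)" "3 \<le> Z x" using ln_k[OF x] Z_ge[OF x] by auto
    have "real (2 * dd x * BB x) = 2 * (real (dd x) * real (BB x))" by simp
    also have "\<dots> \<le> 2 * ((C * (Z x * t)) * (73 * c0 * (kk x / ep x)))" proof -
      have "real (dd x) * real (BB x) \<le> (C * (Z x * t)) * (73 * c0 * (kk x / ep x))"
        by (rule mult_mono[OF C(2)[OF x, folded t_def] BB_le[OF x]]) (use C(1) Zl t0 in auto)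
      thus ?thesis by linarith
    qed
    also have "\<dots> = 146 * c0 * C * (kk x / ep x) * (Z x * t)" by simp
    also have "\<dots> \<le> 146 * c0 * C * (kk x / ep x) * ((2 * ln (NN x / kk x)) * t)"
    proof (rule mult_left_mono)
      show "Z x * t \<le> (2 * ln (NN x / kk x)) * t" using Zl(1) t0 by (rule mult_right_mono)
      show "0 \<le> 146 * c0 * C * (kk x / ep x)" using C(1) c0 e by simp
    qed
    also have "\<dots> = 292 * c0 * C * (kk x / ep x * ln (NN x / kk x) * t)" by simp
    finally show "real (2 * dd x * BB x) \<le> 292 * c0 * C * (kk x / ep x * ln (NN x / kk x) * ((Z x / ln (kk x)) powr \<gamma> + 1 / ep x))"
      unfolding t_def .
  qed
qed

sublocale gr: growth S ww KK
proof
  fix x assume x: "x \<in> S"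
  have e: "0 < ep x" "ep x \<le> 1" using adm[OF x] by auto
  have "1 / 1 \<le> ww x" unfolding ww_def using e Z_ge[OF x] by (intro frac_le) auto
  thus "1 \<le> ww x" by simp
  show "1 \<le> KK x" unfolding KK_def using adm(1)[OF x] mu by (intro ge_one_powr_ge_zero) auto
qed

sublocale g1: growth S ww "\<lambda>_. 1" by (rule gr.one)

sublocale gN: growth S "\<lambda>x. real (NN x)" "\<lambda>_. 1" by unfold_locales (use N_ge in auto)

lemma p_Z: "gr.p1 Z"
proof (rule poly_in_le[OF g1.id_w])
  fix x assume x: "x \<in> S"
  show "0 \<le> Z x" using Z_ge[OF x] by simp
  have "Z x / 1 \<le> ww x" unfolding ww_def using adm[OF x] Z_ge[OF x] by (intro divide_left_mono) auto
  thus "Z x \<le> ww x" by simp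
qed

lemma p_ep: "gr.p1 (\<lambda>x. 1 / ep x)"
proof (rule poly_in_le[OF g1.id_w])
  fix x assume x: "x \<in> S"
  show "0 \<le> 1 / ep x" using adm[OF x] by simp
  show "1 / ep x \<le> ww x" unfolding ww_def using adm[OF x] Z_ge[OF x] by (intro divide_right_mono) auto
qed

lemma p_Lm: "gr.p1 (\<lambda>x. real (Lm x))"
proof (rule poly_in_le[OF p_Z])
  fix x assume x: "x \<in> S"
  have L: "1 \<le> real (Lm x)" "kap * real (Lm x) ^ 4 \<le> Z x" using Lm[OF x] by auto
  have "real (Lm x) ^ 1 \<le> real (Lm x) ^ 4" using L by (intro power_increasing) auto
  moreover have "1 * real (Lm x) ^ 4 \<le> kap * real (Lm x) ^ 4" using kap by (intro mult_right_mono) auto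
  ultimately show "real (Lm x) \<le> Z x" using L(2) unfolding power_one_right by linarith
qed auto

lemma p_g: "gr.p1 g"
proof (rule poly_in_le[OF g1.mult[OF g1.const[OF cg(1)] p_Z]])
  fix x assume x: "x \<in> S"
  show "0 \<le> g x" using G(4)[OF x] by simp
  show "g x \<le> cg * Z x" using g_le[OF x] unfolding cg_def .
qed

lemma p_s8: "gr.p1 (\<lambda>x. real (s8 x))"
proof (rule poly_in_le[OF g1.mult[OF g1.const[OF cg(2)] p_g]])
  fix x assume x: "x \<in> S"
  show "real (s8 x) \<le> c1 * g x" using s8(4)[OF x] unfolding c1_def .
qed auto

lemma p_mm: "gr.p1 (\<lambda>x. real (mm x))"
proof -
  have "gr.p1 (\<lambda>x. 64 * real D ^ 2 * real (Lm x) ^ (b - 3))" by (intro g1.mult g1.const g1.power p_Lm) simp_all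
  thus ?thesis unfolding mm_def by simp
qed

lemma p_RR: "gr.p1 (\<lambda>x. real (RR x))"
proof -
  have "gr.p1 (\<lambda>x. 64 * real D ^ 2 * (real (Lm x) ^ (b - 3) * real (Lm x) ^ 2))" by (intro g1.mult g1.const g1.power p_Lm) simp_all
  thus ?thesis unfolding RR_def by simp
qed

lemma p_l: "gr.p1 (\<lambda>x. real (l x))"
proof (rule poly_in_le[OF p_Lm])
  fix x :: "nat \<times> nat \<times> real"
  have "real (l x) < 2 ^ l x" by (rule of_nat_less_two_power)
  also have "(2::real) ^ l x \<le> 4 ^ l x" by (rule power_mono) auto
  finally show "real (l x) \<le> real (Lm x)" unfolding Lm_def by simp
qed auto

lemma p_YY: "gr.p1 (\<lambda>x. real (YY x))"
proof (rule poly_in_le)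
  show "gr.p1 (\<lambda>x. 8 * c0 / nu * ww x + 1)" using c0 nu by (intro g1.add g1.mult g1.const g1.id_w) auto
qed (use YY_RR(2) in auto)

lemma p_dd: "gr.p1 (\<lambda>x. real (dd x))"
proof -
  have "gr.p1 (\<lambda>x. real (YY x) * real (RR x) * (8 * real (s8 x)))" by (intro g1.mult g1.const p_YY p_RR p_s8) simp_all
  thus ?thesis unfolding dd_def by simp
qed

lemma p_QQ: "gr.p1 (\<lambda>x. real (QQ x))"
proof -
  have "gr.p1 (\<lambda>x. 24 * real (s8 x) + 5 + (real (Lm x) ^ 2 * (2 * (real (mm x) * (2 * real (Lm x)) * (5 * real (l x) + 7)) + 6) + 5) + (6 * real (dd x) + 40))"
    by (intro g1.add g1.mult g1.const g1.power p_s8 p_Lm p_mm p_l p_dd) simp_all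
  thus ?thesis unfolding QQ_def by simp
qed

lemma p_JJ: "gr.p1 (\<lambda>x. real (JJ x))"
proof (rule poly_in_le)
  show "gr.p1 (\<lambda>x. 20 + 2 * Z x)" by (intro g1.add g1.mult g1.const p_Z) simp_all
  fix x assume x: "x \<in> S"
  have k: "2 \<le> real (kk x)" using adm(1)[OF x] by simp
  have e: "0 < ep x" "ep x \<le> 1" using adm[OF x] by auto
  have "ln (20 * real (kk x) / ep x) = ln (20 * (real (kk x) * (1 / ep x)))" by simp
  also have "\<dots> = ln 20 + (ln (kk x) + ln (1 / ep x))" proof -
    have l3: "ln (p * (q * r)) = ln p + (ln q + ln r)" if "0 < p" "0 < q" "0 < r" for p q r :: real using that by (simp add: ln_mult_pos)
    show ?thesis by (rule l3) (use k e in auto)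
  qed
  also have "\<dots> \<le> 19 + (Z x + Z x)" proof -
    have "ln (1 / ep x) \<le> Z x" unfolding Z_def using N_ge[OF x] e by (intro ln_mono) auto
    thus ?thesis using ln_le_minus_one[of 20] ln_k(2)[OF x] by linarith
  qed
  finally show "real (JJ x) \<le> 20 + 2 * Z x" unfolding JJ_def using Z_ge(2)[OF x] by linarith
qed auto

lemma p_Hh: "gr.p1 (\<lambda>x. real (Hh x))"
proof (rule poly_in_le)
  show "gr.p1 (\<lambda>x. 2 * Z x + 2)" by (intro g1.add g1.mult g1.const p_Z) simp_all
  fix x assume x: "x \<in> S"
  show "real (Hh x) \<le> 2 * Z x + 2" unfolding Hh_def using Z_ge(2)[OF x] by linarith
qed auto

lemma k_kk: "gr.pK (\<lambda>x. real (kk x))"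
proof (rule poly_in_le[OF gr.id_K])
  fix x assume x: "x \<in> S"
  have "real (kk x) powr 1 \<le> KK x" unfolding KK_def using adm(1)[OF x] mu by (intro powr_mono) auto
  thus "real (kk x) \<le> KK x" using adm(1)[OF x] by simp
qed auto

lemma k_BB: "gr.pK (\<lambda>x. real (BB x))"
proof (rule poly_in_le)
  show "gr.pK (\<lambda>x. 73 * c0 * (1 / ep x) * kk x)" using c0 by (intro gr.mult g1.mult g1.const p_ep k_kk) auto
  fix x assume "x \<in> S"
  thus "real (BB x) \<le> 73 * c0 * (1 / ep x) * kk x" using BB_le[of x] by simp
qed auto

text \<open>The source of the power k ^ (1 + mu) in the running time: \<open>u\<close> is linear in
  \<open>k\<close>.\<close>

lemma k_G: "gr.pK (\<lambda>x. real (G x))"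
proof (rule poly_inI[where C = "2 * (24 * c0) ^ 2" and p = 2])
  show "0 \<le> 2 * (24 * c0) ^ 2" by simp
  fix x assume x: "x \<in> S"
  have w1: "1 \<le> ww x" by (rule gr.w1[OF x])
  have c: "1 \<le> 24 * c0" using c0 by linarith
  have "u x = (24 * c0) * (real (kk x) * ww x)" unfolding u_def ww_def by simp
  hence "u x powr (1 + mu) = (24 * c0) powr (1 + mu) * (KK x * ww x powr (1 + mu))" unfolding KK_def using c w1 by (simp add: powr_mult)
  also have "\<dots> \<le> (24 * c0) powr 2 * (KK x * ww x powr 2)" using c w1 mu gr.K1[OF x] by (intro mult_mono powr_mono mult_nonneg_nonneg) auto
  also have "\<dots> = (24 * c0) ^ 2 * (KK x * ww x ^ 2)" using c w1 by (simp add: powr_numeral)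
  finally show "real (G x) \<le> 2 * (24 * c0) ^ 2 * (KK x * ww x ^ 2)" using G(3)[OF x] by simp
qed simp

lemma k_nc: "gr.pK (\<lambda>x. real (nc x))"
proof -
  have "gr.pK (\<lambda>x. real (YY x) * real (RR x) * (real (Lm x) ^ 2) * (1024 * real D ^ 2 * real (Lm x)) * (1024 * real D ^ 2) * real (G x))"
    by (intro gr.mult g1.mult g1.const g1.power p_YY p_RR p_Lm k_G) simp_all
  thus ?thesis unfolding nc_def by (simp add: ac_simps)
qed

lemma k_YRG: "gr.pK (\<lambda>x. real (YY x * RR x * G x))"
proof -
  have "gr.pK (\<lambda>x. real (YY x) * real (RR x) * real (G x))" by (intro gr.mult g1.mult p_YY p_RR k_G)
  thus ?thesis by simp
qed

lemma k_nn: "gr.pK (\<lambda>x. real (nn x))"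
proof -
  have "gr.pK (\<lambda>x. real (QQ x) * (2 * real (dd x) * real (BB x) + real (JJ x) * (real (dd x) * real (BB x) + (real (YY x * RR x * G x) + real (nc x)) +
   (real (dd x) * real (dd x) + 2 * real (dd x) + 4 + 2 * real (Hh x)) * (real (nc x) + real (kk x)) + (3 + 2 * real (Hh x)) * real (kk x) +
    2 * ((2 + 2 * real (dd x)) * real (kk x)) + 2 * (real (nc x) + real (kk x)) + real (kk x)) + real (kk x)))"
    by (intro gr.add gr.mult g1.add g1.mult g1.const gr.const p_QQ p_dd k_BB p_JJ k_YRG k_nc k_kk p_Hh) simp_all
  thus ?thesis unfolding nn_def by (simp only: of_nat_add of_nat_mult of_nat_numeral ac_simps)
qed

end

section \<open>Word size and existence of the systems\<close>

context exponents
begin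

lemma Lm_Z:
  assumes x: "x \<in> S"
  shows "real (Lm x) ^ 2 \<le> Z x" "real (Lm x) \<le> Z x" proof -
  have L: "1 \<le> real (Lm x)" "kap * real (Lm x) ^ 4 \<le> Z x" using Lm[OF x] by auto
  have "real (Lm x) ^ 2 \<le> real (Lm x) ^ 4" "real (Lm x) ^ 1 \<le> real (Lm x) ^ 4" using L by (intro power_increasing; simp)+
  moreover have "1 * real (Lm x) ^ 4 \<le> kap * real (Lm x) ^ 4" using kap by (intro mult_right_mono) auto
  ultimately show "real (Lm x) ^ 2 \<le> Z x" "real (Lm x) \<le> Z x" using L(2) unfolding power_one_right by linarith+
qed

lemma polynomial_in_N:
  assumes "gr.pK f"
  shows "gN.pK f" proof -
  obtain C p where f: "0 \<le> C" "\<And>x. x \<in> S ==> 0 \<le> f x \<and> f x \<le> C * (KK x * ww x ^ p)" using assms unfolding poly_in_def by blast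
  show ?thesis
  proof (rule poly_inI[where C = C and p = "1 + 2 * p"])
    fix x assume x: "x \<in> S"
    have k: "1 \<le> real (kk x)" using adm(1)[OF x] by simp
    have e: "0 < ep x" using adm[OF x] by auto
    have "KK x \<le> real (kk x) powr 2" unfolding KK_def by (rule powr_mono) (use mu k in auto)
    also have "\<dots> = real (kk x) ^ 2" using k by (simp add: powr_numeral)
    also have "\<dots> \<le> NN x" by (rule N_ge[OF x])
    finally have K: "KK x \<le> NN x" .
    have "Z x * (1 / ep x) \<le> real (NN x) * real (NN x)" by (rule mult_mono[OF Z_ge(3)[OF x] N_ge(5)[OF x]]) (use e in auto)
    hence "ww x \<le> real (NN x) ^ 2" unfolding ww_def by (simp add: power2_eq_square)
    hence "ww x ^ p \<le> (real (NN x) ^ 2) ^ p" using gr.w1[OF x] by (intro power_mono) auto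
    hence "KK x * ww x ^ p \<le> real (NN x) * (real (NN x) ^ 2) ^ p" using K gr.w1[OF x] by (intro mult_mono) auto
    also have "\<dots> = 1 * real (NN x) ^ (1 + 2 * p)" by (simp add: power_mult)
    finally have "C * (KK x * ww x ^ p) \<le> C * (1 * real (NN x) ^ (1 + 2 * p))" using f(1) by (rule mult_left_mono)
    thus "f x \<le> C * (1 * real (NN x) ^ (1 + 2 * p))" using f(2)[OF x] by linarith
  qed (use f in auto)
qed

text \<open>Table ranges that are exponentials of O(ln N) are polynomial in \<open>N\<close>, which
  is what words of O(log N) bits require.\<close>

lemma exp_polynomial_in_N:
  assumes "\<And>x. x \<in> S ==> 0 \<le> h x" "\<And>x. x \<in> S ==> h x \<le> exp (f x)" "\<And>x. x \<in> S ==> f x \<le> c * Z x"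
  shows "gN.pK h"
proof (rule poly_inI[where C = 1 and p = "nat \<lceil>c\<rceil>"])
  fix x assume x: "x \<in> S"
  have "c * Z x \<le> nat \<lceil>c\<rceil> * Z x" by (rule mult_right_mono[OF real_nat_ceiling_ge]) (use Z_ge(2)[OF x] in simp)
  hence "f x \<le> nat \<lceil>c\<rceil> * Z x" using assms(3)[OF x] by linarith
  hence "exp (f x) \<le> exp (nat \<lceil>c\<rceil> * Z x)" unfolding exp_le_cancel_iff .
  also have "\<dots> = real (NN x) ^ nat \<lceil>c\<rceil>" unfolding exp_of_nat_mult Z_ge(4)[OF x] ..
  finally show "h x \<le> 1 * (1 * real (NN x) ^ nat \<lceil>c\<rceil>)" using assms(2)[OF x] by simp
qed (use assms in auto)

lemma two_power_le_exp: "(2::real) ^ n \<le> exp (real n)"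
proof -
  have "(2::real) ^ n \<le> exp 1 ^ n" by (rule power_mono) (use exp_ge_add_one_self[of 1] in simp_all)
  thus ?thesis by (simp flip: exp_of_nat_mult)
qed

lemma N_M0: "gN.pK (\<lambda>x. real (M0 x) ^ (Lm x ^ 2))"
proof (rule exp_polynomial_in_N[where f = "\<lambda>x. real (Lm x ^ 2) * ln (M0 x)" and c = "8192 * real D ^ 2 + 1"])
  fix x assume x: "x \<in> S"
  have M: "0 < real (M0 x)" using M0(2)[OF x] by simp
  show "real (M0 x) ^ (Lm x ^ 2) \<le> exp (real (Lm x ^ 2) * ln (M0 x))" unfolding exp_of_nat_mult exp_ln[OF M] by simp
  have "real (Lm x ^ 2) * ln (M0 x) \<le> real (Lm x ^ 2) * (aa x + 1)" using M0(4)[OF x] by (intro mult_left_mono) auto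
  also have "\<dots> = real (Lm x) ^ 2 * aa x + real (Lm x) ^ 2" by (simp add: distrib_left)
  also have "\<dots> \<le> 4096 * real D ^ 2 * (Z x + 3) + Z x" unfolding aa(2)[OF x] using Lm_Z(1)[OF x] by simp
  also have "\<dots> \<le> 4096 * real D ^ 2 * (2 * Z x) + Z x" using Z_ge(2)[OF x] by (intro add_right_mono mult_left_mono) auto
  finally show "real (Lm x ^ 2) * ln (M0 x) \<le> (8192 * real D ^ 2 + 1) * Z x" by (simp add: distrib_right)
qed auto

text \<open>\<open>FF\<close> is bounded through \<open>sym_fits\<close>, on whose left side it
  occurs as a factor under the logarithm.\<close>

lemma N_F: "gN.pK (\<lambda>x. real (FF x))"
proof (rule exp_polynomial_in_N[where f = "\<lambda>x. ln (FF x)" and c = "A * (1 + cg)"])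
  fix x assume x: "x \<in> S"
  have F: "1 \<le> real (FF x)" by (rule FF[OF x])
  show "real (FF x) \<le> exp (ln (FF x))" using F by simp
  have L: "1 \<le> real (Lm x)" by (rule Lm[OF x])
  have g0: "1 \<le> g x" by (rule G[OF x])
  have M: "1 \<le> real (M0 x)" by (rule M0[OF x])
  have n: "1 \<le> Lm x ^ 2" using L by simp
  have "1 * (1 * real (FF x)) \<le> (4 * exp 1) * (real (M0 x) * real (FF x) ^ (Lm x ^ 2))"
  proof (intro mult_mono)
    show "1 \<le> 4 * exp (1::real)" using exp_ge_add_one_self[of 1] by linarith
    have "real (FF x) ^ 1 \<le> real (FF x) ^ (Lm x ^ 2)" using n F by (rule power_increasing)
    thus "real (FF x) \<le> real (FF x) ^ (Lm x ^ 2)" by simp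
  qed (use M in auto)
  hence "ln (FF x) \<le> ln (4 * exp 1 * (real (M0 x) * real (FF x) ^ (Lm x ^ 2)))" using F by (intro ln_mono) auto
  also have "\<dots> \<le> real (Lm x) ^ (b - 3) / 32 * g x" by (rule sym_fits[OF x])
  also have "\<dots> \<le> real (Lm x) ^ (b - 2) * g x"
  proof (rule mult_right_mono)
    have "real (Lm x) ^ (b - 3) \<le> real (Lm x) ^ (b - 2)" using L by (intro power_increasing) auto
    moreover have "0 \<le> real (Lm x) ^ (b - 3)" by simp
    ultimately show "real (Lm x) ^ (b - 3) / 32 \<le> real (Lm x) ^ (b - 2)" by linarith
  qed (use g0 in simp)
  also have "\<dots> \<le> A * (1 + cg) * Z x" by (rule Lm_g[OF x])
  finally show "ln (FF x) \<le> A * (1 + cg) * Z x" .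
qed auto

lemma N_s8: "gN.pK (\<lambda>x. 2 ^ (8 * s8 x))"
proof (rule exp_polynomial_in_N[where f = "\<lambda>x. real (8 * s8 x)" and c = "8 * (c1 * cg)"])
  fix x assume x: "x \<in> S"
  have "c1 * g x \<le> c1 * (cg * Z x)" using g_le[OF x] cg unfolding cg_def by (intro mult_left_mono) auto
  moreover have "8 * (c1 * cg) * Z x = 8 * (c1 * (cg * Z x))" by simp
  moreover have "real (8 * s8 x) = 8 * real (s8 x)" by simp
  moreover have "real (s8 x) \<le> c1 * g x" using s8(4)[OF x] unfolding c1_def .
  ultimately show "real (8 * s8 x) \<le> 8 * (c1 * cg) * Z x" by linarith
qed (use two_power_le_exp[of "8 * s8 x" for x] in auto)

lemma N_G: "gN.pK (\<lambda>x. real (G x) ^ Suc D)" by (rule gN.power[OF polynomial_in_N[OF k_G]])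

text \<open>All lists of a group fit into one word, because m * (2 * Lm) * g is a constant times Lm
  ^ (b - 2) * g and hence O(ln N).\<close>

lemma N_lists: "gN.pK (\<lambda>x. real (G x) ^ (mm x * (2 * Lm x)))"
proof (rule exp_polynomial_in_N[where f = "\<lambda>x. real (mm x * (2 * Lm x)) * g x" and c = "128 * real D ^ 2 * (A * (1 + cg))"])
  fix x assume x: "x \<in> S"
  show "real (G x) ^ (mm x * (2 * Lm x)) \<le> exp (real (mm x * (2 * Lm x)) * g x)" unfolding exp_of_nat_mult g_def using G(8)[OF x] by simp
  have "b - 2 = Suc (b - 3)" using b(1) by simp
  hence "real (mm x * (2 * Lm x)) * g x = 128 * real D ^ 2 * (real (Lm x) ^ (b - 2) * g x)" unfolding mm_def by simp
  also have "\<dots> \<le> 128 * real D ^ 2 * (A * (1 + cg) * Z x)" using Lm_g[OF x] by (rule mult_left_mono) simp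
  finally show "real (mm x * (2 * Lm x)) * g x \<le> 128 * real D ^ 2 * (A * (1 + cg)) * Z x" by (simp only: mult.assoc)
qed auto

lemma N_Hh: "gN.pK (\<lambda>x. 2 ^ Hh x)"
proof (rule exp_polynomial_in_N[where f = "\<lambda>x. real (Hh x)" and c = 3])
  fix x assume x: "x \<in> S"
  show "real (Hh x) \<le> 3 * Z x" unfolding Hh_def using Z_ge(2)[OF x] by linarith
qed (use two_power_le_exp in auto)

lemma N_EE: "gN.pK (\<lambda>x. real (EE x))"
proof -
  note N = polynomial_in_N[OF k_nn] polynomial_in_N[OF k_YRG] polynomial_in_N[OF k_nc] polynomial_in_N[OF k_kk]
    polynomial_in_N[OF k_BB] polynomial_in_N[OF gr.up[OF p_dd]] polynomial_in_N[OF gr.up[OF p_QQ]]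
  have "gN.pK (\<lambda>x. 2 ^ (8 * s8 x) + real (YY x * RR x * G x) + real (G x) ^ Suc D + real (G x) ^ (mm x * (2 * Lm x)) +
      real (M0 x) ^ (Lm x ^ 2) + real (FF x) + 2 * real (dd x) * real (BB x) + real (nc x) + 2 * 2 ^ Hh x + real (kk x) +
      real (dd x) * real (dd x) + real (QQ x) + 1)" by (intro gN.add gN.mult gN.const N N_s8 N_G N_lists N_M0 N_F N_Hh) simp_all
  hence V: "gN.pK (\<lambda>x. real (VV x))" unfolding VV_def by (simp only: of_nat_add of_nat_mult of_nat_power of_nat_numeral of_nat_1)
  have "gN.pK (\<lambda>x. 8 * (real (nn x) + 2) + real (nn x) * (real (VV x) * real (VV x)) + 16 * real (VV x) + 64)"
    by (intro gN.add gN.mult gN.const N V) simp_all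
  thus ?thesis unfolding EE_def by (simp only: of_nat_add of_nat_mult of_nat_numeral)
qed

lemma wb_le: "\<exists>C\<ge>0. \<forall>x\<in>S. real (wb x) \<le> C * Z x"
proof -
  obtain C p where C: "0 \<le> C" "\<And>x. x \<in> S ==> real (EE x) \<le> C * (1 * real (NN x) ^ p)" using gN.bound[OF N_EE] by blast
  show ?thesis
  proof (intro exI[of _ "2 * C + 2 * real p + 1"] conjI ballI)
    show "0 \<le> 2 * C + 2 * real p + 1" using C by simp
    fix x assume x: "x \<in> S"
    have Z3: "3 \<le> Z x" by (rule Z_ge[OF x])
    have N: "1 \<le> real (NN x)" by (rule N_ge[OF x])
    have E: "1 \<le> real (EE x)" unfolding EE_def by simp
    have "real (EE x) \<le> (C + 1) * real (NN x) ^ p" using C(2)[OF x] zero_le_power[of "real (NN x)" p] by (simp add: distrib_right add_increasing2)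
    hence "ln (EE x) \<le> ln ((C + 1) * real (NN x) ^ p)" using E by (intro ln_mono) auto
    also have "\<dots> = ln (C + 1) + p * Z x" unfolding Z_def using C(1) N by (simp add: ln_mult_pos ln_realpow)
    also have "\<dots> \<le> C + p * Z x" using ln_le_minus_one[of "C + 1"] C(1) by simp
    finally have le: "ln (EE x) \<le> C + p * Z x" .
    have "0 \<le> 2 * ln (EE x)" using E by simp
    hence "real (wb x) \<le> 2 * C + 2 * (p * Z x) + 2" using le real_nat_ceiling[of "2 * ln (EE x)"] unfolding wb_def by linarith
    moreover have "2 * C * 1 \<le> 2 * C * Z x" using C(1) Z3 by (intro mult_left_mono) auto
    moreover have "(2 * C + 2 * real p + 1) * Z x = 2 * C * Z x + 2 * (p * Z x) + Z x" by (simp add: algebra_simps)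
    ultimately show "real (wb x) \<le> (2 * C + 2 * real p + 1) * Z x" using Z3 by linarith
  qed
qed

lemma bounds: "\<exists>C p. 0 \<le> C \<and> (\<forall>x\<in>S. real (wb x) \<le> C * Z x \<and>
    real (2 * dd x * BB x) \<le> C * (kk x / ep x * ln (NN x / kk x) * ((Z x / ln (kk x)) powr \<gamma> + 1 / ep x)) \<and>
    real (40 * nn x + 8) \<le> C * (KK x * ww x ^ p))"
proof -
  define r where "r x = kk x / ep x * ln (NN x / kk x) * ((Z x / ln (kk x)) powr \<gamma> + 1 / ep x)" for x
  obtain C1 where 1: "0 \<le> C1" "\<And>x. x \<in> S ==> real (wb x) \<le> C1 * Z x" using wb_le by blast
  obtain C2 where 2: "0 \<le> C2" "\<And>x. x \<in> S ==> real (2 * dd x * BB x) \<le> C2 * r x" using rows_le unfolding r_def by blast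
  have "gr.pK (\<lambda>x. 40 * real (nn x) + 8)" by (intro gr.add gr.mult g1.const gr.const k_nn) simp_all
  from gr.bound[OF this] obtain C3 p where 3: "0 \<le> C3" "\<And>x. x \<in> S ==> real (40 * nn x + 8) \<le> C3 * (KK x * ww x ^ p)" by auto
  have up: "a \<le> (C1 + C2 + C3) * t" if "a \<le> c * t" "c \<le> C1 + C2 + C3" "0 \<le> t" for a c t
    using mult_right_mono[OF that(2,3)] that(1) by linarith
  show ?thesis unfolding r_def[symmetric]
  proof (intro exI[of _ "C1 + C2 + C3"] exI[of _ p] conjI ballI)
    fix x assume x: "x \<in> S"
    have p: "0 < ep x" "0 \<le> ln (NN x / kk x)" "0 \<le> Z x" using adm[OF x] ln_k[OF x] Z_ge[OF x] N_ge[OF x] by auto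
    show "real (wb x) \<le> (C1 + C2 + C3) * Z x" by (rule up[OF 1(2)[OF x]]) (use 2(1) 3(1) p in auto)
    show "real (2 * dd x * BB x) \<le> (C1 + C2 + C3) * r x" by (rule up[OF 2(2)[OF x]]) (use 1(1) 3(1) p in \<open>auto simp: r_def\<close>)
    show "real (40 * nn x + 8) \<le> (C1 + C2 + C3) * (KK x * ww x ^ p)" by (rule up[OF 3(2)[OF x]]) (use 1(1) 2(1) gr.w1[OF x] gr.K1[OF x] in auto)
  qed (use 1(1) 2(1) 3(1) in auto)
qed

lemma systems: "\<exists>\<Phi> A. \<forall>x\<in>S. sparse_recovery_system (NN x) (kk x) (ep x) (\<Phi> x) interpreter (A x) (40 * nn x + 8) \<and>
    word_bits (A x) = wb x \<and> dim_row (\<Phi> x) = 2 * dd x * BB x"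
proof -
  have "\<forall>x\<in>S. \<exists>\<Phi> A. sparse_recovery_system (NN x) (kk x) (ep x) \<Phi> interpreter A (40 * nn x + 8) \<and>
    word_bits A = wb x \<and> dim_row \<Phi> = 2 * dd x * BB x"
    using parameters.system_exists[OF parameters_hold] unfolding D_def[symmetric] Lm_def[symmetric] RR_def[symmetric] dd_def[symmetric] by blast
  thus ?thesis by metis
qed

end

theorem mainTheorem1:
  fixes \<beta> \<gamma> :: real
  assumes "\<beta> > 0" and "\<gamma> > 0"
  shows "\<exists>C0 > 0. \<exists>(\<Phi> :: nat \<Rightarrow> nat \<Rightarrow> real \<Rightarrow> real mat) (P :: instr list)
      (A :: nat \<Rightarrow> nat \<Rightarrow> real \<Rightarrow> preprocessed) (T :: nat \<Rightarrow> nat \<Rightarrow> real \<Rightarrow> nat) (C :: real) (p :: nat).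
    (\<forall>N k \<epsilon>. admissible C0 N k \<epsilon> \<longrightarrow>
       sparse_recovery_system N k \<epsilon> (\<Phi> N k \<epsilon>) P (A N k \<epsilon>) (T N k \<epsilon>) \<and>
       real (word_bits (A N k \<epsilon>)) \<le> C * ln (real N) \<and>
       real (dim_row (\<Phi> N k \<epsilon>))
         \<le> C * (real k / \<epsilon> * ln (real N / real k) * ((ln (real N) / ln (real k)) powr \<gamma> + 1 / \<epsilon>)) \<and>
       real (T N k \<epsilon>) \<le> C * (real k powr (1 + \<beta>) * (ln (real N) / \<epsilon>) ^ p)) \<and>
    (\<forall>c :: real. \<exists>C' :: real. \<forall>N k \<epsilon>.
       admissible C0 N k \<epsilon> \<and> \<epsilon> \<le> c * (ln (real k) / ln (real N)) powr \<gamma> \<longrightarrow>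
       real (dim_row (\<Phi> N k \<epsilon>)) \<le> C' * (1 / \<epsilon> ^ 2 * real k * ln (real N / real k))) \<and>
    (\<forall>(c :: real) (d :: real). \<exists>(P' :: instr list) (A' :: nat \<Rightarrow> nat \<Rightarrow> real \<Rightarrow> preprocessed)
        (T' :: nat \<Rightarrow> nat \<Rightarrow> real \<Rightarrow> nat) (C' :: real) (p' :: nat). \<forall>N k \<epsilon>.
       admissible C0 N k \<epsilon> \<and> \<epsilon> \<le> c * (ln (real k) / ln (real N)) powr \<gamma> \<and>
       real k \<le> ln (real N) powr d \<longrightarrow>
       sparse_recovery_system N k \<epsilon> (\<Phi> N k \<epsilon>) P' (A' N k \<epsilon>) (T' N k \<epsilon>) \<and>
       real (word_bits (A' N k \<epsilon>)) \<le> C' * ln (real N) \<and>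
       real (T' N k \<epsilon>) \<le> C' * (real k * (ln (real N) / \<epsilon>) ^ p') \<and>
       real (T' N k \<epsilon>) \<le> C' * (real k * (real N / \<epsilon>) ^ p'))"
proof -
  interpret exponents \<beta> \<gamma> by unfold_locales (use assms in auto)
  obtain \<Phi> A where sys: "\<And>x. x \<in> S ==> sparse_recovery_system (NN x) (kk x) (ep x) (\<Phi> x) interpreter (A x) (40 * nn x + 8) \<and>
    word_bits (A x) = wb x \<and> dim_row (\<Phi> x) = 2 * dd x * BB x" using systems by blast
  obtain C p where C: "0 \<le> C" "\<And>x. x \<in> S ==> real (wb x) \<le> C * Z x" "\<And>x. x \<in> S ==> real (2 * dd x * BB x) \<le>
      C * (kk x / ep x * ln (NN x / kk x) * ((Z x / ln (kk x)) powr \<gamma> + 1 / ep x))"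
    "\<And>x. x \<in> S ==> real (40 * nn x + 8) \<le> C * (KK x * ww x ^ p)" using bounds by blast
  have S: "(N, k, \<epsilon>) \<in> S" if "admissible (exp Z0) N k \<epsilon>" for N k \<epsilon> using that unfolding S_def by simp
  have pos: "0 < ep x" "2 \<le> real (kk x)" "3 \<le> Z x" "0 < ln (kk x)" "0 \<le> ln (NN x / kk x)" "1 \<le> ww x" if "x \<in> S" for x
    using adm[OF that] Z_ge[OF that] ln_k[OF that] gr.w1[OF that] N_ge[OF that] by auto
  show ?thesis
  proof (rule exI[of _ "exp Z0"], rule conjI[OF exp_gt_zero], rule exI[of _ "\<lambda>N k \<epsilon>. \<Phi> (N, k, \<epsilon>)"], rule exI[of _ interpreter],
      rule exI[of _ "\<lambda>N k \<epsilon>. A (N, k, \<epsilon>)"], rule exI[of _ "\<lambda>N k \<epsilon>. 40 * nn (N, k, \<epsilon>) + 8"], rule exI[of _ C], rule exI[of _ p],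
      intro conjI allI, goal_cases)
    case (1 N k \<epsilon>)
    let ?x = "(N, k, \<epsilon>)"
    show ?case
    proof (rule impI, goal_cases)
      case 1
      note x = S[OF 1]
      have "KK ?x \<le> real k powr (1 + \<beta>)" unfolding KK_def using pos(2)[OF x] mu by (auto intro: powr_mono)
      hence "C * (KK ?x * ww ?x ^ p) \<le> C * (real k powr (1 + \<beta>) * ww ?x ^ p)"
        using pos(6)[OF x] C(1) by (intro mult_left_mono mult_right_mono) auto
      with sys[OF x] C(2-4)[OF x] show ?case by (simp add: Z_def ww_def)
    qed
  next
    case (2 c)
    show ?case
    proof (intro exI[of _ "C * (c + 1)"] allI impI, goal_cases)
      case a: (1 N k \<epsilon>)
      define x where "x = (N, k, \<epsilon>)"
      have x: "x \<in> S" using S a unfolding x_def by blast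
      have xs: "NN x = N" "kk x = k" "ep x = \<epsilon>" unfolding x_def by simp_all
      note p = pos[OF x]
      define t where "t = (Z x / ln (kk x)) powr \<gamma>"
      \<comment> \<open>For such \<epsilon> the factor t is O(1 / \<epsilon>), so the two terms of
        the row bound merge.\<close>
      have "t * ep x \<le> t * (c * (ln (kk x) / Z x) powr \<gamma>)" using a unfolding Z_def xs t_def by (intro mult_left_mono) auto
      also have "\<dots> = c" unfolding t_def using p by (simp add: powr_divide)
      finally have "t \<le> c * (1 / ep x)" using p by (simp add: pos_le_divide_eq)
      hence "t + 1 / ep x \<le> (c + 1) * (1 / ep x)" by (simp add: add_divide_distrib)
      hence "C * (kk x / ep x * ln (NN x / kk x) * (t + 1 / ep x)) \<le> C * (kk x / ep x * ln (NN x / kk x) * ((c + 1) * (1 / ep x)))"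
        using p C(1) by (intro mult_left_mono) auto
      also have "\<dots> = C * (c + 1) * (1 / ep x ^ 2 * kk x * ln (NN x / kk x))" by (simp add: power2_eq_square)
      finally show ?case using C(3)[OF x] sys[OF x] unfolding t_def xs unfolding x_def by simp
    qed
  next
    case (3 c d)
    define n where "n = nat \<lceil>\<bar>d\<bar>\<rceil>"
    show ?case
    proof (rule exI[of _ interpreter], rule exI[of _ "\<lambda>N k \<epsilon>. A (N, k, \<epsilon>)"], rule exI[of _ "\<lambda>N k \<epsilon>. 40 * nn (N, k, \<epsilon>) + 8"],
        rule exI[of _ C], rule exI[of _ "n + p"], intro allI impI, goal_cases)
      case a: (1 N k \<epsilon>)
      define x where "x = (N, k, \<epsilon>)"
      have x: "x \<in> S" using S a unfolding x_def by blast
      have xs: "NN x = N" "kk x = k" "ep x = \<epsilon>" unfolding x_def by simp_all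
      note p = pos[OF x]
      \<comment> \<open>The same system serves here: k ^ mu is at most k, thus polylogarithmic, and
        joins the power of ln N / \<epsilon>.\<close>
      have "real (kk x) powr mu \<le> real (kk x) powr 1" using mu p by (intro powr_mono) auto
      also have "\<dots> \<le> Z x powr d" using a p unfolding Z_def xs by simp
      also have "\<dots> \<le> Z x powr real n" unfolding n_def using p by (intro powr_mono) (auto, linarith)
      also have "\<dots> = Z x ^ n" using p by (intro powr_realpow) simp
      also have "\<dots> \<le> ww x ^ n" using p adm(3)[OF x] unfolding ww_def by (intro power_mono) (auto simp: pos_le_divide_eq)
      finally have "kk x * real (kk x) powr mu \<le> kk x * ww x ^ n" by (rule mult_left_mono) simp
      hence "KK x \<le> kk x * ww x ^ n" unfolding KK_def powr_add using p by simp
      hence "C * (KK x * ww x ^ p) \<le> C * (kk x * ww x ^ n * ww x ^ p)" using p C(1) by (intro mult_left_mono mult_right_mono) auto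
      hence t1: "real (40 * nn x + 8) \<le> C * (kk x * ww x ^ (n + p))" using C(4)[OF x] unfolding power_add by (simp only: mult.assoc)
      \<comment> \<open>The polylogarithmic bound implies the one that is polynomial in
        \<open>N\<close>, as ln N \<le> N.\<close>
      have "ww x \<le> NN x / ep x" unfolding ww_def using Z_ge(3)[OF x] p by (intro divide_right_mono) auto
      hence "C * (kk x * ww x ^ (n + p)) \<le> C * (kk x * (NN x / ep x) ^ (n + p))" using p C(1) by (intro mult_left_mono power_mono) auto
      with sys[OF x] C(2)[OF x] t1 show ?case unfolding Z_def ww_def xs unfolding x_def by simp
    qed
  qed
qed

end
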